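(* Let $i\le j$ be integers. (1) Inside $T_{ij}\otimes V^{j*}\otimes V^{(j+1)*}$ the following equality holds: $$(R_{i,j+1}\otimes V^{(j+1)*})\cap(T_{ij}\otimes Q_j)=R_{ij}\otimes Q_j.$$ (2) There is an exact sequence $$0\to A_{ij}\otimes Q_j\to A_{i,j+1}\otimes V^{(j+1)*}\to A_{i,j+2}\to0$$ (induced by multiplication). In particular, the left and right dimensions of $A_{ij}$ (over $K_i$ and $K_j$ respectively) equal $j-i+1$ for $j\ge i$. (3) Furthermore, for every $j\in\mathbb{Z}$ there is an exact sequence of left $A$-modules $$0\to Ae_j\to(Ae_{j+1})^{\oplus2}\to Ae_{j+2}\to A_{j+2,j+2}\to0.$$
   Context: $K_0,K_1$ are fields of characteristic $\neq 2$ and $V$ is a $K_0$-$K_1$-bimodule of rank two: $\dim_{K_0}V=\dim V_{K_1}=2$. For $i\in\mathbb{Z}$ put $K_i=K_0$ if $i$ is even, $K_i=K_1$ if $i$ is odd. For fields $L,M$ and an $L$-$M$-bimodule $W$, the right dual $W^*=\operatorname{Hom}_M(W_M,M)$ and left dual ${}^*W=\operatorname{Hom}_L({}_LW,L)$ are $M$-$L$-bimodules via $(a\psi b)(v)=a\psi(bv)$, respectively $(a\phi b)(v)=b\phi(va)$. Put $V^{0*}=V$, $V^{i*}=(V^{(i-1)*})^*$ for $i>0$, $V^{i*}={}^*(V^{(i+1)*})$ for $i<0$; $V^{i*}$ is a $K_i$-$K_{i+1}$-bimodule of rank two, and $V^{(i+1)*}$ is canonically the right dual of $V^{i*}$ for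 every $i$. A $\mathbb{Z}$-indexed algebra $D$ consists of abelian groups $D_{ij}$ ($i,j\in\mathbb{Z}$) with associative biadditive multiplications $D_{ij}\times D_{jl}\to D_{il}$ and units $e_i\in D_{ii}$. A (graded) left $D$-module is $M=\bigoplus_iM_i$ with multiplications $D_{ij}\times M_j\to M_i$ satisfying the usual axioms; e.g. $(De_j)_i=D_{ij}$. Let $T$ be the tensor $\mathbb{Z}$-indexed algebra: $T_{ij}=0$ for $i>j$, $T_{ii}=K_i$, $T_{ij}=V^{i*}\otimes_{K_{i+1}}\cdots\otimes_{K_{j-1}}V^{(j-1)*}$ for $i<j$. Let $Q_i\subset V^{i*}\otimes V^{(i+1)*}\cong\operatorname{End}_{K_{i+1}}(V^{i*})$ be the image of $K_i$ acting by left multiplication; it is generated by $\sum_s x_s\otimes x_s^*$ for any right basis $\{x_s\}$ of $V^{i*}$ with dual basis $\{x_s^*\}$. $R\subset T$ is the ideal generated by all $Q_i$ (so $R_{ij}=0$ if $j<i+2$), and $A=\mathbb{S}^{nc}(V)=T/R$. Tensor products are over the appropriate $K_l$. In (3), $A_{j+2,j+2}=K_{j+2}$ is the left $A$-module concentrated in degree $j+2$, a quotient of $Ae_{j+2}$. *)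

theory Defs
  imports "HOL-Algebra.Free_Abelian_Groups" "HOL-Algebra.Chinese_Remainder" "Jordan_Normal_Form.Missing_VectorSpace"
begin

section \<open>Abelian groups\<close>

text \<open>Abelian groups are written additively, as in \<^theory>\<open>HOL-Algebra.Module\<close>: they are
  \<open>ring\<close> records of which only \<open>carrier\<close>, \<open>zero\<close> and \<open>add\<close> matter.\<close>

definition add_hom :: "'a ring \<Rightarrow> 'b ring \<Rightarrow> ('a \<Rightarrow> 'b) \<Rightarrow> bool"
  where "add_hom G H f \<longleftrightarrow> f \<in> hom (add_monoid G) (add_monoid H)"

definition quot_group :: "'a ring \<Rightarrow> 'a set \<Rightarrow> 'a set ring"
  where "quot_group G H =
    \<lparr>carrier = a_rcosets\<^bsub>G\<^esub> H, monoid.mult = undefined, one = undefined, ring.zero = H, add = (<+>\<^bsub>G\<^esub>)\<rparr>"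

text \<open>The additive version of \<^const>\<open>free_Abelian_group\<close>, which is its \<open>add_monoid\<close>.\<close>

definition free_group :: "'g set \<Rightarrow> ('g \<Rightarrow>\<^sub>0 int) ring"
  where "free_group S = \<lparr>carrier = {c. Poly_Mapping.keys c \<subseteq> S},
    monoid.mult = undefined, one = undefined, ring.zero = 0, add = (+)\<rparr>"

definition rel_span :: "'g set \<Rightarrow> ('g \<Rightarrow>\<^sub>0 int) set \<Rightarrow> ('g \<Rightarrow>\<^sub>0 int) set"
  where "rel_span S Rel = generate (free_Abelian_group S) Rel"

definition presented_group :: "'g set \<Rightarrow> ('g \<Rightarrow>\<^sub>0 int) set \<Rightarrow> ('g \<Rightarrow>\<^sub>0 int) set ring"
  where "presented_group S Rel = quot_group (free_group S) (rel_span S Rel)"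

definition pclass :: "'g set \<Rightarrow> ('g \<Rightarrow>\<^sub>0 int) set \<Rightarrow> ('g \<Rightarrow>\<^sub>0 int) \<Rightarrow> ('g \<Rightarrow>\<^sub>0 int) set"
  where "pclass S Rel x = rel_span S Rel +>\<^bsub>free_group S\<^esub> x"

text \<open>The endomorphism of a presented group induced by a map of the generators; the union runs
  over all representatives, as in the library's \<open>set_mult\<close> on cosets.\<close>

definition induced_map ::
    "'g set \<Rightarrow> ('g \<Rightarrow>\<^sub>0 int) set \<Rightarrow> ('g \<Rightarrow> 'g) \<Rightarrow> ('g \<Rightarrow>\<^sub>0 int) set \<Rightarrow> ('g \<Rightarrow>\<^sub>0 int) set"
  where "induced_map S Rel h X = (\<Union>x\<in>X. pclass S Rel (frag_extend (\<lambda>g. frag_of (h g)) x))"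


section \<open>Bimodules over fields\<close>

record ('k, 'v) bimod = "'v ring" +
  lact :: "'k \<Rightarrow> 'v \<Rightarrow> 'v"
  ract :: "'v \<Rightarrow> 'k \<Rightarrow> 'v"

definition make_bimod ::
    "'v ring \<Rightarrow> ('k \<Rightarrow> 'v \<Rightarrow> 'v) \<Rightarrow> ('v \<Rightarrow> 'k \<Rightarrow> 'v) \<Rightarrow> ('k, 'v) bimod"
  where "make_bimod G l r = ring.extend G (bimod.fields l r)"

definition left_module :: "('k, 'v) bimod \<Rightarrow> ('k, 'v) module"
  where "left_module W = ring.extend (ring.truncate W) (module.fields (lact W))"

text \<open>A right module over a commutative ring is a module with the arguments of the action swapped.\<close>

definition right_module :: "('k, 'v) bimod \<Rightarrow> ('k, 'v) module"
  where "right_module W = ring.extend (ring.truncate W) (module.fields (\<lambda>a v. ract W v a))"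

locale bimodule =
  fixes L M :: "'k ring" and W :: "('k, 'v) bimod"
  assumes left: "module L (left_module W)"
    and right: "module M (right_module W)"
    and lact_ract: "\<lbrakk>a \<in> carrier L; v \<in> carrier W; b \<in> carrier M\<rbrakk> \<Longrightarrow>
      ract W (lact W a v) b = lact W a (ract W v b)"

definition bimodule_hom ::
    "'k ring \<Rightarrow> 'k ring \<Rightarrow> ('k, 'v) bimod \<Rightarrow> ('k, 'w) bimod \<Rightarrow> ('v \<Rightarrow> 'w) \<Rightarrow> bool"
  where "bimodule_hom L M X Y f \<longleftrightarrow>
    bimodule L M X \<and> bimodule L M Y \<and>
    f \<in> module_hom L (left_module X) (left_module Y) \<and>
    f \<in> module_hom M (right_module X) (right_module Y)"

definition short_exact_bimodules ::
    "'k ring \<Rightarrow> 'k ring \<Rightarrow> ('k, 'u) bimod \<Rightarrow> ('u \<Rightarrow> 'v) \<Rightarrow> ('k, 'v) bimod \<Rightarrow> ('v \<Rightarrow> 'w) \<Rightarrow>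
     ('k, 'w) bimod \<Rightarrow> bool"
  where "short_exact_bimodules L M X f Y g Z \<longleftrightarrow>
    bimodule_hom L M X Y f \<and> bimodule_hom L M Y Z g \<and>
    inj_on f (carrier X) \<and> f ` carrier X = a_kernel Y Z g \<and> g ` carrier Y = carrier Z"

definition has_dim :: "'k ring \<Rightarrow> ('k, 'v) module \<Rightarrow> nat \<Rightarrow> bool"
  where "has_dim K W n \<longleftrightarrow>
    vectorspace K W \<and> vectorspace.fin_dim K W \<and> vectorspace.dim K W = n"

definition rank_two_bimodule :: "'k ring \<Rightarrow> 'k ring \<Rightarrow> ('k, 'v) bimod \<Rightarrow> bool"
  where "rank_two_bimodule L M W \<longleftrightarrow>
    bimodule L M W \<and> has_dim L (left_module W) 2 \<and> has_dim M (right_module W) 2"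

subsection \<open>Tensor products of two bimodules\<close>

definition tensor_rels ::
    "'k ring \<Rightarrow> ('k, 'v) bimod \<Rightarrow> ('k, 'w) bimod \<Rightarrow> ('v \<times> 'w \<Rightarrow>\<^sub>0 int) set"
  where "tensor_rels K X Y =
    {frag_of (x \<oplus>\<^bsub>X\<^esub> x', y) - frag_of (x, y) - frag_of (x', y) | x x' y.
       x \<in> carrier X \<and> x' \<in> carrier X \<and> y \<in> carrier Y} \<union>
    {frag_of (x, y \<oplus>\<^bsub>Y\<^esub> y') - frag_of (x, y) - frag_of (x, y') | x y y'.
       x \<in> carrier X \<and> y \<in> carrier Y \<and> y' \<in> carrier Y} \<union>
    {frag_of (ract X x c, y) - frag_of (x, lact Y c y) | x c y.
       x \<in> carrier X \<and> c \<in> carrier K \<and> y \<in> carrier Y}"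

definition pure_tensor ::
    "'k ring \<Rightarrow> ('k, 'v) bimod \<Rightarrow> ('k, 'w) bimod \<Rightarrow> 'v \<Rightarrow> 'w \<Rightarrow> ('v \<times> 'w \<Rightarrow>\<^sub>0 int) set"
  where "pure_tensor K X Y x y =
    pclass (carrier X \<times> carrier Y) (tensor_rels K X Y) (frag_of (x, y))"

definition tensor ::
    "'k ring \<Rightarrow> ('k, 'v) bimod \<Rightarrow> ('k, 'w) bimod \<Rightarrow> ('k, ('v \<times> 'w \<Rightarrow>\<^sub>0 int) set) bimod"
  where "tensor K X Y =
    make_bimod (presented_group (carrier X \<times> carrier Y) (tensor_rels K X Y))
      (\<lambda>a. induced_map (carrier X \<times> carrier Y) (tensor_rels K X Y) (\<lambda>(x, y). (lact X a x, y)))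
      (\<lambda>t b. induced_map (carrier X \<times> carrier Y) (tensor_rels K X Y) (\<lambda>(x, y). (x, ract Y y b)) t)"

subsection \<open>Dual bimodules\<close>

definition right_dual :: "'k ring \<Rightarrow> ('k, 'v) bimod \<Rightarrow> ('k, 'v \<Rightarrow> 'k) bimod"
  where "right_dual M W = make_bimod
    \<lparr>carrier = {\<psi> \<in> carrier W \<rightarrow>\<^sub>E carrier M.
        (\<forall>v\<in>carrier W. \<forall>w\<in>carrier W. \<psi> (v \<oplus>\<^bsub>W\<^esub> w) = \<psi> v \<oplus>\<^bsub>M\<^esub> \<psi> w) \<and>
        (\<forall>v\<in>carrier W. \<forall>a\<in>carrier M. \<psi> (ract W v a) = \<psi> v \<otimes>\<^bsub>M\<^esub> a)},
      monoid.mult = undefined, one = undefined,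
      ring.zero = (\<lambda>v\<in>carrier W. \<zero>\<^bsub>M\<^esub>),
      add = (\<lambda>\<psi> \<psi>'. \<lambda>v\<in>carrier W. \<psi> v \<oplus>\<^bsub>M\<^esub> \<psi>' v)\<rparr>
    (\<lambda>a \<psi>. \<lambda>v\<in>carrier W. a \<otimes>\<^bsub>M\<^esub> \<psi> v)
    (\<lambda>\<psi> b. \<lambda>v\<in>carrier W. \<psi> (lact W b v))"

definition left_dual :: "'k ring \<Rightarrow> ('k, 'v) bimod \<Rightarrow> ('k, 'v \<Rightarrow> 'k) bimod"
  where "left_dual L W = make_bimod
    \<lparr>carrier = {\<phi> \<in> carrier W \<rightarrow>\<^sub>E carrier L.
        (\<forall>v\<in>carrier W. \<forall>w\<in>carrier W. \<phi> (v \<oplus>\<^bsub>W\<^esub> w) = \<phi> v \<oplus>\<^bsub>L\<^esub> \<phi> w) \<and>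
        (\<forall>v\<in>carrier W. \<forall>a\<in>carrier L. \<phi> (lact W a v) = a \<otimes>\<^bsub>L\<^esub> \<phi> v)},
      monoid.mult = undefined, one = undefined,
      ring.zero = (\<lambda>v\<in>carrier W. \<zero>\<^bsub>L\<^esub>),
      add = (\<lambda>\<phi> \<phi>'. \<lambda>v\<in>carrier W. \<phi> v \<oplus>\<^bsub>L\<^esub> \<phi>' v)\<rparr>
    (\<lambda>a \<phi>. \<lambda>v\<in>carrier W. \<phi> (ract W v a))
    (\<lambda>\<phi> b. \<lambda>v\<in>carrier W. b \<otimes>\<^bsub>L\<^esub> \<phi> v)"

text \<open>
  The functionals on \<open>W :: ('k, 'v) bimod\<close> have type \<open>'v \<Rightarrow> 'k\<close>, so forming duals cannot be
  iterated inside one type. When \<open>W\<close> has rank two, \<open>W\<close> and either dual are two-dimensional over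
  the same field, hence equipotent. \<open>dual_code H W\<close> picks a bijection from the dual \<open>H\<close> onto
  \<open>carrier W\<close>, along which the bimodule structure of \<open>H\<close> is transported; \<open>decode\<close> is its inverse
  and gives back the functional. Nothing depends on the bijection up to isomorphism.
\<close>

definition dual_code :: "('k, 'v \<Rightarrow> 'k) bimod \<Rightarrow> ('k, 'v) bimod \<Rightarrow> ('v \<Rightarrow> 'k) \<Rightarrow> 'v"
  where "dual_code H W = (SOME f. bij_betw f (carrier H) (carrier W))"

definition decode :: "('k, 'v \<Rightarrow> 'k) bimod \<Rightarrow> ('k, 'v) bimod \<Rightarrow> 'v \<Rightarrow> ('v \<Rightarrow> 'k)"
  where "decode H W = inv_into (carrier H) (dual_code H W)"

definition transport :: "('k, 'v \<Rightarrow> 'k) bimod \<Rightarrow> ('k, 'v) bimod \<Rightarrow> ('k, 'v) bimod"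
  where "transport H W = make_bimod
    \<lparr>carrier = dual_code H W ` carrier H,
      monoid.mult = undefined, one = undefined,
      ring.zero = dual_code H W \<zero>\<^bsub>H\<^esub>,
      add = (\<lambda>x y. dual_code H W (decode H W x \<oplus>\<^bsub>H\<^esub> decode H W y))\<rparr>
    (\<lambda>a x. dual_code H W (lact H a (decode H W x)))
    (\<lambda>x b. dual_code H W (ract H (decode H W x) b))"

definition field_at :: "'k ring \<Rightarrow> 'k ring \<Rightarrow> int \<Rightarrow> 'k ring"
  where "field_at K0 K1 i = (if even i then K0 else K1)"

text \<open>\<open>upper_dual n\<close> and \<open>lower_dual n\<close> are the dual bimodules with index \<open>n\<close> and \<open>-n\<close>.\<close>

primrec upper_dual :: "'k ring \<Rightarrow> 'k ring \<Rightarrow> ('k, 'v) bimod \<Rightarrow> nat \<Rightarrow> ('k, 'v) bimod" where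
  "upper_dual K0 K1 V 0 = V"
| "upper_dual K0 K1 V (Suc n) =
     transport (right_dual (field_at K0 K1 (int n + 1)) (upper_dual K0 K1 V n))
       (upper_dual K0 K1 V n)"

primrec lower_dual :: "'k ring \<Rightarrow> 'k ring \<Rightarrow> ('k, 'v) bimod \<Rightarrow> nat \<Rightarrow> ('k, 'v) bimod" where
  "lower_dual K0 K1 V 0 = V"
| "lower_dual K0 K1 V (Suc n) =
     transport (left_dual (field_at K0 K1 (- int n)) (lower_dual K0 K1 V n))
       (lower_dual K0 K1 V n)"

definition iter_dual :: "'k ring \<Rightarrow> 'k ring \<Rightarrow> ('k, 'v) bimod \<Rightarrow> int \<Rightarrow> ('k, 'v) bimod"
  where "iter_dual K0 K1 V i =
    (if i \<ge> 0 then upper_dual K0 K1 V (nat i) else lower_dual K0 K1 V (nat (- i)))"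

text \<open>
  \<open>dual_pairing K0 K1 V i \<psi> v\<close>, for \<open>\<psi>\<close> in the dual with index \<open>i + 1\<close> and \<open>v\<close> in the one with
  index \<open>i\<close>, is the value \<open>\<psi>(v)\<close> in \<open>K\<^bsub>i+1\<^esub>\<close> of \<open>\<psi>\<close> viewed as an element of the right dual. For
  \<open>i < 0\<close> it is \<open>v\<close> that is by definition a functional, on the left dual side, and \<open>\<psi>\<close> acts on it by
  evaluation: this is the canonical map to the right dual of the left dual.
\<close>

definition dual_pairing :: "'k ring \<Rightarrow> 'k ring \<Rightarrow> ('k, 'v) bimod \<Rightarrow> int \<Rightarrow> 'v \<Rightarrow> 'v \<Rightarrow> 'k"
  where "dual_pairing K0 K1 V i \<psi> v =
    (if i \<ge> 0
     then decode (right_dual (field_at K0 K1 (i + 1)) (iter_dual K0 K1 V i))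
            (iter_dual K0 K1 V i) \<psi> v
     else decode (left_dual (field_at K0 K1 (i + 1)) (iter_dual K0 K1 V (i + 1)))
            (iter_dual K0 K1 V (i + 1)) v \<psi>)"


section \<open>Algebras and modules indexed by the integers\<close>

text \<open>\<open>zmul D i j l\<close> is the multiplication \<open>D\<^bsub>ij\<^esub> \<times> D\<^bsub>jl\<^esub> \<rightarrow> D\<^bsub>il\<^esub>\<close>.\<close>

record 'a zalg =
  zcomp :: "int \<Rightarrow> int \<Rightarrow> 'a ring"
  zmul :: "int \<Rightarrow> int \<Rightarrow> int \<Rightarrow> 'a \<Rightarrow> 'a \<Rightarrow> 'a"
  zunit :: "int \<Rightarrow> 'a"

locale zalgebra =
  fixes D :: "'a zalg"
  assumes comp_abelian: "abelian_group (zcomp D i j)"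
    and mul_closed: "\<lbrakk>x \<in> carrier (zcomp D i j); y \<in> carrier (zcomp D j l)\<rbrakk> \<Longrightarrow>
      zmul D i j l x y \<in> carrier (zcomp D i l)"
    and mul_add_left: "\<lbrakk>x \<in> carrier (zcomp D i j); x' \<in> carrier (zcomp D i j);
      y \<in> carrier (zcomp D j l)\<rbrakk> \<Longrightarrow>
      zmul D i j l (x \<oplus>\<^bsub>zcomp D i j\<^esub> x') y = zmul D i j l x y \<oplus>\<^bsub>zcomp D i l\<^esub> zmul D i j l x' y"
    and mul_add_right: "\<lbrakk>x \<in> carrier (zcomp D i j); y \<in> carrier (zcomp D j l);
      y' \<in> carrier (zcomp D j l)\<rbrakk> \<Longrightarrow>
      zmul D i j l x (y \<oplus>\<^bsub>zcomp D j l\<^esub> y') = zmul D i j l x y \<oplus>\<^bsub>zcomp D i l\<^esub> zmul D i j l x y'"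
    and mul_assoc: "\<lbrakk>x \<in> carrier (zcomp D i j); y \<in> carrier (zcomp D j l);
      z \<in> carrier (zcomp D l m)\<rbrakk> \<Longrightarrow>
      zmul D i l m (zmul D i j l x y) z = zmul D i j m x (zmul D j l m y z)"
    and unit_closed: "zunit D i \<in> carrier (zcomp D i i)"
    and unit_left: "x \<in> carrier (zcomp D i j) \<Longrightarrow> zmul D i i j (zunit D i) x = x"
    and unit_right: "x \<in> carrier (zcomp D i j) \<Longrightarrow> zmul D i j j x (zunit D j) = x"

definition zideal :: "'a zalg \<Rightarrow> (int \<Rightarrow> int \<Rightarrow> 'a set) \<Rightarrow> bool"
  where "zideal D I \<longleftrightarrow>
    (\<forall>i j. additive_subgroup (I i j) (zcomp D i j)) \<and>
    (\<forall>i j l. \<forall>x\<in>carrier (zcomp D i j). \<forall>y\<in>I j l. zmul D i j l x y \<in> I i l) \<and>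
    (\<forall>i j l. \<forall>x\<in>I i j. \<forall>y\<in>carrier (zcomp D j l). zmul D i j l x y \<in> I i l)"

definition gen_zideal :: "'a zalg \<Rightarrow> (int \<Rightarrow> int \<Rightarrow> 'a set) \<Rightarrow> int \<Rightarrow> int \<Rightarrow> 'a set"
  where "gen_zideal D S i j = \<Inter>{I i j | I. zideal D I \<and> (\<forall>p q. S p q \<subseteq> I p q)}"

definition zquot :: "'a zalg \<Rightarrow> (int \<Rightarrow> int \<Rightarrow> 'a set) \<Rightarrow> 'a set zalg"
  where "zquot D I =
    \<lparr>zcomp = (\<lambda>i j. quot_group (zcomp D i j) (I i j)),
     zmul = (\<lambda>i j l X Y. \<Union>x\<in>X. \<Union>y\<in>Y. I i l +>\<^bsub>zcomp D i l\<^esub> zmul D i j l x y),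
     zunit = (\<lambda>i. I i i +>\<^bsub>zcomp D i i\<^esub> zunit D i)\<rparr>"

definition zprod_span :: "'a zalg \<Rightarrow> int \<Rightarrow> int \<Rightarrow> int \<Rightarrow> 'a set \<Rightarrow> 'a set \<Rightarrow> 'a set"
  where "zprod_span D i j l X Y =
    generate (add_monoid (zcomp D i l)) {zmul D i j l x y | x y. x \<in> X \<and> y \<in> Y}"

text \<open>Given ring homomorphisms \<open>\<iota> i : K\<^sub>i \<rightarrow> D\<^bsub>ii\<^esub>\<close>, each \<open>D\<^bsub>ij\<^esub>\<close> is a \<open>K\<^sub>i\<close>-\<open>K\<^sub>j\<close>-bimodule.\<close>

definition comp_bimod :: "(int \<Rightarrow> 'k \<Rightarrow> 'a) \<Rightarrow> 'a zalg \<Rightarrow> int \<Rightarrow> int \<Rightarrow> ('k, 'a) bimod"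
  where "comp_bimod \<iota> D i j = make_bimod (zcomp D i j)
    (\<lambda>a x. zmul D i i j (\<iota> i a) x) (\<lambda>x b. zmul D i j j x (\<iota> j b))"

text \<open>A graded left module is given by the family of its homogeneous components;
  \<open>mact M i j\<close> is the multiplication \<open>D\<^bsub>ij\<^esub> \<times> M\<^sub>j \<rightarrow> M\<^sub>i\<close>.\<close>

record ('a, 'm) zmod =
  mcomp :: "int \<Rightarrow> 'm ring"
  mact :: "int \<Rightarrow> int \<Rightarrow> 'a \<Rightarrow> 'm \<Rightarrow> 'm"

locale zmodule = zalgebra D for D :: "'a zalg" +
  fixes M :: "('a, 'm) zmod"
  assumes mcomp_abelian: "abelian_group (mcomp M i)"
    and act_closed: "\<lbrakk>x \<in> carrier (zcomp D i j); m \<in> carrier (mcomp M j)\<rbrakk> \<Longrightarrow>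
      mact M i j x m \<in> carrier (mcomp M i)"
    and act_add_left: "\<lbrakk>x \<in> carrier (zcomp D i j); x' \<in> carrier (zcomp D i j);
      m \<in> carrier (mcomp M j)\<rbrakk> \<Longrightarrow>
      mact M i j (x \<oplus>\<^bsub>zcomp D i j\<^esub> x') m = mact M i j x m \<oplus>\<^bsub>mcomp M i\<^esub> mact M i j x' m"
    and act_add_right: "\<lbrakk>x \<in> carrier (zcomp D i j); m \<in> carrier (mcomp M j);
      m' \<in> carrier (mcomp M j)\<rbrakk> \<Longrightarrow>
      mact M i j x (m \<oplus>\<^bsub>mcomp M j\<^esub> m') = mact M i j x m \<oplus>\<^bsub>mcomp M i\<^esub> mact M i j x m'"
    and act_assoc: "\<lbrakk>x \<in> carrier (zcomp D i j); y \<in> carrier (zcomp D j l);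
      m \<in> carrier (mcomp M l)\<rbrakk> \<Longrightarrow>
      mact M i l (zmul D i j l x y) m = mact M i j x (mact M j l y m)"
    and act_unit: "m \<in> carrier (mcomp M i) \<Longrightarrow> mact M i i (zunit D i) m = m"

definition zmodule_hom ::
    "'a zalg \<Rightarrow> ('a, 'm) zmod \<Rightarrow> ('a, 'n) zmod \<Rightarrow> (int \<Rightarrow> 'm \<Rightarrow> 'n) \<Rightarrow> bool"
  where "zmodule_hom D M N f \<longleftrightarrow>
    zmodule D M \<and> zmodule D N \<and>
    (\<forall>i. add_hom (mcomp M i) (mcomp N i) (f i)) \<and>
    (\<forall>i j. \<forall>x\<in>carrier (zcomp D i j). \<forall>m\<in>carrier (mcomp M j).
       f i (mact M i j x m) = mact N i j x (f j m))"

text \<open>Exactness of \<open>0 \<rightarrow> M1 \<rightarrow> M2 \<rightarrow> M3 \<rightarrow> M4 \<rightarrow> 0\<close>.\<close>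

definition exact_zmodules ::
    "'a zalg \<Rightarrow> ('a, 'm) zmod \<Rightarrow> (int \<Rightarrow> 'm \<Rightarrow> 'n) \<Rightarrow> ('a, 'n) zmod \<Rightarrow> (int \<Rightarrow> 'n \<Rightarrow> 'p) \<Rightarrow>
     ('a, 'p) zmod \<Rightarrow> (int \<Rightarrow> 'p \<Rightarrow> 'q) \<Rightarrow> ('a, 'q) zmod \<Rightarrow> bool"
  where "exact_zmodules D M1 f M2 g M3 h M4 \<longleftrightarrow>
    zmodule_hom D M1 M2 f \<and> zmodule_hom D M2 M3 g \<and> zmodule_hom D M3 M4 h \<and>
    (\<forall>i. inj_on (f i) (carrier (mcomp M1 i)) \<and>
         f i ` carrier (mcomp M1 i) = a_kernel (mcomp M2 i) (mcomp M3 i) (g i) \<and>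
         g i ` carrier (mcomp M2 i) = a_kernel (mcomp M3 i) (mcomp M4 i) (h i) \<and>
         h i ` carrier (mcomp M3 i) = carrier (mcomp M4 i))"

definition proj_module :: "'a zalg \<Rightarrow> int \<Rightarrow> ('a, 'a) zmod"
  where "proj_module D j = \<lparr>mcomp = (\<lambda>i. zcomp D i j), mact = (\<lambda>i l. zmul D i l j)\<rparr>"

definition zmod_sum :: "('a, 'm) zmod \<Rightarrow> ('a, 'n) zmod \<Rightarrow> ('a, 'm \<times> 'n) zmod"
  where "zmod_sum M N =
    \<lparr>mcomp = (\<lambda>i. RDirProd (mcomp M i) (mcomp N i)),
     mact = (\<lambda>i j x (m, n). (mact M i j x m, mact N i j x n))\<rparr>"

text \<open>\<open>D\<^bsub>jj\<^esub>\<close> as a left module concentrated in degree \<open>j\<close> (a module if \<open>D\<^bsub>il\<^esub> = 0\<close> for \<open>i > l\<close>),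
  and the projection onto it.\<close>

definition simple_module :: "'a zalg \<Rightarrow> int \<Rightarrow> ('a, 'a) zmod"
  where "simple_module D j =
    \<lparr>mcomp = (\<lambda>i. if i = j then zcomp D j j else (zcomp D i j)\<lparr>carrier := {\<zero>\<^bsub>zcomp D i j\<^esub>}\<rparr>),
     mact = (\<lambda>i l x m. if i = j \<and> l = j then zmul D j j j x m else \<zero>\<^bsub>zcomp D i j\<^esub>)\<rparr>"

definition simple_proj :: "'a zalg \<Rightarrow> int \<Rightarrow> int \<Rightarrow> 'a \<Rightarrow> 'a"
  where "simple_proj D j i x = (if i = j then x else \<zero>\<^bsub>zcomp D i j\<^esub>)"


section \<open>The tensor algebra\<close>

text \<open>
  Let \<open>E i\<close> be a \<open>K i\<close>-\<open>K (i + 1)\<close>-bimodule for every integer \<open>i\<close>. For \<open>i \<le> j\<close> the abelian group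
  \<open>T\<^bsub>ij\<^esub> = K\<^sub>i \<otimes> E\<^sub>i \<otimes> \<dots> \<otimes> E\<^bsub>j-1\<^esub>\<close> (tensor products over \<open>K\<^sub>i, \<dots>, K\<^bsub>j-1\<^esub>\<close>) is presented by generators
  \<open>(a, [v\<^sub>i, \<dots>, v\<^bsub>j-1\<^esub>])\<close>, standing for \<open>a \<otimes> v\<^sub>i \<otimes> \<dots> \<otimes> v\<^bsub>j-1\<^esub>\<close>, subject to additivity in each
  position and to balancing. The leading factor \<open>K\<^sub>i\<close> changes nothing for \<open>i < j\<close>, and makes the
  formula yield \<open>T\<^bsub>ii\<^esub> = K\<^sub>i\<close>. For \<open>i > j\<close> there are no generators, so \<open>T\<^bsub>ij\<^esub> = 0\<close>.
\<close>

definition tens_words ::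
    "(int \<Rightarrow> 'k ring) \<Rightarrow> (int \<Rightarrow> ('k, 'v) bimod) \<Rightarrow> int \<Rightarrow> int \<Rightarrow> ('k \<times> 'v list) set"
  where "tens_words K E i j = {(a, vs). i \<le> j \<and> a \<in> carrier (K i) \<and> length vs = nat (j - i) \<and>
    (\<forall>k<length vs. vs ! k \<in> carrier (E (i + int k)))}"

definition word_rels ::
    "(int \<Rightarrow> 'k ring) \<Rightarrow> (int \<Rightarrow> ('k, 'v) bimod) \<Rightarrow> int \<Rightarrow> int \<Rightarrow> ('k \<times> 'v list \<Rightarrow>\<^sub>0 int) set"
  where "word_rels K E i j =
    {frag_of (a \<oplus>\<^bsub>K i\<^esub> b, vs) - frag_of (a, vs) - frag_of (b, vs) | a b vs.
       (a, vs) \<in> tens_words K E i j \<and> b \<in> carrier (K i)} \<union>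
    {frag_of (a, vs[k := v \<oplus>\<^bsub>E (i + int k)\<^esub> w]) - frag_of (a, vs[k := v]) - frag_of (a, vs[k := w])
       | a vs k v w. (a, vs) \<in> tens_words K E i j \<and> k < length vs \<and>
         v \<in> carrier (E (i + int k)) \<and> w \<in> carrier (E (i + int k))} \<union>
    {frag_of (a \<otimes>\<^bsub>K i\<^esub> c, v # vs) - frag_of (a, lact (E i) c v # vs) | a c v vs.
       (a, v # vs) \<in> tens_words K E i j \<and> c \<in> carrier (K i)} \<union>
    {frag_of (a, vs[k := ract (E (i + int k)) (vs ! k) c]) -
     frag_of (a, vs[Suc k := lact (E (i + int k + 1)) c (vs ! Suc k)]) | a vs k c.
       (a, vs) \<in> tens_words K E i j \<and> Suc k < length vs \<and> c \<in> carrier (K (i + int k + 1))}"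

definition tens_class :: "(int \<Rightarrow> 'k ring) \<Rightarrow> (int \<Rightarrow> ('k, 'v) bimod) \<Rightarrow> int \<Rightarrow> int \<Rightarrow>
    ('k \<times> 'v list \<Rightarrow>\<^sub>0 int) \<Rightarrow> ('k \<times> 'v list \<Rightarrow>\<^sub>0 int) set"
  where "tens_class K E i j = pclass (tens_words K E i j) (word_rels K E i j)"

text \<open>The product of words from \<open>i\<close> to \<open>j\<close> and from \<open>j\<close> on; the scalar of the second one is
  absorbed by the last letter of the first one.\<close>

definition word_mul :: "(int \<Rightarrow> 'k ring) \<Rightarrow> (int \<Rightarrow> ('k, 'v) bimod) \<Rightarrow> int \<Rightarrow>
    'k \<times> 'v list \<Rightarrow> 'k \<times> 'v list \<Rightarrow> 'k \<times> 'v list"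
  where "word_mul K E j p q = (case p of (a, vs) \<Rightarrow> case q of (b, ws) \<Rightarrow>
    if vs = [] then (a \<otimes>\<^bsub>K j\<^esub> b, ws)
    else (a, butlast vs @ [ract (E (j - 1)) (last vs) b] @ ws))"

definition tensor_zalg ::
    "(int \<Rightarrow> 'k ring) \<Rightarrow> (int \<Rightarrow> ('k, 'v) bimod) \<Rightarrow> ('k \<times> 'v list \<Rightarrow>\<^sub>0 int) set zalg"
  where "tensor_zalg K E =
    \<lparr>zcomp = (\<lambda>i j. presented_group (tens_words K E i j) (word_rels K E i j)),
     zmul = (\<lambda>i j l X Y. \<Union>x\<in>X. \<Union>y\<in>Y.
       tens_class K E i l
         (frag_extend (\<lambda>p. frag_extend (\<lambda>q. frag_of (word_mul K E j p q)) y) x)),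
     zunit = (\<lambda>i. tens_class K E i i (frag_of (\<one>\<^bsub>K i\<^esub>, [])))\<rparr>"

text \<open>The identification \<open>K\<^sub>i = T\<^bsub>ii\<^esub>\<close>, and pure tensors \<open>v\<^sub>i \<otimes> \<dots> \<otimes> v\<^bsub>j-1\<^esub>\<close>.\<close>

definition tens_scalar :: "(int \<Rightarrow> 'k ring) \<Rightarrow> (int \<Rightarrow> ('k, 'v) bimod) \<Rightarrow> int \<Rightarrow> 'k \<Rightarrow>
    ('k \<times> 'v list \<Rightarrow>\<^sub>0 int) set"
  where "tens_scalar K E i a = tens_class K E i i (frag_of (a, []))"

definition tens_pure :: "(int \<Rightarrow> 'k ring) \<Rightarrow> (int \<Rightarrow> ('k, 'v) bimod) \<Rightarrow> int \<Rightarrow> 'v list \<Rightarrow>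
    ('k \<times> 'v list \<Rightarrow>\<^sub>0 int) set"
  where "tens_pure K E i vs = tens_class K E i (i + int (length vs)) (frag_of (\<one>\<^bsub>K i\<^esub>, vs))"


section \<open>The noncommutative symmetric algebra of a rank two bimodule\<close>

context
  fixes K0 K1 :: "'k ring" and V :: "('k, 'v) bimod"
begin

abbreviation (input) "KK \<equiv> field_at K0 K1"
abbreviation (input) "VV \<equiv> iter_dual K0 K1 V"

definition nc_tensor :: "('k \<times> 'v list \<Rightarrow>\<^sub>0 int) set zalg"
  where "nc_tensor = tensor_zalg KK VV"

text \<open>
  \<open>quad_rel i\<close> is \<open>Q\<^sub>i\<close>: the tensors \<open>\<Sum> x\<^sub>k \<otimes> \<psi>\<^sub>k\<close> whose associated endomorphism
  \<open>w \<mapsto> \<Sum> x\<^sub>k \<psi>\<^sub>k(w)\<close> is left multiplication by an element of \<open>K\<^sub>i\<close>.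
\<close>

definition quad_rel :: "int \<Rightarrow> ('k \<times> 'v list \<Rightarrow>\<^sub>0 int) set set"
  where "quad_rel i = {t. \<exists>a\<in>carrier (KK i). \<exists>(n::nat) x \<psi>.
    (\<forall>k<n. x k \<in> carrier (VV i) \<and> \<psi> k \<in> carrier (VV (i + 1))) \<and>
    t = (\<Oplus>\<^bsub>zcomp nc_tensor i (i + 2)\<^esub> k\<in>{..<n}. tens_pure KK VV i [x k, \<psi> k]) \<and>
    (\<forall>w\<in>carrier (VV i).
       (\<Oplus>\<^bsub>VV i\<^esub> k\<in>{..<n}. ract (VV i) (x k) (dual_pairing K0 K1 V i (\<psi> k) w)) = lact (VV i) a w)}"

definition nc_ideal :: "int \<Rightarrow> int \<Rightarrow> ('k \<times> 'v list \<Rightarrow>\<^sub>0 int) set set"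
  where "nc_ideal = gen_zideal nc_tensor (\<lambda>i j. if j = i + 2 then quad_rel i else {})"

definition nc_sym :: "('k \<times> 'v list \<Rightarrow>\<^sub>0 int) set set zalg"
  where "nc_sym = zquot nc_tensor nc_ideal"

definition sym_class :: "int \<Rightarrow> int \<Rightarrow> ('k \<times> 'v list \<Rightarrow>\<^sub>0 int) set \<Rightarrow> ('k \<times> 'v list \<Rightarrow>\<^sub>0 int) set set"
  where "sym_class i j t = nc_ideal i j +>\<^bsub>zcomp nc_tensor i j\<^esub> t"

text \<open>\<open>V\<^sup>i\<^sup>*\<close> inside \<open>T\<^bsub>i,i+1\<^esub>\<close>.\<close>

definition deg_one :: "int \<Rightarrow> ('k \<times> 'v list \<Rightarrow>\<^sub>0 int) set set"
  where "deg_one i = (\<lambda>v. tens_pure KK VV i [v]) ` carrier (VV i)"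

definition sym_vec :: "int \<Rightarrow> 'v \<Rightarrow> ('k \<times> 'v list \<Rightarrow>\<^sub>0 int) set set"
  where "sym_vec i v = sym_class i (i + 1) (tens_pure KK VV i [v])"

definition sym_bimod :: "int \<Rightarrow> int \<Rightarrow> ('k, ('k \<times> 'v list \<Rightarrow>\<^sub>0 int) set set) bimod"
  where "sym_bimod i j = comp_bimod (\<lambda>l a. sym_class l l (tens_scalar KK VV l a)) nc_sym i j"

definition quad_bimod :: "int \<Rightarrow> ('k, ('k \<times> 'v list \<Rightarrow>\<^sub>0 int) set) bimod"
  where "quad_bimod j =
    (comp_bimod (tens_scalar KK VV) nc_tensor j (j + 2))\<lparr>carrier := quad_rel j\<rparr>"

text \<open>
  The maps of the sequence \<open>A\<^bsub>ij\<^esub> \<otimes> Q\<^sub>j \<rightarrow> A\<^bsub>i,j+1\<^esub> \<otimes> V\<^sup>(\<^sup>j\<^sup>+\<^sup>1\<^sup>)\<^sup>* \<rightarrow> A\<^bsub>i,j+2\<^esub>\<close> are induced by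
  multiplication: \<open>a \<otimes> \<Sum> x\<^sub>k \<otimes> \<psi>\<^sub>k \<mapsto> \<Sum> a x\<^sub>k \<otimes> \<psi>\<^sub>k\<close> and \<open>a \<otimes> v \<mapsto> a v\<close>. These conditions
  determine homomorphisms \<open>f\<close> and \<open>g\<close> uniquely.
\<close>

definition mult_induced_left ::
    "int \<Rightarrow> int \<Rightarrow>
     ((('k \<times> 'v list \<Rightarrow>\<^sub>0 int) set set \<times> ('k \<times> 'v list \<Rightarrow>\<^sub>0 int) set \<Rightarrow>\<^sub>0 int) set \<Rightarrow>
      (('k \<times> 'v list \<Rightarrow>\<^sub>0 int) set set \<times> 'v \<Rightarrow>\<^sub>0 int) set) \<Rightarrow> bool"
  where "mult_induced_left i j f \<longleftrightarrow>
    (\<forall>a\<in>carrier (zcomp nc_sym i j). \<forall>(n::nat) x \<psi> t.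
       (\<forall>k<n. x k \<in> carrier (VV j) \<and> \<psi> k \<in> carrier (VV (j + 1))) \<and>
       t = (\<Oplus>\<^bsub>zcomp nc_tensor j (j + 2)\<^esub> k\<in>{..<n}. tens_pure KK VV j [x k, \<psi> k]) \<and>
       t \<in> quad_rel j \<longrightarrow>
       f (pure_tensor (KK j) (sym_bimod i j) (quad_bimod j) a t) =
       (\<Oplus>\<^bsub>tensor (KK (j + 1)) (sym_bimod i (j + 1)) (VV (j + 1))\<^esub> k\<in>{..<n}.
          pure_tensor (KK (j + 1)) (sym_bimod i (j + 1)) (VV (j + 1))
            (zmul nc_sym i j (j + 1) a (sym_vec j (x k))) (\<psi> k)))"

definition mult_induced_right ::
    "int \<Rightarrow> int \<Rightarrow>
     ((('k \<times> 'v list \<Rightarrow>\<^sub>0 int) set set \<times> 'v \<Rightarrow>\<^sub>0 int) set \<Rightarrow> ('k \<times> 'v list \<Rightarrow>\<^sub>0 int) set set) \<Rightarrow> bool"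
  where "mult_induced_right i j g \<longleftrightarrow>
    (\<forall>a\<in>carrier (zcomp nc_sym i (j + 1)). \<forall>v\<in>carrier (VV (j + 1)).
       g (pure_tensor (KK (j + 1)) (sym_bimod i (j + 1)) (VV (j + 1)) a v) =
       zmul nc_sym i (j + 1) (j + 2) a (sym_vec (j + 1) v))"

end

end

theory Submission imports Defs begin

text \<open>
  Write \<open>E\<^sub>j\<close> for the dual with index \<open>j\<close>. A left basis \<open>Y\<^sub>j, Y'\<^sub>j\<close> of \<open>E\<^bsub>j+1\<^esub>\<close> and the dual right basis
  \<open>X\<^sub>j, X'\<^sub>j\<close> of \<open>E\<^sub>j\<close> give \<open>Q\<^sub>j = K\<^sub>j q\<^sub>j\<close> with the central element \<open>q\<^sub>j = X\<^sub>j Y\<^sub>j + X'\<^sub>j Y'\<^sub>j\<close>. Every element of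
  \<open>T\<^bsub>i,j+2\<^esub>\<close> is uniquely \<open>u Y\<^sub>j + u' Y'\<^sub>j\<close>, and \<open>R\<^bsub>i,j+2\<^esub> = R\<^bsub>i,j+1\<^esub> E\<^bsub>j+1\<^esub> + T\<^bsub>ij\<^esub> q\<^sub>j\<close>, so \<open>a Y\<^sub>j + a' Y'\<^sub>j = 0\<close> in \<open>A\<close>
  exactly when \<open>a = b X\<^sub>j\<close> and \<open>a' = b X'\<^sub>j\<close> for some \<open>b\<close>. The point is that right multiplication by
  a nonzero vector is injective on \<open>A\<close>; by the previous remark a zero product can be pushed one
  degree down until it becomes trivial. In particular \<open>b\<close> is unique, which gives the exact
  sequences and, by counting dimensions, the ranks; and \<open>t X\<^sub>j \<in> R\<close> implies \<open>t \<in> R\<close>, which is (1).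

  That all duals have rank two on both sides is not formal: it holds because a rank two bimodule
  over fields carries a nondegenerate symmetric form for which the left action is self-adjoint.
\<close>

text \<open>Why the claim is about all nonzero vectors and not only about X_j: the vector produced
  one degree down depends on the given one and need not be a basis vector. Rank two is what keeps
  the descent closed. A vector has two coordinates, hence there are two equations with a common b,
  and eliminating a between them leaves a single equation of the original form. Why forms enter: a
  right basis of W shows the dimension of Hom_M(W, M) over M, but not over L, which acts by
  precomposition. An isomorphism of the dual with W that exchanges the two sides settles both
  dimensions at once, and it also supplies the bijection on which the coding of iterated duals
  relies. Afterwards only the pairing and a choice of dual bases are retained. Algebras, actions and
  products are given by unions over representatives, so each of them is first identified with a map
  obtained from a universal property. T_{i,j+1} is never replaced by a tensor product of T_ij with
  E_j; uniqueness of expansions is read off by contracting the last letter of a word.\<close>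

definition additive :: "('a, 'm) ring_scheme \<Rightarrow> ('b, 'n) ring_scheme \<Rightarrow> ('a \<Rightarrow> 'b) \<Rightarrow> bool"
  where "additive G H f \<longleftrightarrow> f \<in> hom (add_monoid G) (add_monoid H)"

text \<open>\<open>add_hom\<close> is restricted to bare \<open>ring\<close> records, whereas
  \<open>additive\<close> accepts record extensions, so fields, modules and bimodules can be source
  or target without truncation.\<close>

lemma add_hom_iff_additive: "add_hom G H f \<longleftrightarrow> additive G H f"
  by (simp add: add_hom_def additive_def)

lemma additiveI:
  assumes "\<And>x. x \<in> carrier G \<Longrightarrow> f x \<in> carrier H"
    and "\<And>x y. x \<in> carrier G \<Longrightarrow> y \<in> carrier G \<Longrightarrow> f (x \<oplus>\<^bsub>G\<^esub> y) = f x \<oplus>\<^bsub>H\<^esub> f y"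
  shows "additive G H f"
  using assms by (auto simp: additive_def hom_def)

lemma additive_closed: "additive G H f \<Longrightarrow> x \<in> carrier G \<Longrightarrow> f x \<in> carrier H"
  by (auto simp: additive_def hom_def)

lemma additive_add:
  "additive G H f \<Longrightarrow> x \<in> carrier G \<Longrightarrow> y \<in> carrier G \<Longrightarrow> f (x \<oplus>\<^bsub>G\<^esub> y) = f x \<oplus>\<^bsub>H\<^esub> f y"
  by (auto simp: additive_def hom_def)

lemma additive_abelian_group_hom:
  "additive G H f \<Longrightarrow> abelian_group G \<Longrightarrow> abelian_group H \<Longrightarrow> abelian_group_hom G H f"
  by (intro abelian_group_homI group_hom.intro group_hom_axioms.intro abelian_group.a_group)
    (simp_all only: additive_def)

lemma additive_zero:
  "additive G H f \<Longrightarrow> abelian_group G \<Longrightarrow> abelian_group H \<Longrightarrow> f \<zero>\<^bsub>G\<^esub> = \<zero>\<^bsub>H\<^esub>"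
  by (rule abelian_group_hom.hom_zero[OF additive_abelian_group_hom])

lemma additive_neg:
  "additive G H f \<Longrightarrow> abelian_group G \<Longrightarrow> abelian_group H \<Longrightarrow> x \<in> carrier G \<Longrightarrow>
    f (\<ominus>\<^bsub>G\<^esub> x) = \<ominus>\<^bsub>H\<^esub> f x"
  by (rule abelian_group_hom.hom_a_inv[OF additive_abelian_group_hom])

lemma additive_diff:
  "additive G H f \<Longrightarrow> abelian_group G \<Longrightarrow> abelian_group H \<Longrightarrow> x \<in> carrier G \<Longrightarrow> y \<in> carrier G \<Longrightarrow>
    f (x \<ominus>\<^bsub>G\<^esub> y) = f x \<ominus>\<^bsub>H\<^esub> f y"
  by (simp add: a_minus_def additive_add additive_neg abelian_group.a_inv_closed)

lemma additive_inj_on: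
  assumes "additive G H f" "abelian_group G" "abelian_group H"
    and "\<And>x. x \<in> carrier G \<Longrightarrow> f x = \<zero>\<^bsub>H\<^esub> \<Longrightarrow> x = \<zero>\<^bsub>G\<^esub>"
  shows "inj_on f (carrier G)"
proof (rule inj_onI)
  interpret G: abelian_group G by fact
  interpret H: abelian_group H by fact
  fix x y assume xy: "x \<in> carrier G" "y \<in> carrier G" "f x = f y"
  then have "f (x \<ominus>\<^bsub>G\<^esub> y) = \<zero>\<^bsub>H\<^esub>"
    by (simp add: additive_diff[OF assms(1-3)] additive_closed[OF assms(1)] H.minus_eq H.r_neg)
  then have "x \<ominus>\<^bsub>G\<^esub> y = \<zero>\<^bsub>G\<^esub>" using assms(4) xy by simp
  then show "x = y" using xy by simp
qed

lemma additive_compose: "additive G H f \<Longrightarrow> additive H L g \<Longrightarrow> additive G L (\<lambda>x. g (f x))"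
  by (auto intro!: additiveI simp: additive_closed additive_add)

lemma additive_plus:
  assumes "abelian_group H" "additive G H f" "additive G H g"
  shows "additive G H (\<lambda>x. f x \<oplus>\<^bsub>H\<^esub> g x)"
proof -
  interpret H: abelian_group H by fact
  show ?thesis
    using assms(2,3) by (auto intro!: additiveI simp: additive_closed additive_add H.a_ac)
qed

lemma additive_finsum:
  assumes "additive G H f" "abelian_group G" "abelian_group H" "finite I" "\<And>i. i \<in> I \<Longrightarrow> x i \<in> carrier G"
  shows "f (\<Oplus>\<^bsub>G\<^esub>i\<in>I. x i) = (\<Oplus>\<^bsub>H\<^esub>i\<in>I. f (x i))"
proof -
  interpret G: abelian_group G by fact
  interpret H: abelian_group H by fact
  show ?thesis
    using assms(4,5)
    by (induction I rule: finite_induct)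
      (auto simp: additive_zero[OF assms(1-3)] additive_add[OF assms(1)] additive_closed[OF assms(1)] Pi_def)
qed

section \<open>Quotients of abelian groups\<close>

lemma quot_group_simps:
  "carrier (quot_group G H) = {H +>\<^bsub>G\<^esub> x | x. x \<in> carrier G}"
  "\<zero>\<^bsub>quot_group G H\<^esub> = H"
  "X \<oplus>\<^bsub>quot_group G H\<^esub> Y = X <+>\<^bsub>G\<^esub> Y"
  by (auto simp: quot_group_def A_RCOSETS_def')

lemma abelian_group_quot_group:
  assumes "abelian_group G" "additive_subgroup H G"
  shows "abelian_group (quot_group G H)"
proof -
  interpret S: abelian_subgroup H G by (rule abelian_subgroupI3[OF assms(2,1)])
  have "add_monoid (quot_group G H) = G A_Mod H"
    by (simp add: quot_group_def A_FactGroup_def')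
  then show ?thesis
    using S.a_factorgroup_is_comm_group
    by (simp add: abelian_group_def abelian_group_axioms_def abelian_monoid_def comm_group.axioms)
qed

context
  fixes G :: "'a ring" and H :: "'a set"
  assumes G: "abelian_group G" and H: "additive_subgroup H G"
begin

interpretation S: abelian_subgroup H G by (rule abelian_subgroupI3[OF H G])

lemma quot_class_add:
  "x \<in> carrier G \<Longrightarrow> y \<in> carrier G \<Longrightarrow>
    H +>\<^bsub>G\<^esub> (x \<oplus>\<^bsub>G\<^esub> y) = (H +>\<^bsub>G\<^esub> x) <+>\<^bsub>G\<^esub> (H +>\<^bsub>G\<^esub> y)"
  by (simp add: S.a_rcos_sum)

lemma quot_class_eq_iff:
  assumes "x \<in> carrier G" "y \<in> carrier G"
  shows "H +>\<^bsub>G\<^esub> x = H +>\<^bsub>G\<^esub> y \<longleftrightarrow> x \<ominus>\<^bsub>G\<^esub> y \<in> H"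
  using assms S.a_rcos_module[of y x] S.a_rcos_self[of x] S.a_repr_independence'[of x y]
  by (auto simp: a_minus_def)

lemma quot_class_zero_iff:
  assumes "x \<in> carrier G"
  shows "H +>\<^bsub>G\<^esub> x = H \<longleftrightarrow> x \<in> H"
  using assms by (metis S.a_coset_join1 S.a_coset_join2 S.a_rcos_const S.a_rcos_self)

lemma quot_class_mem: "x \<in> carrier G \<Longrightarrow> x \<in> H +>\<^bsub>G\<^esub> x"
  by (simp add: S.a_rcos_self)

lemma quot_class_subset: "x \<in> carrier G \<Longrightarrow> H +>\<^bsub>G\<^esub> x \<subseteq> carrier G"
  by (simp add: S.a_r_coset_subset_G S.a_subset)

lemma quot_class_eqI: "x \<in> carrier G \<Longrightarrow> y \<in> H +>\<^bsub>G\<^esub> x \<Longrightarrow> H +>\<^bsub>G\<^esub> y = H +>\<^bsub>G\<^esub> x"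
  using S.a_repr_independence'[of y x] by auto

lemma quot_group_universal:
  assumes "abelian_group B" "additive G B f" "\<And>h. h \<in> H \<Longrightarrow> f h = \<zero>\<^bsub>B\<^esub>"
  obtains F where "additive (quot_group G H) B F" "\<And>x. x \<in> carrier G \<Longrightarrow> F (H +>\<^bsub>G\<^esub> x) = f x"
proof
  interpret B: abelian_group B by fact
  \<comment> \<open>Evaluation at a chosen representative; it is independent of the choice because
    \<open>f\<close> vanishes on \<open>H\<close>.\<close>
  define F where "F X = f (SOME x. x \<in> carrier G \<and> X = H +>\<^bsub>G\<^esub> x)" for X
  show F: "F (H +>\<^bsub>G\<^esub> x) = f x" if x: "x \<in> carrier G" for x
  proof -
    let ?y = "SOME y. y \<in> carrier G \<and> H +>\<^bsub>G\<^esub> x = H +>\<^bsub>G\<^esub> y"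
    have y: "?y \<in> carrier G \<and> H +>\<^bsub>G\<^esub> x = H +>\<^bsub>G\<^esub> ?y"
      by (rule someI[of _ x]) (use x in simp)
    then have "f (x \<ominus>\<^bsub>G\<^esub> ?y) = \<zero>\<^bsub>B\<^esub>"
      using assms(3) quot_class_eq_iff[of x ?y] x by blast
    then have "f x \<ominus>\<^bsub>B\<^esub> f ?y = \<zero>\<^bsub>B\<^esub>"
      using additive_diff[OF assms(2) G assms(1)] x y by simp
    then show ?thesis
      using additive_closed[OF assms(2)] x y by (simp add: F_def)
  qed
  show "additive (quot_group G H) B F"
  proof (rule additiveI)
    fix X assume "X \<in> carrier (quot_group G H)"
    then obtain x where x: "x \<in> carrier G" "X = H +>\<^bsub>G\<^esub> x" by (auto simp: quot_group_simps)
    then show "F X \<in> carrier B" using F[of x] additive_closed[OF assms(2)] by simp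
    fix Y assume "Y \<in> carrier (quot_group G H)"
    then obtain y where y: "y \<in> carrier G" "Y = H +>\<^bsub>G\<^esub> y" by (auto simp: quot_group_simps)
    have "X \<oplus>\<^bsub>quot_group G H\<^esub> Y = H +>\<^bsub>G\<^esub> (x \<oplus>\<^bsub>G\<^esub> y)"
      using x y by (simp add: quot_group_simps quot_class_add)
    moreover have "x \<oplus>\<^bsub>G\<^esub> y \<in> carrier G" using x y by auto
    ultimately show "F (X \<oplus>\<^bsub>quot_group G H\<^esub> Y) = F X \<oplus>\<^bsub>B\<^esub> F Y"
      using F x y additive_add[OF assms(2)] by metis
  qed
qed

end


section \<open>Groups given by generators and relations\<close>

lemma add_monoid_free_group [simp]: "add_monoid (free_group S) = free_Abelian_group S"
  by (simp add: free_group_def free_Abelian_group_def)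

lemma carrier_free_group_iff: "x \<in> carrier (free_group S) \<longleftrightarrow> Poly_Mapping.keys x \<subseteq> S"
  by (simp add: free_group_def)

lemma free_group_simps [simp]:
  "frag_of g \<in> carrier (free_group S) \<longleftrightarrow> g \<in> S"
  "0 \<in> carrier (free_group S)"
  "\<zero>\<^bsub>free_group S\<^esub> = 0" "x \<oplus>\<^bsub>free_group S\<^esub> y = x + y"
  by (simp_all add: free_group_def)

lemma abelian_group_free_group [simp]: "abelian_group (free_group S)"
  by (intro abelian_group.intro abelian_monoid.intro abelian_group_axioms.intro)
    (simp_all only: add_monoid_free_group comm_group.axioms abelian_free_Abelian_group)

lemma free_group_neg [simp]: "x \<in> carrier (free_group S) \<Longrightarrow> \<ominus>\<^bsub>free_group S\<^esub> x = - x"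
  unfolding a_inv_def add_monoid_free_group by (simp add: carrier_free_group_iff)

lemma free_group_minus [simp]:
  "x \<in> carrier (free_group S) \<Longrightarrow> y \<in> carrier (free_group S) \<Longrightarrow> x \<ominus>\<^bsub>free_group S\<^esub> y = x - y"
  by (simp add: a_minus_def)

lemma free_group_add_closed:
  "x \<in> carrier (free_group S) \<Longrightarrow> y \<in> carrier (free_group S) \<Longrightarrow> x + y \<in> carrier (free_group S)"
  using keys_add[of x y] by (auto simp: carrier_free_group_iff)

lemma free_group_induct [consumes 1, case_names zero diff gen]:
  assumes "x \<in> carrier (free_group S)"
    and "P 0"
    and "\<And>x y. x \<in> carrier (free_group S) \<Longrightarrow> y \<in> carrier (free_group S) \<Longrightarrow> P x \<Longrightarrow> P y \<Longrightarrow> P (x - y)"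
    and "\<And>a. a \<in> S \<Longrightarrow> P (frag_of a)"
  shows "P x"
  by (rule free_Abelian_group_induct[of x S P]) (use assms in \<open>auto simp: carrier_free_group_iff\<close>)

lemma free_group_diff_closed:
  "x \<in> carrier (free_group S) \<Longrightarrow> y \<in> carrier (free_group S) \<Longrightarrow> x - y \<in> carrier (free_group S)"
  using keys_diff[of x y] by (auto simp: carrier_free_group_iff)

text \<open>\<open>preserves_rels S Rel B h\<close> says that the map \<open>h\<close> of generators kills the relations, tested on
  every additive extension of \<open>h\<close> to the free group.\<close>

definition preserves_rels :: "'g set \<Rightarrow> ('g \<Rightarrow>\<^sub>0 int) set \<Rightarrow> ('b, 'm) ring_scheme \<Rightarrow> ('g \<Rightarrow> 'b) \<Rightarrow> bool"
  where "preserves_rels S Rel B h \<longleftrightarrow> h \<in> S \<rightarrow> carrier B \<and>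
    (\<forall>F. additive (free_group S) B F \<longrightarrow> (\<forall>g\<in>S. F (frag_of g) = h g) \<longrightarrow> (\<forall>r\<in>Rel. F r = \<zero>\<^bsub>B\<^esub>))"

lemma free_group_extend:
  assumes "abelian_group B" "h \<in> S \<rightarrow> carrier B"
  obtains F where "additive (free_group S) B F" "\<And>g. g \<in> S \<Longrightarrow> F (frag_of g) = h g"
proof -
  interpret B: abelian_group B by fact
  have "comm_group (add_monoid B)"
    by (rule B.a_comm_group)
  then obtain F where "F \<in> hom (free_Abelian_group S) (add_monoid B)" "\<And>g. g \<in> S \<Longrightarrow> F (frag_of g) = h g"
    using comm_group.free_Abelian_group_universal[of "add_monoid B" h S] assms(2) by auto
  then show thesis using that unfolding additive_def add_monoid_free_group by blast
qed

lemma free_group_hom_eq: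
  assumes "abelian_group B" "additive (free_group S) B F" "additive (free_group S) B F'"
    "\<And>g. g \<in> S \<Longrightarrow> F (frag_of g) = F' (frag_of g)" "x \<in> carrier (free_group S)"
  shows "F x = F' x"
  using assms(5)
proof (induction rule: free_group_induct)
  case zero
  then show ?case
    using additive_zero[OF assms(2) abelian_group_free_group assms(1)]
      additive_zero[OF assms(3) abelian_group_free_group assms(1)] by simp
next
  case (diff x y)
  then show ?case
    using additive_diff[OF assms(2) abelian_group_free_group assms(1), of x y]
      additive_diff[OF assms(3) abelian_group_free_group assms(1), of x y] by simp
qed (simp add: assms(4))

locale presentation =
  fixes S :: "'g set" and Rel :: "('g \<Rightarrow>\<^sub>0 int) set"
  assumes Rel: "Rel \<subseteq> carrier (free_group S)"
begin

abbreviation "P \<equiv> presented_group S Rel"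
abbreviation "cls \<equiv> pclass S Rel"
abbreviation "gen g \<equiv> pclass S Rel (frag_of g)"

lemma additive_subgroup_rel_span: "additive_subgroup (rel_span S Rel) (free_group S)"
  unfolding rel_span_def additive_subgroup_def add_monoid_free_group
  by (rule group.generate_is_subgroup[OF group_free_Abelian_group])
    (use Rel in \<open>auto simp: carrier_free_group_iff\<close>)

lemmas rsp = abelian_group_free_group[of S] additive_subgroup_rel_span

lemma abelian_group_P: "abelian_group P"
  unfolding presented_group_def by (rule abelian_group_quot_group[OF rsp])

sublocale P: abelian_group P by (rule abelian_group_P)

lemma cls_closed: "x \<in> carrier (free_group S) \<Longrightarrow> cls x \<in> carrier P"
  by (auto simp: presented_group_def quot_group_simps pclass_def)

lemma gen_closed: "g \<in> S \<Longrightarrow> gen g \<in> carrier P"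
  by (rule cls_closed) simp

lemma cls_additive: "additive (free_group S) P cls"
  using quot_class_add[OF rsp]
  by (intro additiveI cls_closed) (auto simp: presented_group_def quot_group_simps pclass_def)

lemma cls_cases:
  assumes "X \<in> carrier P" obtains x where "x \<in> carrier (free_group S)" "X = cls x"
  using assms by (auto simp: presented_group_def quot_group_simps pclass_def)

lemma cls_rel: "r \<in> Rel \<Longrightarrow> cls r = \<zero>\<^bsub>P\<^esub>"
  using quot_class_zero_iff[OF rsp, of r] Rel generate.incl[of r Rel "free_Abelian_group S"]
  by (auto simp: presented_group_def quot_group_simps pclass_def rel_span_def)

lemma cls_mem: "x \<in> carrier (free_group S) \<Longrightarrow> x \<in> cls x"
  unfolding pclass_def by (rule quot_class_mem[OF rsp])

lemma mem_cls: "X \<in> carrier P \<Longrightarrow> x \<in> X \<Longrightarrow> x \<in> carrier (free_group S) \<and> cls x = X"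
proof (elim cls_cases)
  fix y assume "x \<in> X" "y \<in> carrier (free_group S)" "X = cls y"
  then show "x \<in> carrier (free_group S) \<and> cls x = X"
    using quot_class_subset[OF rsp, of y] quot_class_eqI[OF rsp, of y x] by (auto simp: pclass_def)
qed

lemma cls_diff:
  "x \<in> carrier (free_group S) \<Longrightarrow> y \<in> carrier (free_group S) \<Longrightarrow> cls (x - y) = cls x \<ominus>\<^bsub>P\<^esub> cls y"
  using additive_diff[OF cls_additive abelian_group_free_group abelian_group_P, of x y] by simp

lemma cls_zero: "cls 0 = \<zero>\<^bsub>P\<^esub>"
  using additive_zero[OF cls_additive abelian_group_free_group abelian_group_P] by simp

lemma induct [consumes 1, case_names zero diff gen]:
  assumes "X \<in> carrier P" and "Q \<zero>\<^bsub>P\<^esub>"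
    and "\<And>X Y. X \<in> carrier P \<Longrightarrow> Y \<in> carrier P \<Longrightarrow> Q X \<Longrightarrow> Q Y \<Longrightarrow> Q (X \<ominus>\<^bsub>P\<^esub> Y)"
    and "\<And>g. g \<in> S \<Longrightarrow> Q (gen g)"
  shows "Q X"
proof -
  obtain x where x: "x \<in> carrier (free_group S)" "X = cls x" using assms(1) by (rule cls_cases)
  from x(1) have "Q (cls x)"
    by (induction rule: free_group_induct) (use assms in \<open>auto simp: cls_zero cls_diff cls_closed\<close>)
  then show ?thesis using x by simp
qed

lemma hom_eq:
  assumes "abelian_group B" "additive P B F" "additive P B F'"
    "\<And>g. g \<in> S \<Longrightarrow> F (gen g) = F' (gen g)" "X \<in> carrier P"
  shows "F X = F' X"
  using assms(5)
proof (induction rule: induct)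
  case zero
  then show ?case
    using additive_zero[OF assms(2) abelian_group_P assms(1)]
      additive_zero[OF assms(3) abelian_group_P assms(1)] by simp
next
  case (diff x y)
  then show ?case
    using additive_diff[OF assms(2) abelian_group_P assms(1), of x y]
      additive_diff[OF assms(3) abelian_group_P assms(1), of x y] by simp
qed (simp add: assms(4))

lemma universal:
  assumes B: "abelian_group B" and h: "preserves_rels S Rel B h"
  obtains F where "additive P B F" "\<And>g. g \<in> S \<Longrightarrow> F (gen g) = h g"
proof -
  interpret B: abelian_group B by fact
  obtain F where F: "additive (free_group S) B F" "\<And>g. g \<in> S \<Longrightarrow> F (frag_of g) = h g"
    using free_group_extend[OF B] h unfolding preserves_rels_def by metis
  have rel: "F r = \<zero>\<^bsub>B\<^esub>" if "r \<in> Rel" for r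
    using h F that unfolding preserves_rels_def by blast
  \<comment> \<open>Membership in the free group is carried along because the additivity of
    \<open>F\<close> is available only there.\<close>
  have span: "F x = \<zero>\<^bsub>B\<^esub> \<and> x \<in> carrier (free_group S)" if "x \<in> rel_span S Rel" for x
    using that unfolding rel_span_def
  proof (induction rule: generate.induct)
    case one
    then show ?case using additive_zero[OF F(1) abelian_group_free_group B] by simp
  next
    case (incl r)
    then show ?case using rel Rel by auto
  next
    case (inv r)
    then have "r \<in> carrier (free_group S)" using Rel by auto
    then show ?case using rel inv additive_neg[OF F(1) abelian_group_free_group B, of r] keys_minus[of r]
      by (auto simp: carrier_free_group_iff)
  next
    case (eng x y)
    then show ?case
      using additive_add[OF F(1), of x y] free_group_add_closed by auto
  qed
  obtain F' where "additive P B F'" "\<And>x. x \<in> carrier (free_group S) \<Longrightarrow> F' (cls x) = F x"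
    using quot_group_universal[OF rsp B F(1)] span unfolding presented_group_def pclass_def by metis
  then show thesis using that F(2) by auto
qed

text \<open>Induced maps and products on presented groups are unions over all representatives. Such
  a union is over a nonempty set and of a constant family, since \<open>L\<close> and the composite
  of \<open>F\<close> with the class map agree on generators.\<close>

lemma union_representatives:
  assumes B: "abelian_group B" and F: "additive P B F" and L: "additive (free_group S) B L"
    and eq: "\<And>g. g \<in> S \<Longrightarrow> L (frag_of g) = F (gen g)" and X: "X \<in> carrier P"
  shows "x \<in> X \<Longrightarrow> L x = F X" and "X \<noteq> {}"
proof -
  show "X \<noteq> {}" using X cls_mem by (elim cls_cases) auto
  assume "x \<in> X"
  then have x: "x \<in> carrier (free_group S)" "cls x = X" using mem_cls[OF X] by auto
  have "L x = F (cls x)"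
    by (rule free_group_hom_eq[OF B L additive_compose[OF cls_additive F]]) (use eq x in auto)
  then show "L x = F X" using x by simp
qed

end

lemma frag_extend_additive:
  assumes "presentation S' Rel'" "h \<in> S \<rightarrow> carrier (free_group S')"
  shows "additive (free_group S) (presented_group S' Rel') (\<lambda>x. pclass S' Rel' (frag_extend h x))"
proof -
  interpret presentation S' Rel' by fact
  have "frag_extend h x \<in> carrier (free_group S')" if "x \<in> carrier (free_group S)" for x
    using keys_frag_extend[of h x] that assms(2) by (fastforce simp: Pi_iff carrier_free_group_iff)
  then show ?thesis
    by (intro additiveI) (auto simp: cls_closed frag_extend_add additive_add[OF cls_additive, simplified])
qed

lemma (in presentation) induced_map_eq:
  assumes "additive P P F" "h \<in> S \<rightarrow> S" "\<And>g. g \<in> S \<Longrightarrow> F (gen g) = gen (h g)" "X \<in> carrier P"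
  shows "induced_map S Rel h X = F X"
proof -
  have "presentation S Rel" ..
  then have L: "additive (free_group S) P (\<lambda>x. cls (frag_extend (\<lambda>g. frag_of (h g)) x))"
    by (rule frag_extend_additive) (use assms(2) in auto)
  show ?thesis
    unfolding induced_map_def
    using union_representatives[OF abelian_group_P assms(1) L _ assms(4)] assms(3)
    by (auto simp: UNION_singleton_eq_range)
qed

text \<open>The universal property is applied once in each variable. Between the two applications
  one needs the relations of the first group against every element of the second, although
  \<open>h1\<close> gives them only against generators.\<close>

lemma presented_bilinear:
  assumes "presentation S Rel" "presentation S' Rel'" and B: "abelian_group B"
    and h1: "\<And>q. q \<in> S' \<Longrightarrow> preserves_rels S Rel B (\<lambda>p. h p q)"
    and h2: "\<And>p. p \<in> S \<Longrightarrow> preserves_rels S' Rel' B (h p)"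
  obtains F where
    "\<And>Y. Y \<in> carrier (presented_group S' Rel') \<Longrightarrow> additive (presented_group S Rel) B (\<lambda>X. F X Y)"
    "\<And>X. X \<in> carrier (presented_group S Rel) \<Longrightarrow> additive (presented_group S' Rel') B (F X)"
    "\<And>p q. p \<in> S \<Longrightarrow> q \<in> S' \<Longrightarrow> F (pclass S Rel (frag_of p)) (pclass S' Rel' (frag_of q)) = h p q"
proof -
  interpret A: presentation S Rel by fact
  interpret C: presentation S' Rel' by fact
  interpret B: abelian_group B by fact
  have "\<exists>F. \<forall>p\<in>S. additive C.P B (F p) \<and> (\<forall>q\<in>S'. F p (C.gen q) = h p q)"
    by (rule bchoice) (use C.universal[OF B h2] in metis)
  then obtain F where F: "\<And>p. p \<in> S \<Longrightarrow> additive C.P B (F p)" "\<And>p q. p \<in> S \<Longrightarrow> q \<in> S' \<Longrightarrow> F p (C.gen q) = h p q"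
    by blast
  have Fc: "F p Y \<in> carrier B" if "p \<in> S" "Y \<in> carrier C.P" for p Y
    using additive_closed[OF F(1)] that by blast
  \<comment> \<open>Induction on \<open>Y\<close>, for all \<open>L\<close> at once: in the
    difference step the extensions belonging to the two parts are different maps from the given
    one.\<close>
  have resp: "preserves_rels S Rel B (\<lambda>p. F p Y)" if Y: "Y \<in> carrier C.P" for Y
    unfolding preserves_rels_def
  proof (intro conjI allI impI ballI)
    show "(\<lambda>p. F p Y) \<in> S \<rightarrow> carrier B" using Fc Y by auto
    fix L r assume "additive (free_group S) B L" "\<forall>p\<in>S. L (frag_of p) = F p Y" and r: "r \<in> Rel"
    with Y show "L r = \<zero>\<^bsub>B\<^esub>"
    proof (induction Y arbitrary: L rule: C.induct)
      case zero
      note 1 = zero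
      have "additive (free_group S) B (\<lambda>_. \<zero>\<^bsub>B\<^esub>)" by (rule additiveI) auto
      then show ?case
        using free_group_hom_eq[OF B 1(1), of "\<lambda>_. \<zero>\<^bsub>B\<^esub>" r] 1(2) r A.Rel
          additive_zero[OF F(1) C.abelian_group_P B] by auto
    next
      case (diff X Y)
      note 2 = diff
      have *: "(\<lambda>p. F p X) \<in> S \<rightarrow> carrier B" "(\<lambda>p. F p Y) \<in> S \<rightarrow> carrier B"
        using Fc 2(1,2) by blast+
      obtain L1 where L1: "additive (free_group S) B L1" "\<And>g. g \<in> S \<Longrightarrow> L1 (frag_of g) = F g X"
        using free_group_extend[OF B *(1)] by metis
      obtain L2 where L2: "additive (free_group S) B L2" "\<And>g. g \<in> S \<Longrightarrow> L2 (frag_of g) = F g Y"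
        using free_group_extend[OF B *(2)] by metis
      have r0: "L1 r = \<zero>\<^bsub>B\<^esub>" "L2 r = \<zero>\<^bsub>B\<^esub>" using 2 L1 L2 r by auto
      \<comment> \<open>A sum is compared with \<open>L1\<close> instead of a difference with
        \<open>L\<close>: the two sides agree on generators, and evaluation at \<open>r\<close>
        leaves \<open>L r = 0\<close>.\<close>
      have "additive (free_group S) B (\<lambda>x. L x \<oplus>\<^bsub>B\<^esub> L2 x)"
        by (rule additive_plus[OF B 2(5) L2(1)])
      moreover have "L (frag_of g) \<oplus>\<^bsub>B\<^esub> L2 (frag_of g) = L1 (frag_of g)" if "g \<in> S" for g
        using that 2(1,2,6) L1(2) L2(2) additive_diff[OF F(1)[OF that] C.abelian_group_P B, of X Y] *
        by (auto simp: B.minus_eq B.add.m_assoc B.l_neg Pi_iff)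
      ultimately have "L r \<oplus>\<^bsub>B\<^esub> L2 r = L1 r"
        by (rule free_group_hom_eq[OF B _ L1(1)]) (use r A.Rel in auto)
      moreover have "L r \<in> carrier B" using additive_closed[OF 2(5)] r A.Rel by blast
      ultimately show ?case using r0 by simp
    next
      case (gen q)
      then show ?case using h1[of q] F(2) r unfolding preserves_rels_def by auto
    qed
  qed
  have "\<exists>G. \<forall>Y\<in>carrier C.P. additive A.P B (G Y) \<and> (\<forall>p\<in>S. G Y (A.gen p) = F p Y)"
    by (rule bchoice) (use A.universal[OF B resp] in metis)
  then obtain G where G: "\<And>Y. Y \<in> carrier C.P \<Longrightarrow> additive A.P B (G Y)"
    "\<And>Y p. Y \<in> carrier C.P \<Longrightarrow> p \<in> S \<Longrightarrow> G Y (A.gen p) = F p Y"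
    by blast
  show thesis
  proof (rule that[of "\<lambda>X Y. G Y X"])
    fix X assume X: "X \<in> carrier A.P"
    show "additive C.P B (\<lambda>Y. G Y X)"
    proof (rule additiveI)
      fix Y assume Y: "Y \<in> carrier C.P"
      show "G Y X \<in> carrier B" using additive_closed[OF G(1)] X Y by blast
      fix Y' assume Y': "Y' \<in> carrier C.P"
      show "G (Y \<oplus>\<^bsub>C.P\<^esub> Y') X = G Y X \<oplus>\<^bsub>B\<^esub> G Y' X"
        by (rule A.hom_eq[OF B G(1) additive_plus[OF B G(1) G(1)] _ X])
          (use Y Y' in \<open>auto simp: G(2) additive_add[OF F(1)]\<close>)
    qed
  qed (use G F C.gen_closed in auto)
qed

lemma (in presentation) gen_eq_add:
  assumes "frag_of a - frag_of b - frag_of c \<in> Rel" "a \<in> S" "b \<in> S" "c \<in> S"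
  shows "gen a = gen b \<oplus>\<^bsub>P\<^esub> gen c"
proof -
  have "gen a \<ominus>\<^bsub>P\<^esub> gen b \<ominus>\<^bsub>P\<^esub> gen c = \<zero>\<^bsub>P\<^esub>"
    using cls_rel[OF assms(1)] assms(2-4) by (simp add: cls_diff free_group_diff_closed)
  then have "gen a \<ominus>\<^bsub>P\<^esub> gen b = gen c" using assms(2-4) by (simp add: gen_closed)
  then have "gen b \<oplus>\<^bsub>P\<^esub> (gen a \<ominus>\<^bsub>P\<^esub> gen b) = gen b \<oplus>\<^bsub>P\<^esub> gen c" by simp
  then show ?thesis
    using assms(2-4) by (simp add: gen_closed P.minus_eq P.a_lcomm[of "gen b"] P.r_neg)
qed

lemma (in presentation) gen_eq:
  assumes "frag_of a - frag_of b \<in> Rel" "a \<in> S" "b \<in> S"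
  shows "gen a = gen b"
  using cls_rel[OF assms(1)] assms(2,3) by (simp add: cls_diff gen_closed)

text \<open>Every presentation used here has relations of only two shapes, additivity and
  identification of two generators. Checking them amounts to equations between values of
  \<open>h\<close>.\<close>

lemma preserves_relsI:
  assumes B: "abelian_group B" and h: "h \<in> S \<rightarrow> carrier B"
    and rel: "\<And>r. r \<in> Rel \<Longrightarrow>
      (\<exists>a\<in>S. \<exists>b\<in>S. \<exists>c\<in>S. r = frag_of a - frag_of b - frag_of c \<and> h a = h b \<oplus>\<^bsub>B\<^esub> h c) \<or>
      (\<exists>a\<in>S. \<exists>b\<in>S. r = frag_of a - frag_of b \<and> h a = h b)"
  shows "preserves_rels S Rel B h"
  unfolding preserves_rels_def
proof (intro conjI allI impI ballI h)
  interpret B: abelian_group B by fact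
  fix F r assume F: "additive (free_group S) B F" "\<forall>g\<in>S. F (frag_of g) = h g" and r: "r \<in> Rel"
  have diff: "F (x - y) = F x \<ominus>\<^bsub>B\<^esub> F y" if "x \<in> carrier (free_group S)" "y \<in> carrier (free_group S)" for x y
    using additive_diff[OF F(1) abelian_group_free_group B that] that by simp
  have hc: "h g \<in> carrier B" if "g \<in> S" for g using h that by auto
  show "F r = \<zero>\<^bsub>B\<^esub>"
    using rel[OF r]
  proof (elim disjE bexE conjE)
    fix a b c assume *: "a \<in> S" "b \<in> S" "c \<in> S" "r = frag_of a - frag_of b - frag_of c" "h a = h b \<oplus>\<^bsub>B\<^esub> h c"
    have "F r = (h b \<oplus>\<^bsub>B\<^esub> h c) \<ominus>\<^bsub>B\<^esub> h b \<ominus>\<^bsub>B\<^esub> h c"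
      using F(2) * by (simp add: diff free_group_diff_closed)
    also have "\<dots> = (h b \<oplus>\<^bsub>B\<^esub> h c) \<ominus>\<^bsub>B\<^esub> (h b \<oplus>\<^bsub>B\<^esub> h c)"
      using hc * by (simp add: B.minus_eq B.minus_add B.a_assoc)
    also have "\<dots> = \<zero>\<^bsub>B\<^esub>" using hc * by (simp add: B.minus_eq B.r_neg)
    finally show ?thesis .
  next
    fix a b assume *: "a \<in> S" "b \<in> S" "r = frag_of a - frag_of b" "h a = h b"
    then show ?thesis using F(2) hc by (simp add: diff B.minus_eq B.r_neg)
  qed
qed

section \<open>Bimodules\<close>

lemma make_bimod_simps [simp]:
  "carrier (make_bimod G l r) = carrier G" "\<zero>\<^bsub>make_bimod G l r\<^esub> = \<zero>\<^bsub>G\<^esub>"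
  "x \<oplus>\<^bsub>make_bimod G l r\<^esub> y = x \<oplus>\<^bsub>G\<^esub> y" "lact (make_bimod G l r) = l" "ract (make_bimod G l r) = r"
  by (simp_all add: make_bimod_def ring.extend_def bimod.fields_def)

lemma left_module_simps [simp]:
  "carrier (left_module W) = carrier W" "\<zero>\<^bsub>left_module W\<^esub> = \<zero>\<^bsub>W\<^esub>"
  "x \<oplus>\<^bsub>left_module W\<^esub> y = x \<oplus>\<^bsub>W\<^esub> y" "a \<odot>\<^bsub>left_module W\<^esub> x = lact W a x"
  by (simp_all add: left_module_def ring.extend_def ring.truncate_def module.fields_def)

lemma right_module_simps [simp]:
  "carrier (right_module W) = carrier W" "\<zero>\<^bsub>right_module W\<^esub> = \<zero>\<^bsub>W\<^esub>"
  "x \<oplus>\<^bsub>right_module W\<^esub> y = x \<oplus>\<^bsub>W\<^esub> y" "a \<odot>\<^bsub>right_module W\<^esub> x = ract W x a"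
  by (simp_all add: right_module_def ring.extend_def ring.truncate_def module.fields_def)

lemma abelian_group_cong:
  assumes "abelian_group G" "carrier H = carrier G" "\<zero>\<^bsub>H\<^esub> = \<zero>\<^bsub>G\<^esub>"
    "\<And>x y. x \<in> carrier G \<Longrightarrow> y \<in> carrier G \<Longrightarrow> x \<oplus>\<^bsub>H\<^esub> y = x \<oplus>\<^bsub>G\<^esub> y"
  shows "abelian_group H"
proof -
  interpret G: abelian_group G by fact
  have "\<exists>y\<in>carrier H. y \<oplus>\<^bsub>H\<^esub> x = \<zero>\<^bsub>H\<^esub>" if "x \<in> carrier H" for x
    using that assms(2-4) by (intro bexI[of _ "\<ominus>\<^bsub>G\<^esub> x"]) (auto simp: G.l_neg)
  then show ?thesis
    using assms(2-4) by (intro abelian_groupI) (auto simp: G.a_assoc intro: G.a_comm)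
qed

lemma finsum_cong_ring:
  "carrier H = carrier G \<Longrightarrow> \<zero>\<^bsub>H\<^esub> = \<zero>\<^bsub>G\<^esub> \<Longrightarrow> add H = add G \<Longrightarrow> finsum H = finsum G"
  by (intro ext) (simp add: finsum_def finprod_def)

lemma bimoduleI:
  assumes "cring L" "cring M" "abelian_group W"
    and "\<And>a v. a \<in> carrier L \<Longrightarrow> v \<in> carrier W \<Longrightarrow> lact W a v \<in> carrier W"
    and "\<And>a b v. a \<in> carrier L \<Longrightarrow> b \<in> carrier L \<Longrightarrow> v \<in> carrier W \<Longrightarrow>
      lact W (a \<oplus>\<^bsub>L\<^esub> b) v = lact W a v \<oplus>\<^bsub>W\<^esub> lact W b v"
    and "\<And>a v w. a \<in> carrier L \<Longrightarrow> v \<in> carrier W \<Longrightarrow> w \<in> carrier W \<Longrightarrow>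
      lact W a (v \<oplus>\<^bsub>W\<^esub> w) = lact W a v \<oplus>\<^bsub>W\<^esub> lact W a w"
    and "\<And>a b v. a \<in> carrier L \<Longrightarrow> b \<in> carrier L \<Longrightarrow> v \<in> carrier W \<Longrightarrow>
      lact W (a \<otimes>\<^bsub>L\<^esub> b) v = lact W a (lact W b v)"
    and "\<And>v. v \<in> carrier W \<Longrightarrow> lact W \<one>\<^bsub>L\<^esub> v = v"
    and "\<And>a v. a \<in> carrier M \<Longrightarrow> v \<in> carrier W \<Longrightarrow> ract W v a \<in> carrier W"
    and "\<And>a b v. a \<in> carrier M \<Longrightarrow> b \<in> carrier M \<Longrightarrow> v \<in> carrier W \<Longrightarrow>
      ract W v (a \<oplus>\<^bsub>M\<^esub> b) = ract W v a \<oplus>\<^bsub>W\<^esub> ract W v b"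
    and "\<And>a v w. a \<in> carrier M \<Longrightarrow> v \<in> carrier W \<Longrightarrow> w \<in> carrier W \<Longrightarrow>
      ract W (v \<oplus>\<^bsub>W\<^esub> w) a = ract W v a \<oplus>\<^bsub>W\<^esub> ract W w a"
    and "\<And>a b v. a \<in> carrier M \<Longrightarrow> b \<in> carrier M \<Longrightarrow> v \<in> carrier W \<Longrightarrow>
      ract W v (a \<otimes>\<^bsub>M\<^esub> b) = ract W (ract W v a) b"
    and "\<And>v. v \<in> carrier W \<Longrightarrow> ract W v \<one>\<^bsub>M\<^esub> = v"
    and "\<And>a v b. a \<in> carrier L \<Longrightarrow> v \<in> carrier W \<Longrightarrow> b \<in> carrier M \<Longrightarrow>
      ract W (lact W a v) b = lact W a (ract W v b)"
  shows "bimodule L M W"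
proof (rule bimodule.intro)
  have ab: "abelian_group (left_module W)" "abelian_group (right_module W)"
    by (auto intro!: abelian_group_cong[OF assms(3)])
  interpret M: cring M by fact
  show "module L (left_module W)"
    by (rule moduleI) (use assms ab in auto)
  show "ract W (lact W a v) b = lact W a (ract W v b)"
    if "a \<in> carrier L" "v \<in> carrier W" "b \<in> carrier M" for a v b
    using assms that by auto
  \<comment> \<open>Swapping the arguments makes a right action a left action of the opposite ring;
    commutativity of \<open>M\<close> is what turns it into a module over \<open>M\<close>.\<close>
  have "ract W v (a \<otimes>\<^bsub>M\<^esub> b) = ract W (ract W v b) a" if "a \<in> carrier M" "b \<in> carrier M" "v \<in> carrier W" for a b v
    using assms(12)[of b a v] that by (simp add: M.m_comm)
  then show "module M (right_module W)"
    by (intro moduleI) (use assms ab in auto)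
qed

context bimodule begin

lemma cring_left: "cring L" using left by (simp add: module_def)
lemma cring_right: "cring M" using right by (simp add: module_def)

lemma abelian_group_W: "abelian_group W"
  by (rule abelian_group_cong[of "left_module W"]) (use left in \<open>auto simp: module_def\<close>)

sublocale W: abelian_group W by (rule abelian_group_W)

lemma lact_closed [simp]: "a \<in> carrier L \<Longrightarrow> v \<in> carrier W \<Longrightarrow> lact W a v \<in> carrier W"
  using module.smult_closed[OF left, of a v] by simp

lemma ract_closed [simp]: "a \<in> carrier M \<Longrightarrow> v \<in> carrier W \<Longrightarrow> ract W v a \<in> carrier W"
  using module.smult_closed[OF right, of a v] by simp

lemma lact_add_left: "a \<in> carrier L \<Longrightarrow> b \<in> carrier L \<Longrightarrow> v \<in> carrier W \<Longrightarrow>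
    lact W (a \<oplus>\<^bsub>L\<^esub> b) v = lact W a v \<oplus>\<^bsub>W\<^esub> lact W b v"
  using module.smult_l_distr[OF left, of a b v] by simp

lemma lact_add_right: "a \<in> carrier L \<Longrightarrow> v \<in> carrier W \<Longrightarrow> w \<in> carrier W \<Longrightarrow>
    lact W a (v \<oplus>\<^bsub>W\<^esub> w) = lact W a v \<oplus>\<^bsub>W\<^esub> lact W a w"
  using module.smult_r_distr[OF left, of a v w] by simp

lemma lact_mult: "a \<in> carrier L \<Longrightarrow> b \<in> carrier L \<Longrightarrow> v \<in> carrier W \<Longrightarrow>
    lact W (a \<otimes>\<^bsub>L\<^esub> b) v = lact W a (lact W b v)"
  using module.smult_assoc1[OF left, of a b v] by simp

lemma lact_one [simp]: "v \<in> carrier W \<Longrightarrow> lact W \<one>\<^bsub>L\<^esub> v = v"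
  using module.smult_one[OF left, of v] by simp

lemma ract_add_right: "a \<in> carrier M \<Longrightarrow> b \<in> carrier M \<Longrightarrow> v \<in> carrier W \<Longrightarrow>
    ract W v (a \<oplus>\<^bsub>M\<^esub> b) = ract W v a \<oplus>\<^bsub>W\<^esub> ract W v b"
  using module.smult_l_distr[OF right, of a b v] by simp

lemma ract_add_left: "a \<in> carrier M \<Longrightarrow> v \<in> carrier W \<Longrightarrow> w \<in> carrier W \<Longrightarrow>
    ract W (v \<oplus>\<^bsub>W\<^esub> w) a = ract W v a \<oplus>\<^bsub>W\<^esub> ract W w a"
  using module.smult_r_distr[OF right, of a v w] by simp

lemma ract_mult: "a \<in> carrier M \<Longrightarrow> b \<in> carrier M \<Longrightarrow> v \<in> carrier W \<Longrightarrow>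
    ract W v (a \<otimes>\<^bsub>M\<^esub> b) = ract W (ract W v a) b"
  using module.smult_assoc1[OF right, of b a v] cring.cring_simprules(14)[OF cring_right, of a b] by simp

lemma ract_one [simp]: "v \<in> carrier W \<Longrightarrow> ract W v \<one>\<^bsub>M\<^esub> = v"
  using module.smult_one[OF right, of v] by simp

lemma lact_additive: "a \<in> carrier L \<Longrightarrow> additive W W (lact W a)"
  by (rule additiveI) (auto simp: lact_add_right)

lemma ract_additive: "a \<in> carrier M \<Longrightarrow> additive W W (\<lambda>v. ract W v a)"
  by (rule additiveI) (auto simp: ract_add_left)

lemma lact_zero_left [simp]: "v \<in> carrier W \<Longrightarrow> lact W \<zero>\<^bsub>L\<^esub> v = \<zero>\<^bsub>W\<^esub>"
  using module.smult_l_null[OF left, of v] by simp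

lemma ract_zero_right [simp]: "v \<in> carrier W \<Longrightarrow> ract W v \<zero>\<^bsub>M\<^esub> = \<zero>\<^bsub>W\<^esub>"
  using module.smult_l_null[OF right, of v] by simp

end

text \<open>The same group with the two sides exchanged. Statements about left duals and left
  dimensions are obtained from the right-handed ones through it.\<close>

definition op_bimod :: "('k, 'v) bimod \<Rightarrow> ('k, 'v) bimod"
  where "op_bimod W = make_bimod (ring.truncate W) (\<lambda>a v. ract W v a) (\<lambda>v a. lact W a v)"

lemma op_bimod_simps [simp]:
  "carrier (op_bimod W) = carrier W" "\<zero>\<^bsub>op_bimod W\<^esub> = \<zero>\<^bsub>W\<^esub>"
  "x \<oplus>\<^bsub>op_bimod W\<^esub> y = x \<oplus>\<^bsub>W\<^esub> y" "lact (op_bimod W) = (\<lambda>a v. ract W v a)" "ract (op_bimod W) = (\<lambda>v a. lact W a v)"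
  by (simp_all add: op_bimod_def ring.truncate_def)

lemma left_module_op: "left_module (op_bimod W) = right_module W"
  and right_module_op: "right_module (op_bimod W) = left_module W"
  by (simp_all add: left_module_def right_module_def op_bimod_def make_bimod_def ring.extend_def
      ring.truncate_def module.fields_def bimod.fields_def)

lemma bimodule_op: "bimodule L M W \<Longrightarrow> bimodule M L (op_bimod W)"
  by (simp add: bimodule_def left_module_op right_module_op)

lemma rank_two_op: "rank_two_bimodule L M W \<Longrightarrow> rank_two_bimodule M L (op_bimod W)"
  by (simp add: rank_two_bimodule_def bimodule_op left_module_op right_module_op)

lemma bimodule_homI:
  assumes "bimodule L M X" "bimodule L M Y" "additive X Y f"
    and "\<And>a x. a \<in> carrier L \<Longrightarrow> x \<in> carrier X \<Longrightarrow> f (lact X a x) = lact Y a (f x)"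
    and "\<And>a x. a \<in> carrier M \<Longrightarrow> x \<in> carrier X \<Longrightarrow> f (ract X x a) = ract Y (f x) a"
  shows "bimodule_hom L M X Y f"
  using assms by (auto simp: bimodule_hom_def module_hom_def additive_closed additive_add)

lemma bimodule_transfer:
  assumes "bimodule L M X" and bij: "bij_betw f (carrier X) (carrier Y)"
    and zero: "f \<zero>\<^bsub>X\<^esub> = \<zero>\<^bsub>Y\<^esub>"
    and add: "\<And>x y. x \<in> carrier X \<Longrightarrow> y \<in> carrier X \<Longrightarrow> f (x \<oplus>\<^bsub>X\<^esub> y) = f x \<oplus>\<^bsub>Y\<^esub> f y"
    and l: "\<And>a x. a \<in> carrier L \<Longrightarrow> x \<in> carrier X \<Longrightarrow> f (lact X a x) = lact Y a (f x)"
    and r: "\<And>a x. a \<in> carrier M \<Longrightarrow> x \<in> carrier X \<Longrightarrow> f (ract X x a) = ract Y (f x) a"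
  shows "bimodule L M Y"
proof -
  interpret bimodule L M X by fact
  interpret L: cring L by (rule cring_left)
  interpret M: cring M by (rule cring_right)
  have im: "\<exists>x. x \<in> carrier X \<and> y = f x" if "y \<in> carrier Y" for y
    using bij that by (auto simp: bij_betw_def)
  have cl: "f x \<in> carrier Y" if "x \<in> carrier X" for x using bij that by (auto simp: bij_betw_def)
  have ab: "abelian_group Y"
  proof (rule abelian_groupI, goal_cases)
    case (1 x y) then show ?case using im[of x] im[of y] by (auto simp: cl simp flip: add)
  next
    case 2 then show ?case using cl zero by (metis W.zero_closed)
  next
    case (3 x y z) then show ?case
      using im[of x] im[of y] im[of z] by (auto simp: W.a_assoc simp flip: add)
  next
    case (4 x y) then show ?case using im[of x] im[of y] by (auto simp: W.a_comm simp flip: add)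
  next
    case (5 x) then show ?case using im[of x] by (auto simp flip: add zero)
  next
    case (6 x)
    then obtain u where u: "u \<in> carrier X" "x = f u" using im by blast
    then have "f (\<ominus>\<^bsub>X\<^esub> u) \<oplus>\<^bsub>Y\<^esub> x = \<zero>\<^bsub>Y\<^esub>" by (simp add: W.l_neg flip: add zero)
    then show ?case using cl u by blast
  qed
  show ?thesis
    by (rule bimoduleI[OF cring_left cring_right ab];
        (drule im)+; auto simp: cl lact_add_left lact_add_right lact_mult ract_add_left ract_add_right
          ract_mult lact_ract simp flip: add l r)
qed

section \<open>Bases\<close>

text \<open>A finite basis together with its dual functionals. Having the coordinates as additive
  maps lets them be composed with other maps and transported along isomorphisms.\<close>

definition basis_family ::
    "'k ring \<Rightarrow> ('k, 'v) module \<Rightarrow> 'i set \<Rightarrow> ('i \<Rightarrow> 'v) \<Rightarrow> ('i \<Rightarrow> 'v \<Rightarrow> 'k) \<Rightarrow> bool"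
  where "basis_family K W I b l \<longleftrightarrow> finite I \<and> (\<forall>i\<in>I. b i \<in> carrier W \<and> additive W K (l i) \<and>
      (\<forall>a\<in>carrier K. \<forall>w\<in>carrier W. l i (a \<odot>\<^bsub>W\<^esub> w) = a \<otimes>\<^bsub>K\<^esub> l i w)) \<and>
    (\<forall>w\<in>carrier W. w = (\<Oplus>\<^bsub>W\<^esub>i\<in>I. l i w \<odot>\<^bsub>W\<^esub> b i)) \<and>
    (\<forall>i\<in>I. \<forall>j\<in>I. l i (b j) = (if i = j then \<one>\<^bsub>K\<^esub> else \<zero>\<^bsub>K\<^esub>))"

lemma basis_family_coords:
  assumes "field K" "module K W" "basis_family K W I b l" "c \<in> I \<rightarrow> carrier K" "i \<in> I"
  shows "l i (\<Oplus>\<^bsub>W\<^esub>j\<in>I. c j \<odot>\<^bsub>W\<^esub> b j) = c i"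
proof -
  interpret K: field K by fact
  interpret W: module K W by fact
  have "l i (\<Oplus>\<^bsub>W\<^esub>j\<in>I. c j \<odot>\<^bsub>W\<^esub> b j) = (\<Oplus>\<^bsub>K\<^esub>j\<in>I. l i (c j \<odot>\<^bsub>W\<^esub> b j))"
    by (rule additive_finsum) (use assms(3-5) in \<open>auto simp: basis_family_def Pi_iff
      W.abelian_group_axioms K.abelian_group_axioms\<close>)
  also have "\<dots> = (\<Oplus>\<^bsub>K\<^esub>j\<in>I. if i = j then c j else \<zero>\<^bsub>K\<^esub>)"
    using assms(3-5) by (intro K.finsum_cong') (auto simp: basis_family_def Pi_iff)
  also have "\<dots> = c i"
    using assms(3-5) K.add.finprod_singleton[of i I c] by (simp add: basis_family_def)
  finally show ?thesis .
qed

lemma has_dim_if_basis_family: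
  assumes "field K" "module K W" "basis_family K W I b l"
  shows "has_dim K W (card I)"
proof -
  interpret K: field K by fact
  interpret W: module K W by fact
  interpret V: vectorspace K W by (intro vectorspace.intro assms)
  have fin: "finite I" and bc: "\<And>i. i \<in> I \<Longrightarrow> b i \<in> carrier W"
    and ex: "\<And>w. w \<in> carrier W \<Longrightarrow> w = (\<Oplus>\<^bsub>W\<^esub>i\<in>I. l i w \<odot>\<^bsub>W\<^esub> b i)"
    and dl: "\<And>i j. i \<in> I \<Longrightarrow> j \<in> I \<Longrightarrow> l i (b j) = (if i = j then \<one>\<^bsub>K\<^esub> else \<zero>\<^bsub>K\<^esub>)"
    and lc: "\<And>i w. i \<in> I \<Longrightarrow> w \<in> carrier W \<Longrightarrow> l i w \<in> carrier K"
    using assms(3) by (auto simp: basis_family_def intro: additive_closed)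
  have inj: "inj_on b I"
  proof (rule inj_onI)
    fix i j assume "i \<in> I" "j \<in> I" "b i = b j"
    then show "i = j" using dl[of i i] dl[of i j] K.one_not_zero by (auto split: if_splits)
  qed
  have lin: "W.lincomb a (b ` I) = (\<Oplus>\<^bsub>W\<^esub>i\<in>I. a (b i) \<odot>\<^bsub>W\<^esub> b i)" if "a \<in> b ` I \<rightarrow> carrier K" for a
    unfolding W.lincomb_def by (rule W.add.finprod_reindex[OF _ inj]) (use that bc in auto)
  have "V.basis (b ` I)"
  proof (subst V.basis_criterion)
    show "finite (b ` I)" using fin by simp
    show "b ` I \<subseteq> carrier W" using bc by auto
    show "\<forall>v. v \<in> carrier W \<longrightarrow> (\<exists>!a. a \<in> b ` I \<rightarrow>\<^sub>E carrier K \<and> W.lincomb a (b ` I) = v)"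
    proof (intro allI impI ex_ex1I)
      fix v assume v: "v \<in> carrier W"
      \<comment> \<open>Coefficients of a linear combination are indexed by the basis vectors
        themselves and are extensional, so the index is recovered by inverting
        \<open>b\<close>.\<close>
      let ?a = "\<lambda>x\<in>b ` I. l (inv_into I b x) v"
      have "W.lincomb ?a (b ` I) = (\<Oplus>\<^bsub>W\<^esub>i\<in>I. l i v \<odot>\<^bsub>W\<^esub> b i)"
        by (subst lin) (use v lc inj bc in \<open>auto intro!: W.finsum_cong'\<close>)
      then show "\<exists>a. a \<in> b ` I \<rightarrow>\<^sub>E carrier K \<and> W.lincomb a (b ` I) = v"
        using ex[OF v] v lc inj by (intro exI[of _ ?a]) auto
    next
      fix v a a' assume v: "v \<in> carrier W"
        and a: "a \<in> b ` I \<rightarrow>\<^sub>E carrier K \<and> W.lincomb a (b ` I) = v"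
        and a': "a' \<in> b ` I \<rightarrow>\<^sub>E carrier K \<and> W.lincomb a' (b ` I) = v"
      have "l i v = a (b i)" "l i v = a' (b i)" if "i \<in> I" for i
        using basis_family_coords[OF assms(1-3), of "\<lambda>i. a (b i)" i]
          basis_family_coords[OF assms(1-3), of "\<lambda>i. a' (b i)" i] that a a' lin[of a] lin[of a']
        by (auto simp: PiE_def Pi_iff)
      then show "a = a'" using a a' by (intro PiE_ext[of a "b ` I"]) auto
    qed
  qed
  moreover have "finite (b ` I)" using fin by simp
  ultimately have "V.dim = card (b ` I)" "V.fin_dim"
    using V.dim_basis by (auto simp: V.fin_dim_def V.basis_def)
  then show ?thesis using inj by (simp add: has_dim_def V.vectorspace_axioms card_image)
qed

lemma basis_family_if_has_dim:
  assumes "has_dim K W n"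
  obtains b l where "basis_family K W {..<n} b l"
proof -
  interpret V: vectorspace K W using assms by (simp add: has_dim_def)
  obtain B where B: "finite B" "V.basis B" using V.finite_basis_exists assms by (auto simp: has_dim_def)
  then have "card B = n" using V.dim_basis assms by (simp add: has_dim_def)
  then obtain b where b: "bij_betw b {..<n} B"
    using ex_bij_betw_nat_finite[OF B(1)] by (auto simp: atLeast0LessThan)
  have inj: "inj_on b {..<n}" and im: "b ` {..<n} = B" using b by (auto simp: bij_betw_def)
  have BW: "B \<subseteq> carrier W" using B by (auto simp: V.basis_def)
  have bc: "b i \<in> carrier W" if "i < n" for i using BW im that by auto
  have crit: "\<exists>!a. a \<in> B \<rightarrow>\<^sub>E carrier K \<and> V.lincomb a B = v" if "v \<in> carrier W" for v
    using V.basis_criterion[OF B(1) BW] B(2) that by blast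
  \<comment> \<open>Additivity, homogeneity and the values on basis vectors all follow in the same
    way from uniqueness: the expected coefficient function is shown to represent the vector.\<close>
  define co where "co v = (THE a. a \<in> B \<rightarrow>\<^sub>E carrier K \<and> V.lincomb a B = v)" for v
  have co: "co v \<in> B \<rightarrow>\<^sub>E carrier K" "V.lincomb (co v) B = v" if "v \<in> carrier W" for v
    using theI'[OF crit[OF that]] by (simp_all add: co_def)
  have uniq: "co v = a" if "v \<in> carrier W" "a \<in> B \<rightarrow>\<^sub>E carrier K" "V.lincomb a B = v" for v a
    using crit[OF that(1)] co[OF that(1)] that by blast
  have coK: "co v x \<in> carrier K" if "v \<in> carrier W" "x \<in> B" for v x
    using co(1)[OF that(1)] that(2) by auto
  have add: "co (v \<oplus>\<^bsub>W\<^esub> w) = (\<lambda>x\<in>B. co v x \<oplus>\<^bsub>K\<^esub> co w x)" if "v \<in> carrier W" "w \<in> carrier W" for v w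
  proof (rule uniq)
    have "V.lincomb (\<lambda>x\<in>B. co v x \<oplus>\<^bsub>K\<^esub> co w x) B = (\<Oplus>\<^bsub>W\<^esub>x\<in>B. co v x \<odot>\<^bsub>W\<^esub> x \<oplus>\<^bsub>W\<^esub> co w x \<odot>\<^bsub>W\<^esub> x)"
      unfolding V.lincomb_def using BW coK that by (intro V.finsum_cong') (auto simp: V.smult_l_distr)
    also have "\<dots> = V.lincomb (co v) B \<oplus>\<^bsub>W\<^esub> V.lincomb (co w) B"
      unfolding V.lincomb_def using BW coK that B by (intro V.finsum_addf) auto
    finally show "V.lincomb (\<lambda>x\<in>B. co v x \<oplus>\<^bsub>K\<^esub> co w x) B = v \<oplus>\<^bsub>W\<^esub> w" using co that by simp
  qed (use coK that in auto)
  have smult: "co (c \<odot>\<^bsub>W\<^esub> v) = (\<lambda>x\<in>B. c \<otimes>\<^bsub>K\<^esub> co v x)" if "v \<in> carrier W" "c \<in> carrier K" for v c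
  proof (rule uniq)
    have "V.lincomb (\<lambda>x\<in>B. c \<otimes>\<^bsub>K\<^esub> co v x) B = V.lincomb (\<lambda>x. c \<otimes>\<^bsub>K\<^esub> co v x) B"
      unfolding V.lincomb_def using BW coK that by (intro V.finsum_cong') auto
    also have "\<dots> = c \<odot>\<^bsub>W\<^esub> v"
      using V.lincomb_smult[OF BW, of "co v" c] coK that co(2) by auto
    finally show "V.lincomb (\<lambda>x\<in>B. c \<otimes>\<^bsub>K\<^esub> co v x) B = c \<odot>\<^bsub>W\<^esub> v" .
  qed (use coK that in auto)
  have delta: "co y = (\<lambda>x\<in>B. if x = y then \<one>\<^bsub>K\<^esub> else \<zero>\<^bsub>K\<^esub>)" if y: "y \<in> B" for y
  proof (rule uniq)
    have yW: "y \<in> carrier W" using BW y by auto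
    have "V.lincomb (\<lambda>x\<in>B. if x = y then \<one>\<^bsub>K\<^esub> else \<zero>\<^bsub>K\<^esub>) B = (\<Oplus>\<^bsub>W\<^esub>x\<in>B. if y = x then x else \<zero>\<^bsub>W\<^esub>)"
      unfolding V.lincomb_def using BW by (intro V.finsum_cong') auto
    also have "\<dots> = y" using V.add.finprod_singleton[of y B "\<lambda>x. x"] y BW B by (auto simp: Pi_iff)
    finally show "V.lincomb (\<lambda>x\<in>B. if x = y then \<one>\<^bsub>K\<^esub> else \<zero>\<^bsub>K\<^esub>) B = y" .
  qed (use BW y in auto)
  have "basis_family K W {..<n} b (\<lambda>i w. co w (b i))"
    unfolding basis_family_def
  proof (intro conjI ballI additiveI)
    fix w assume w: "w \<in> carrier W"
    have "(\<Oplus>\<^bsub>W\<^esub>x\<in>b ` {..<n}. co w x \<odot>\<^bsub>W\<^esub> x) = (\<Oplus>\<^bsub>W\<^esub>i\<in>{..<n}. co w (b i) \<odot>\<^bsub>W\<^esub> b i)"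
      by (rule V.add.finprod_reindex[OF _ inj]) (use coK w BW im in auto)
    then show "w = (\<Oplus>\<^bsub>W\<^esub>i\<in>{..<n}. co w (b i) \<odot>\<^bsub>W\<^esub> b i)"
      using co(2)[OF w] im by (simp add: V.lincomb_def)
  next
    fix i j assume "i \<in> {..<n}" "j \<in> {..<n}"
    then show "co (b j) (b i) = (if i = j then \<one>\<^bsub>K\<^esub> else \<zero>\<^bsub>K\<^esub>)"
      using delta[of "b j"] im inj by (auto simp: inj_on_def)
  qed (use coK bc im add smult in auto)
  then show thesis by (rule that)
qed

lemma basis_family_transfer:
  assumes "basis_family K W I b l" "field K" "module K W" "module K W'" and bij: "bij_betw f (carrier W) (carrier W')"
    and add: "additive W W' f"
    and sm: "\<And>a w. a \<in> carrier K \<Longrightarrow> w \<in> carrier W \<Longrightarrow> f (a \<odot>\<^bsub>W\<^esub> w) = a \<odot>\<^bsub>W'\<^esub> f w"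
  shows "basis_family K W' I (\<lambda>i. f (b i)) (\<lambda>i w. l i (inv_into (carrier W) f w))"
proof -
  interpret K: field K by fact
  interpret W: module K W by fact
  interpret W': module K W' by fact
  have fin: "finite I" and bc: "\<And>i. i \<in> I \<Longrightarrow> b i \<in> carrier W"
    and ex: "\<And>w. w \<in> carrier W \<Longrightarrow> w = (\<Oplus>\<^bsub>W\<^esub>i\<in>I. l i w \<odot>\<^bsub>W\<^esub> b i)"
    and dl: "\<And>i j. i \<in> I \<Longrightarrow> j \<in> I \<Longrightarrow> l i (b j) = (if i = j then \<one>\<^bsub>K\<^esub> else \<zero>\<^bsub>K\<^esub>)"
    and la: "\<And>i. i \<in> I \<Longrightarrow> additive W K (l i)"
    and ls: "\<And>i a w. i \<in> I \<Longrightarrow> a \<in> carrier K \<Longrightarrow> w \<in> carrier W \<Longrightarrow> l i (a \<odot>\<^bsub>W\<^esub> w) = a \<otimes>\<^bsub>K\<^esub> l i w"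
    and lc: "\<And>i w. i \<in> I \<Longrightarrow> w \<in> carrier W \<Longrightarrow> l i w \<in> carrier K"
    using assms(1) by (auto simp: basis_family_def intro: additive_closed)
  have inj: "inj_on f (carrier W)" and im: "f ` carrier W = carrier W'" using bij by (auto simp: bij_betw_def)
  have inv: "inv_into (carrier W) f (f w) = w" if "w \<in> carrier W" for w using inj that by simp
  have obt: "\<exists>v. v \<in> carrier W \<and> w = f v" if "w \<in> carrier W'" for w using im that by auto
  show ?thesis
    unfolding basis_family_def
  proof (intro conjI ballI additiveI)
    fix w assume "w \<in> carrier W'"
    then obtain v where v: "v \<in> carrier W" "w = f v" using obt by blast
    have "f v = f (\<Oplus>\<^bsub>W\<^esub>i\<in>I. l i v \<odot>\<^bsub>W\<^esub> b i)" using ex[OF v(1)] by simp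
    also have "\<dots> = (\<Oplus>\<^bsub>W'\<^esub>i\<in>I. f (l i v \<odot>\<^bsub>W\<^esub> b i))"
      by (rule additive_finsum[OF add W.abelian_group_axioms W'.abelian_group_axioms fin]) (use v bc lc in auto)
    also have "\<dots> = (\<Oplus>\<^bsub>W'\<^esub>i\<in>I. l i v \<odot>\<^bsub>W'\<^esub> f (b i))"
      using v bc lc im by (intro W'.finsum_cong') (auto simp: sm intro!: W'.smult_closed)
    finally show "w = (\<Oplus>\<^bsub>W'\<^esub>i\<in>I. l i (inv_into (carrier W) f w) \<odot>\<^bsub>W'\<^esub> f (b i))"
      unfolding v(2) inv[OF v(1)] .
  next
    fix i x y assume "i \<in> I" "x \<in> carrier W'" "y \<in> carrier W'"
    then show "l i (inv_into (carrier W) f (x \<oplus>\<^bsub>W'\<^esub> y)) =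
        l i (inv_into (carrier W) f x) \<oplus>\<^bsub>K\<^esub> l i (inv_into (carrier W) f y)"
      using obt[of x] obt[of y] by (auto simp: inv additive_add[OF la] simp flip: additive_add[OF add])
  next
    fix i a x assume "i \<in> I" "x \<in> carrier W'" "a \<in> carrier K"
    then show "l i (inv_into (carrier W) f (a \<odot>\<^bsub>W'\<^esub> x)) = a \<otimes>\<^bsub>K\<^esub> l i (inv_into (carrier W) f x)"
      using obt[of x] by (auto simp: inv ls simp flip: sm)
  next
    fix i x assume "i \<in> I" "x \<in> carrier W'"
    then show "l i (inv_into (carrier W) f x) \<in> carrier K"
      using obt[of x] by (auto simp: inv lc)
  qed (use fin bc im dl inv in auto)
qed

lemma has_dim_transfer:
  assumes "has_dim K W n" "field K" "module K W'" "bij_betw f (carrier W) (carrier W')" "additive W W' f"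
    and "\<And>a w. a \<in> carrier K \<Longrightarrow> w \<in> carrier W \<Longrightarrow> f (a \<odot>\<^bsub>W\<^esub> w) = a \<odot>\<^bsub>W'\<^esub> f w"
  shows "has_dim K W' n"
proof -
  obtain b l where b: "basis_family K W {..<n} b l" by (rule basis_family_if_has_dim[OF assms(1)])
  have "module K W" using assms(1) by (simp add: has_dim_def vectorspace_def)
  from basis_family_transfer[OF b assms(2) this assms(3-6)]
  have "has_dim K W' (card {..<n})" by (rule has_dim_if_basis_family[OF assms(2,3)])
  then show ?thesis by simp
qed

lemma rank_two_transfer:
  assumes "rank_two_bimodule L M X" "field L" "field M" and bij: "bij_betw f (carrier X) (carrier Y)"
    and zero: "f \<zero>\<^bsub>X\<^esub> = \<zero>\<^bsub>Y\<^esub>"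
    and add: "\<And>x y. x \<in> carrier X \<Longrightarrow> y \<in> carrier X \<Longrightarrow> f (x \<oplus>\<^bsub>X\<^esub> y) = f x \<oplus>\<^bsub>Y\<^esub> f y"
    and l: "\<And>a x. a \<in> carrier L \<Longrightarrow> x \<in> carrier X \<Longrightarrow> f (lact X a x) = lact Y a (f x)"
    and r: "\<And>a x. a \<in> carrier M \<Longrightarrow> x \<in> carrier X \<Longrightarrow> f (ract X x a) = ract Y (f x) a"
  shows "rank_two_bimodule L M Y"
proof -
  have "bimodule L M X" using assms by (simp add: rank_two_bimodule_def)
  then have Y: "bimodule L M Y" by (rule bimodule_transfer[OF _ bij zero add l r])
  have "f x \<in> carrier Y" if "x \<in> carrier X" for x using bij that by (auto simp: bij_betw_def)
  then have f: "additive (left_module X) (left_module Y) f" "additive (right_module X) (right_module Y) f"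
    by (auto intro!: additiveI simp: add)
  have X: "has_dim L (left_module X) 2" "has_dim M (right_module X) 2"
    using assms(1) by (simp_all add: rank_two_bimodule_def)
  have "has_dim L (left_module Y) 2"
    by (rule has_dim_transfer[OF X(1) assms(2) bimodule.left[OF Y] _ f(1)]) (simp_all add: bij l)
  moreover have "has_dim M (right_module Y) 2"
    by (rule has_dim_transfer[OF X(2) assms(3) bimodule.right[OF Y] _ f(2)]) (simp_all add: bij r)
  ultimately show ?thesis using Y by (simp add: rank_two_bimodule_def)
qed

lemma basis_family_two:
  assumes "has_dim K W 2" "field K"
  obtains x y l m where "x \<in> carrier W" "y \<in> carrier W" "additive W K l" "additive W K m"
    "\<And>a w. a \<in> carrier K \<Longrightarrow> w \<in> carrier W \<Longrightarrow> l (a \<odot>\<^bsub>W\<^esub> w) = a \<otimes>\<^bsub>K\<^esub> l w"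
    "\<And>a w. a \<in> carrier K \<Longrightarrow> w \<in> carrier W \<Longrightarrow> m (a \<odot>\<^bsub>W\<^esub> w) = a \<otimes>\<^bsub>K\<^esub> m w"
    "\<And>w. w \<in> carrier W \<Longrightarrow> w = l w \<odot>\<^bsub>W\<^esub> x \<oplus>\<^bsub>W\<^esub> m w \<odot>\<^bsub>W\<^esub> y"
    "l x = \<one>\<^bsub>K\<^esub>" "l y = \<zero>\<^bsub>K\<^esub>" "m x = \<zero>\<^bsub>K\<^esub>" "m y = \<one>\<^bsub>K\<^esub>"
proof -
  obtain b l where "basis_family K W {..<2::nat} b l" by (rule basis_family_if_has_dim[OF assms(1)])
  then have *: "basis_family K W {0, Suc 0} b l" by (simp add: numeral_2_eq_2 lessThan_Suc insert_commute)
  interpret K: field K by fact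
  interpret W: module K W using assms(1) by (simp add: has_dim_def vectorspace_def)
  have c: "l i w \<in> carrier K" if "i \<in> {0, Suc 0}" "w \<in> carrier W" for i w
    using * that by (auto simp: basis_family_def intro: additive_closed)
  have bc: "b 0 \<in> carrier W" "b (Suc 0) \<in> carrier W" using * by (auto simp: basis_family_def)
  show thesis
  proof (rule that[of "b 0" "b (Suc 0)" "l 0" "l (Suc 0)"])
    fix w assume w: "w \<in> carrier W"
    have "w = (\<Oplus>\<^bsub>W\<^esub>i\<in>{0, Suc 0}. l i w \<odot>\<^bsub>W\<^esub> b i)" using * w by (simp add: basis_family_def)
    also have "\<dots> = l 0 w \<odot>\<^bsub>W\<^esub> b 0 \<oplus>\<^bsub>W\<^esub> l (Suc 0) w \<odot>\<^bsub>W\<^esub> b (Suc 0)"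
      using bc c w by (subst W.finsum_insert) (auto simp: Pi_iff)
    finally show "w = l 0 w \<odot>\<^bsub>W\<^esub> b 0 \<oplus>\<^bsub>W\<^esub> l (Suc 0) w \<odot>\<^bsub>W\<^esub> b (Suc 0)" .
  qed (use * in \<open>auto simp: basis_family_def\<close>)
qed

section \<open>Duals of rank two bimodules\<close>

locale two_basis = bimodule L M W + L: field L + M: field M for L M :: "'k ring" and W :: "('k, 'v) bimod" +
  fixes x y :: 'v and l m :: "'v \<Rightarrow> 'k"
  assumes x: "x \<in> carrier W" and y: "y \<in> carrier W"
    and l: "additive W M l" and m: "additive W M m"
    and l_ract: "\<And>a w. a \<in> carrier M \<Longrightarrow> w \<in> carrier W \<Longrightarrow> l (ract W w a) = a \<otimes>\<^bsub>M\<^esub> l w"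
    and m_ract: "\<And>a w. a \<in> carrier M \<Longrightarrow> w \<in> carrier W \<Longrightarrow> m (ract W w a) = a \<otimes>\<^bsub>M\<^esub> m w"
    and expand: "\<And>w. w \<in> carrier W \<Longrightarrow> w = ract W x (l w) \<oplus>\<^bsub>W\<^esub> ract W y (m w)"
    and coords: "l x = \<one>\<^bsub>M\<^esub>" "l y = \<zero>\<^bsub>M\<^esub>" "m x = \<zero>\<^bsub>M\<^esub>" "m y = \<one>\<^bsub>M\<^esub>"
begin

lemma l_closed [simp]: "w \<in> carrier W \<Longrightarrow> l w \<in> carrier M" using additive_closed[OF l] .
lemma m_closed [simp]: "w \<in> carrier W \<Longrightarrow> m w \<in> carrier M" using additive_closed[OF m] .
lemmas l_add = additive_add[OF l] and m_add = additive_add[OF m]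
lemmas basis_closed [simp] = x y

lemma l_combination: "a \<in> carrier M \<Longrightarrow> b \<in> carrier M \<Longrightarrow> l (ract W x a \<oplus>\<^bsub>W\<^esub> ract W y b) = a"
  by (simp add: l_add l_ract coords)

lemma m_combination: "a \<in> carrier M \<Longrightarrow> b \<in> carrier M \<Longrightarrow> m (ract W x a \<oplus>\<^bsub>W\<^esub> ract W y b) = b"
  by (simp add: m_add m_ract coords)

lemma two_basis_swap: "two_basis L M W y x m l"
proof (intro two_basis.intro two_basis_axioms.intro)
  fix w assume w: "w \<in> carrier W"
  then show "w = ract W y (m w) \<oplus>\<^bsub>W\<^esub> ract W x (l w)"
    using expand[OF w] W.a_comm[of "ract W x (l w)" "ract W y (m w)"] by simp
qed (use l m l_ract m_ract coords in \<open>auto intro: bimodule_axioms L.field_axioms M.field_axioms\<close>)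

text \<open>In this basis the second coordinate is \<open>m - l\<close>; it detects whether a left
  multiplication moves \<open>x + y\<close> off its line.\<close>

lemma two_basis_add:
  "two_basis L M W (x \<oplus>\<^bsub>W\<^esub> y) y l (\<lambda>w. m w \<ominus>\<^bsub>M\<^esub> l w)"
proof (intro two_basis.intro two_basis_axioms.intro)
  show "additive W M (\<lambda>w. m w \<ominus>\<^bsub>M\<^esub> l w)"
    by (rule additiveI) (auto simp: l_add m_add M.minus_eq M.minus_add M.a_ac)
  fix w assume w: "w \<in> carrier W"
  have "ract W (x \<oplus>\<^bsub>W\<^esub> y) (l w) \<oplus>\<^bsub>W\<^esub> ract W y (m w \<ominus>\<^bsub>M\<^esub> l w) =
      ract W x (l w) \<oplus>\<^bsub>W\<^esub> ract W y (l w \<oplus>\<^bsub>M\<^esub> (m w \<ominus>\<^bsub>M\<^esub> l w))"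
    using w by (simp add: ract_add_left ract_add_right W.a_assoc)
  also have "l w \<oplus>\<^bsub>M\<^esub> (m w \<ominus>\<^bsub>M\<^esub> l w) = m w"
    using w by (simp add: M.minus_eq M.a_lcomm[of "l w"] M.r_neg)
  finally show "w = ract W (x \<oplus>\<^bsub>W\<^esub> y) (l w) \<oplus>\<^bsub>W\<^esub> ract W y (m w \<ominus>\<^bsub>M\<^esub> l w)"
    using expand[OF w] by simp
  fix a assume "a \<in> carrier M"
  then show "m (ract W w a) \<ominus>\<^bsub>M\<^esub> l (ract W w a) = a \<otimes>\<^bsub>M\<^esub> (m w \<ominus>\<^bsub>M\<^esub> l w)"
    using w by (simp add: l_ract m_ract M.minus_eq M.r_distr M.r_minus)
qed (use l l_ract coords in \<open>auto intro: bimodule_axioms L.field_axioms M.field_axioms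
    simp: l_add m_add M.minus_eq M.r_neg\<close>)

lemma two_basis_replace:
  assumes z: "z \<in> carrier W" "m z \<noteq> \<zero>\<^bsub>M\<^esub>"
  shows "\<exists>l' m'. two_basis L M W x z l' m'"
proof -
  define b where "b = inv\<^bsub>M\<^esub> (m z)"
  have b: "b \<in> carrier M" "m z \<otimes>\<^bsub>M\<^esub> b = \<one>\<^bsub>M\<^esub>" "b \<otimes>\<^bsub>M\<^esub> m z = \<one>\<^bsub>M\<^esub>"
    using z M.field_Units by (auto simp: b_def)
  \<comment> \<open>Solving \<open>w = x l' + z m'\<close>: the \<open>y\<close> coordinate forces
    \<open>m' = m w / m z\<close>, and the part of \<open>z m'\<close> along \<open>x\<close> is
    subtracted from \<open>l w\<close>.\<close>
  define l' where "l' w = l w \<ominus>\<^bsub>M\<^esub> l z \<otimes>\<^bsub>M\<^esub> (b \<otimes>\<^bsub>M\<^esub> m w)" for w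
  define m' where "m' w = b \<otimes>\<^bsub>M\<^esub> m w" for w
  have "two_basis L M W x z l' m'"
  proof (intro two_basis.intro two_basis_axioms.intro)
    show "additive W M l'" "additive W M m'"
      using z b by (auto intro!: additiveI simp: l'_def m'_def l_add m_add M.r_distr M.minus_eq M.minus_add M.a_ac)
    fix w assume w: "w \<in> carrier W"
    define c where "c = b \<otimes>\<^bsub>M\<^esub> m w"
    have c: "c \<in> carrier M" using b w by (simp add: c_def)
    have "ract W z c = ract W (ract W x (l z) \<oplus>\<^bsub>W\<^esub> ract W y (m z)) c" using expand[OF z(1)] by simp
    also have "\<dots> = ract W x (l z \<otimes>\<^bsub>M\<^esub> c) \<oplus>\<^bsub>W\<^esub> ract W y (m z \<otimes>\<^bsub>M\<^esub> c)"
      using z c by (simp add: ract_add_left ract_mult)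
    also have "m z \<otimes>\<^bsub>M\<^esub> c = m w" using z b w by (simp add: c_def M.m_assoc[symmetric])
    finally have "ract W x (l' w) \<oplus>\<^bsub>W\<^esub> ract W z c =
        ract W x (l' w \<oplus>\<^bsub>M\<^esub> l z \<otimes>\<^bsub>M\<^esub> c) \<oplus>\<^bsub>W\<^esub> ract W y (m w)"
      using z c w by (simp add: l'_def c_def[symmetric] ract_add_right W.a_assoc)
    also have "l' w \<oplus>\<^bsub>M\<^esub> l z \<otimes>\<^bsub>M\<^esub> c = l w"
      using z c w by (simp add: l'_def c_def[symmetric] M.minus_eq M.a_assoc M.l_neg)
    finally show "w = ract W x (l' w) \<oplus>\<^bsub>W\<^esub> ract W z (m' w)"
      using expand[OF w] by (simp add: m'_def c_def)
    fix a assume "a \<in> carrier M"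
    then show "l' (ract W w a) = a \<otimes>\<^bsub>M\<^esub> l' w" "m' (ract W w a) = a \<otimes>\<^bsub>M\<^esub> m' w"
      using z b w by (simp_all add: l'_def m'_def l_ract m_ract M.minus_eq M.r_distr M.r_minus M.m_ac)
  qed (use z b in \<open>auto intro: bimodule_axioms L.field_axioms M.field_axioms
      simp: l'_def m'_def coords M.minus_eq M.r_neg\<close>)
  then show ?thesis by blast
qed

end

text \<open>A symmetric nondegenerate right bilinear form for which the left action is self-adjoint
  identifies a bimodule with its right dual, the sides being exchanged.\<close>

definition selfadjoint_form ::
    "'k ring \<Rightarrow> 'k ring \<Rightarrow> ('k, 'v) bimod \<Rightarrow> ('v \<Rightarrow> 'v \<Rightarrow> 'k) \<Rightarrow> bool"
  where "selfadjoint_form L M W B \<longleftrightarrow>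
    (\<forall>w\<in>carrier W. additive W M (B w)) \<and>
    (\<forall>v\<in>carrier W. \<forall>w\<in>carrier W. B v w = B w v) \<and>
    (\<forall>v\<in>carrier W. \<forall>w\<in>carrier W. \<forall>a\<in>carrier M. B v (ract W w a) = a \<otimes>\<^bsub>M\<^esub> B v w) \<and>
    (\<forall>v\<in>carrier W. \<forall>w\<in>carrier W. \<forall>c\<in>carrier L. B (lact W c v) w = B v (lact W c w)) \<and>
    (\<forall>f. additive W M f \<longrightarrow> (\<forall>a\<in>carrier M. \<forall>w\<in>carrier W. f (ract W w a) = a \<otimes>\<^bsub>M\<^esub> f w) \<longrightarrow>
      (\<exists>!v. v \<in> carrier W \<and> (\<forall>w\<in>carrier W. B v w = f w)))"

context two_basis begin

lemma functional_expand:
  assumes "additive W M f" "\<And>a w. a \<in> carrier M \<Longrightarrow> w \<in> carrier W \<Longrightarrow> f (ract W w a) = a \<otimes>\<^bsub>M\<^esub> f w"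
    "w \<in> carrier W"
  shows "f w = l w \<otimes>\<^bsub>M\<^esub> f x \<oplus>\<^bsub>M\<^esub> m w \<otimes>\<^bsub>M\<^esub> f y"
proof -
  have "f w = f (ract W x (l w) \<oplus>\<^bsub>W\<^esub> ract W y (m w))" using expand[OF assms(3)] by simp
  then show ?thesis using assms by (simp add: additive_add[OF assms(1)])
qed

lemma functional_eqI:
  assumes "additive W M f" "\<And>a w. a \<in> carrier M \<Longrightarrow> w \<in> carrier W \<Longrightarrow> f (ract W w a) = a \<otimes>\<^bsub>M\<^esub> f w"
    and "additive W M g" "\<And>a w. a \<in> carrier M \<Longrightarrow> w \<in> carrier W \<Longrightarrow> g (ract W w a) = a \<otimes>\<^bsub>M\<^esub> g w"
    and "f x = g x" "f y = g y" "w \<in> carrier W"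
  shows "f w = g w"
  using functional_expand[of f w] functional_expand[of g w] assms by simp

text \<open>If each left multiplication equals a right multiplication by a scalar, bilinearity alone
  makes it self-adjoint, so the dot product in the given basis will do.\<close>

lemma selfadjoint_form_scalar:
  assumes "\<And>c w. c \<in> carrier L \<Longrightarrow> w \<in> carrier W \<Longrightarrow> \<exists>s\<in>carrier M. \<forall>w\<in>carrier W. lact W c w = ract W w s"
  shows "\<exists>B. selfadjoint_form L M W B"
proof -
  define B where "B v w = l v \<otimes>\<^bsub>M\<^esub> l w \<oplus>\<^bsub>M\<^esub> m v \<otimes>\<^bsub>M\<^esub> m w" for v w
  have Badd: "additive W M (B v)" if "v \<in> carrier W" for v
    using that by (auto intro!: additiveI simp: B_def l_add m_add M.r_distr M.a_ac)
  have Bract: "B v (ract W w a) = a \<otimes>\<^bsub>M\<^esub> B v w" if "v \<in> carrier W" "w \<in> carrier W" "a \<in> carrier M" for v w a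
    using that by (simp add: B_def l_ract m_ract M.r_distr M.m_ac)
  have Bsym: "B v w = B w v" if "v \<in> carrier W" "w \<in> carrier W" for v w
    using that by (simp add: B_def M.m_ac)
  have adj: "B (lact W c v) w = B v (lact W c w)" if vw: "v \<in> carrier W" "w \<in> carrier W" and c: "c \<in> carrier L" for v w c
  proof -
    obtain s where s: "s \<in> carrier M" "\<forall>w\<in>carrier W. lact W c w = ract W w s" using assms c x by blast
    then show ?thesis using vw Bsym[of "ract W v s" w] Bract[of w v s] Bract[of v w s] Bsym[of v w] by simp
  qed
  have nd: "\<exists>!v. v \<in> carrier W \<and> (\<forall>w\<in>carrier W. B v w = f w)"
    if f: "additive W M f" "\<forall>a\<in>carrier M. \<forall>w\<in>carrier W. f (ract W w a) = a \<otimes>\<^bsub>M\<^esub> f w" for f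
  proof (rule ex1I)
    let ?v = "ract W x (f x) \<oplus>\<^bsub>W\<^esub> ract W y (f y)"
    have fxy [simp]: "f x \<in> carrier M" "f y \<in> carrier M" using additive_closed[OF f(1)] by auto
    have "B ?v w = f w" if w: "w \<in> carrier W" for w
      by (rule functional_eqI[OF Badd Bract f(1) _ _ _ w])
        (use f in \<open>auto simp: B_def l_combination m_combination coords\<close>)
    then show "?v \<in> carrier W \<and> (\<forall>w\<in>carrier W. B ?v w = f w)" by simp
    fix v assume v: "v \<in> carrier W \<and> (\<forall>w\<in>carrier W. B v w = f w)"
    then have "B v x = f x" "B v y = f y" by auto
    then have "l v = f x" "m v = f y" using v by (auto simp: B_def coords)
    then show "v = ?v" using expand[of v] v by simp
  qed
  show ?thesis
    unfolding selfadjoint_form_def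
    by (intro exI[of _ B] conjI ballI allI impI; rule Badd Bsym Bract adj nd; assumption)
qed

text \<open>If \<open>y = c x\<close> then \<open>W\<close> is cyclic over the commutative ring generated by \<open>M\<close> and \<open>c\<close>, and the
  form is the \<open>c\<close>-coefficient of the product in that ring.\<close>

lemma selfadjoint_form_cyclic:
  assumes c: "c \<in> carrier L" and yc: "y = lact W c x"
  shows "\<exists>B. selfadjoint_form L M W B"
proof -
  \<comment> \<open>\<open>c\<close> acts with c^2 = p + q c. Multiplying l + m c by l' + m' c, the
    coefficient of c is l m' + m l' + m m' q, which is the value of \<open>B\<close>.\<close>
  define p q where "p = l (lact W c y)" and "q = m (lact W c y)"
  have pq [simp]: "p \<in> carrier M" "q \<in> carrier M" using c by (auto simp: p_def q_def)
  define B where "B v w = l v \<otimes>\<^bsub>M\<^esub> m w \<oplus>\<^bsub>M\<^esub> (m v \<otimes>\<^bsub>M\<^esub> l w \<oplus>\<^bsub>M\<^esub> m v \<otimes>\<^bsub>M\<^esub> m w \<otimes>\<^bsub>M\<^esub> q)" for v w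
  have Bc [simp]: "B v w \<in> carrier M" if "v \<in> carrier W" "w \<in> carrier W" for v w
    using that by (simp add: B_def)
  have Badd: "additive W M (B v)" if "v \<in> carrier W" for v
    using that by (auto intro!: additiveI simp: B_def l_add m_add M.r_distr M.l_distr M.a_ac)
  have Bract: "B v (ract W w a) = a \<otimes>\<^bsub>M\<^esub> B v w" if "v \<in> carrier W" "w \<in> carrier W" "a \<in> carrier M" for v w a
    using that by (simp add: B_def l_ract m_ract M.r_distr M.m_ac)
  have Bsym: "B v w = B w v" if "v \<in> carrier W" "w \<in> carrier W" for v w
    using that by (simp add: B_def M.m_ac M.a_ac)
  have cw: "lact W c w = ract W x (p \<otimes>\<^bsub>M\<^esub> m w) \<oplus>\<^bsub>W\<^esub> ract W y (l w \<oplus>\<^bsub>M\<^esub> q \<otimes>\<^bsub>M\<^esub> m w)" if w: "w \<in> carrier W" for w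
  proof -
    have "lact W c w = lact W c (ract W x (l w) \<oplus>\<^bsub>W\<^esub> ract W y (m w))" using expand[OF w] by simp
    also have "\<dots> = ract W y (l w) \<oplus>\<^bsub>W\<^esub> ract W (lact W c y) (m w)"
      using c w yc by (simp add: lact_add_right lact_ract)
    also have "ract W (lact W c y) (m w) = ract W (ract W x p \<oplus>\<^bsub>W\<^esub> ract W y q) (m w)"
      using expand[of "lact W c y"] c by (simp add: p_def q_def)
    also have "\<dots> = ract W x (p \<otimes>\<^bsub>M\<^esub> m w) \<oplus>\<^bsub>W\<^esub> ract W y (q \<otimes>\<^bsub>M\<^esub> m w)"
      using w by (simp add: ract_add_left ract_mult)
    finally show ?thesis using w by (simp add: ract_add_right W.a_ac)
  qed
  have adjc: "B (lact W c v) w = B v (lact W c w)" if vw: "v \<in> carrier W" "w \<in> carrier W" for v w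
    using vw unfolding cw[OF vw(1)] cw[OF vw(2)]
    by (simp add: B_def l_combination m_combination M.l_distr M.r_distr M.a_ac M.m_ac)
  \<comment> \<open>As \<open>L\<close> is commutative, \<open>d\<close> is determined by its value
    x a + (c x) b on the generator: d w = w a + (c w) b for every w. Self-adjointness of
    \<open>d\<close> thus reduces to that of \<open>c\<close>.\<close>
  have adj: "B (lact W d v) w = B v (lact W d w)" if vw: "v \<in> carrier W" "w \<in> carrier W" and d: "d \<in> carrier L" for v w d
  proof -
    define a b where "a = l (lact W d x)" and "b = m (lact W d x)"
    have ab [simp]: "a \<in> carrier M" "b \<in> carrier M" using d by (auto simp: a_def b_def)
    have dx: "lact W d x = ract W x a \<oplus>\<^bsub>W\<^esub> ract W y b" using expand[of "lact W d x"] d by (simp add: a_def b_def)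
    have dy: "lact W d y = ract W y a \<oplus>\<^bsub>W\<^esub> ract W (lact W c y) b"
    proof -
      have "lact W d y = lact W c (lact W d x)"
        using c d yc by (simp add: lact_mult[symmetric] L.m_comm)
      then show ?thesis using c yc by (simp add: dx lact_add_right lact_ract)
    qed
    have dw: "lact W d w = ract W w a \<oplus>\<^bsub>W\<^esub> ract W (lact W c w) b" if w: "w \<in> carrier W" for w
    proof -
      have "lact W d w = lact W d (ract W x (l w) \<oplus>\<^bsub>W\<^esub> ract W y (m w))" using expand[OF w] by simp
      also have "\<dots> = ract W (lact W d x) (l w) \<oplus>\<^bsub>W\<^esub> ract W (lact W d y) (m w)"
        using d w by (simp add: lact_add_right lact_ract)
      also have "\<dots> = ract W (ract W x (l w) \<oplus>\<^bsub>W\<^esub> ract W y (m w)) a \<oplus>\<^bsub>W\<^esub>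
          ract W (lact W c (ract W x (l w) \<oplus>\<^bsub>W\<^esub> ract W y (m w))) b"
        using c w yc[symmetric] unfolding dx dy
        by (simp add: ract_add_left lact_add_right ract_mult[symmetric] lact_ract[symmetric] M.m_comm W.a_ac)
      finally show ?thesis using expand[OF w] by simp
    qed
    have "B (lact W d v) w = B w v \<otimes>\<^bsub>M\<^esub> a \<oplus>\<^bsub>M\<^esub> B w (lact W c v) \<otimes>\<^bsub>M\<^esub> b"
      using vw c d by (subst Bsym) (simp_all add: dw additive_add[OF Badd] Bract M.m_comm)
    moreover have "B v (lact W d w) = B v w \<otimes>\<^bsub>M\<^esub> a \<oplus>\<^bsub>M\<^esub> B v (lact W c w) \<otimes>\<^bsub>M\<^esub> b"
      using vw c by (simp add: dw additive_add[OF Badd] Bract M.m_comm)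
    ultimately show ?thesis
      using adjc[OF vw] Bsym[OF vw] Bsym[of "lact W c v" w] vw c by simp
  qed
  have nd: "\<exists>!v. v \<in> carrier W \<and> (\<forall>w\<in>carrier W. B v w = f w)"
    if f: "additive W M f" "\<forall>a\<in>carrier M. \<forall>w\<in>carrier W. f (ract W w a) = a \<otimes>\<^bsub>M\<^esub> f w" for f
  proof (rule ex1I)
    have fxy [simp]: "f x \<in> carrier M" "f y \<in> carrier M" using additive_closed[OF f(1)] by auto
    \<comment> \<open>The two conditions are \<open>m v = f x\<close>, from pairing with
      \<open>x\<close>, and \<open>l v + m v q = f y\<close>, from pairing with
      \<open>y\<close>.\<close>
    let ?v = "ract W x (f y \<ominus>\<^bsub>M\<^esub> f x \<otimes>\<^bsub>M\<^esub> q) \<oplus>\<^bsub>W\<^esub> ract W y (f x)"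
    have "B ?v w = f w" if w: "w \<in> carrier W" for w
      by (rule functional_eqI[OF Badd Bract f(1) _ _ _ w])
        (use f in \<open>auto simp: B_def l_combination m_combination coords M.minus_eq M.a_assoc M.l_neg\<close>)
    then show "?v \<in> carrier W \<and> (\<forall>w\<in>carrier W. B ?v w = f w)" by simp
    fix v assume v: "v \<in> carrier W \<and> (\<forall>w\<in>carrier W. B v w = f w)"
    then have vc: "v \<in> carrier W" by simp
    have "B v x = f x" "B v y = f y" using v by auto
    then have "m v = f x" "f y = l v \<oplus>\<^bsub>M\<^esub> m v \<otimes>\<^bsub>M\<^esub> q" using vc by (auto simp: B_def coords)
    moreover have "(l v \<oplus>\<^bsub>M\<^esub> m v \<otimes>\<^bsub>M\<^esub> q) \<ominus>\<^bsub>M\<^esub> m v \<otimes>\<^bsub>M\<^esub> q = l v"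
      using vc by (simp add: M.minus_eq M.a_assoc M.r_neg)
    ultimately show "v = ?v" using expand[OF vc] by metis
  qed
  show ?thesis
    unfolding selfadjoint_form_def
    by (intro exI[of _ B] conjI ballI allI impI; rule Badd Bsym Bract adj nd; assumption)
qed

text \<open>\<open>x\<close> and \<open>c x\<close> are then a right basis, which is the cyclic
  case.\<close>

lemma selfadjoint_form_if_moved:
  assumes "c \<in> carrier L" "m (lact W c x) \<noteq> \<zero>\<^bsub>M\<^esub>"
  shows "\<exists>B. selfadjoint_form L M W B"
proof -
  obtain l' m' where "two_basis L M W x (lact W c x) l' m'"
    using two_basis_replace assms by (metis lact_closed x)
  from two_basis.selfadjoint_form_cyclic[OF this assms(1) refl] show ?thesis .
qed

text \<open>If no \<open>c\<close> moves \<open>x\<close>, \<open>y\<close> or \<open>x + y\<close> off its own line, then the left action is by scalars.\<close>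

lemma selfadjoint_form_exists: "\<exists>B. selfadjoint_form L M W B"
proof (cases "\<exists>c\<in>carrier L. m (lact W c x) \<noteq> \<zero>\<^bsub>M\<^esub> \<or> l (lact W c y) \<noteq> \<zero>\<^bsub>M\<^esub> \<or> m (lact W c y) \<noteq> l (lact W c x)")
  case True
  then obtain c where c: "c \<in> carrier L" and
    "m (lact W c x) \<noteq> \<zero>\<^bsub>M\<^esub> \<or> l (lact W c y) \<noteq> \<zero>\<^bsub>M\<^esub> \<or> m (lact W c y) \<noteq> l (lact W c x)" by blast
  then consider "m (lact W c x) \<noteq> \<zero>\<^bsub>M\<^esub>" | "l (lact W c y) \<noteq> \<zero>\<^bsub>M\<^esub>" |
    "m (lact W c x) = \<zero>\<^bsub>M\<^esub>" "l (lact W c y) = \<zero>\<^bsub>M\<^esub>" "m (lact W c y) \<noteq> l (lact W c x)" by blast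
  then show ?thesis
  proof cases
    case 1 then show ?thesis using selfadjoint_form_if_moved c by blast
  next
    case 2 then show ?thesis using two_basis.selfadjoint_form_if_moved[OF two_basis_swap c] by blast
  next
    case 3
    \<comment> \<open>Both \<open>x\<close> and \<open>y\<close> are eigenvectors of
      \<open>c\<close> but with different eigenvalues, so \<open>c\<close> moves
      \<open>x + y\<close>; the difference of the eigenvalues is the second coordinate in the basis
      \<open>x + y\<close>, \<open>y\<close>.\<close>
    then have "m (lact W c (x \<oplus>\<^bsub>W\<^esub> y)) \<ominus>\<^bsub>M\<^esub> l (lact W c (x \<oplus>\<^bsub>W\<^esub> y)) \<noteq> \<zero>\<^bsub>M\<^esub>"
      using c by (simp add: lact_add_right l_add m_add)
    then show ?thesis using two_basis.selfadjoint_form_if_moved[OF two_basis_add c] by blast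
  qed
next
  case False
  \<comment> \<open>Now \<open>x\<close> and \<open>y\<close> are eigenvectors of every
    \<open>c\<close> with a common eigenvalue, which is the right scalar wanted.\<close>
  have "lact W c w = ract W w (l (lact W c x))" if c: "c \<in> carrier L" and w: "w \<in> carrier W" for c w
  proof -
    have x': "lact W c x = ract W x (l (lact W c x))"
      using expand[of "lact W c x"] False c by simp
    have y': "lact W c y = ract W y (l (lact W c x))"
      using expand[of "lact W c y"] False c by simp
    have "lact W c w = lact W c (ract W x (l w) \<oplus>\<^bsub>W\<^esub> ract W y (m w))" using expand[OF w] by simp
    also have "\<dots> = ract W (lact W c x) (l w) \<oplus>\<^bsub>W\<^esub> ract W (lact W c y) (m w)"
      using c w by (simp add: lact_add_right lact_ract)
    also have "\<dots> = ract W (ract W x (l w) \<oplus>\<^bsub>W\<^esub> ract W y (m w)) (l (lact W c x))"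
      using c w by (subst x', subst y') (simp add: ract_add_left ract_mult[symmetric] M.m_comm)
    finally show ?thesis using expand[OF w] by simp
  qed
  then show ?thesis by (intro selfadjoint_form_scalar) (meson l_closed lact_closed x)
qed

end


section \<open>Dual bimodules and dual bases\<close>

lemma additive_right_module: "additive (right_module W) M f \<longleftrightarrow> additive W M f"
  by (simp add: additive_def hom_def)

lemma two_basis_if_rank_two:
  assumes "field L" "field M" "rank_two_bimodule L M W"
  obtains x y l m where "two_basis L M W x y l m"
proof -
  have "has_dim M (right_module W) 2" "bimodule L M W" using assms by (simp_all add: rank_two_bimodule_def)
  obtain x y l m where *: "x \<in> carrier (right_module W)" "y \<in> carrier (right_module W)"
    "additive (right_module W) M l" "additive (right_module W) M m"
    "\<And>a w. a \<in> carrier M \<Longrightarrow> w \<in> carrier (right_module W) \<Longrightarrow> l (a \<odot>\<^bsub>right_module W\<^esub> w) = a \<otimes>\<^bsub>M\<^esub> l w"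
    "\<And>a w. a \<in> carrier M \<Longrightarrow> w \<in> carrier (right_module W) \<Longrightarrow> m (a \<odot>\<^bsub>right_module W\<^esub> w) = a \<otimes>\<^bsub>M\<^esub> m w"
    "\<And>w. w \<in> carrier (right_module W) \<Longrightarrow>
      w = l w \<odot>\<^bsub>right_module W\<^esub> x \<oplus>\<^bsub>right_module W\<^esub> m w \<odot>\<^bsub>right_module W\<^esub> y"
    "l x = \<one>\<^bsub>M\<^esub>" "l y = \<zero>\<^bsub>M\<^esub>" "m x = \<zero>\<^bsub>M\<^esub>" "m y = \<one>\<^bsub>M\<^esub>"
    by (rule basis_family_two[OF \<open>has_dim M (right_module W) 2\<close> assms(2)]) blast
  show thesis
    by (rule that[of x y l m], intro two_basis.intro two_basis_axioms.intro)
      (use * in \<open>simp_all add: assms(1,2) \<open>bimodule L M W\<close> additive_right_module\<close>)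
qed

lemma right_dual_simps:
  "\<psi> \<in> carrier (right_dual M W) \<longleftrightarrow> \<psi> \<in> extensional (carrier W) \<and> additive W M \<psi> \<and>
    (\<forall>v\<in>carrier W. \<forall>a\<in>carrier M. \<psi> (ract W v a) = \<psi> v \<otimes>\<^bsub>M\<^esub> a)"
  "\<zero>\<^bsub>right_dual M W\<^esub> = (\<lambda>v\<in>carrier W. \<zero>\<^bsub>M\<^esub>)"
  "\<psi> \<oplus>\<^bsub>right_dual M W\<^esub> \<psi>' = (\<lambda>v\<in>carrier W. \<psi> v \<oplus>\<^bsub>M\<^esub> \<psi>' v)"
  "lact (right_dual M W) a \<psi> = (\<lambda>v\<in>carrier W. a \<otimes>\<^bsub>M\<^esub> \<psi> v)"
  "ract (right_dual M W) \<psi> b = (\<lambda>v\<in>carrier W. \<psi> (lact W b v))"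
  by (auto simp: right_dual_def additive_def hom_def PiE_def)

text \<open>The map sends v to B(v, -) for a self-adjoint form B. Symmetry and right linearity turn
  right scalars into left ones, self-adjointness turns left multiplications into right ones, and
  nondegeneracy gives bijectivity.\<close>

lemma right_dual_iso:
  assumes "field L" "field M" "rank_two_bimodule L M W"
  obtains \<beta> where "bij_betw \<beta> (carrier W) (carrier (right_dual M W))"
    "\<beta> \<zero>\<^bsub>W\<^esub> = \<zero>\<^bsub>right_dual M W\<^esub>"
    "\<And>v w. v \<in> carrier W \<Longrightarrow> w \<in> carrier W \<Longrightarrow> \<beta> (v \<oplus>\<^bsub>W\<^esub> w) = \<beta> v \<oplus>\<^bsub>right_dual M W\<^esub> \<beta> w"
    "\<And>a w. a \<in> carrier M \<Longrightarrow> w \<in> carrier W \<Longrightarrow> \<beta> (ract W w a) = lact (right_dual M W) a (\<beta> w)"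
    "\<And>a w. a \<in> carrier L \<Longrightarrow> w \<in> carrier W \<Longrightarrow> \<beta> (lact W a w) = ract (right_dual M W) (\<beta> w) a"
proof -
  obtain x y l m where "two_basis L M W x y l m" using assms by (rule two_basis_if_rank_two)
  then interpret two_basis L M W x y l m .
  obtain B where "selfadjoint_form L M W B" using selfadjoint_form_exists by blast
  note SF = this[unfolded selfadjoint_form_def]
  note B = SF[THEN conjunct1, rule_format] SF[THEN conjunct2, THEN conjunct1, rule_format]
    SF[THEN conjunct2, THEN conjunct2, THEN conjunct1, rule_format]
    SF[THEN conjunct2, THEN conjunct2, THEN conjunct2, THEN conjunct1, rule_format]
    SF[THEN conjunct2, THEN conjunct2, THEN conjunct2, THEN conjunct2, THEN spec, THEN mp, THEN mp]
  have Bc: "B v w \<in> carrier M" if "v \<in> carrier W" "w \<in> carrier W" for v w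
    using additive_closed[OF B(1)] that by blast
  have Badd: "B (v \<oplus>\<^bsub>W\<^esub> w) u = B v u \<oplus>\<^bsub>M\<^esub> B w u" if "v \<in> carrier W" "w \<in> carrier W" "u \<in> carrier W" for v w u
    using that by (simp add: B(2)[of _ u] additive_add[OF B(1)])
  define \<beta> where "\<beta> v = (\<lambda>w\<in>carrier W. B v w)" for v
  have mem: "\<beta> v \<in> carrier (right_dual M W)" if "v \<in> carrier W" for v
    using that by (auto simp: \<beta>_def right_dual_simps Bc additive_add[OF B(1)] B(3) M.m_comm intro!: additiveI)
  have bij: "bij_betw \<beta> (carrier W) (carrier (right_dual M W))"
  proof (rule bij_betwI')
    fix v w assume vw: "v \<in> carrier W" "w \<in> carrier W"
    show "(\<beta> v = \<beta> w) = (v = w)"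
    proof
      assume "\<beta> v = \<beta> w"
      then have "\<forall>u\<in>carrier W. B v u = B w u"
        by (metis \<beta>_def restrict_apply')
      moreover have "\<exists>!u. u \<in> carrier W \<and> (\<forall>z\<in>carrier W. B u z = B v z)"
        by (rule B(5)[OF B(1)[OF vw(1)]]) (use B(3) vw in auto)
      ultimately show "v = w" using vw by (metis (no_types))
    qed simp
  next
    fix \<psi> assume \<psi>: "\<psi> \<in> carrier (right_dual M W)"
    then have a: "additive W M \<psi>" by (simp add: right_dual_simps)
    have "\<forall>a\<in>carrier M. \<forall>w\<in>carrier W. \<psi> (ract W w a) = a \<otimes>\<^bsub>M\<^esub> \<psi> w"
      using \<psi> additive_closed[OF a] by (auto simp: right_dual_simps M.m_comm)
    then obtain v where "v \<in> carrier W" "\<forall>w\<in>carrier W. B v w = \<psi> w" using B(5)[OF a] by blast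
    then show "\<exists>v\<in>carrier W. \<psi> = \<beta> v"
      using \<psi> by (intro bexI[of _ v]) (auto simp: \<beta>_def right_dual_simps intro!: extensionalityI[of _ "carrier W"])
  qed (rule mem)
  show thesis
  proof (rule that[OF bij])
    have "B \<zero>\<^bsub>W\<^esub> w = \<zero>\<^bsub>M\<^esub>" if "w \<in> carrier W" for w
      using B(2)[of "\<zero>\<^bsub>W\<^esub>" w] additive_zero[OF B(1)[OF that] W.abelian_group_axioms M.abelian_group_axioms] that by simp
    then show "\<beta> \<zero>\<^bsub>W\<^esub> = \<zero>\<^bsub>right_dual M W\<^esub>" by (auto simp: \<beta>_def right_dual_simps)
  next
    fix a w assume "a \<in> carrier M" "w \<in> carrier W"
    then show "\<beta> (ract W w a) = lact (right_dual M W) a (\<beta> w)"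
      using B(2)[of "ract W w a"] B(2)[of w] B(3)[of _ w a]
      by (auto simp: \<beta>_def right_dual_simps intro!: restrict_ext)
  qed (auto simp: \<beta>_def right_dual_simps Badd B(4) intro!: restrict_ext)
qed

text \<open>The dual is isomorphic to the bimodule with its sides exchanged, and rank two on both
  sides is a symmetric condition.\<close>

lemma rank_two_right_dual:
  assumes "field L" "field M" "rank_two_bimodule L M W"
  shows "rank_two_bimodule M L (right_dual M W)"
proof -
  obtain \<beta> where \<beta>: "bij_betw \<beta> (carrier W) (carrier (right_dual M W))"
    "\<beta> \<zero>\<^bsub>W\<^esub> = \<zero>\<^bsub>right_dual M W\<^esub>"
    "\<And>v w. v \<in> carrier W \<Longrightarrow> w \<in> carrier W \<Longrightarrow> \<beta> (v \<oplus>\<^bsub>W\<^esub> w) = \<beta> v \<oplus>\<^bsub>right_dual M W\<^esub> \<beta> w"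
    "\<And>a w. a \<in> carrier M \<Longrightarrow> w \<in> carrier W \<Longrightarrow> \<beta> (ract W w a) = lact (right_dual M W) a (\<beta> w)"
    "\<And>a w. a \<in> carrier L \<Longrightarrow> w \<in> carrier W \<Longrightarrow> \<beta> (lact W a w) = ract (right_dual M W) (\<beta> w) a"
    using right_dual_iso[OF assms] by metis
  show ?thesis
    by (rule rank_two_transfer[OF rank_two_op[OF assms(3)] assms(2,1), of \<beta>]) (use \<beta> in simp_all)
qed

text \<open>\<open>U\<close> is the right dual of \<open>W\<close>, and \<open>W\<close> the left dual of \<open>U\<close>, under the pairing \<open>D\<close>; \<open>x, x'\<close>
  and \<open>y, y'\<close> are dual bases.\<close>

locale dual_pair = field_L: field L + field_M: field M + W: bimodule L M W + U: bimodule M L U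
  for L M :: "'k ring" and W :: "('k, 'v) bimod" and U :: "('k, 'u) bimod" +
  fixes D :: "'u \<Rightarrow> 'v \<Rightarrow> 'k" and x x' :: 'v and y y' :: 'u
  assumes D_left: "v \<in> carrier W \<Longrightarrow> additive U M (\<lambda>\<psi>. D \<psi> v)"
    and D_right: "\<psi> \<in> carrier U \<Longrightarrow> additive W M (D \<psi>)"
    and D_lact: "\<psi> \<in> carrier U \<Longrightarrow> v \<in> carrier W \<Longrightarrow> a \<in> carrier M \<Longrightarrow> D (lact U a \<psi>) v = a \<otimes>\<^bsub>M\<^esub> D \<psi> v"
    and D_ract: "\<psi> \<in> carrier U \<Longrightarrow> v \<in> carrier W \<Longrightarrow> a \<in> carrier M \<Longrightarrow> D \<psi> (ract W v a) = D \<psi> v \<otimes>\<^bsub>M\<^esub> a"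
    and D_middle: "\<psi> \<in> carrier U \<Longrightarrow> v \<in> carrier W \<Longrightarrow> b \<in> carrier L \<Longrightarrow> D (ract U \<psi> b) v = D \<psi> (lact W b v)"
    and x_closed [simp]: "x \<in> carrier W" "x' \<in> carrier W" and y_closed [simp]: "y \<in> carrier U" "y' \<in> carrier U"
    and D_basis [simp]: "D y x = \<one>\<^bsub>M\<^esub>" "D y x' = \<zero>\<^bsub>M\<^esub>" "D y' x = \<zero>\<^bsub>M\<^esub>" "D y' x' = \<one>\<^bsub>M\<^esub>"
    and expand_W: "v \<in> carrier W \<Longrightarrow> v = ract W x (D y v) \<oplus>\<^bsub>W\<^esub> ract W x' (D y' v)"
    and expand_U: "\<psi> \<in> carrier U \<Longrightarrow> \<psi> = lact U (D \<psi> x) y \<oplus>\<^bsub>U\<^esub> lact U (D \<psi> x') y'"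
begin

lemma D_closed [simp]: "\<psi> \<in> carrier U \<Longrightarrow> v \<in> carrier W \<Longrightarrow> D \<psi> v \<in> carrier M"
  using additive_closed[OF D_right] .

text \<open>The axioms are symmetric under exchanging the arguments of the pairing together with the
  sides of both bimodules. This handles negative indices, where the functionals are elements of the
  first bimodule.\<close>

lemma flip: "dual_pair L M (op_bimod U) (op_bimod W) (\<lambda>v \<psi>. D \<psi> v) y y' x x'"
proof (intro dual_pair.intro dual_pair_axioms.intro)
  fix v assume "v \<in> carrier (op_bimod U)"
  then show "additive (op_bimod W) M (\<lambda>\<psi>. D v \<psi>)" using D_right[of v] by (simp add: additive_def hom_def)
next
  fix \<psi> assume "\<psi> \<in> carrier (op_bimod W)"
  then show "additive (op_bimod U) M (\<lambda>v. D v \<psi>)" using D_left[of \<psi>] by (simp add: additive_def hom_def)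
qed (use D_lact D_ract D_middle expand_W expand_U in \<open>auto intro: field_L.field_axioms field_M.field_axioms bimodule_op
    W.bimodule_axioms U.bimodule_axioms simp: field_M.m_comm\<close>)

text \<open>Used with \<open>f\<close> the coding of a dual by \<open>dual_code\<close> and
  \<open>g\<close> its inverse \<open>decode\<close>: the dual is seen only through its pairing, so
  its elements may be recoded by any bijection.\<close>

lemma transfer_U:
  assumes U': "bimodule M L U'" and f: "bij_betw f (carrier U) (carrier U')"
    and g: "\<And>\<psi>. \<psi> \<in> carrier U \<Longrightarrow> g (f \<psi>) = \<psi>"
    and add: "\<And>v w. v \<in> carrier U \<Longrightarrow> w \<in> carrier U \<Longrightarrow> f (v \<oplus>\<^bsub>U\<^esub> w) = f v \<oplus>\<^bsub>U'\<^esub> f w"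
    and l: "\<And>a w. a \<in> carrier M \<Longrightarrow> w \<in> carrier U \<Longrightarrow> f (lact U a w) = lact U' a (f w)"
    and r: "\<And>a w. a \<in> carrier L \<Longrightarrow> w \<in> carrier U \<Longrightarrow> f (ract U w a) = ract U' (f w) a"
  shows "dual_pair L M W U' (\<lambda>\<psi>. D (g \<psi>)) x x' (f y) (f y')"
proof -
  have im: "\<exists>\<phi>. \<phi> \<in> carrier U \<and> \<psi> = f \<phi>" if "\<psi> \<in> carrier U'" for \<psi>
    using f that by (auto simp: bij_betw_def)
  have cl: "f \<psi> \<in> carrier U'" if "\<psi> \<in> carrier U" for \<psi> using f that by (auto simp: bij_betw_def)
  show ?thesis
  proof (intro dual_pair.intro dual_pair_axioms.intro)
    fix v assume "v \<in> carrier W"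
    then show "additive U' M (\<lambda>\<psi>. D (g \<psi>) v)"
      by (intro additiveI) (auto dest!: im simp: g additive_add[OF D_left] simp flip: add)
  next
    fix \<psi> assume "\<psi> \<in> carrier U'"
    then show "additive W M (D (g \<psi>))" using im g D_right by force
  next
    fix \<psi> v a assume *: "\<psi> \<in> carrier U'" "v \<in> carrier W"
    obtain \<phi> where \<phi>: "\<phi> \<in> carrier U" "\<psi> = f \<phi>" using im *(1) by blast
    show "D (g (lact U' a \<psi>)) v = a \<otimes>\<^bsub>M\<^esub> D (g \<psi>) v" if "a \<in> carrier M"
      using \<phi> * that D_lact by (simp add: g flip: l)
    show "D (g \<psi>) (ract W v a) = D (g \<psi>) v \<otimes>\<^bsub>M\<^esub> a" if "a \<in> carrier M"
      using \<phi> * that D_ract by (simp add: g)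
    show "D (g (ract U' \<psi> a)) v = D (g \<psi>) (lact W a v)" if "a \<in> carrier L"
      using \<phi> * that D_middle by (simp add: g flip: r)
  next
    fix \<psi> assume "\<psi> \<in> carrier U'"
    then obtain \<phi> where \<phi>: "\<phi> \<in> carrier U" "\<psi> = f \<phi>" using im by blast
    have "f \<phi> = f (lact U (D \<phi> x) y \<oplus>\<^bsub>U\<^esub> lact U (D \<phi> x') y')" using expand_U[OF \<phi>(1)] by simp
    also have "\<dots> = lact U' (D \<phi> x) (f y) \<oplus>\<^bsub>U'\<^esub> lact U' (D \<phi> x') (f y')"
      using \<phi> by (simp add: add l)
    finally show "\<psi> = lact U' (D (g \<psi>) x) (f y) \<oplus>\<^bsub>U'\<^esub> lact U' (D (g \<psi>) x') (f y')"
      unfolding \<phi>(2) g[OF \<phi>(1)] .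
  qed (use expand_W in \<open>auto intro: field_L.field_axioms field_M.field_axioms U' W.bimodule_axioms simp: g cl\<close>)
qed

end

lemma dual_pair_right_dual:
  assumes "field L" "field M" "rank_two_bimodule L M W"
  obtains x x' y y' where "dual_pair L M W (right_dual M W) (\<lambda>\<psi>. \<psi>) x x' y y'"
proof -
  obtain x x' l m where "two_basis L M W x x' l m" using assms by (rule two_basis_if_rank_two)
  then interpret two_basis L M W x x' l m .
  \<comment> \<open>The coordinate functionals form the dual basis; elements of
    \<open>right_dual\<close> are extensional, hence the restriction.\<close>
  let ?l = "restrict l (carrier W)" and ?m = "restrict m (carrier W)"
  have lm: "?l \<in> carrier (right_dual M W)" "?m \<in> carrier (right_dual M W)"
    by (auto simp: right_dual_simps l_add m_add l_ract m_ract M.m_comm intro!: additiveI)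
  have "dual_pair L M W (right_dual M W) (\<lambda>\<psi>. \<psi>) x x' ?l ?m"
  proof (intro dual_pair.intro dual_pair_axioms.intro)
    show "bimodule M L (right_dual M W)"
      using rank_two_right_dual[OF assms] by (simp add: rank_two_bimodule_def)
    fix \<psi> assume \<psi>: "\<psi> \<in> carrier (right_dual M W)"
    then have a: "additive W M \<psi>" by (simp add: right_dual_simps)
    then show "additive W M \<psi>" .
    have "\<psi> w = \<psi> x \<otimes>\<^bsub>M\<^esub> l w \<oplus>\<^bsub>M\<^esub> \<psi> x' \<otimes>\<^bsub>M\<^esub> m w" if w: "w \<in> carrier W" for w
    proof -
      have "\<psi> w = \<psi> (ract W x (l w) \<oplus>\<^bsub>W\<^esub> ract W x' (m w))" using expand[OF w] by simp
      then show ?thesis using w \<psi> additive_add[OF a] by (simp add: right_dual_simps)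
    qed
    note ex = this
    show "\<psi> = lact (right_dual M W) (\<psi> x) ?l \<oplus>\<^bsub>right_dual M W\<^esub> lact (right_dual M W) (\<psi> x') ?m"
    proof (rule extensionalityI[of _ "carrier W"])
      fix w assume w: "w \<in> carrier W"
      show "\<psi> w = (lact (right_dual M W) (\<psi> x) ?l \<oplus>\<^bsub>right_dual M W\<^esub> lact (right_dual M W) (\<psi> x') ?m) w"
        by (subst ex[OF w]) (use w in \<open>simp add: right_dual_simps\<close>)
    qed (use \<psi> in \<open>auto simp: right_dual_simps\<close>)
  next
    fix \<psi> v a assume "\<psi> \<in> carrier (right_dual M W)" "v \<in> carrier W"
    then show "\<psi> (ract W v a) = \<psi> v \<otimes>\<^bsub>M\<^esub> a" if "a \<in> carrier M"
      using that by (simp add: right_dual_simps)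
  next
    fix v assume "v \<in> carrier W"
    then show "additive (right_dual M W) M (\<lambda>\<psi>. \<psi> v)"
      by (intro additiveI) (auto simp: right_dual_simps additive_closed)
  qed (simp_all add: lm expand[symmetric] coords bimodule_axioms L.field_axioms M.field_axioms
      right_dual_simps(4,5))
  then show thesis by (rule that)
qed

lemma op_op_bimod [simp]: "op_bimod (op_bimod W) = W"
  by (cases W) (simp add: op_bimod_def make_bimod_def ring.extend_def ring.truncate_def bimod.fields_def)

text \<open>Reduces left duals to right duals; commutativity of \<open>L\<close> reconciles the two
  ways of writing linearity.\<close>

lemma left_dual_eq:
  assumes "cring L"
  shows "left_dual L W = op_bimod (right_dual L (op_bimod W))"
proof -
  interpret cring L by fact
  have "{\<phi> \<in> carrier W \<rightarrow>\<^sub>E carrier L.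
        (\<forall>v\<in>carrier W. \<forall>w\<in>carrier W. \<phi> (v \<oplus>\<^bsub>W\<^esub> w) = \<phi> v \<oplus>\<^bsub>L\<^esub> \<phi> w) \<and>
        (\<forall>v\<in>carrier W. \<forall>a\<in>carrier L. \<phi> (lact W a v) = a \<otimes>\<^bsub>L\<^esub> \<phi> v)} =
     {\<phi> \<in> carrier W \<rightarrow>\<^sub>E carrier L.
        (\<forall>v\<in>carrier W. \<forall>w\<in>carrier W. \<phi> (v \<oplus>\<^bsub>W\<^esub> w) = \<phi> v \<oplus>\<^bsub>L\<^esub> \<phi> w) \<and>
        (\<forall>v\<in>carrier W. \<forall>a\<in>carrier L. \<phi> (lact W a v) = \<phi> v \<otimes>\<^bsub>L\<^esub> a)}"
    by (intro Collect_cong conj_cong ball_cong refl) (auto simp: m_comm PiE_iff)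
  then show ?thesis
    by (simp add: left_dual_def right_dual_def op_bimod_def make_bimod_def ring.extend_def
        ring.truncate_def bimod.fields_def)
qed


text \<open>\<open>dual_code\<close> is an arbitrary choice and is a bijection only if some
  bijection exists; the isomorphism coming from a self-adjoint form provides one.\<close>

lemma dual_code_bij:
  assumes "field L" "field M" "rank_two_bimodule L M W"
  shows "bij_betw (dual_code (right_dual M W) W) (carrier (right_dual M W)) (carrier W)"
    and "bij_betw (dual_code (left_dual L W) W) (carrier (left_dual L W)) (carrier W)"
proof -
  have *: "\<exists>f. bij_betw f (carrier (right_dual M W)) (carrier W)"
    if "field L" "field M" "rank_two_bimodule L M W" for L M :: "'a ring" and W :: "('a, 'b) bimod"
    using right_dual_iso[OF that] bij_betw_inv_into by metis
  show "bij_betw (dual_code (right_dual M W) W) (carrier (right_dual M W)) (carrier W)"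
    unfolding dual_code_def by (rule someI_ex[OF *[OF assms]])
  have "\<exists>f. bij_betw f (carrier (left_dual L W)) (carrier W)"
    using *[OF assms(2,1) rank_two_op[OF assms(3)]] by (simp add: left_dual_eq assms(1) field.axioms domain.axioms)
  then show "bij_betw (dual_code (left_dual L W) W) (carrier (left_dual L W)) (carrier W)"
    unfolding dual_code_def by (rule someI_ex)
qed

context
  fixes H :: "('k, 'v \<Rightarrow> 'k) bimod" and W :: "('k, 'v) bimod"
  assumes bij: "bij_betw (dual_code H W) (carrier H) (carrier W)"
begin

lemma decode_dual_code: "h \<in> carrier H \<Longrightarrow> decode H W (dual_code H W h) = h"
  using bij by (simp add: decode_def bij_betw_def)

lemma transport_simps:
  "carrier (transport H W) = dual_code H W ` carrier H"
  "\<zero>\<^bsub>transport H W\<^esub> = dual_code H W \<zero>\<^bsub>H\<^esub>"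
  "h \<in> carrier H \<Longrightarrow> h' \<in> carrier H \<Longrightarrow>
    dual_code H W h \<oplus>\<^bsub>transport H W\<^esub> dual_code H W h' = dual_code H W (h \<oplus>\<^bsub>H\<^esub> h')"
  "h \<in> carrier H \<Longrightarrow> lact (transport H W) a (dual_code H W h) = dual_code H W (lact H a h)"
  "h \<in> carrier H \<Longrightarrow> ract (transport H W) (dual_code H W h) a = dual_code H W (ract H h a)"
  by (simp_all add: transport_def decode_dual_code)

lemma transport_bij: "bij_betw (dual_code H W) (carrier H) (carrier (transport H W))"
  using bij by (simp add: transport_simps bij_betw_def)

lemma rank_two_transport:
  assumes "field L" "field M" "rank_two_bimodule L M H"
  shows "rank_two_bimodule L M (transport H W)"
  by (rule rank_two_transfer[OF assms(3,1,2) transport_bij]) (simp_all add: transport_simps)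

end

section \<open>Iterated duals\<close>

context
  fixes K0 K1 :: "'k ring" and V :: "('k, 'v) bimod"
  assumes K0: "field K0" and K1: "field K1" and V: "rank_two_bimodule K0 K1 V"
begin

lemma field_field_at: "field (field_at K0 K1 i)"
  using K0 K1 by (simp add: field_at_def)

lemma field_at_add_two: "field_at K0 K1 (i + 2) = field_at K0 K1 i"
  by (simp add: field_at_def)

lemma rank_two_upper_dual:
  "rank_two_bimodule (field_at K0 K1 (int n)) (field_at K0 K1 (int n + 1)) (upper_dual K0 K1 V n)"
proof (induction n)
  case 0
  then show ?case using V by (simp add: field_at_def)
next
  case (Suc n)
  note * = field_field_at field_field_at Suc
  have "rank_two_bimodule (field_at K0 K1 (int n + 1)) (field_at K0 K1 (int n)) (upper_dual K0 K1 V (Suc n))"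
    unfolding upper_dual.simps by (rule rank_two_transport[OF dual_code_bij(1)[OF *] field_field_at field_field_at rank_two_right_dual[OF *]])
  \<comment> \<open>The dual has the scalars of \<open>n + 1\<close> on the left and of
    \<open>n\<close> on the right; the latter are those of \<open>n + 2\<close> by
    periodicity.\<close>
  moreover have "int (Suc n) + 1 = int n + 2" "int (Suc n) = int n + 1" by auto
  ultimately show ?case by (metis field_at_add_two)
qed

lemma rank_two_left_dual:
  assumes "field L" "field M" "rank_two_bimodule L M W"
  shows "rank_two_bimodule M L (left_dual L W)"
  using rank_two_op[OF rank_two_right_dual[OF assms(2,1) rank_two_op[OF assms(3)]]]
  by (simp add: left_dual_eq assms(1) field.axioms domain.axioms)

lemma rank_two_lower_dual:
  "rank_two_bimodule (field_at K0 K1 (- int n)) (field_at K0 K1 (- int n + 1)) (lower_dual K0 K1 V n)"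
proof (induction n)
  case 0
  then show ?case using V by (simp add: field_at_def)
next
  case (Suc n)
  note * = field_field_at field_field_at Suc
  have "rank_two_bimodule (field_at K0 K1 (- int n + 1)) (field_at K0 K1 (- int n)) (lower_dual K0 K1 V (Suc n))"
    unfolding lower_dual.simps by (rule rank_two_transport[OF dual_code_bij(2)[OF *] field_field_at field_field_at rank_two_left_dual[OF *]])
  moreover have "- int n + 1 = - int (Suc n) + 2" "- int n = - int (Suc n) + 1" by auto
  ultimately show ?case by (metis field_at_add_two)
qed

lemma rank_two_iter_dual:
  "rank_two_bimodule (field_at K0 K1 i) (field_at K0 K1 (i + 1)) (iter_dual K0 K1 V i)"
proof (cases "i \<ge> 0")
  case True
  then show ?thesis using rank_two_upper_dual[of "nat i"] by (simp add: iter_dual_def)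
next
  case False
  then show ?thesis using rank_two_lower_dual[of "nat (- i)"] by (simp add: iter_dual_def add.commute)
qed

text \<open>For \<open>i \<ge> 0\<close> the next dual is a coded right dual by construction. For
  \<open>i < 0\<close> it is the bimodule with index \<open>i\<close> that is a coded left dual of
  the one with index \<open>i + 1\<close>; a pair is built on the opposite sides, recoded, and then
  flipped.\<close>

lemma dual_pair_iter_dual:
  "\<exists>x x' y y'. dual_pair (field_at K0 K1 i) (field_at K0 K1 (i + 1)) (iter_dual K0 K1 V i)
    (iter_dual K0 K1 V (i + 1)) (dual_pairing K0 K1 V i) x x' y y'"
proof (cases "i \<ge> 0")
  case True
  let ?L = "field_at K0 K1 i" and ?M = "field_at K0 K1 (i + 1)" and ?W = "iter_dual K0 K1 V i"
  let ?H = "right_dual ?M ?W"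
  note * = field_field_at field_field_at rank_two_iter_dual
  have next_dual: "iter_dual K0 K1 V (i + 1) = transport ?H ?W"
    using True by (simp add: iter_dual_def nat_add_distrib)
  have pairing: "dual_pairing K0 K1 V i = (\<lambda>\<psi>. decode ?H ?W \<psi>)"
    using True by (simp add: dual_pairing_def fun_eq_iff)
  obtain x x' y y' where "dual_pair ?L ?M ?W ?H (\<lambda>\<psi>. \<psi>) x x' y y'"
    using dual_pair_right_dual[OF *] by blast
  then interpret P: dual_pair ?L ?M ?W ?H "\<lambda>\<psi>. \<psi>" x x' y y' .
  note bij = dual_code_bij(1)[OF *, of i]
  have "bimodule ?M ?L (transport ?H ?W)"
    using rank_two_transport[OF bij field_field_at field_field_at rank_two_right_dual[OF *]]
    by (simp add: rank_two_bimodule_def)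
  then show ?thesis
    unfolding next_dual pairing
    using P.transfer_U[OF _ transport_bij[OF bij], of "decode ?H ?W"]
    by (metis (no_types, lifting) decode_dual_code[OF bij] transport_simps(3-5)[OF bij])
next
  case False
  let ?L = "field_at K0 K1 (i + 1)" and ?M = "field_at K0 K1 (i + 1 + 1)" and ?W = "iter_dual K0 K1 V (i + 1)"
  let ?H = "left_dual ?L ?W"
  note * = field_field_at field_field_at rank_two_iter_dual
  have eq: "field_at K0 K1 (i + 1 + 1) = field_at K0 K1 i" using field_at_add_two[of i] by (simp add: add.assoc)
  have next_dual: "iter_dual K0 K1 V i = transport ?H ?W"
  proof (cases "i = -1")
    case True
    then show ?thesis by (simp add: iter_dual_def)
  next
    case neq: False
    have "nat (- i) = Suc (nat (- (i + 1)))" using False by simp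
    then show ?thesis using False neq by (simp add: iter_dual_def add.commute)
  qed
  have pairing: "dual_pairing K0 K1 V i = (\<lambda>\<psi> v. decode ?H ?W v \<psi>)"
    using False by (simp add: dual_pairing_def fun_eq_iff)
  have H: "?H = op_bimod (right_dual ?L (op_bimod ?W))"
    by (rule left_dual_eq) (use field_field_at[of "i + 1"] in \<open>simp add: field.axioms domain.axioms\<close>)
  obtain x x' y y' where "dual_pair ?M ?L (op_bimod ?W) (right_dual ?L (op_bimod ?W)) (\<lambda>\<psi>. \<psi>) x x' y y'"
    using dual_pair_right_dual[OF field_field_at field_field_at rank_two_op[OF rank_two_iter_dual], of "i + 1"] by blast
  then interpret P: dual_pair ?M ?L "op_bimod ?W" "right_dual ?L (op_bimod ?W)" "\<lambda>\<psi>. \<psi>" x x' y y' .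
  note bij = dual_code_bij(2)[OF *, of "i + 1"]
  have "bimodule ?M ?L (transport ?H ?W)"
    using rank_two_transport[OF bij field_field_at field_field_at rank_two_left_dual[OF *]]
    by (simp add: rank_two_bimodule_def)
  then have "bimodule ?L ?M (op_bimod (transport ?H ?W))" by (rule bimodule_op)
  then have "dual_pair ?M ?L (op_bimod ?W) (op_bimod (transport ?H ?W)) (decode ?H ?W)
      x x' (dual_code ?H ?W y) (dual_code ?H ?W y')"
    by (rule P.transfer_U)
      (use transport_bij[OF bij] decode_dual_code[OF bij] transport_simps(3-5)[OF bij, symmetric] in \<open>auto simp: H\<close>)
  from dual_pair.flip[OF this] show ?thesis
    unfolding next_dual pairing eq op_op_bimod by blast
qed

end

section \<open>Tensor products\<close>

lemma additive_modules [simp]: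
  "additive (left_module X) H f \<longleftrightarrow> additive X H f" "additive H (left_module X) g \<longleftrightarrow> additive H X g"
  "additive (right_module X) H f \<longleftrightarrow> additive X H f" "additive H (right_module X) g \<longleftrightarrow> additive H X g"
  "additive (op_bimod X) H f \<longleftrightarrow> additive X H f" "additive H (op_bimod X) g \<longleftrightarrow> additive H X g"
  by (simp_all add: additive_def hom_def)

lemma additive_sum:
  assumes "abelian_group H" "finite I" "\<And>i. i \<in> I \<Longrightarrow> additive G H (f i)"
  shows "additive G H (\<lambda>x. \<Oplus>\<^bsub>H\<^esub>i\<in>I. f i x)"
proof (rule additiveI)
  interpret H: abelian_group H by fact
  fix x assume x: "x \<in> carrier G"
  show "(\<Oplus>\<^bsub>H\<^esub>i\<in>I. f i x) \<in> carrier H"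
    using additive_closed[OF assms(3)] x by (intro H.finsum_closed) auto
  fix y assume y: "y \<in> carrier G"
  have "(\<Oplus>\<^bsub>H\<^esub>i\<in>I. f i (x \<oplus>\<^bsub>G\<^esub> y)) = (\<Oplus>\<^bsub>H\<^esub>i\<in>I. f i x \<oplus>\<^bsub>H\<^esub> f i y)"
    using additive_closed[OF assms(3)] additive_add[OF assms(3)] x y by (intro H.finsum_cong') auto
  then show "(\<Oplus>\<^bsub>H\<^esub>i\<in>I. f i (x \<oplus>\<^bsub>G\<^esub> y)) = (\<Oplus>\<^bsub>H\<^esub>i\<in>I. f i x) \<oplus>\<^bsub>H\<^esub> (\<Oplus>\<^bsub>H\<^esub>i\<in>I. f i y)"
    using additive_closed[OF assms(3)] x y assms(2) by (simp add: H.finsum_addf Pi_iff)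
qed

lemma (in abelian_group) finsum_product:
  assumes "finite I" "finite J" "\<And>i j. i \<in> I \<Longrightarrow> j \<in> J \<Longrightarrow> f (i, j) \<in> carrier G"
  shows "(\<Oplus>p\<in>I \<times> J. f p) = (\<Oplus>i\<in>I. \<Oplus>j\<in>J. f (i, j))"
  using assms(1,3)
proof (induction I rule: finite_induct)
  case (insert i I)
  have "insert i I \<times> J = Pair i ` J \<union> I \<times> J" by auto
  moreover have "Pair i ` J \<inter> I \<times> J = {}" using insert by auto
  ultimately have "(\<Oplus>p\<in>insert i I \<times> J. f p) = (\<Oplus>p\<in>Pair i ` J. f p) \<oplus> (\<Oplus>p\<in>I \<times> J. f p)"
    using insert assms(2) by (subst finsum_Un_disjoint[symmetric]) auto
  also have "(\<Oplus>p\<in>Pair i ` J. f p) = (\<Oplus>j\<in>J. f (i, j))"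
    using insert by (intro add.finprod_reindex) (auto intro: inj_onI)
  finally show ?case using insert by (subst finsum_insert) (auto intro!: finsum_closed)
qed simp

locale tensor_product = X: bimodule L K X + Y: bimodule K M Y
  for L K M :: "'k ring" and X :: "('k, 'v) bimod" and Y :: "('k, 'w) bimod"
begin

lemma tensor_presentation: "presentation (carrier X \<times> carrier Y) (tensor_rels K X Y)"
proof
  show "tensor_rels K X Y \<subseteq> carrier (free_group (carrier X \<times> carrier Y))"
    unfolding tensor_rels_def by (auto intro!: free_group_diff_closed)
qed

sublocale P: presentation "carrier X \<times> carrier Y" "tensor_rels K X Y" by (rule tensor_presentation)

abbreviation "T \<equiv> tensor K X Y"
abbreviation "pt \<equiv> pure_tensor K X Y"

lemma tensor_group [simp]: "carrier T = carrier P.P" "\<zero>\<^bsub>T\<^esub> = \<zero>\<^bsub>P.P\<^esub>" "add T = add P.P"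
  by (simp_all add: tensor_def make_bimod_def ring.extend_def bimod.fields_def)

lemma abelian_group_tensor: "abelian_group T"
  by (rule abelian_group_cong[OF P.abelian_group_P]) simp_all

sublocale T: abelian_group T by (rule abelian_group_tensor)

lemma additive_tensor: "additive T H f \<longleftrightarrow> additive P.P H f" "additive H T g \<longleftrightarrow> additive H P.P g"
  by (simp_all add: additive_def hom_def)

lemma pt_closed: "x \<in> carrier X \<Longrightarrow> y \<in> carrier Y \<Longrightarrow> pt x y \<in> carrier T"
  by (simp add: pure_tensor_def P.gen_closed)

lemma pt_add_left:
  assumes "x \<in> carrier X" "x' \<in> carrier X" "y \<in> carrier Y"
  shows "pt (x \<oplus>\<^bsub>X\<^esub> x') y = pt x y \<oplus>\<^bsub>T\<^esub> pt x' y"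
  unfolding pure_tensor_def tensor_group
  by (rule P.gen_eq_add) (use assms in \<open>auto simp: tensor_rels_def\<close>)

lemma pt_add_right:
  assumes "x \<in> carrier X" "y' \<in> carrier Y" "y \<in> carrier Y"
  shows "pt x (y \<oplus>\<^bsub>Y\<^esub> y') = pt x y \<oplus>\<^bsub>T\<^esub> pt x y'"
  unfolding pure_tensor_def tensor_group
  by (rule P.gen_eq_add) (use assms in \<open>auto simp: tensor_rels_def\<close>)

lemma pt_middle:
  assumes "x \<in> carrier X" "c \<in> carrier K" "y \<in> carrier Y"
  shows "pt (ract X x c) y = pt x (lact Y c y)"
  unfolding pure_tensor_def
  by (rule P.gen_eq) (use assms in \<open>auto simp: tensor_rels_def\<close>)

lemma pt_additive_left: "y \<in> carrier Y \<Longrightarrow> additive X T (\<lambda>x. pt x y)"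
  by (rule additiveI) (auto simp: pt_closed pt_add_left simp del: tensor_group)

lemma pt_additive_right: "x \<in> carrier X \<Longrightarrow> additive Y T (pt x)"
  by (rule additiveI) (auto simp: pt_closed pt_add_right simp del: tensor_group)

lemma tensor_hom_eq:
  assumes "abelian_group B" "additive T B F" "additive T B F'"
    and "\<And>x y. x \<in> carrier X \<Longrightarrow> y \<in> carrier Y \<Longrightarrow> F (pt x y) = F' (pt x y)" "t \<in> carrier T"
  shows "F t = F' t"
  by (rule P.hom_eq[OF assms(1)]) (use assms in \<open>auto simp: additive_tensor pure_tensor_def\<close>)

lemma tensor_universal:
  assumes B: "abelian_group B"
    and l: "\<And>y. y \<in> carrier Y \<Longrightarrow> additive X B (\<lambda>x. \<beta> x y)"
    and r: "\<And>x. x \<in> carrier X \<Longrightarrow> additive Y B (\<beta> x)"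
    and m: "\<And>x c y. x \<in> carrier X \<Longrightarrow> c \<in> carrier K \<Longrightarrow> y \<in> carrier Y \<Longrightarrow> \<beta> (ract X x c) y = \<beta> x (lact Y c y)"
  obtains F where "additive T B F" "\<And>x y. x \<in> carrier X \<Longrightarrow> y \<in> carrier Y \<Longrightarrow> F (pt x y) = \<beta> x y"
proof -
  have "preserves_rels (carrier X \<times> carrier Y) (tensor_rels K X Y) B (\<lambda>(x, y). \<beta> x y)"
  proof (rule preserves_relsI[OF B])
    fix rel assume "rel \<in> tensor_rels K X Y"
    then consider
      x x' y where "rel = frag_of (x \<oplus>\<^bsub>X\<^esub> x', y) - frag_of (x, y) - frag_of (x', y)"
        "x \<in> carrier X" "x' \<in> carrier X" "y \<in> carrier Y"
      | x y y' where "rel = frag_of (x, y \<oplus>\<^bsub>Y\<^esub> y') - frag_of (x, y) - frag_of (x, y')"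
        "x \<in> carrier X" "y \<in> carrier Y" "y' \<in> carrier Y"
      | x c y where "rel = frag_of (ract X x c, y) - frag_of (x, lact Y c y)"
        "x \<in> carrier X" "c \<in> carrier K" "y \<in> carrier Y"
      unfolding tensor_rels_def by blast
    then show "(\<exists>a\<in>carrier X \<times> carrier Y. \<exists>b\<in>carrier X \<times> carrier Y. \<exists>c\<in>carrier X \<times> carrier Y.
        rel = frag_of a - frag_of b - frag_of c \<and>
        (case a of (x, y) \<Rightarrow> \<beta> x y) = (case b of (x, y) \<Rightarrow> \<beta> x y) \<oplus>\<^bsub>B\<^esub> (case c of (x, y) \<Rightarrow> \<beta> x y)) \<or>
      (\<exists>a\<in>carrier X \<times> carrier Y. \<exists>b\<in>carrier X \<times> carrier Y. rel = frag_of a - frag_of b \<and>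
        (case a of (x, y) \<Rightarrow> \<beta> x y) = (case b of (x, y) \<Rightarrow> \<beta> x y))"
    proof cases
      case 1
      then show ?thesis
        by (intro disjI1 bexI[of _ "(x \<oplus>\<^bsub>X\<^esub> x', y)"] bexI[of _ "(x, y)"] bexI[of _ "(x', y)"])
          (auto simp: additive_add[OF l])
    next
      case 2
      then show ?thesis
        by (intro disjI1 bexI[of _ "(x, y \<oplus>\<^bsub>Y\<^esub> y')"] bexI[of _ "(x, y)"] bexI[of _ "(x, y')"])
          (auto simp: additive_add[OF r])
    next
      case 3
      then show ?thesis
        by (intro disjI2 bexI[of _ "(ract X x c, y)"] bexI[of _ "(x, lact Y c y)"]) (auto simp: m)
    qed
  qed (use additive_closed[OF l] in auto)
  from P.universal[OF B this] obtain F where F: "additive P.P B F"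
    "\<And>g. g \<in> carrier X \<times> carrier Y \<Longrightarrow> F (P.gen g) = (case g of (x, y) \<Rightarrow> \<beta> x y)" by blast
  show thesis by (rule that[of F]) (use F in \<open>auto simp: additive_tensor pure_tensor_def\<close>)
qed

lemma tensor_lact:
  assumes a: "a \<in> carrier L"
  shows "additive T T (lact T a)"
    and "x \<in> carrier X \<Longrightarrow> y \<in> carrier Y \<Longrightarrow> lact T a (pt x y) = pt (lact X a x) y"
proof -
  obtain F where F: "additive T T F" "\<And>x y. x \<in> carrier X \<Longrightarrow> y \<in> carrier Y \<Longrightarrow> F (pt x y) = pt (lact X a x) y"
    by (rule tensor_universal[OF abelian_group_tensor, of "\<lambda>x y. pt (lact X a x) y"])
      (use a in \<open>auto intro!: additiveI simp: pt_closed pt_add_left pt_add_right pt_middle[symmetric] X.lact_add_right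
        X.lact_ract[symmetric] simp del: tensor_group\<close>)
  \<comment> \<open>The action is defined as a union over representatives; here it is identified
    with the map from the universal property, which is visibly additive.\<close>
  have eq: "lact T a t = F t" if "t \<in> carrier T" for t
  proof -
    have "induced_map (carrier X \<times> carrier Y) (tensor_rels K X Y) (\<lambda>(x, y). (lact X a x, y)) t = F t"
      by (rule P.induced_map_eq) (use F a that in \<open>auto simp: additive_tensor pure_tensor_def\<close>)
    then show ?thesis by (simp add: tensor_def)
  qed
  show "additive T T (lact T a)"
    using F(1) eq by (auto intro!: additiveI simp: additive_closed additive_add simp del: tensor_group)
  show "lact T a (pt x y) = pt (lact X a x) y" if "x \<in> carrier X" "y \<in> carrier Y"
    using that eq F(2) pt_closed by simp
qed

lemma tensor_ract:
  assumes a: "a \<in> carrier M"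
  shows "additive T T (\<lambda>t. ract T t a)"
    and "x \<in> carrier X \<Longrightarrow> y \<in> carrier Y \<Longrightarrow> ract T (pt x y) a = pt x (ract Y y a)"
proof -
  obtain F where F: "additive T T F" "\<And>x y. x \<in> carrier X \<Longrightarrow> y \<in> carrier Y \<Longrightarrow> F (pt x y) = pt x (ract Y y a)"
    by (rule tensor_universal[OF abelian_group_tensor, of "\<lambda>x y. pt x (ract Y y a)"])
      (use a in \<open>auto intro!: additiveI simp: pt_closed pt_add_left pt_add_right pt_middle Y.ract_add_left
        Y.lact_ract simp del: tensor_group\<close>)
  have eq: "ract T t a = F t" if "t \<in> carrier T" for t
  proof -
    have "induced_map (carrier X \<times> carrier Y) (tensor_rels K X Y) (\<lambda>(x, y). (x, ract Y y a)) t = F t"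
      by (rule P.induced_map_eq) (use F a that in \<open>auto simp: additive_tensor pure_tensor_def\<close>)
    then show ?thesis by (simp add: tensor_def)
  qed
  show "additive T T (\<lambda>t. ract T t a)"
    using F(1) eq by (auto intro!: additiveI simp: additive_closed additive_add simp del: tensor_group)
  show "ract T (pt x y) a = pt x (ract Y y a)" if "x \<in> carrier X" "y \<in> carrier Y"
    using that eq F(2) pt_closed by simp
qed

lemma additive_ident: "additive T T (\<lambda>t. t)"
  by (rule additiveI) auto

lemma bimodule_tensor: "bimodule L M T"
proof (rule bimoduleI)
  interpret L: cring L by (rule X.cring_left)
  interpret M: cring M by (rule Y.cring_right)
  note lc = additive_closed[OF tensor_lact(1)] and rc = additive_closed[OF tensor_ract(1)]
  note [simp] = tensor_lact(2) tensor_ract(2) pt_closed pt_add_left pt_add_right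
  note [simp del] = tensor_group
  note eqI = tensor_hom_eq[OF abelian_group_tensor]
  show "cring L" "cring M" by (rule X.cring_left Y.cring_right)+
  show "abelian_group T" by (rule abelian_group_tensor)
  fix a t assume t: "t \<in> carrier T"
  show "lact T a t \<in> carrier T" if "a \<in> carrier L" using lc that t .
  show "ract T t a \<in> carrier T" if "a \<in> carrier M" using rc that t .
  show "lact T a (t \<oplus>\<^bsub>T\<^esub> t') = lact T a t \<oplus>\<^bsub>T\<^esub> lact T a t'" if "a \<in> carrier L" "t' \<in> carrier T" for t'
    using that t by (simp add: additive_add[OF tensor_lact(1)])
  show "ract T (t \<oplus>\<^bsub>T\<^esub> t') a = ract T t a \<oplus>\<^bsub>T\<^esub> ract T t' a" if "a \<in> carrier M" "t' \<in> carrier T" for t'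
    using that t by (simp add: additive_add[OF tensor_ract(1)])
  show "lact T (a \<oplus>\<^bsub>L\<^esub> b) t = lact T a t \<oplus>\<^bsub>T\<^esub> lact T b t" if "a \<in> carrier L" "b \<in> carrier L" for b
    by (rule eqI[OF tensor_lact(1) additive_plus[OF abelian_group_tensor tensor_lact(1) tensor_lact(1)] _ t])
      (use that in \<open>auto simp: X.lact_add_left\<close>)
  show "lact T (a \<otimes>\<^bsub>L\<^esub> b) t = lact T a (lact T b t)" if "a \<in> carrier L" "b \<in> carrier L" for b
    by (rule eqI[OF tensor_lact(1) additive_compose[OF tensor_lact(1) tensor_lact(1)] _ t])
      (use that in \<open>auto simp: X.lact_mult\<close>)
  show "ract T t (a \<oplus>\<^bsub>M\<^esub> b) = ract T t a \<oplus>\<^bsub>T\<^esub> ract T t b" if "a \<in> carrier M" "b \<in> carrier M" for b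
    by (rule eqI[OF tensor_ract(1) additive_plus[OF abelian_group_tensor tensor_ract(1) tensor_ract(1)] _ t])
      (use that in \<open>auto simp: Y.ract_add_right\<close>)
  show "ract T t (a \<otimes>\<^bsub>M\<^esub> b) = ract T (ract T t a) b" if "a \<in> carrier M" "b \<in> carrier M" for b
    by (rule eqI[OF tensor_ract(1) additive_compose[OF tensor_ract(1) tensor_ract(1)] _ t])
      (use that in \<open>auto simp: Y.ract_mult\<close>)
  show "lact T \<one>\<^bsub>L\<^esub> t = t"
    by (rule eqI[OF tensor_lact(1) additive_ident _ t]) auto
  show "ract T t \<one>\<^bsub>M\<^esub> = t"
    by (rule eqI[OF tensor_ract(1) additive_ident _ t]) auto
  show "ract T (lact T a t) b = lact T a (ract T t b)" if "a \<in> carrier L" "b \<in> carrier M" for b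
    by (rule eqI[OF additive_compose[OF tensor_lact(1) tensor_ract(1)]
          additive_compose[OF tensor_ract(1) tensor_lact(1)] _ t]) (use that in auto)
qed

text \<open>This is the map l tensor identity, followed by the identification of K tensor Y with Y.
  Applied to the coordinates of a basis of X it gives the coordinates of a tensor.\<close>

lemma contract_left:
  assumes "additive X K l" "\<And>a x. a \<in> carrier K \<Longrightarrow> x \<in> carrier X \<Longrightarrow> l (ract X x a) = a \<otimes>\<^bsub>K\<^esub> l x"
  obtains F where "additive T Y F" "\<And>x y. x \<in> carrier X \<Longrightarrow> y \<in> carrier Y \<Longrightarrow> F (pt x y) = lact Y (l x) y"
    "\<And>t a. t \<in> carrier T \<Longrightarrow> a \<in> carrier M \<Longrightarrow> F (ract T t a) = ract Y (F t) a"
proof -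
  interpret K: cring K by (rule Y.cring_left)
  have lc [simp]: "l x \<in> carrier K" if "x \<in> carrier X" for x using additive_closed[OF assms(1) that] .
  obtain F where F: "additive T Y F" "\<And>x y. x \<in> carrier X \<Longrightarrow> y \<in> carrier Y \<Longrightarrow> F (pt x y) = lact Y (l x) y"
    by (rule tensor_universal[OF Y.abelian_group_W, of "\<lambda>x y. lact Y (l x) y"])
      (auto intro!: additiveI simp: additive_add[OF assms(1)] assms(2) Y.lact_add_left Y.lact_add_right
        Y.lact_mult[symmetric] K.m_comm)
  show thesis
  proof (rule that[OF F])
    fix t a assume t: "t \<in> carrier T" and a: "a \<in> carrier M"
    show "F (ract T t a) = ract Y (F t) a"
      by (rule tensor_hom_eq[OF Y.abelian_group_W additive_compose[OF tensor_ract(1)[OF a] F(1)]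
            additive_compose[OF F(1) Y.ract_additive[OF a]] _ t])
        (use a in \<open>auto simp: tensor_ract(2) F(2) Y.lact_ract\<close>)
  qed
qed

text \<open>The mirror image: identity tensor l. With l the pairing against a fixed vector, it reads
  off the coefficients of a tensor at a left basis of Y.\<close>

lemma contract_right:
  assumes "additive Y K l" "\<And>a y. a \<in> carrier K \<Longrightarrow> y \<in> carrier Y \<Longrightarrow> l (lact Y a y) = a \<otimes>\<^bsub>K\<^esub> l y"
  obtains F where "additive T X F" "\<And>x y. x \<in> carrier X \<Longrightarrow> y \<in> carrier Y \<Longrightarrow> F (pt x y) = ract X x (l y)"
proof -
  have lc [simp]: "l x \<in> carrier K" if "x \<in> carrier Y" for x using additive_closed[OF assms(1) that] .
  show thesis
    by (rule tensor_universal[OF X.abelian_group_W, of "\<lambda>x y. ract X x (l y)"]; (rule that, assumption, blast)?)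
      (auto intro!: additiveI simp: additive_add[OF assms(1)] assms(2) X.ract_add_left X.ract_add_right
        X.ract_mult)
qed

text \<open>The tensors of basis vectors form a basis. Their coordinate functionals are the
  contraction by a coordinate of X followed by a coordinate of Y, so independence needs no separate
  argument.\<close>

lemma tensor_right_dim:
  assumes "field K" "field M" "has_dim K (right_module X) m" "has_dim M (right_module Y) n"
  shows "has_dim M (right_module T) (m * n)"
proof -
  interpret K: field K by fact
  interpret M: field M by fact
  obtain b l where b: "basis_family K (right_module X) {..<m} b l" by (rule basis_family_if_has_dim[OF assms(3)])
  obtain c k where c: "basis_family M (right_module Y) {..<n} c k" by (rule basis_family_if_has_dim[OF assms(4)])
  have bX [simp]: "b i \<in> carrier X" and la: "additive X K (l i)"
    and ls: "\<And>a x. a \<in> carrier K \<Longrightarrow> x \<in> carrier X \<Longrightarrow> l i (ract X x a) = a \<otimes>\<^bsub>K\<^esub> l i x" if "i < m" for i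
    using b that by (auto simp: basis_family_def)
  have cY [simp]: "c i \<in> carrier Y" and ka: "additive Y M (k i)"
    and ks: "\<And>a x. a \<in> carrier M \<Longrightarrow> x \<in> carrier Y \<Longrightarrow> k i (ract Y x a) = a \<otimes>\<^bsub>M\<^esub> k i x" if "i < n" for i
    using c that by (auto simp: basis_family_def)
  have lc [simp]: "l i x \<in> carrier K" if "i < m" "x \<in> carrier X" for i x using additive_closed[OF la] that .
  have kc [simp]: "k i x \<in> carrier M" if "i < n" "x \<in> carrier Y" for i x using additive_closed[OF ka] that .
  have ld: "l i (b j) = (if i = j then \<one>\<^bsub>K\<^esub> else \<zero>\<^bsub>K\<^esub>)" if "i < m" "j < m" for i j
    using b that by (auto simp: basis_family_def)
  have kd: "k i (c j) = (if i = j then \<one>\<^bsub>M\<^esub> else \<zero>\<^bsub>M\<^esub>)" if "i < n" "j < n" for i j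
    using c that by (auto simp: basis_family_def)
  have finsum_X: "finsum (right_module X) = finsum X" and finsum_Y: "finsum (right_module Y) = finsum Y"
    and finsum_T: "finsum (right_module T) = finsum T"
    by (rule finsum_cong_ring; simp add: right_module_def ring.extend_def ring.truncate_def module.fields_def)+
  have ex: "x = (\<Oplus>\<^bsub>X\<^esub>i\<in>{..<m}. ract X (b i) (l i x))" if "x \<in> carrier X" for x
    using b that by (simp add: basis_family_def finsum_X)
  have ey: "y = (\<Oplus>\<^bsub>Y\<^esub>j\<in>{..<n}. ract Y (c j) (k j y))" if "y \<in> carrier Y" for y
    using c that by (simp add: basis_family_def finsum_Y)
  have "\<exists>F. \<forall>i\<in>{..<m}. additive T Y (F i) \<and>
      (\<forall>x\<in>carrier X. \<forall>y\<in>carrier Y. F i (pt x y) = lact Y (l i x) y) \<and>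
      (\<forall>t\<in>carrier T. \<forall>a\<in>carrier M. F i (ract T t a) = ract Y (F i t) a)"
  proof (rule bchoice, rule ballI)
    fix i assume "i \<in> {..<m}"
    then have i: "i < m" by simp
    show "\<exists>F. additive T Y F \<and> (\<forall>x\<in>carrier X. \<forall>y\<in>carrier Y. F (pt x y) = lact Y (l i x) y) \<and>
        (\<forall>t\<in>carrier T. \<forall>a\<in>carrier M. F (ract T t a) = ract Y (F t) a)"
      by (rule contract_left[OF la[OF i] ls[OF i]]) blast+
  qed
  then obtain F where F0: "\<forall>i\<in>{..<m}. additive T Y (F i) \<and>
      (\<forall>x\<in>carrier X. \<forall>y\<in>carrier Y. F i (pt x y) = lact Y (l i x) y) \<and>
      (\<forall>t\<in>carrier T. \<forall>a\<in>carrier M. F i (ract T t a) = ract Y (F i t) a)" ..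
  have Fa: "\<And>i. i < m \<Longrightarrow> additive T Y (F i)"
    and Fp: "\<And>i x y. i < m \<Longrightarrow> x \<in> carrier X \<Longrightarrow> y \<in> carrier Y \<Longrightarrow> F i (pt x y) = lact Y (l i x) y"
    and Fr: "\<And>i t a. i < m \<Longrightarrow> t \<in> carrier T \<Longrightarrow> a \<in> carrier M \<Longrightarrow> F i (ract T t a) = ract Y (F i t) a"
    using F0 by blast+
  have Fc [simp]: "F i t \<in> carrier Y" if "i < m" "t \<in> carrier T" for i t using additive_closed[OF Fa] that .
  interpret B: bimodule L M T by (rule bimodule_tensor)
  note [simp del] = tensor_group
  have e1: "t = (\<Oplus>\<^bsub>T\<^esub>i\<in>{..<m}. pt (b i) (F i t))" if "t \<in> carrier T" for t
  proof (rule tensor_hom_eq[OF abelian_group_tensor additive_ident additive_sum _ that])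
    fix x y assume xy: "x \<in> carrier X" "y \<in> carrier Y"
    have "pt x y = pt (\<Oplus>\<^bsub>X\<^esub>i\<in>{..<m}. ract X (b i) (l i x)) y" using ex[OF xy(1)] by simp
    also have "\<dots> = (\<Oplus>\<^bsub>T\<^esub>i\<in>{..<m}. pt (ract X (b i) (l i x)) y)"
      by (rule additive_finsum[OF pt_additive_left X.abelian_group_W abelian_group_tensor]) (use xy in auto)
    also have "\<dots> = (\<Oplus>\<^bsub>T\<^esub>i\<in>{..<m}. pt (b i) (F i (pt x y)))"
      using xy by (intro T.finsum_cong') (auto simp: Fp pt_middle pt_closed)
    finally show "pt x y = (\<Oplus>\<^bsub>T\<^esub>i\<in>{..<m}. pt (b i) (F i (pt x y)))" .
  qed (auto intro!: abelian_group_tensor additive_compose[OF Fa pt_additive_right])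
  have e2: "(\<Oplus>\<^bsub>T\<^esub>i\<in>{..<m}. pt (b i) (F i t)) =
      (\<Oplus>\<^bsub>T\<^esub>i\<in>{..<m}. \<Oplus>\<^bsub>T\<^esub>j\<in>{..<n}. ract T (pt (b i) (c j)) (k j (F i t)))" if t: "t \<in> carrier T" for t
  proof (rule T.finsum_cong'[OF refl])
    fix i assume "i \<in> {..<m}"
    then have i: "i < m" by simp
    have "pt (b i) (F i t) = pt (b i) (\<Oplus>\<^bsub>Y\<^esub>j\<in>{..<n}. ract Y (c j) (k j (F i t)))"
      using ey[of "F i t"] i t by simp
    also have "\<dots> = (\<Oplus>\<^bsub>T\<^esub>j\<in>{..<n}. pt (b i) (ract Y (c j) (k j (F i t))))"
      by (rule additive_finsum[OF pt_additive_right Y.abelian_group_W abelian_group_tensor]) (use i t in auto)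
    also have "\<dots> = (\<Oplus>\<^bsub>T\<^esub>j\<in>{..<n}. ract T (pt (b i) (c j)) (k j (F i t)))"
      using i t by (intro T.finsum_cong') (auto simp: tensor_ract(2) pt_closed)
    finally show "pt (b i) (F i t) = (\<Oplus>\<^bsub>T\<^esub>j\<in>{..<n}. ract T (pt (b i) (c j)) (k j (F i t)))" .
  qed (use t in \<open>auto intro!: T.finsum_closed B.ract_closed pt_closed\<close>)
  have e3: "(\<Oplus>\<^bsub>T\<^esub>i\<in>{..<m}. \<Oplus>\<^bsub>T\<^esub>j\<in>{..<n}. ract T (pt (b i) (c j)) (k j (F i t))) =
      (\<Oplus>\<^bsub>T\<^esub>p\<in>{..<m} \<times> {..<n}. ract T (pt (b (fst p)) (c (snd p))) (k (snd p) (F (fst p) t)))"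
    if t: "t \<in> carrier T" for t
    by (subst T.finsum_product) (use t in \<open>auto intro!: B.ract_closed pt_closed\<close>)
  have exT: "t = (\<Oplus>\<^bsub>T\<^esub>p\<in>{..<m} \<times> {..<n}. ract T (pt (b (fst p)) (c (snd p))) (k (snd p) (F (fst p) t)))"
    if "t \<in> carrier T" for t
    by (rule trans[OF e1[OF that] trans[OF e2[OF that] e3[OF that]]])
  have "basis_family M (right_module T) ({..<m} \<times> {..<n}) (\<lambda>p. pt (b (fst p)) (c (snd p)))
      (\<lambda>p t. k (snd p) (F (fst p) t))"
    unfolding basis_family_def
  proof (intro conjI ballI; clarsimp simp: pt_closed finsum_T Fr ks)
    fix i j assume "i < m" "j < n"
    then show "additive T M (\<lambda>t. k j (F i t))" by (intro additive_compose[OF Fa ka])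
  next
    fix i j i' j' assume ij: "i < m" "j < n" "i' < m" "j' < n"
    have "k j \<zero>\<^bsub>Y\<^esub> = \<zero>\<^bsub>M\<^esub>"
      using additive_zero[OF ka Y.abelian_group_W M.abelian_group_axioms] ij by simp
    then show "(i = i' \<and> j = j' \<longrightarrow> k j' (F i' (pt (b i') (c j'))) = \<one>\<^bsub>M\<^esub>) \<and>
        ((i = i' \<longrightarrow> j \<noteq> j') \<longrightarrow> k j (F i (pt (b i') (c j'))) = \<zero>\<^bsub>M\<^esub>)"
      using ij by (auto simp: Fp ld kd)
  next
    fix t assume "t \<in> carrier T"
    then show "t = (\<Oplus>\<^bsub>T\<^esub>p\<in>{..<m} \<times> {..<n}. ract T (pt (b (fst p)) (c (snd p))) (k (snd p) (F (fst p) t)))"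
      by (rule exT)
  qed
  from has_dim_if_basis_family[OF assms(2) B.right this] show ?thesis by simp
qed

lemma tensor_product_op: "tensor_product M K L (op_bimod Y) (op_bimod X)"
  by (intro tensor_product.intro bimodule_op X.bimodule_axioms Y.bimodule_axioms)

text \<open>Exchanging the factors identifies the tensor product with that of the opposite bimodules
  in reverse order, where the left dimension becomes a right one.\<close>

lemma tensor_left_dim:
  assumes "field L" "field K" "has_dim L (left_module X) m" "has_dim K (left_module Y) n"
  shows "has_dim L (left_module T) (m * n)"
proof -
  interpret O: tensor_product M K L "op_bimod Y" "op_bimod X" by (rule tensor_product_op)
  note [simp del] = tensor_group O.tensor_group
  note [simp] = pt_closed O.pt_closed[simplified] tensor_lact(2) O.tensor_ract(2)[simplified]
  obtain F where F: "additive T O.T F" "\<And>x y. x \<in> carrier X \<Longrightarrow> y \<in> carrier Y \<Longrightarrow> F (pt x y) = O.pt y x"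
    by (rule tensor_universal[OF O.abelian_group_tensor, of "\<lambda>x y. O.pt y x"])
      (auto intro!: additiveI simp: O.pt_add_left[simplified] O.pt_add_right[simplified] O.pt_middle[simplified])
  obtain G where G: "additive O.T T G" "\<And>x y. x \<in> carrier X \<Longrightarrow> y \<in> carrier Y \<Longrightarrow> G (O.pt y x) = pt x y"
    by (rule O.tensor_universal[OF abelian_group_tensor, of "\<lambda>y x. pt x y"])
      (auto intro!: additiveI simp: pt_add_left pt_add_right pt_middle)
  have GF: "G (F t) = t" if "t \<in> carrier T" for t
    by (rule tensor_hom_eq[OF abelian_group_tensor additive_compose[OF F(1) G(1)] additive_ident _ that]) (simp add: F G)
  have FG: "F (G t) = t" if "t \<in> carrier O.T" for t
    by (rule O.tensor_hom_eq[OF O.abelian_group_tensor additive_compose[OF G(1) F(1)] O.additive_ident _ that])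
      (simp add: F G)
  have bij: "bij_betw G (carrier O.T) (carrier T)"
    by (rule bij_betw_byWitness[of _ F]) (use GF FG additive_closed[OF F(1)] additive_closed[OF G(1)] in auto)
  have act: "G (ract O.T t a) = lact T a (G t)" if t: "t \<in> carrier O.T" and a: "a \<in> carrier L" for t a
    by (rule O.tensor_hom_eq[OF abelian_group_tensor additive_compose[OF O.tensor_ract(1)[OF a] G(1)]
          additive_compose[OF G(1) tensor_lact(1)[OF a]] _ t]) (use a in \<open>simp add: G\<close>)
  have "has_dim L (right_module O.T) (n * m)"
    by (rule O.tensor_right_dim) (use assms in \<open>simp_all add: right_module_op\<close>)
  then have "has_dim L (left_module T) (n * m)"
    by (rule has_dim_transfer[OF _ assms(1) bimodule.left[OF bimodule_tensor], of _ _ G])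
      (use bij act G(1) in auto)
  then show ?thesis by (simp add: mult.commute)
qed

end

section \<open>The tensor algebra\<close>

text \<open>The condition on the letters in \<open>tens_words\<close>, separated from the length
  condition so that it splits along \<open>#\<close> and \<open>@\<close>.\<close>

definition letters :: "(int \<Rightarrow> ('k, 'v) bimod) \<Rightarrow> int \<Rightarrow> 'v list \<Rightarrow> bool"
  where "letters E i vs \<longleftrightarrow> (\<forall>k<length vs. vs ! k \<in> carrier (E (i + int k)))"

lemma letters_Nil [simp]: "letters E i []"
  by (simp add: letters_def)

lemma letters_Cons [simp]: "letters E i (v # vs) \<longleftrightarrow> v \<in> carrier (E i) \<and> letters E (i + 1) vs"
  unfolding letters_def by (auto simp: All_less_Suc2 ac_simps)

lemma letters_append [simp]: "letters E i (us @ vs) \<longleftrightarrow> letters E i us \<and> letters E (i + int (length us)) vs"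
  by (induction us arbitrary: i) (auto simp: add.assoc)

lemma mem_tens_words:
  "(a, vs) \<in> tens_words K E i j \<longleftrightarrow> a \<in> carrier (K i) \<and> letters E i vs \<and> j = i + int (length vs)"
  unfolding tens_words_def letters_def by auto

lemma list_split_two:
  assumes "Suc k < length vs"
  obtains us v w ws where "vs = us @ v # w # ws" "length us = k"
proof (rule that)
  show "vs = take k vs @ vs ! k # vs ! Suc k # drop (Suc (Suc k)) vs"
    using assms by (simp add: Cons_nth_drop_Suc)
qed (use assms in simp)

text \<open>The relations address letters by position. Cutting the word at that position instead
  makes them compatible with products, which glue words at their ends.\<close>

lemma word_rels_iff:
  "r \<in> word_rels K E i j \<longleftrightarrow>
    (\<exists>a b vs. r = frag_of (a \<oplus>\<^bsub>K i\<^esub> b, vs) - frag_of (a, vs) - frag_of (b, vs) \<and>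
      (a, vs) \<in> tens_words K E i j \<and> b \<in> carrier (K i)) \<or>
    (\<exists>a us v w ws k. r = frag_of (a, us @ (v \<oplus>\<^bsub>E k\<^esub> w) # ws) - frag_of (a, us @ v # ws) - frag_of (a, us @ w # ws) \<and>
      k = i + int (length us) \<and> (a, us @ v # ws) \<in> tens_words K E i j \<and> w \<in> carrier (E k)) \<or>
    (\<exists>a c v vs. r = frag_of (a \<otimes>\<^bsub>K i\<^esub> c, v # vs) - frag_of (a, lact (E i) c v # vs) \<and>
      (a, v # vs) \<in> tens_words K E i j \<and> c \<in> carrier (K i)) \<or>
    (\<exists>a us v w ws c k. r = frag_of (a, us @ ract (E k) v c # w # ws) - frag_of (a, us @ v # lact (E (k + 1)) c w # ws) \<and>
      k = i + int (length us) \<and> (a, us @ v # w # ws) \<in> tens_words K E i j \<and> c \<in> carrier (K (k + 1)))"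
  (is "_ \<longleftrightarrow> ?A r \<or> ?B r \<or> ?C r \<or> ?D r")
proof -
  let ?B' = "{frag_of (a, vs[k := v \<oplus>\<^bsub>E (i + int k)\<^esub> w]) - frag_of (a, vs[k := v]) - frag_of (a, vs[k := w])
       | a vs k v w. (a, vs) \<in> tens_words K E i j \<and> k < length vs \<and>
         v \<in> carrier (E (i + int k)) \<and> w \<in> carrier (E (i + int k))}"
  let ?D' = "{frag_of (a, vs[k := ract (E (i + int k)) (vs ! k) c]) -
     frag_of (a, vs[Suc k := lact (E (i + int k + 1)) c (vs ! Suc k)]) | a vs k c.
       (a, vs) \<in> tens_words K E i j \<and> Suc k < length vs \<and> c \<in> carrier (K (i + int k + 1))}"
  have B: "r \<in> ?B' \<longleftrightarrow> ?B r"
  proof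
    assume "r \<in> ?B'"
    then obtain a vs k v w where *: "r = frag_of (a, vs[k := v \<oplus>\<^bsub>E (i + int k)\<^esub> w]) - frag_of (a, vs[k := v]) - frag_of (a, vs[k := w])"
      "(a, vs) \<in> tens_words K E i j" "k < length vs" "v \<in> carrier (E (i + int k))" "w \<in> carrier (E (i + int k))" by blast
    have up: "vs[k := x] = take k vs @ x # drop (Suc k) vs" for x using * by (simp add: upd_conv_take_nth_drop)
    have "letters E i (take k vs @ vs ! k # drop (Suc k) vs)" "i + int (length vs) = j"
      using *(2) by (simp_all add: mem_tens_words id_take_nth_drop[OF *(3), symmetric])
    then have "(a, take k vs @ v # drop (Suc k) vs) \<in> tens_words K E i j"
      using * by (auto simp: mem_tens_words)
    then show "?B r"
      using * up by (intro exI[of _ a] exI[of _ "take k vs"] exI[of _ v] exI[of _ w] exI[of _ "drop (Suc k) vs"]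
        exI[of _ "i + int k"]) simp
  next
    assume "?B r"
    then obtain a us v w ws k where *: "r = frag_of (a, us @ (v \<oplus>\<^bsub>E k\<^esub> w) # ws) - frag_of (a, us @ v # ws) - frag_of (a, us @ w # ws)"
      "k = i + int (length us)" "(a, us @ v # ws) \<in> tens_words K E i j" "w \<in> carrier (E k)" by blast
    then show "r \<in> ?B'"
      by (intro CollectI exI[of _ a] exI[of _ "us @ v # ws"] exI[of _ "length us"] exI[of _ v] exI[of _ w])
        (simp add: mem_tens_words)
  qed
  have D: "r \<in> ?D' \<longleftrightarrow> ?D r"
  proof
    assume "r \<in> ?D'"
    then obtain a vs k c where *: "r = frag_of (a, vs[k := ract (E (i + int k)) (vs ! k) c]) -
       frag_of (a, vs[Suc k := lact (E (i + int k + 1)) c (vs ! Suc k)])"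
      "(a, vs) \<in> tens_words K E i j" "Suc k < length vs" "c \<in> carrier (K (i + int k + 1))" by blast
    obtain us v w ws where vs: "vs = us @ v # w # ws" "length us = k" using *(3) by (rule list_split_two)
    show "?D r"
      using * vs by (intro exI[of _ a] exI[of _ us] exI[of _ v] exI[of _ w] exI[of _ ws] exI[of _ c]
        exI[of _ "i + int k"]) (simp add: nth_append list_update_append)
  next
    assume "?D r"
    then obtain a us v w ws c k where *: "r = frag_of (a, us @ ract (E k) v c # w # ws) - frag_of (a, us @ v # lact (E (k + 1)) c w # ws)"
      "k = i + int (length us)" "(a, us @ v # w # ws) \<in> tens_words K E i j" "c \<in> carrier (K (k + 1))" by blast
    then show "r \<in> ?D'"
      by (intro CollectI exI[of _ a] exI[of _ "us @ v # w # ws"] exI[of _ "length us"] exI[of _ c])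
        (simp add: nth_append list_update_append)
  qed
  have "r \<in> word_rels K E i j \<longleftrightarrow> ?A r \<or> r \<in> ?B' \<or> ?C r \<or> r \<in> ?D'"
    unfolding word_rels_def Un_iff mem_Collect_eq by blast
  then show ?thesis unfolding B D .
qed

locale bimodule_chain =
  fixes K :: "int \<Rightarrow> 'k ring" and E :: "int \<Rightarrow> ('k, 'v) bimod"
  assumes bimod: "bimodule (K i) (K (i + 1)) (E i)"
begin

sublocale E: bimodule "K i" "K (i + 1)" "E i" for i by (rule bimod)
sublocale K: cring "K i" for i by (rule E.cring_left)

abbreviation "words \<equiv> tens_words K E"
abbreviation "T \<equiv> tensor_zalg K E"
abbreviation "Tc i j \<equiv> zcomp (tensor_zalg K E) i j"
abbreviation "mul \<equiv> zmul (tensor_zalg K E)"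
abbreviation "wgen i j p \<equiv> pclass (tens_words K E i j) (word_rels K E i j) (frag_of p)"

lemma word_presentation: "presentation (words i j) (word_rels K E i j)"
proof
  show "word_rels K E i j \<subseteq> carrier (free_group (words i j))"
  proof
    fix r assume "r \<in> word_rels K E i j"
    then show "r \<in> carrier (free_group (words i j))"
      unfolding word_rels_iff
      by (elim disjE exE conjE) (auto intro!: free_group_diff_closed simp: mem_tens_words add.assoc)
  qed
qed

sublocale P: presentation "words i j" "word_rels K E i j" for i j by (rule word_presentation)

lemma zcomp_T: "Tc i j = P.P i j"
  by (simp add: tensor_zalg_def)

lemma abelian_group_Tc: "abelian_group (Tc i j)"
  unfolding zcomp_T by (rule P.abelian_group_P)

sublocale Tc: abelian_group "Tc i j" for i j by (rule abelian_group_Tc)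

lemma wgen_closed: "p \<in> words i j \<Longrightarrow> wgen i j p \<in> carrier (Tc i j)"
  by (simp add: zcomp_T P.gen_closed)

lemma T_hom_eq:
  assumes "abelian_group B" "additive (Tc i j) B F" "additive (Tc i j) B F'"
    "\<And>p. p \<in> words i j \<Longrightarrow> F (wgen i j p) = F' (wgen i j p)" "X \<in> carrier (Tc i j)"
  shows "F X = F' X"
  using P.hom_eq[OF assms(1), of i j F F' X] assms(2-5) by (simp add: zcomp_T)

lemma wgen_add_scalar:
  assumes "(a, vs) \<in> words i j" "b \<in> carrier (K i)"
  shows "wgen i j (a \<oplus>\<^bsub>K i\<^esub> b, vs) = wgen i j (a, vs) \<oplus>\<^bsub>Tc i j\<^esub> wgen i j (b, vs)"
  unfolding zcomp_T
proof (rule P.gen_eq_add)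
  show "frag_of (a \<oplus>\<^bsub>K i\<^esub> b, vs) - frag_of (a, vs) - frag_of (b, vs) \<in> word_rels K E i j"
    unfolding word_rels_iff using assms by blast
qed (use assms in \<open>auto simp: mem_tens_words\<close>)

lemma wgen_add_letter:
  assumes "k = i + int (length us)" "(a, us @ v # ws) \<in> words i j" "w \<in> carrier (E k)"
  shows "wgen i j (a, us @ (v \<oplus>\<^bsub>E k\<^esub> w) # ws) = wgen i j (a, us @ v # ws) \<oplus>\<^bsub>Tc i j\<^esub> wgen i j (a, us @ w # ws)"
  unfolding zcomp_T
proof (rule P.gen_eq_add)
  show "frag_of (a, us @ (v \<oplus>\<^bsub>E k\<^esub> w) # ws) - frag_of (a, us @ v # ws) - frag_of (a, us @ w # ws) \<in> word_rels K E i j"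
    unfolding word_rels_iff using assms by blast
qed (use assms in \<open>auto simp: mem_tens_words\<close>)

lemma wgen_scalar_letter:
  assumes "(a, v # vs) \<in> words i j" "c \<in> carrier (K i)"
  shows "wgen i j (a \<otimes>\<^bsub>K i\<^esub> c, v # vs) = wgen i j (a, lact (E i) c v # vs)"
proof (rule P.gen_eq)
  show "frag_of (a \<otimes>\<^bsub>K i\<^esub> c, v # vs) - frag_of (a, lact (E i) c v # vs) \<in> word_rels K E i j"
    unfolding word_rels_iff using assms by blast
qed (use assms in \<open>auto simp: mem_tens_words\<close>)

lemma wgen_middle:
  assumes "k = i + int (length us)" "(a, us @ v # w # ws) \<in> words i j" "c \<in> carrier (K (k + 1))"
  shows "wgen i j (a, us @ ract (E k) v c # w # ws) = wgen i j (a, us @ v # lact (E (k + 1)) c w # ws)"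
proof (rule P.gen_eq)
  show "frag_of (a, us @ ract (E k) v c # w # ws) - frag_of (a, us @ v # lact (E (k + 1)) c w # ws) \<in> word_rels K E i j"
    unfolding word_rels_iff using assms by blast
qed (use assms in \<open>auto simp: mem_tens_words\<close>)

lemma words_preserves_relsI:
  assumes B: "abelian_group B" and h: "\<And>p. p \<in> words i j \<Longrightarrow> h p \<in> carrier B"
    and 1: "\<And>a b vs. (a, vs) \<in> words i j \<Longrightarrow> b \<in> carrier (K i) \<Longrightarrow>
      h (a \<oplus>\<^bsub>K i\<^esub> b, vs) = h (a, vs) \<oplus>\<^bsub>B\<^esub> h (b, vs)"
    and 2: "\<And>a us v w ws k. k = i + int (length us) \<Longrightarrow> (a, us @ v # ws) \<in> words i j \<Longrightarrow> w \<in> carrier (E k) \<Longrightarrow>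
      h (a, us @ (v \<oplus>\<^bsub>E k\<^esub> w) # ws) = h (a, us @ v # ws) \<oplus>\<^bsub>B\<^esub> h (a, us @ w # ws)"
    and 3: "\<And>a c v vs. (a, v # vs) \<in> words i j \<Longrightarrow> c \<in> carrier (K i) \<Longrightarrow>
      h (a \<otimes>\<^bsub>K i\<^esub> c, v # vs) = h (a, lact (E i) c v # vs)"
    and 4: "\<And>a us v w ws c k. k = i + int (length us) \<Longrightarrow> (a, us @ v # w # ws) \<in> words i j \<Longrightarrow>
      c \<in> carrier (K (k + 1)) \<Longrightarrow>
      h (a, us @ ract (E k) v c # w # ws) = h (a, us @ v # lact (E (k + 1)) c w # ws)"
  shows "preserves_rels (words i j) (word_rels K E i j) B h"
proof (rule preserves_relsI[OF B])
  show "h \<in> words i j \<rightarrow> carrier B" using h by auto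
  fix r assume "r \<in> word_rels K E i j"
  then show "(\<exists>a\<in>words i j. \<exists>b\<in>words i j. \<exists>c\<in>words i j. r = frag_of a - frag_of b - frag_of c \<and> h a = h b \<oplus>\<^bsub>B\<^esub> h c) \<or>
      (\<exists>a\<in>words i j. \<exists>b\<in>words i j. r = frag_of a - frag_of b \<and> h a = h b)"
    unfolding word_rels_iff
  proof (elim disjE exE conjE)
    fix a b vs assume *: "r = frag_of (a \<oplus>\<^bsub>K i\<^esub> b, vs) - frag_of (a, vs) - frag_of (b, vs)"
      "(a, vs) \<in> words i j" "b \<in> carrier (K i)"
    show ?thesis
      by (rule disjI1, rule bexI[of _ "(a \<oplus>\<^bsub>K i\<^esub> b, vs)"], rule bexI[of _ "(a, vs)"], rule bexI[of _ "(b, vs)"])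
        (use * 1[OF *(2,3)] in \<open>auto simp: mem_tens_words\<close>)
  next
    fix a us v w ws k assume *: "r = frag_of (a, us @ (v \<oplus>\<^bsub>E k\<^esub> w) # ws) - frag_of (a, us @ v # ws) - frag_of (a, us @ w # ws)"
      "k = i + int (length us)" "(a, us @ v # ws) \<in> words i j" "w \<in> carrier (E k)"
    show ?thesis
      by (rule disjI1, rule bexI[of _ "(a, us @ (v \<oplus>\<^bsub>E k\<^esub> w) # ws)"], rule bexI[of _ "(a, us @ v # ws)"],
          rule bexI[of _ "(a, us @ w # ws)"])
        (use * 2[OF *(2-4)] in \<open>auto simp: mem_tens_words\<close>)
  next
    fix a c v vs assume *: "r = frag_of (a \<otimes>\<^bsub>K i\<^esub> c, v # vs) - frag_of (a, lact (E i) c v # vs)"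
      "(a, v # vs) \<in> words i j" "c \<in> carrier (K i)"
    show ?thesis
      by (rule disjI2, rule bexI[of _ "(a \<otimes>\<^bsub>K i\<^esub> c, v # vs)"], rule bexI[of _ "(a, lact (E i) c v # vs)"])
        (use * 3[OF *(2-3)] in \<open>auto simp: mem_tens_words\<close>)
  next
    fix a us v w ws c k assume *: "r = frag_of (a, us @ ract (E k) v c # w # ws) - frag_of (a, us @ v # lact (E (k + 1)) c w # ws)"
      "k = i + int (length us)" "(a, us @ v # w # ws) \<in> words i j" "c \<in> carrier (K (k + 1))"
    show ?thesis
      by (rule disjI2, rule bexI[of _ "(a, us @ ract (E k) v c # w # ws)"],
          rule bexI[of _ "(a, us @ v # lact (E (k + 1)) c w # ws)"])
        (use * 4[OF *(2-4)] in \<open>auto simp: mem_tens_words\<close>)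
  qed
qed

lemma word_mul_Nil: "word_mul K E j (a, []) (b, ws) = (a \<otimes>\<^bsub>K j\<^esub> b, ws)"
  and word_mul_snoc: "word_mul K E j (a, vs @ [v]) (b, ws) = (a, vs @ ract (E (j - 1)) v b # ws)"
  by (simp_all add: word_mul_def)

text \<open>Matches the shape of \<open>word_mul\<close>, which treats the empty word separately and
  otherwise changes the last letter of its first factor.\<close>

lemma word_cases:
  assumes "p \<in> words i j"
  obtains a where "i = j" "p = (a, [])" "a \<in> carrier (K i)"
  | a vs v where "j = i + int (length vs) + 1" "p = (a, vs @ [v])" "a \<in> carrier (K i)" "letters E i vs"
      "v \<in> carrier (E (i + int (length vs)))"
proof -
  obtain a ws where p: "p = (a, ws)" by (cases p)
  show thesis
    using assms that(1)[of a] that(2)[of "butlast ws" a "last ws"] unfolding p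
    by (cases ws rule: rev_cases) (auto simp: mem_tens_words)
qed

lemma word_mul_closed:
  assumes "p \<in> words i j" "q \<in> words j l"
  shows "word_mul K E j p q \<in> words i l"
proof -
  obtain b ws where q: "q = (b, ws)" by (cases q)
  from assms(1) show ?thesis
    by (cases rule: word_cases) (use assms(2) in \<open>auto simp: q word_mul_Nil word_mul_snoc mem_tens_words add.assoc\<close>)
qed

text \<open>Multiplication by \<open>q\<close> acts on the last letter by the scalar of
  \<open>q\<close>. A relation away from that letter survives unchanged; one that touches it
  survives because right multiplication by a scalar is additive and commutes with the left
  action.\<close>

lemma word_mul_preserves_left:
  assumes q: "q \<in> words j l"
  shows "preserves_rels (words i j) (word_rels K E i j) (Tc i l) (\<lambda>p. wgen i l (word_mul K E j p q))"
proof (rule words_preserves_relsI[OF abelian_group_Tc])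
  obtain b ws where qd: "q = (b, ws)" by (cases q)
  have q': "b \<in> carrier (K j)" "letters E j ws" "l = j + int (length ws)" using q by (auto simp: qd mem_tens_words)
  note [simp] = word_mul_Nil word_mul_snoc[where vs = "_ # _", simplified] word_mul_snoc[where vs = "[]", simplified] word_mul_snoc
    word_mul_snoc[where vs = "_ @ _ # _", simplified] word_mul_snoc[where vs = "_ @ _ # _ # _", simplified]
  show "wgen i l (word_mul K E j p q) \<in> carrier (Tc i l)" if "p \<in> words i j" for p
    by (rule wgen_closed[OF word_mul_closed[OF that q]])
  show "wgen i l (word_mul K E j (a \<oplus>\<^bsub>K i\<^esub> c, vs) q) =
      wgen i l (word_mul K E j (a, vs) q) \<oplus>\<^bsub>Tc i l\<^esub> wgen i l (word_mul K E j (c, vs) q)"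
    if "(a, vs) \<in> words i j" "c \<in> carrier (K i)" for a c vs
    using that(1) by (cases rule: word_cases)
      (use that(2) q' in \<open>auto simp: qd K.l_distr mem_tens_words intro!: wgen_add_scalar\<close>)
  show "wgen i l (word_mul K E j (a, us @ (v \<oplus>\<^bsub>E k\<^esub> w) # ts) q) =
      wgen i l (word_mul K E j (a, us @ v # ts) q) \<oplus>\<^bsub>Tc i l\<^esub> wgen i l (word_mul K E j (a, us @ w # ts) q)"
    if "k = i + int (length us)" "(a, us @ v # ts) \<in> words i j" "w \<in> carrier (E k)" for a us v w ts k
  proof (cases ts rule: rev_cases)
    case Nil
    then have "j = k + 1" using that by (simp add: mem_tens_words)
    then show ?thesis
      using that q' Nil wgen_add_letter[of k i us a "ract (E k) v b" ws l "ract (E k) w b"]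
      by (simp add: qd E.ract_add_left mem_tens_words)
  next
    case (snoc ts' t)
    then have "j = k + 2 + int (length ts')" using that by (simp add: mem_tens_words)
    then show ?thesis
      using that q' snoc wgen_add_letter[of k i us a v "ts' @ ract (E (j - 1)) t b # ws" l w]
        E.ract_closed[of b "j - 1" t]
      by (simp add: qd mem_tens_words algebra_simps)
  qed
  show "wgen i l (word_mul K E j (a \<otimes>\<^bsub>K i\<^esub> c, v # vs) q) = wgen i l (word_mul K E j (a, lact (E i) c v # vs) q)"
    if "(a, v # vs) \<in> words i j" "c \<in> carrier (K i)" for a c v vs
  proof (cases vs rule: rev_cases)
    case Nil
    then have "j = i + 1" using that by (simp add: mem_tens_words)
    then show ?thesis
      using that q' Nil wgen_scalar_letter[of a "ract (E i) v b" ws i l c]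
      by (simp add: qd E.lact_ract mem_tens_words)
  next
    case (snoc ts' t)
    then have "j = i + 2 + int (length ts')" using that by (simp add: mem_tens_words)
    then show ?thesis
      using that q' snoc wgen_scalar_letter[of a v "ts' @ ract (E (j - 1)) t b # ws" i l c]
        E.ract_closed[of b "j - 1" t]
      by (simp add: qd mem_tens_words algebra_simps)
  qed
  show "wgen i l (word_mul K E j (a, us @ ract (E k) v c # w # ts) q) =
      wgen i l (word_mul K E j (a, us @ v # lact (E (k + 1)) c w # ts) q)"
    if "k = i + int (length us)" "(a, us @ v # w # ts) \<in> words i j" "c \<in> carrier (K (k + 1))" for a us v w ts c k
  proof (cases ts rule: rev_cases)
    case Nil
    then have "j = k + 2" using that by (simp add: mem_tens_words)
    then show ?thesis
      using that q' Nil wgen_middle[of k i us a v "ract (E (k + 1)) w b" ws l c]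
        E.ract_closed[of b "k + 1" w] E.lact_ract[of c "k + 1" w b]
        word_mul_snoc[of j a "us @ [x]" y b ws for x y]
      by (simp add: qd mem_tens_words algebra_simps)
  next
    case (snoc ts' t)
    then have "j = k + 3 + int (length ts')" using that by (simp add: mem_tens_words)
    then show ?thesis
      using that q' snoc wgen_middle[of k i us a v w "ts' @ ract (E (j - 1)) t b # ws" l c]
        E.ract_closed[of b "j - 1" t]
      by (simp add: qd mem_tens_words algebra_simps)
  qed
qed

text \<open>The relation between the scalar of the second word and its first letter becomes
  balancing at the joint of the two words, or the scalar relation again if the first word is
  empty.\<close>

lemma word_mul_preserves_right:
  assumes p: "p \<in> words i j"
  shows "preserves_rels (words j l) (word_rels K E j l) (Tc i l) (\<lambda>q. wgen i l (word_mul K E j p q))"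
proof (rule words_preserves_relsI[OF abelian_group_Tc])
  show "wgen i l (word_mul K E j p q) \<in> carrier (Tc i l)" if "q \<in> words j l" for q
    by (rule wgen_closed[OF word_mul_closed[OF p that]])
  note [simp] = word_mul_Nil word_mul_snoc
  show "wgen i l (word_mul K E j p (b \<oplus>\<^bsub>K j\<^esub> c, ws)) =
      wgen i l (word_mul K E j p (b, ws)) \<oplus>\<^bsub>Tc i l\<^esub> wgen i l (word_mul K E j p (c, ws))"
    if "(b, ws) \<in> words j l" "c \<in> carrier (K j)" for b c ws
    using p
  proof (cases rule: word_cases)
    case (1 a)
    then show ?thesis using that wgen_add_scalar[of "a \<otimes>\<^bsub>K j\<^esub> b" ws i l "a \<otimes>\<^bsub>K j\<^esub> c"]
      by (simp add: K.r_distr mem_tens_words)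
  next
    case (2 a vs v)
    then show ?thesis
      using that wgen_add_letter[of "j - 1" i vs a "ract (E (j - 1)) v b" ws l "ract (E (j - 1)) v c"]
        E.ract_add_right[of b "j - 1" c v] E.ract_closed[of b "j - 1" v] E.ract_closed[of c "j - 1" v]
      by (simp add: mem_tens_words algebra_simps)
  qed
  show "wgen i l (word_mul K E j p (b, us @ (v \<oplus>\<^bsub>E k\<^esub> w) # ws)) =
      wgen i l (word_mul K E j p (b, us @ v # ws)) \<oplus>\<^bsub>Tc i l\<^esub> wgen i l (word_mul K E j p (b, us @ w # ws))"
    if "k = j + int (length us)" "(b, us @ v # ws) \<in> words j l" "w \<in> carrier (E k)" for b us v w ws k
    using p
  proof (cases rule: word_cases)
    case (1 a)
    then show ?thesis using that wgen_add_letter[of k i us "a \<otimes>\<^bsub>K j\<^esub> b" v ws l w]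
      by (simp add: mem_tens_words)
  next
    case (2 a vs v')
    then show ?thesis
      using that wgen_add_letter[of k i "vs @ ract (E (j - 1)) v' b # us" a v ws l w] E.ract_closed[of b "j - 1" v']
      by (simp add: mem_tens_words algebra_simps)
  qed
  show "wgen i l (word_mul K E j p (b \<otimes>\<^bsub>K j\<^esub> c, w # ws)) = wgen i l (word_mul K E j p (b, lact (E j) c w # ws))"
    if "(b, w # ws) \<in> words j l" "c \<in> carrier (K j)" for b c w ws
    using p
  proof (cases rule: word_cases)
    case (1 a)
    then show ?thesis using that wgen_scalar_letter[of "a \<otimes>\<^bsub>K j\<^esub> b" w ws i l c]
      by (simp add: mem_tens_words K.m_assoc)
  next
    case (2 a vs v)
    then show ?thesis
      using that wgen_middle[of "j - 1" i vs a "ract (E (j - 1)) v b" w ws l c]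
        E.ract_mult[of b "j - 1" c v] E.ract_closed[of b "j - 1" v]
      by (simp add: mem_tens_words algebra_simps)
  qed
  show "wgen i l (word_mul K E j p (b, us @ ract (E k) v c # w # ws)) =
      wgen i l (word_mul K E j p (b, us @ v # lact (E (k + 1)) c w # ws))"
    if "k = j + int (length us)" "(b, us @ v # w # ws) \<in> words j l" "c \<in> carrier (K (k + 1))" for b us v w ws c k
    using p
  proof (cases rule: word_cases)
    case (1 a)
    then show ?thesis using that wgen_middle[of k i us "a \<otimes>\<^bsub>K j\<^esub> b" v w ws l c]
      by (simp add: mem_tens_words)
  next
    case (2 a vs v')
    then show ?thesis
      using that wgen_middle[of k i "vs @ ract (E (j - 1)) v' b # us" a v w ws l c] E.ract_closed[of b "j - 1" v']
      by (simp add: mem_tens_words algebra_simps)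
  qed
qed

text \<open>The product is a double union over representatives; it is identified with the biadditive
  map that extends \<open>word_mul\<close>.\<close>

lemma mul_bilinear:
  shows "Y \<in> carrier (Tc j l) \<Longrightarrow> additive (Tc i j) (Tc i l) (\<lambda>X. mul i j l X Y)"
    and "X \<in> carrier (Tc i j) \<Longrightarrow> additive (Tc j l) (Tc i l) (mul i j l X)"
    and "p \<in> words i j \<Longrightarrow> q \<in> words j l \<Longrightarrow>
      mul i j l (wgen i j p) (wgen j l q) = wgen i l (word_mul K E j p q)"
proof -
  obtain F where F: "\<And>Y. Y \<in> carrier (P.P j l) \<Longrightarrow> additive (P.P i j) (Tc i l) (\<lambda>X. F X Y)"
    "\<And>X. X \<in> carrier (P.P i j) \<Longrightarrow> additive (P.P j l) (Tc i l) (F X)"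
    "\<And>p q. p \<in> words i j \<Longrightarrow> q \<in> words j l \<Longrightarrow> F (wgen i j p) (wgen j l q) = wgen i l (word_mul K E j p q)"
    by (rule presented_bilinear[OF word_presentation word_presentation abelian_group_Tc
          word_mul_preserves_left word_mul_preserves_right]) blast+
  have eq: "mul i j l X Y = F X Y" if X: "X \<in> carrier (Tc i j)" and Y: "Y \<in> carrier (Tc j l)" for X Y
  proof -
    \<comment> \<open>Each \<open>frag_extend\<close> is evaluated by uniqueness of additive maps on
      a free group: first in \<open>y\<close> against a single word, then in
      \<open>x\<close>.\<close>
    have L: "P.cls i l (frag_extend (\<lambda>p. frag_extend (\<lambda>q. frag_of (word_mul K E j p q)) y) x) = F X Y"
      if x: "x \<in> X" and y: "y \<in> Y" for x y
    proof -
      have x': "x \<in> carrier (free_group (words i j))" "P.cls i j x = X" using P.mem_cls X x by (auto simp: zcomp_T)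
      have y': "y \<in> carrier (free_group (words j l))" "P.cls j l y = Y" using P.mem_cls Y y by (auto simp: zcomp_T)
      have in_y: "P.cls i l (frag_extend (\<lambda>q. frag_of (word_mul K E j p q)) y) = F (wgen i j p) Y"
        if p: "p \<in> words i j" for p
      proof -
        have "P.cls i l (frag_extend (\<lambda>q. frag_of (word_mul K E j p q)) y) = F (wgen i j p) (P.cls j l y)"
          by (rule free_group_hom_eq[OF P.abelian_group_P frag_extend_additive[OF word_presentation]
                additive_compose[OF P.cls_additive F(2)[unfolded zcomp_T]]])
            (use p y' F(3) in \<open>auto simp: P.gen_closed word_mul_closed\<close>)
        then show ?thesis using y' by simp
      qed
      have "P.cls i l (frag_extend (\<lambda>p. frag_extend (\<lambda>q. frag_of (word_mul K E j p q)) y) x) = F (P.cls i j x) Y"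
      proof (rule free_group_hom_eq[OF P.abelian_group_P frag_extend_additive[OF word_presentation]
                additive_compose[OF P.cls_additive F(1)[unfolded zcomp_T]]])
        show "(\<lambda>p. frag_extend (\<lambda>q. frag_of (word_mul K E j p q)) y) \<in> words i j \<rightarrow> carrier (free_group (words i l))"
        proof (rule funcsetI)
          fix p assume p: "p \<in> words i j"
          then show "frag_extend (\<lambda>q. frag_of (word_mul K E j p q)) y \<in> carrier (free_group (words i l))"
            using keys_frag_extend[of "\<lambda>q. frag_of (word_mul K E j p q)" y] y'(1) word_mul_closed[OF p]
            by (fastforce simp: carrier_free_group_iff)
        qed
      qed (use x' Y in_y in \<open>auto simp: zcomp_T\<close>)
      then show ?thesis using x' by simp
    qed
    have "X \<noteq> {}" "Y \<noteq> {}" using X Y P.cls_mem by (auto simp: zcomp_T elim!: P.cls_cases)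
    then show ?thesis using L by (auto simp: tensor_zalg_def tens_class_def)
  qed
  show "additive (Tc i j) (Tc i l) (\<lambda>X. mul i j l X Y)" if "Y \<in> carrier (Tc j l)"
    using F(1)[of Y] that eq additive_closed[OF F(1)[of Y]] additive_add[OF F(1)[of Y]]
    unfolding zcomp_T by (auto intro!: additiveI)
  show "additive (Tc j l) (Tc i l) (mul i j l X)" if "X \<in> carrier (Tc i j)"
    using F(2)[of X] that eq additive_closed[OF F(2)[of X]] additive_add[OF F(2)[of X]]
    unfolding zcomp_T by (auto intro!: additiveI)
  show "mul i j l (wgen i j p) (wgen j l q) = wgen i l (word_mul K E j p q)" if "p \<in> words i j" "q \<in> words j l"
    using that eq F(3) wgen_closed by simp
qed

lemma word_mul_assoc:
  assumes "p \<in> words i j" "q \<in> words j l" "r \<in> words l m"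
  shows "word_mul K E l (word_mul K E j p q) r = word_mul K E j p (word_mul K E l q r)"
proof -
  obtain c ts where r: "r = (c, ts)" by (cases r)
  have c: "c \<in> carrier (K l)" using assms(3) by (simp add: r mem_tens_words)
  have snoc2: "word_mul K E l (a, us @ v # vs @ [w]) (c, ts) = (a, us @ v # vs @ ract (E (l - 1)) w c # ts)" for a us v vs w
    using word_mul_snoc[of l a "us @ v # vs" w c ts] by simp
  from assms(1) show ?thesis
  proof (cases rule: word_cases)
    case p: (1 a)
    from assms(2) show ?thesis
      by (cases rule: word_cases) (use p c in \<open>auto simp: r word_mul_Nil word_mul_snoc K.m_assoc\<close>)
  next
    case p: (2 a vs v)
    from assms(2) show ?thesis
    proof (cases rule: word_cases)
      case (1 b)
      moreover have "v \<in> carrier (E (j - 1))" using p by simp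
      ultimately show ?thesis using p(2) c E.ract_mult[of b "j - 1" c v]
        by (simp add: r word_mul_Nil word_mul_snoc)
    next
      case (2 b us u)
      then show ?thesis using p c snoc2 by (simp add: r word_mul_snoc)
    qed
  qed
qed

lemma zunit_T: "zunit T i = wgen i i (\<one>\<^bsub>K i\<^esub>, [])"
  by (simp add: tensor_zalg_def tens_class_def)

lemma one_word: "(\<one>\<^bsub>K i\<^esub>, []) \<in> words i i"
  by (simp add: mem_tens_words)

lemma word_mul_one:
  assumes "p \<in> words i j"
  shows "word_mul K E i (\<one>\<^bsub>K i\<^esub>, []) p = p" "word_mul K E j p (\<one>\<^bsub>K j\<^esub>, []) = p"
proof -
  show "word_mul K E i (\<one>\<^bsub>K i\<^esub>, []) p = p" using assms by (cases p) (simp add: word_mul_Nil mem_tens_words)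
  from assms show "word_mul K E j p (\<one>\<^bsub>K j\<^esub>, []) = p"
  proof (cases rule: word_cases)
    case (2 a vs v)
    then show ?thesis using E.ract_one[of v "j - 1"] by (simp add: word_mul_snoc)
  qed (simp add: word_mul_Nil)
qed

lemma additive_id_Tc: "additive (Tc i j) (Tc i j) (\<lambda>X. X)"
  by (rule additiveI) auto

lemma zalgebra_T: "zalgebra T"
proof (rule zalgebra.intro)
  show "abelian_group (Tc i j)" for i j by (rule abelian_group_Tc)
  fix i j l
  show "mul i j l X Y \<in> carrier (Tc i l)" if "X \<in> carrier (Tc i j)" "Y \<in> carrier (Tc j l)" for X Y
    using additive_closed[OF mul_bilinear(1)] that by blast
  show "mul i j l (X \<oplus>\<^bsub>Tc i j\<^esub> X') Y = mul i j l X Y \<oplus>\<^bsub>Tc i l\<^esub> mul i j l X' Y"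
    if "X \<in> carrier (Tc i j)" "X' \<in> carrier (Tc i j)" "Y \<in> carrier (Tc j l)" for X X' Y
    using additive_add[OF mul_bilinear(1)] that by blast
  show "mul i j l X (Y \<oplus>\<^bsub>Tc j l\<^esub> Y') = mul i j l X Y \<oplus>\<^bsub>Tc i l\<^esub> mul i j l X Y'"
    if "X \<in> carrier (Tc i j)" "Y \<in> carrier (Tc j l)" "Y' \<in> carrier (Tc j l)" for X Y Y'
    using additive_add[OF mul_bilinear(2)] that by blast
  \<comment> \<open>Both sides are additive in each of the three arguments, so it suffices to
    compare them on words, one argument after the other.\<close>
  show "mul i l m (mul i j l X Y) Z = mul i j m X (mul j l m Y Z)"
    if X: "X \<in> carrier (Tc i j)" and Y: "Y \<in> carrier (Tc j l)" and Z: "Z \<in> carrier (Tc l m)" for X Y Z m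
  proof (rule T_hom_eq[OF abelian_group_Tc additive_compose[OF mul_bilinear(1)[OF Y] mul_bilinear(1)[OF Z]]
        mul_bilinear(1)[OF additive_closed[OF mul_bilinear(1)[OF Z] Y]] _ X])
    fix p assume p: "p \<in> words i j"
    note pc = wgen_closed[OF p]
    show "mul i l m (mul i j l (wgen i j p) Y) Z = mul i j m (wgen i j p) (mul j l m Y Z)"
    proof (rule T_hom_eq[OF abelian_group_Tc additive_compose[OF mul_bilinear(2)[OF pc] mul_bilinear(1)[OF Z]]
          additive_compose[OF mul_bilinear(1)[OF Z] mul_bilinear(2)[OF pc]] _ Y])
      fix q assume q: "q \<in> words j l"
      note qc = wgen_closed[OF q]
      show "mul i l m (mul i j l (wgen i j p) (wgen j l q)) Z = mul i j m (wgen i j p) (mul j l m (wgen j l q) Z)"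
      proof (rule T_hom_eq[OF abelian_group_Tc mul_bilinear(2)[OF additive_closed[OF mul_bilinear(2)[OF pc] qc]]
            additive_compose[OF mul_bilinear(2)[OF qc] mul_bilinear(2)[OF pc]] _ Z])
        fix r assume r: "r \<in> words l m"
        then show "mul i l m (mul i j l (wgen i j p) (wgen j l q)) (wgen l m r) =
            mul i j m (wgen i j p) (mul j l m (wgen j l q) (wgen l m r))"
          using p q by (simp add: mul_bilinear(3) word_mul_closed word_mul_assoc)
      qed
    qed
  qed
  show "zunit T i \<in> carrier (Tc i i)" by (simp add: zunit_T wgen_closed one_word)
  show "mul i i j (zunit T i) X = X" if "X \<in> carrier (Tc i j)" for X
    unfolding zunit_T
    by (rule T_hom_eq[OF abelian_group_Tc mul_bilinear(2)[OF wgen_closed[OF one_word]] additive_id_Tc _ that])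
      (simp add: mul_bilinear(3) one_word word_mul_one)
  show "mul i j j X (zunit T j) = X" if "X \<in> carrier (Tc i j)" for X
    unfolding zunit_T
    by (rule T_hom_eq[OF abelian_group_Tc mul_bilinear(1)[OF wgen_closed[OF one_word]] additive_id_Tc _ that])
      (simp add: mul_bilinear(3) one_word word_mul_one)
qed

sublocale T: zalgebra T by (rule zalgebra_T)

end

lemma (in abelian_group) add_diff_add:
  "a \<in> carrier G \<Longrightarrow> b \<in> carrier G \<Longrightarrow> c \<in> carrier G \<Longrightarrow> d \<in> carrier G \<Longrightarrow>
    (a \<oplus> b) \<ominus> (c \<oplus> d) = (a \<ominus> c) \<oplus> (b \<ominus> d)"
  by (simp add: minus_eq minus_add a_ac)

context zalgebra begin

sublocale C: abelian_group "zcomp D i j" for i j by (rule comp_abelian)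

lemmas [simp] = mul_closed unit_closed

lemma mul_additive_left: "y \<in> carrier (zcomp D j l) \<Longrightarrow> additive (zcomp D i j) (zcomp D i l) (\<lambda>x. zmul D i j l x y)"
  by (rule additiveI) (auto simp: mul_add_left)

lemma mul_additive_right: "x \<in> carrier (zcomp D i j) \<Longrightarrow> additive (zcomp D j l) (zcomp D i l) (zmul D i j l x)"
  by (rule additiveI) (auto simp: mul_add_right)

lemma mul_zero_left [simp]: "y \<in> carrier (zcomp D j l) \<Longrightarrow> zmul D i j l \<zero>\<^bsub>zcomp D i j\<^esub> y = \<zero>\<^bsub>zcomp D i l\<^esub>"
  by (rule additive_zero[OF mul_additive_left comp_abelian comp_abelian])

lemma mul_zero_right [simp]: "x \<in> carrier (zcomp D i j) \<Longrightarrow> zmul D i j l x \<zero>\<^bsub>zcomp D j l\<^esub> = \<zero>\<^bsub>zcomp D i l\<^esub>"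
  by (rule additive_zero[OF mul_additive_right comp_abelian comp_abelian])

lemma mul_neg_left: "x \<in> carrier (zcomp D i j) \<Longrightarrow> y \<in> carrier (zcomp D j l) \<Longrightarrow>
    zmul D i j l (\<ominus>\<^bsub>zcomp D i j\<^esub> x) y = \<ominus>\<^bsub>zcomp D i l\<^esub> zmul D i j l x y"
  using additive_neg[OF mul_additive_left comp_abelian comp_abelian] by simp

lemma mul_neg_right: "x \<in> carrier (zcomp D i j) \<Longrightarrow> y \<in> carrier (zcomp D j l) \<Longrightarrow>
    zmul D i j l x (\<ominus>\<^bsub>zcomp D j l\<^esub> y) = \<ominus>\<^bsub>zcomp D i l\<^esub> zmul D i j l x y"
  using additive_neg[OF mul_additive_right comp_abelian comp_abelian] by simp

lemma mul_diff_left: "x \<in> carrier (zcomp D i j) \<Longrightarrow> x' \<in> carrier (zcomp D i j) \<Longrightarrow> y \<in> carrier (zcomp D j l) \<Longrightarrow>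
    zmul D i j l (x \<ominus>\<^bsub>zcomp D i j\<^esub> x') y = zmul D i j l x y \<ominus>\<^bsub>zcomp D i l\<^esub> zmul D i j l x' y"
  by (simp add: a_minus_def mul_add_left mul_neg_left)

lemma mul_diff_right: "x \<in> carrier (zcomp D i j) \<Longrightarrow> y \<in> carrier (zcomp D j l) \<Longrightarrow> y' \<in> carrier (zcomp D j l) \<Longrightarrow>
    zmul D i j l x (y \<ominus>\<^bsub>zcomp D j l\<^esub> y') = zmul D i j l x y \<ominus>\<^bsub>zcomp D i l\<^esub> zmul D i j l x y'"
  by (simp add: a_minus_def mul_add_right mul_neg_right)

end

text \<open>The common framework for the tensor algebra and its quotient: an algebra with compatible
  images of the scalars in degree zero and of the bimodules in degree one. It is inherited by
  quotients by ideals.\<close>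

locale chain_algebra = bimodule_chain K E + D: zalgebra D
  for K :: "int \<Rightarrow> 'k ring" and E :: "int \<Rightarrow> ('k, 'v) bimod" and D :: "'a zalg" +
  fixes sc :: "int \<Rightarrow> 'k \<Rightarrow> 'a" and vec :: "int \<Rightarrow> 'v \<Rightarrow> 'a"
  assumes sc_additive: "additive (K i) (zcomp D i i) (sc i)"
    and vec_additive: "additive (E i) (zcomp D i (i + 1)) (vec i)"
    and sc_mult: "a \<in> carrier (K i) \<Longrightarrow> b \<in> carrier (K i) \<Longrightarrow> sc i (a \<otimes>\<^bsub>K i\<^esub> b) = zmul D i i i (sc i a) (sc i b)"
    and sc_one: "sc i \<one>\<^bsub>K i\<^esub> = zunit D i"
    and vec_lact: "a \<in> carrier (K i) \<Longrightarrow> v \<in> carrier (E i) \<Longrightarrow>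
      vec i (lact (E i) a v) = zmul D i i (i + 1) (sc i a) (vec i v)"
    and vec_ract: "a \<in> carrier (K (i + 1)) \<Longrightarrow> v \<in> carrier (E i) \<Longrightarrow>
      vec i (ract (E i) v a) = zmul D i (i + 1) (i + 1) (vec i v) (sc (i + 1) a)"
begin

lemma sc_closed [simp]: "a \<in> carrier (K i) \<Longrightarrow> sc i a \<in> carrier (zcomp D i i)"
  by (rule additive_closed[OF sc_additive])

text \<open>The endpoint is a separate variable because targets are written \<open>j + 2\<close>
  rather than \<open>j + 1 + 1\<close>; the primed variants below exist for the same reason.\<close>

lemma vec_closed [simp]: "j = i + 1 \<Longrightarrow> v \<in> carrier (E i) \<Longrightarrow> vec i v \<in> carrier (zcomp D i j)"
  by (simp add: additive_closed[OF vec_additive])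

lemmas sc_add = additive_add[OF sc_additive]

lemma vec_add: "j = i + 1 \<Longrightarrow> v \<in> carrier (E i) \<Longrightarrow> w \<in> carrier (E i) \<Longrightarrow>
    vec i (v \<oplus>\<^bsub>E i\<^esub> w) = vec i v \<oplus>\<^bsub>zcomp D i j\<^esub> vec i w"
  by (simp add: additive_add[OF vec_additive])

lemma vec_lact': "j = i + 1 \<Longrightarrow> a \<in> carrier (K i) \<Longrightarrow> v \<in> carrier (E i) \<Longrightarrow>
    vec i (lact (E i) a v) = zmul D i i j (sc i a) (vec i v)"
  by (simp add: vec_lact)

lemma vec_ract': "j = i + 1 \<Longrightarrow> a \<in> carrier (K j) \<Longrightarrow> v \<in> carrier (E i) \<Longrightarrow>
    vec i (ract (E i) v a) = zmul D i j j (vec i v) (sc j a)"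
  by (simp add: vec_ract)

abbreviation "bim i j \<equiv> comp_bimod sc D i j"

lemma comp_bimod_simps [simp]:
  "carrier (comp_bimod \<iota> D i j) = carrier (zcomp D i j)" "\<zero>\<^bsub>comp_bimod \<iota> D i j\<^esub> = \<zero>\<^bsub>zcomp D i j\<^esub>"
  "add (comp_bimod \<iota> D i j) = add (zcomp D i j)"
  "lact (comp_bimod \<iota> D i j) a x = zmul D i i j (\<iota> i a) x"
  "ract (comp_bimod \<iota> D i j) x b = zmul D i j j x (\<iota> j b)"
  by (simp_all add: comp_bimod_def make_bimod_def ring.extend_def bimod.fields_def)

lemma additive_comp_bimod [simp]:
  "additive (comp_bimod \<iota> D i j) H f \<longleftrightarrow> additive (zcomp D i j) H f"
  "additive H (comp_bimod \<iota> D i j) g \<longleftrightarrow> additive H (zcomp D i j) g"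
  by (simp_all add: additive_def hom_def)

lemma bimodule_comp: "bimodule (K i) (K j) (bim i j)"
proof (rule bimoduleI)
  show "cring (K i)" "cring (K j)" by (rule K.cring_axioms)+
  show "abelian_group (bim i j)" by (rule abelian_group_cong[OF D.comp_abelian]) simp_all
qed (auto simp: sc_add D.mul_add_left D.mul_add_right sc_mult D.mul_assoc sc_one D.unit_left D.unit_right)

end

context bimodule_chain begin

abbreviation "sc \<equiv> tens_scalar K E"
abbreviation "vec i v \<equiv> tens_pure K E i [v]"

lemma sc_eq: "sc i a = wgen i i (a, [])"
  by (simp add: tens_scalar_def tens_class_def)

lemma vec_eq: "vec i v = wgen i (i + 1) (\<one>\<^bsub>K i\<^esub>, [v])"
  by (simp add: tens_pure_def tens_class_def)

lemma sc_word: "a \<in> carrier (K i) \<Longrightarrow> (a, []) \<in> words i i"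
  by (simp add: mem_tens_words)

lemma vec_word: "v \<in> carrier (E i) \<Longrightarrow> (\<one>\<^bsub>K i\<^esub>, [v]) \<in> words i (i + 1)"
  by (simp add: mem_tens_words)

lemma chain_algebra_T: "chain_algebra K E T sc vec"
proof (intro chain_algebra.intro chain_algebra_axioms.intro bimodule_chain_axioms zalgebra_T)
  fix i
  show "additive (K i) (Tc i i) (sc i)"
    by (rule additiveI) (auto simp: sc_eq wgen_closed sc_word wgen_add_scalar)
  show "additive (E i) (Tc i (i + 1)) (vec i)"
    using wgen_add_letter[of i i "[]" "\<one>\<^bsub>K i\<^esub>" _ "[]" "i + 1"]
    by (auto intro!: additiveI simp: vec_eq wgen_closed vec_word)
  show "sc i \<one>\<^bsub>K i\<^esub> = zunit T i" by (simp add: sc_eq zunit_T)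
  fix a assume a: "a \<in> carrier (K i)"
  show "sc i (a \<otimes>\<^bsub>K i\<^esub> b) = mul i i i (sc i a) (sc i b)" if "b \<in> carrier (K i)" for b
    using a that by (simp add: sc_eq mul_bilinear(3) sc_word word_mul_Nil)
  show "vec i (lact (E i) a v) = mul i i (i + 1) (sc i a) (vec i v)" if "v \<in> carrier (E i)" for v
    using a that wgen_scalar_letter[of "\<one>\<^bsub>K i\<^esub>" v "[]" i "i + 1" a]
    by (simp add: sc_eq vec_eq mul_bilinear(3) sc_word vec_word word_mul_Nil)
next
  fix i a v assume "a \<in> carrier (K (i + 1))" "v \<in> carrier (E i)"
  then show "vec i (ract (E i) v a) = mul i (i + 1) (i + 1) (vec i v) (sc (i + 1) a)"
    using word_mul_snoc[of "i + 1" "\<one>\<^bsub>K i\<^esub>" "[]" v a "[]"]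
    by (simp add: sc_eq vec_eq mul_bilinear(3) sc_word vec_word)
qed

sublocale T: chain_algebra K E T sc vec by (rule chain_algebra_T)

text \<open>The scalar of a single letter is one, so absorbing it changes nothing. This allows
  induction on the last letter.\<close>

lemma wgen_snoc:
  assumes "(a, vs) \<in> words i j" "v \<in> carrier (E j)"
  shows "wgen i (j + 1) (a, vs @ [v]) = mul i j (j + 1) (wgen i j (a, vs)) (vec j v)"
  using assms(1)
proof (cases rule: word_cases)
  case (1 b)
  then show ?thesis using assms by (simp add: vec_eq mul_bilinear(3) vec_word word_mul_Nil)
next
  case (2 b us u)
  then have "u \<in> carrier (E (j - 1))" by simp
  then have "ract (E (j - 1)) u \<one>\<^bsub>K j\<^esub> = u" using E.ract_one[of u "j - 1"] by simp
  then show ?thesis using 2(2) assms by (simp add: vec_eq mul_bilinear(3) vec_word word_mul_snoc)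
qed

lemma tens_pure_two:
  assumes "x \<in> carrier (E i)" "y \<in> carrier (E (i + 1))"
  shows "tens_pure K E i [x, y] = mul i (i + 1) (i + 2) (vec i x) (vec (i + 1) y)"
  using wgen_snoc[of "\<one>\<^bsub>K i\<^esub>" "[x]" i "i + 1" y] assms
  by (simp add: vec_word vec_eq tens_pure_def tens_class_def add.assoc)

lemma T_lower:
  assumes "j < i" "X \<in> carrier (Tc i j)"
  shows "X = \<zero>\<^bsub>Tc i j\<^esub>"
  using assms(2) unfolding zcomp_T
proof (induction rule: P.induct)
  case (gen p)
  then show ?case using assms(1) by (auto simp: tens_words_def)
qed (simp_all add: P.P.minus_eq)

lemma T_snoc_induct [consumes 2, case_names zero diff snoc]:
  assumes "X \<in> carrier (Tc i (j + 1))" "i \<le> j"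
    and "Q \<zero>\<^bsub>Tc i (j + 1)\<^esub>"
    and "\<And>X Y. X \<in> carrier (Tc i (j + 1)) \<Longrightarrow> Y \<in> carrier (Tc i (j + 1)) \<Longrightarrow> Q X \<Longrightarrow> Q Y \<Longrightarrow> Q (X \<ominus>\<^bsub>Tc i (j + 1)\<^esub> Y)"
    and "\<And>t v. t \<in> carrier (Tc i j) \<Longrightarrow> v \<in> carrier (E j) \<Longrightarrow> Q (mul i j (j + 1) t (vec j v))"
  shows "Q X"
  using assms(1) unfolding zcomp_T
proof (induction rule: P.induct)
  case (gen p)
  then show ?case
  proof (cases rule: word_cases)
    case (2 a vs v)
    then have "(a, vs) \<in> words i j" "v \<in> carrier (E j)" by (auto simp: mem_tens_words)
    then show ?thesis using wgen_snoc assms(5) 2(2) wgen_closed by metis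
  qed (use assms in simp)
qed (use assms in \<open>auto simp: zcomp_T\<close>)

lemma T_scalar:
  assumes "X \<in> carrier (Tc i i)"
  obtains a where "a \<in> carrier (K i)" "X = sc i a"
proof -
  have "\<exists>a\<in>carrier (K i). X = sc i a"
    using assms unfolding zcomp_T
  proof (induction rule: P.induct)
    case zero
    then show ?case
      using additive_zero[OF T.sc_additive K.abelian_group_axioms abelian_group_Tc, of i]
      by (intro bexI[of _ "\<zero>\<^bsub>K i\<^esub>"]) (auto simp: zcomp_T)
  next
    case (diff X Y)
    then obtain a b where "a \<in> carrier (K i)" "X = sc i a" "b \<in> carrier (K i)" "Y = sc i b" by blast
    then show ?case
      using additive_diff[OF T.sc_additive K.abelian_group_axioms abelian_group_Tc, of a i b]
      by (intro bexI[of _ "a \<ominus>\<^bsub>K i\<^esub> b"]) (auto simp: zcomp_T)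
  next
    case (gen p)
    then show ?case by (cases rule: word_cases) (auto simp: sc_eq)
  qed
  then show thesis using that by blast
qed

text \<open>Words of length zero carry only the additivity relation, so the scalar of a word gives a
  well-defined map back to the field.\<close>

lemma sc_inj:
  assumes "a \<in> carrier (K i)" "sc i a = \<zero>\<^bsub>Tc i i\<^esub>"
  shows "a = \<zero>\<^bsub>K i\<^esub>"
proof -
  have "preserves_rels (words i i) (word_rels K E i i) (K i) fst"
    by (rule words_preserves_relsI) (auto simp: mem_tens_words K.abelian_group_axioms)
  then obtain F where F: "additive (P.P i i) (K i) F" "\<And>p. p \<in> words i i \<Longrightarrow> F (wgen i i p) = fst p"
    using P.universal[OF K.abelian_group_axioms] by blast
  have "a = F (sc i a)" using F(2)[OF sc_word[OF assms(1)]] by (simp add: sc_eq)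
  also have "\<dots> = \<zero>\<^bsub>K i\<^esub>"
    using additive_zero[OF F(1) P.abelian_group_P K.abelian_group_axioms] assms(2) by (simp add: zcomp_T)
  finally show ?thesis .
qed

text \<open>This is the map identity tensor l on the last tensor factor, defined on words directly:
  the last letter is replaced by its value, which multiplies the rest from the right. It does for
  words what \<open>contract_right\<close> does for tensor products of two bimodules.\<close>

lemma T_contract:
  assumes l: "additive (E j) (K j) l" "\<And>a v. a \<in> carrier (K j) \<Longrightarrow> v \<in> carrier (E j) \<Longrightarrow> l (lact (E j) a v) = a \<otimes>\<^bsub>K j\<^esub> l v"
    and ij: "i \<le> j"
  obtains F where "additive (Tc i (j + 1)) (Tc i j) F"
    "\<And>t v. t \<in> carrier (Tc i j) \<Longrightarrow> v \<in> carrier (E j) \<Longrightarrow> F (mul i j (j + 1) t (vec j v)) = mul i j j t (sc j (l v))"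
proof -
  have lc [simp]: "l v \<in> carrier (K j)" if "v \<in> carrier (E j)" for v using additive_closed[OF l(1) that] .
  \<comment> \<open>Words from \<open>i\<close> to \<open>j + 1\<close> are nonempty because
    \<open>i \<le> j\<close>, so \<open>last\<close> and \<open>butlast\<close> are applied only
    where they make sense.\<close>
  define h where "h p = (case p of (a, ws) \<Rightarrow> mul i j j (wgen i j (a, butlast ws)) (sc j (l (last ws))))" for p
  have h_snoc: "h (a, vs @ [v]) = mul i j j (wgen i j (a, vs)) (sc j (l v))" for a vs v
    by (simp add: h_def)
  have h1: "h (a, [v]) = mul i j j (wgen i j (a, [])) (sc j (l v))" for a v
    by (simp add: h_def)
  have h2: "h (a, us @ [u, v]) = mul i j j (wgen i j (a, us @ [u])) (sc j (l v))" for a us u v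
    using h_snoc[of a "us @ [u]" v] by simp
  have h3: "h (a, us @ u # vs @ [v]) = mul i j j (wgen i j (a, us @ u # vs)) (sc j (l v))" for a us u vs v
    using h_snoc[of a "us @ u # vs" v] by simp
  have h4: "h (a, us @ u # w # vs @ [v]) = mul i j j (wgen i j (a, us @ u # w # vs)) (sc j (l v))" for a us u vs v w
    using h_snoc[of a "us @ u # w # vs" v] by simp
  have h5: "h (a, u # vs @ [v]) = mul i j j (wgen i j (a, u # vs)) (sc j (l v))" for a u vs v
    using h_snoc[of a "u # vs" v] by simp
  have wg: "wgen i j (a, vs) \<in> carrier (Tc i j)" if "a \<in> carrier (K i)" "letters E i vs" "j = i + int (length vs)" for a vs
    using that by (intro wgen_closed) (simp add: mem_tens_words)
  have "preserves_rels (words i (j + 1)) (word_rels K E i (j + 1)) (Tc i j) h"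
  proof (rule words_preserves_relsI[OF abelian_group_Tc])
    fix p assume "p \<in> words i (j + 1)"
    then show "h p \<in> carrier (Tc i j)"
    proof (cases rule: word_cases)
      case (2 a vs v)
      show ?thesis
        unfolding 2(2) h_snoc by (rule T.mul_closed[OF wg T.sc_closed[OF lc]]) (use 2 in auto)
    qed (use ij in simp)
  next
    fix a b vs assume *: "(a, vs) \<in> words i (j + 1)" "b \<in> carrier (K i)"
    from *(1) show "h (a \<oplus>\<^bsub>K i\<^esub> b, vs) = h (a, vs) \<oplus>\<^bsub>Tc i j\<^esub> h (b, vs)"
    proof (cases rule: word_cases)
      case (2 c us u)
      have f: "vs = us @ [u]" "(a, us) \<in> words i j" "(b, us) \<in> words i j" "u \<in> carrier (E j)"
        using 2 * by (auto simp: mem_tens_words)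
      show ?thesis using f(2-4) *(2)
        unfolding f(1) by (simp add: h_snoc wgen_add_scalar wgen_closed T.mul_add_left)
    qed (use ij in simp)
  next
    fix a us v ws w k
    assume *: "k = i + int (length us)" "(a, us @ v # ws) \<in> words i (j + 1)" "w \<in> carrier (E k)"
    show "h (a, us @ (v \<oplus>\<^bsub>E k\<^esub> w) # ws) = h (a, us @ v # ws) \<oplus>\<^bsub>Tc i j\<^esub> h (a, us @ w # ws)"
    proof (cases ws rule: rev_cases)
      case Nil
      then have k: "k = j" and f: "(a, us) \<in> words i j" "v \<in> carrier (E j)" using * by (auto simp: mem_tens_words)
      show ?thesis using f *(3)
        unfolding k Nil by (simp add: h_snoc wgen_closed additive_add[OF l(1)] T.sc_add T.mul_add_right)
    next
      case (snoc ws' w')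
      then have f: "(a, us @ v # ws') \<in> words i j" "(a, us @ w # ws') \<in> words i j" "w' \<in> carrier (E j)"
        using * by (auto simp: mem_tens_words ac_simps)
      show ?thesis using f(2,3)
        unfolding snoc h3 wgen_add_letter[OF *(1) f(1) *(3)]
        by (simp add: wgen_closed[OF f(1)] wgen_closed T.mul_add_left)
    qed
  next
    fix a c v vs assume *: "(a, v # vs) \<in> words i (j + 1)" "c \<in> carrier (K i)"
    show "h (a \<otimes>\<^bsub>K i\<^esub> c, v # vs) = h (a, lact (E i) c v # vs)"
    proof (cases vs rule: rev_cases)
      case Nil
      then have j: "i = j" and f: "a \<in> carrier (K j)" "v \<in> carrier (E j)" using * by (auto simp: mem_tens_words)
      show ?thesis using f *(2)
        unfolding Nil h1 by (simp add: j l(2) sc_eq[symmetric] T.sc_mult T.mul_assoc)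
    next
      case (snoc ws' w')
      then show ?thesis using * wgen_scalar_letter[of a v ws' i j c] by (simp add: h5 mem_tens_words)
    qed
  next
    fix a us v w ws c k
    assume *: "k = i + int (length us)" "(a, us @ v # w # ws) \<in> words i (j + 1)" "c \<in> carrier (K (k + 1))"
    show "h (a, us @ ract (E k) v c # w # ws) = h (a, us @ v # lact (E (k + 1)) c w # ws)"
    proof (cases ws rule: rev_cases)
      case Nil
      then have jk: "j = k + 1" using * by (simp add: mem_tens_words)
      \<comment> \<open>A scalar on the next to last letter becomes right multiplication by that
        scalar after the contraction; on the other side it leaves \<open>l\<close> by left
        linearity.\<close>
      have "wgen i j (a, us @ [ract (E k) v c]) = mul i j j (wgen i j (a, us @ [v])) (sc j c)"
        using * jk Nil word_mul_snoc[of j a us v c "[]"]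
        by (simp add: sc_eq mul_bilinear(3) sc_word mem_tens_words)
      moreover have f: "(a, us @ [v]) \<in> words i j" "w \<in> carrier (E j)" "c \<in> carrier (K j)"
        using * jk by (auto simp: mem_tens_words)
      ultimately show ?thesis
        unfolding Nil h2 jk[symmetric] using f by (simp add: l(2) T.sc_mult T.mul_assoc wgen_closed)
    next
      case (snoc ws' w')
      then show ?thesis using * wgen_middle[of k i us a v w ws' j c] by (simp add: h4 mem_tens_words)
    qed
  qed
  from P.universal[OF abelian_group_Tc this]
  obtain F where F: "additive (P.P i (j + 1)) (Tc i j) F" "\<And>p. p \<in> words i (j + 1) \<Longrightarrow> F (wgen i (j + 1) p) = h p"
    by blast
  show thesis
  proof (rule that[of F])
    show Fa: "additive (Tc i (j + 1)) (Tc i j) F" using F(1) by (simp add: zcomp_T)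
    fix t v assume t: "t \<in> carrier (Tc i j)" and v: "v \<in> carrier (E j)"
    show "F (mul i j (j + 1) t (vec j v)) = mul i j j t (sc j (l v))"
    proof (rule T_hom_eq[OF abelian_group_Tc additive_compose[OF T.mul_additive_left Fa]
          T.mul_additive_left _ t])
      fix p assume p: "p \<in> words i j"
      then show "F (mul i j (j + 1) (wgen i j p) (vec j v)) = mul i j j (wgen i j p) (sc j (l v))"
        using wgen_snoc[of "fst p" "snd p" i j v] v F(2)[of "(fst p, snd p @ [v])"]
        by (simp add: mem_tens_words h_snoc) (cases p, simp add: mem_tens_words)
    qed (use v in auto)
  qed
qed

end

section \<open>Quotient algebras\<close>

locale zquotient = zalgebra D for D :: "'a zalg" +
  fixes I :: "int \<Rightarrow> int \<Rightarrow> 'a set"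
  assumes ideal: "zideal D I"
begin

abbreviation "cl i j x \<equiv> I i j +>\<^bsub>zcomp D i j\<^esub> x"

lemma subgroup: "additive_subgroup (I i j) (zcomp D i j)"
  and ideal_left: "x \<in> carrier (zcomp D i j) \<Longrightarrow> y \<in> I j l \<Longrightarrow> zmul D i j l x y \<in> I i l"
  and ideal_right: "x \<in> I i j \<Longrightarrow> y \<in> carrier (zcomp D j l) \<Longrightarrow> zmul D i j l x y \<in> I i l"
  using ideal unfolding zideal_def by blast+

lemma ideal_carrier: "x \<in> I i j \<Longrightarrow> x \<in> carrier (zcomp D i j)"
  using additive_subgroup.a_subset[OF subgroup] by blast

lemma ideal_add: "x \<in> I i j \<Longrightarrow> y \<in> I i j \<Longrightarrow> x \<oplus>\<^bsub>zcomp D i j\<^esub> y \<in> I i j"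
  by (rule additive_subgroup.a_closed[OF subgroup])

lemma ideal_zero: "\<zero>\<^bsub>zcomp D i j\<^esub> \<in> I i j"
  by (rule additive_subgroup.zero_closed[OF subgroup])

lemma ideal_neg: "x \<in> I i j \<Longrightarrow> \<ominus>\<^bsub>zcomp D i j\<^esub> x \<in> I i j"
  using subgroup.m_inv_closed[OF additive_subgroup.a_subgroup[OF subgroup]] by (simp add: a_inv_def)

lemmas qc = comp_abelian subgroup

lemma zcomp_zquot: "zcomp (zquot D I) i j = quot_group (zcomp D i j) (I i j)"
  by (simp add: zquot_def)

lemma abelian_zquot: "abelian_group (zcomp (zquot D I) i j)"
  unfolding zcomp_zquot by (rule abelian_group_quot_group[OF qc])

lemma cl_additive: "additive (zcomp D i j) (zcomp (zquot D I) i j) (\<lambda>x. cl i j x)"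
  unfolding zcomp_zquot
  by (rule additiveI) (auto simp: quot_group_simps quot_class_add[OF qc])

lemma cl_closed [simp]: "x \<in> carrier (zcomp D i j) \<Longrightarrow> cl i j x \<in> carrier (zcomp (zquot D I) i j)"
  by (rule additive_closed[OF cl_additive])

lemma cl_add: "x \<in> carrier (zcomp D i j) \<Longrightarrow> y \<in> carrier (zcomp D i j) \<Longrightarrow>
    cl i j (x \<oplus>\<^bsub>zcomp D i j\<^esub> y) = cl i j x \<oplus>\<^bsub>zcomp (zquot D I) i j\<^esub> cl i j y"
  by (rule additive_add[OF cl_additive])

lemma cl_cases:
  assumes "X \<in> carrier (zcomp (zquot D I) i j)"
  obtains x where "x \<in> carrier (zcomp D i j)" "X = cl i j x"
  using assms by (auto simp: zcomp_zquot quot_group_simps)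

lemma cl_zero_iff: "x \<in> carrier (zcomp D i j) \<Longrightarrow> cl i j x = \<zero>\<^bsub>zcomp (zquot D I) i j\<^esub> \<longleftrightarrow> x \<in> I i j"
  by (simp add: zcomp_zquot quot_group_simps quot_class_zero_iff[OF qc])

lemma cl_rep:
  assumes "x \<in> carrier (zcomp D i j)" "u \<in> cl i j x"
  shows "u \<in> carrier (zcomp D i j)" "u \<ominus>\<^bsub>zcomp D i j\<^esub> x \<in> I i j"
proof -
  show u: "u \<in> carrier (zcomp D i j)" using quot_class_subset[OF qc assms(1)] assms(2) by auto
  show "u \<ominus>\<^bsub>zcomp D i j\<^esub> x \<in> I i j"
    using quot_class_eqI[OF qc assms] quot_class_eq_iff[OF qc u assms(1)] by simp
qed

text \<open>The product of classes is a union over representatives, constant because u v - x y = (u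
  - x) v + x (v - y) lies in the ideal.\<close>

lemma cl_mul:
  assumes "x \<in> carrier (zcomp D i j)" "y \<in> carrier (zcomp D j l)"
  shows "zmul (zquot D I) i j l (cl i j x) (cl j l y) = cl i l (zmul D i j l x y)"
proof -
  have eq: "cl i l (zmul D i j l u v) = cl i l (zmul D i j l x y)" if u: "u \<in> cl i j x" and v: "v \<in> cl j l y" for u v
  proof -
    note uc = cl_rep[OF assms(1) u] and vc = cl_rep[OF assms(2) v]
    have "zmul D i j l (u \<ominus>\<^bsub>zcomp D i j\<^esub> x) v \<oplus>\<^bsub>zcomp D i l\<^esub> zmul D i j l x (v \<ominus>\<^bsub>zcomp D j l\<^esub> y) \<in> I i l"
      by (rule ideal_add[OF ideal_right[OF uc(2) vc(1)] ideal_left[OF assms(1) vc(2)]])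
    also have "zmul D i j l (u \<ominus>\<^bsub>zcomp D i j\<^esub> x) v \<oplus>\<^bsub>zcomp D i l\<^esub> zmul D i j l x (v \<ominus>\<^bsub>zcomp D j l\<^esub> y) =
        (zmul D i j l u v \<ominus>\<^bsub>zcomp D i l\<^esub> zmul D i j l x v) \<oplus>\<^bsub>zcomp D i l\<^esub>
        (zmul D i j l x v \<ominus>\<^bsub>zcomp D i l\<^esub> zmul D i j l x y)"
      using assms uc vc by (simp add: mul_diff_left mul_diff_right)
    also have "\<dots> = zmul D i j l u v \<ominus>\<^bsub>zcomp D i l\<^esub> zmul D i j l x y"
      using assms uc vc by (simp add: C.minus_eq C.a_assoc C.r_neg1)
    finally show ?thesis
      using quot_class_eq_iff[OF qc, of "zmul D i j l u v" i l "zmul D i j l x y"] assms uc vc by simp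
  qed
  have ne: "x \<in> cl i j x" "y \<in> cl j l y"
    using quot_class_mem[OF qc] assms by blast+
  have "zmul (zquot D I) i j l (cl i j x) (cl j l y) = (\<Union>u\<in>cl i j x. \<Union>v\<in>cl j l y. cl i l (zmul D i j l u v))"
    by (simp add: zquot_def)
  also have "\<dots> = (\<Union>u\<in>cl i j x. \<Union>v\<in>cl j l y. cl i l (zmul D i j l x y))"
    by (intro SUP_cong refl eq)
  also have "\<dots> = cl i l (zmul D i j l x y)" using ne by blast
  finally show ?thesis .
qed

lemma zunit_zquot: "zunit (zquot D I) i = cl i i (zunit D i)"
  by (simp add: zquot_def)

lemma zalgebra_zquot: "zalgebra (zquot D I)"
proof (rule zalgebra.intro)
  show "abelian_group (zcomp (zquot D I) i j)" for i j by (rule abelian_zquot)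
qed (auto elim!: cl_cases simp: cl_mul cl_add[symmetric] mul_add_left mul_add_right mul_assoc
    zunit_zquot unit_left unit_right)

end

lemma zideal_gen_zideal:
  assumes "zalgebra D" "\<And>p q. S p q \<subseteq> carrier (zcomp D p q)"
  shows "zideal D (gen_zideal D S)" and "S p q \<subseteq> gen_zideal D S p q"
    and "zideal D I \<Longrightarrow> (\<And>p q. S p q \<subseteq> I p q) \<Longrightarrow> gen_zideal D S p q \<subseteq> I p q"
proof -
  interpret zalgebra D by fact
  let ?F = "{I. zideal D I \<and> (\<forall>p q. S p q \<subseteq> I p q)}"
  have gen: "gen_zideal D S i j = (\<Inter>I\<in>?F. I i j)" for i j
    unfolding gen_zideal_def by blast
  \<comment> \<open>The whole algebra is one of the ideals intersected, so the family is not
    empty.\<close>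
  have "zideal D (\<lambda>i j. carrier (zcomp D i j))"
    unfolding zideal_def by (intro conjI allI ballI additive_subgroup.intro C.add.subgroup_self mul_closed)
  then have ne: "(\<lambda>i j. carrier (zcomp D i j)) \<in> ?F" using assms(2) by simp
  show "S p q \<subseteq> gen_zideal D S p q" for p q unfolding gen by blast
  show "zideal D I \<Longrightarrow> (\<And>p q. S p q \<subseteq> I p q) \<Longrightarrow> gen_zideal D S p q \<subseteq> I p q" for I
    unfolding gen by blast
  have sub: "additive_subgroup (I i j) (zcomp D i j)" if "I \<in> ?F" for I i j
    using that unfolding zideal_def by blast
  have "additive_subgroup (gen_zideal D S i j) (zcomp D i j)" for i j
  proof (rule additive_subgroup.intro)
    have "subgroup (\<Inter>((\<lambda>I. I i j) ` ?F)) (add_monoid (zcomp D i j))"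
      by (rule C.add.subgroups_Inter) (use sub ne additive_subgroup.a_subgroup in blast)+
    then show "subgroup (gen_zideal D S i j) (add_monoid (zcomp D i j))" unfolding gen .
  qed
  moreover have "zmul D i j l x y \<in> gen_zideal D S i l"
    if "x \<in> carrier (zcomp D i j)" "y \<in> gen_zideal D S j l" for i j l x y
    using that unfolding gen zideal_def by blast
  moreover have "zmul D i j l x y \<in> gen_zideal D S i l"
    if "x \<in> gen_zideal D S i j" "y \<in> carrier (zcomp D j l)" for i j l x y
    using that unfolding gen zideal_def by blast
  ultimately show "zideal D (gen_zideal D S)" unfolding zideal_def by blast
qed

lemma (in chain_algebra) chain_algebra_zquot:
  assumes "zideal D I"
  shows "chain_algebra K E (zquot D I) (\<lambda>i a. I i i +>\<^bsub>zcomp D i i\<^esub> sc i a) (\<lambda>i v. I i (i + 1) +>\<^bsub>zcomp D i (i + 1)\<^esub> vec i v)"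
proof -
  interpret Q: zquotient D I by (intro zquotient.intro zquotient_axioms.intro assms D.zalgebra_axioms)
  show ?thesis
  proof (intro chain_algebra.intro chain_algebra_axioms.intro bimodule_chain_axioms Q.zalgebra_zquot)
    show "additive (K i) (zcomp (zquot D I) i i) (\<lambda>a. Q.cl i i (sc i a))" for i
      by (rule additive_compose[OF sc_additive Q.cl_additive])
    show "additive (E i) (zcomp (zquot D I) i (i + 1)) (\<lambda>v. Q.cl i (i + 1) (vec i v))" for i
      by (rule additive_compose[OF vec_additive Q.cl_additive])
  qed (simp_all add: sc_mult Q.cl_mul sc_one Q.zunit_zquot vec_lact vec_ract)
qed

section \<open>Quadratic relations\<close>

text \<open>All that is retained of the iterated duals: scalars of period two and, for every index,
  a perfect pairing of consecutive bimodules with a chosen pair of dual bases.\<close>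

locale dual_chain = bimodule_chain K E
  for K :: "int \<Rightarrow> 'k ring" and E :: "int \<Rightarrow> ('k, 'v) bimod" +
  fixes Dp :: "int \<Rightarrow> 'v \<Rightarrow> 'v \<Rightarrow> 'k" and X X' Y Y' :: "int \<Rightarrow> 'v"
  assumes period: "K (i + 2) = K i"
    and dual: "dual_pair (K i) (K (i + 1)) (E i) (E (i + 1)) (Dp i) (X i) (X' i) (Y i) (Y' i)"
begin

sublocale dual: dual_pair "K i" "K (i + 1)" "E i" "E (i + 1)" "Dp i" "X i" "X' i" "Y i" "Y' i" for i
  by (rule dual)

text \<open>The tensor corresponding to the identity endomorphism of \<open>E i\<close>.\<close>

definition q :: "int \<Rightarrow> ('k \<times> 'v list \<Rightarrow>\<^sub>0 int) set"
  where "q i = mul i (i + 1) (i + 2) (vec i (X i)) (vec (i + 1) (Y i)) \<oplus>\<^bsub>Tc i (i + 2)\<^esub>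
    mul i (i + 1) (i + 2) (vec i (X' i)) (vec (i + 1) (Y' i))"

definition quad :: "int \<Rightarrow> ('k \<times> 'v list \<Rightarrow>\<^sub>0 int) set set"
  where "quad i = {t. \<exists>a\<in>carrier (K i). \<exists>(n::nat) x \<psi>.
    (\<forall>k<n. x k \<in> carrier (E i) \<and> \<psi> k \<in> carrier (E (i + 1))) \<and>
    t = (\<Oplus>\<^bsub>Tc i (i + 2)\<^esub> k\<in>{..<n}. tens_pure K E i [x k, \<psi> k]) \<and>
    (\<forall>w\<in>carrier (E i).
       (\<Oplus>\<^bsub>E i\<^esub> k\<in>{..<n}. ract (E i) (x k) (Dp i (\<psi> k) w)) = lact (E i) a w)}"

lemma q_closed [simp]: "q i \<in> carrier (Tc i (i + 2))"
  by (simp add: q_def)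

lemma vec_middle:
  assumes "x \<in> carrier (E i)" "y \<in> carrier (E (i + 1))" "c \<in> carrier (K (i + 1))"
  shows "mul i (i + 1) (i + 2) (vec i x) (vec (i + 1) (lact (E (i + 1)) c y)) =
    mul i (i + 1) (i + 2) (vec i (ract (E i) x c)) (vec (i + 1) y)"
  using assms T.vec_lact'[of "i + 2" "i + 1" c y] T.vec_ract[of c i x] by (simp add: T.mul_assoc)

text \<open>A tensor is determined by its endomorphism: expanding every \<open>\<psi> k\<close> in
  the left basis leaves the values of the endomorphism at \<open>X i\<close> and \<open>X' i\<close>
  as coefficients of \<open>Y i\<close> and \<open>Y' i\<close>. For left multiplication by
  \<open>a\<close> these are a X and a X', the coefficients of a q.\<close>

lemma endomorphism_tensor:
  assumes a: "a \<in> carrier (K i)"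
    and x: "\<And>k. k < n \<Longrightarrow> x k \<in> carrier (E i)" and \<psi>: "\<And>k. k < n \<Longrightarrow> \<psi> k \<in> carrier (E (i + 1))"
    and endo: "\<And>w. w \<in> carrier (E i) \<Longrightarrow>
       (\<Oplus>\<^bsub>E i\<^esub> k\<in>{..<n::nat}. ract (E i) (x k) (Dp i (\<psi> k) w)) = lact (E i) a w"
  shows "(\<Oplus>\<^bsub>Tc i (i + 2)\<^esub> k\<in>{..<n}. mul i (i + 1) (i + 2) (vec i (x k)) (vec (i + 1) (\<psi> k))) =
    mul i i (i + 2) (sc i a) (q i)"
proof -
  let ?m = "\<lambda>u v. mul i (i + 1) (i + 2) (vec i u) (vec (i + 1) v)"
  have expand: "?m u \<phi> = ?m (ract (E i) u (Dp i \<phi> (X i))) (Y i) \<oplus>\<^bsub>Tc i (i + 2)\<^esub> ?m (ract (E i) u (Dp i \<phi> (X' i))) (Y' i)"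
    if "u \<in> carrier (E i)" "\<phi> \<in> carrier (E (i + 1))" for u \<phi>
  proof -
    have "?m u \<phi> = ?m u (lact (E (i + 1)) (Dp i \<phi> (X i)) (Y i) \<oplus>\<^bsub>E (i + 1)\<^esub> lact (E (i + 1)) (Dp i \<phi> (X' i)) (Y' i))"
      using dual.expand_U[of \<phi> i] that by simp
    also have "\<dots> = ?m u (lact (E (i + 1)) (Dp i \<phi> (X i)) (Y i)) \<oplus>\<^bsub>Tc i (i + 2)\<^esub> ?m u (lact (E (i + 1)) (Dp i \<phi> (X' i)) (Y' i))"
      using that T.vec_add[of "i + 2" "i + 1"] by (simp add: T.mul_add_right)
    finally show ?thesis using that by (simp add: vec_middle)
  qed
  have add_m: "additive (E i) (Tc i (i + 2)) (\<lambda>u. ?m u v)" if "v \<in> carrier (E (i + 1))" for v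
    by (rule additive_compose[OF T.vec_additive T.mul_additive_left]) (use that in simp)
  have sum_m: "(\<Oplus>\<^bsub>Tc i (i + 2)\<^esub> k\<in>{..<n}. ?m (ract (E i) (x k) (Dp i (\<psi> k) w)) v) = mul i i (i + 2) (sc i a) (?m w v)"
    if "w \<in> carrier (E i)" "v \<in> carrier (E (i + 1))" for w v
  proof -
    have "(\<Oplus>\<^bsub>Tc i (i + 2)\<^esub> k\<in>{..<n}. ?m (ract (E i) (x k) (Dp i (\<psi> k) w)) v) =
        ?m (\<Oplus>\<^bsub>E i\<^esub> k\<in>{..<n}. ract (E i) (x k) (Dp i (\<psi> k) w)) v"
      using that x \<psi>
      by (intro additive_finsum[OF add_m E.abelian_group_W abelian_group_Tc, symmetric]) auto
    also have "\<dots> = ?m (lact (E i) a w) v" using endo that by simp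
    also have "\<dots> = mul i i (i + 2) (sc i a) (?m w v)" using that a by (simp add: T.vec_lact T.mul_assoc)
    finally show ?thesis .
  qed
  have "(\<Oplus>\<^bsub>Tc i (i + 2)\<^esub> k\<in>{..<n}. ?m (x k) (\<psi> k)) =
      (\<Oplus>\<^bsub>Tc i (i + 2)\<^esub> k\<in>{..<n}. ?m (ract (E i) (x k) (Dp i (\<psi> k) (X i))) (Y i) \<oplus>\<^bsub>Tc i (i + 2)\<^esub>
         ?m (ract (E i) (x k) (Dp i (\<psi> k) (X' i))) (Y' i))"
  proof (rule Tc.finsum_cong'[OF refl])
    fix k assume "k \<in> {..<n}"
    then show "?m (x k) (\<psi> k) = ?m (ract (E i) (x k) (Dp i (\<psi> k) (X i))) (Y i) \<oplus>\<^bsub>Tc i (i + 2)\<^esub>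
         ?m (ract (E i) (x k) (Dp i (\<psi> k) (X' i))) (Y' i)"
      by (intro expand x \<psi>) auto
  qed (use x \<psi> in auto)
  also have "\<dots> = (\<Oplus>\<^bsub>Tc i (i + 2)\<^esub> k\<in>{..<n}. ?m (ract (E i) (x k) (Dp i (\<psi> k) (X i))) (Y i)) \<oplus>\<^bsub>Tc i (i + 2)\<^esub>
      (\<Oplus>\<^bsub>Tc i (i + 2)\<^esub> k\<in>{..<n}. ?m (ract (E i) (x k) (Dp i (\<psi> k) (X' i))) (Y' i))"
    using x \<psi> by (intro Tc.finsum_addf) auto
  also have "\<dots> = mul i i (i + 2) (sc i a) (q i)"
    using a by (simp add: sum_m q_def T.mul_add_right)
  finally show ?thesis .
qed

lemma finsum_two:
  assumes "abelian_group G" "f 0 \<in> carrier G" "f (Suc 0) \<in> carrier G"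
  shows "(\<Oplus>\<^bsub>G\<^esub>k\<in>{..<2::nat}. f k) = f 0 \<oplus>\<^bsub>G\<^esub> f (Suc 0)"
proof -
  interpret G: abelian_group G by fact
  have "{..<2::nat} = {0, Suc 0}" by auto
  then show ?thesis using assms(2,3) by simp
qed

text \<open>Right multiplication by \<open>a\<close> turns the endomorphism w of q into X Y(a w) +
  X' Y'(a w) = a w, which is also the endomorphism of a q.\<close>

lemma q_central:
  assumes a: "a \<in> carrier (K i)"
  shows "mul i (i + 2) (i + 2) (q i) (sc (i + 2) a) = mul i i (i + 2) (sc i a) (q i)"
proof -
  let ?x = "\<lambda>k::nat. if k = 0 then X i else X' i"
  let ?\<psi> = "\<lambda>k::nat. if k = 0 then ract (E (i + 1)) (Y i) a else ract (E (i + 1)) (Y' i) a"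
  have a2: "a \<in> carrier (K (i + 1 + 1))" using a period[of i] by (simp add: add.assoc)
  have "(\<Oplus>\<^bsub>Tc i (i + 2)\<^esub> k\<in>{..<2}. mul i (i + 1) (i + 2) (vec i (?x k)) (vec (i + 1) (?\<psi> k))) =
    mul i i (i + 2) (sc i a) (q i)"
  proof (rule endomorphism_tensor[OF a])
    fix w assume w: "w \<in> carrier (E i)"
    have "(\<Oplus>\<^bsub>E i\<^esub> k\<in>{..<2::nat}. ract (E i) (?x k) (Dp i (?\<psi> k) w)) =
        ract (E i) (X i) (Dp i (Y i) (lact (E i) a w)) \<oplus>\<^bsub>E i\<^esub> ract (E i) (X' i) (Dp i (Y' i) (lact (E i) a w))"
      using a w by (subst finsum_two) (auto simp: E.abelian_group_W dual.D_middle)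
    also have "\<dots> = lact (E i) a w" using dual.expand_W[of "lact (E i) a w" i] a w by simp
    finally show "(\<Oplus>\<^bsub>E i\<^esub> k\<in>{..<2::nat}. ract (E i) (?x k) (Dp i (?\<psi> k) w)) = lact (E i) a w" .
  qed (use a in auto)
  also have "(\<Oplus>\<^bsub>Tc i (i + 2)\<^esub> k\<in>{..<2}. mul i (i + 1) (i + 2) (vec i (?x k)) (vec (i + 1) (?\<psi> k))) =
      mul i (i + 2) (i + 2) (q i) (sc (i + 2) a)"
    using a a2 T.vec_ract[OF a2, of "Y i"] T.vec_ract[OF a2, of "Y' i"]
    by (subst finsum_two) (auto simp: q_def T.mul_add_left T.mul_assoc add.assoc abelian_group_Tc)
  finally show ?thesis .
qed

lemma quad_eq: "quad i = {mul i i (i + 2) (sc i a) (q i) | a. a \<in> carrier (K i)}"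
proof (intro equalityI subsetI)
  fix t assume "t \<in> quad i"
  then obtain a and n :: nat and x \<psi> where *: "a \<in> carrier (K i)"
    "\<And>k. k < n \<Longrightarrow> x k \<in> carrier (E i)" "\<And>k. k < n \<Longrightarrow> \<psi> k \<in> carrier (E (i + 1))"
    "t = (\<Oplus>\<^bsub>Tc i (i + 2)\<^esub> k\<in>{..<n}. tens_pure K E i [x k, \<psi> k])"
    "\<And>w. w \<in> carrier (E i) \<Longrightarrow> (\<Oplus>\<^bsub>E i\<^esub> k\<in>{..<n}. ract (E i) (x k) (Dp i (\<psi> k) w)) = lact (E i) a w"
    unfolding quad_def by blast
  have "t = (\<Oplus>\<^bsub>Tc i (i + 2)\<^esub> k\<in>{..<n}. mul i (i + 1) (i + 2) (vec i (x k)) (vec (i + 1) (\<psi> k)))"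
    unfolding *(4) using *(2,3) by (intro Tc.finsum_cong') (auto simp: tens_pure_two)
  also have "\<dots> = mul i i (i + 2) (sc i a) (q i)"
    by (rule endomorphism_tensor) (use * in auto)
  finally show "t \<in> {mul i i (i + 2) (sc i a) (q i) | a. a \<in> carrier (K i)}" using *(1) by blast
next
  fix t assume "t \<in> {mul i i (i + 2) (sc i a) (q i) | a. a \<in> carrier (K i)}"
  then obtain a where a: "a \<in> carrier (K i)" "t = mul i i (i + 2) (sc i a) (q i)" by blast
  \<comment> \<open>The representation of a q by the tensors (a X) Y and (a X') Y'.\<close>
  let ?x = "\<lambda>k::nat. if k = 0 then lact (E i) a (X i) else lact (E i) a (X' i)"
  let ?\<psi> = "\<lambda>k::nat. if k = 0 then Y i else Y' i"
  have "(\<Oplus>\<^bsub>E i\<^esub> k\<in>{..<2::nat}. ract (E i) (?x k) (Dp i (?\<psi> k) w)) = lact (E i) a w" if w: "w \<in> carrier (E i)" for w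
  proof -
    have "(\<Oplus>\<^bsub>E i\<^esub> k\<in>{..<2::nat}. ract (E i) (?x k) (Dp i (?\<psi> k) w)) =
        lact (E i) a (ract (E i) (X i) (Dp i (Y i) w) \<oplus>\<^bsub>E i\<^esub> ract (E i) (X' i) (Dp i (Y' i) w))"
      using a w by (subst finsum_two) (auto simp: E.abelian_group_W E.lact_ract E.lact_add_right)
    then show ?thesis using dual.expand_W[OF w] by simp
  qed
  moreover have "t = (\<Oplus>\<^bsub>Tc i (i + 2)\<^esub> k\<in>{..<2::nat}. tens_pure K E i [?x k, ?\<psi> k])"
    using a by (subst finsum_two) (auto simp: tens_pure_two abelian_group_Tc T.vec_lact q_def T.mul_add_right T.mul_assoc)
  ultimately show "t \<in> quad i"
    unfolding quad_def using a
    by (intro CollectI bexI[of _ a] exI[of _ "2::nat"] exI[of _ ?x] exI[of _ ?\<psi>]) auto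
qed

section \<open>Unique expansion at the last letter\<close>

abbreviation "two i j u u' \<equiv> mul i (j + 1) (j + 2) u (vec (j + 1) (Y j)) \<oplus>\<^bsub>Tc i (j + 2)\<^esub>
    mul i (j + 1) (j + 2) u' (vec (j + 1) (Y' j))"

lemma mul_vec_two:
  assumes "u \<in> carrier (Tc i (j + 1))" "v \<in> carrier (E (j + 1))"
  shows "mul i (j + 1) (j + 2) u (vec (j + 1) v) =
    two i j (mul i (j + 1) (j + 1) u (sc (j + 1) (Dp j v (X j)))) (mul i (j + 1) (j + 1) u (sc (j + 1) (Dp j v (X' j))))"
proof -
  have "vec (j + 1) v = vec (j + 1) (lact (E (j + 1)) (Dp j v (X j)) (Y j) \<oplus>\<^bsub>E (j + 1)\<^esub> lact (E (j + 1)) (Dp j v (X' j)) (Y' j))"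
    using dual.expand_U[OF assms(2)] by simp
  also have "\<dots> = mul (j + 1) (j + 1) (j + 2) (sc (j + 1) (Dp j v (X j))) (vec (j + 1) (Y j)) \<oplus>\<^bsub>Tc (j + 1) (j + 2)\<^esub>
      mul (j + 1) (j + 1) (j + 2) (sc (j + 1) (Dp j v (X' j))) (vec (j + 1) (Y' j))"
    using assms T.vec_add[of "j + 2" "j + 1"] T.vec_lact'[of "j + 2" "j + 1"] by simp
  finally show ?thesis using assms by (simp add: T.mul_add_right T.mul_assoc)
qed

lemma T_step:
  assumes "t \<in> carrier (Tc i (j + 2))" "i \<le> j + 1"
  obtains u u' where "u \<in> carrier (Tc i (j + 1))" "u' \<in> carrier (Tc i (j + 1))"
    "t = two i j u u'"
proof -
  let ?p = "\<lambda>u u'. two i j u u'"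
  have j2: "j + 1 + 1 = j + 2" by simp
  have "\<exists>u\<in>carrier (Tc i (j + 1)). \<exists>u'\<in>carrier (Tc i (j + 1)). t = ?p u u'"
    using assms(1)[folded j2] assms(2)
  proof (induction rule: T_snoc_induct)
    case zero
    show ?case by (intro bexI[of _ "\<zero>\<^bsub>Tc i (j + 1)\<^esub>"]) (auto simp: j2)
  next
    case (diff s t)
    then obtain u u' v v' where *: "u \<in> carrier (Tc i (j + 1))" "u' \<in> carrier (Tc i (j + 1))" "s = ?p u u'"
      "v \<in> carrier (Tc i (j + 1))" "v' \<in> carrier (Tc i (j + 1))" "t = ?p v v'" by blast
    then show ?case
      by (intro rev_bexI[of "u \<ominus>\<^bsub>Tc i (j + 1)\<^esub> v", OF _ rev_bexI[of "u' \<ominus>\<^bsub>Tc i (j + 1)\<^esub> v'"]])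
        (simp_all add: j2 T.mul_diff_left Tc.add_diff_add)
  next
    case (snoc t v)
    have "mul i (j + 1) (j + 2) t (vec (j + 1) v) =
      ?p (mul i (j + 1) (j + 1) t (sc (j + 1) (Dp j v (X j)))) (mul i (j + 1) (j + 1) t (sc (j + 1) (Dp j v (X' j))))"
      by (rule mul_vec_two) (use snoc in \<open>simp_all add: j2\<close>)
    then show ?case using snoc
      by (intro rev_bexI[of "mul i (j + 1) (j + 1) t (sc (j + 1) (Dp j v (X j)))", OF _
          rev_bexI[of "mul i (j + 1) (j + 1) t (sc (j + 1) (Dp j v (X' j)))"]]) (simp_all add: j2)
  qed
  then show thesis using that by blast
qed

text \<open>Contracting the last letter against a vector v leaves u Y(v) + u' Y'(v); the choices v =
  X and v = X' isolate u and u'.\<close>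

lemma T_free:
  assumes "i \<le> j + 1" "u \<in> carrier (Tc i (j + 1))" "u' \<in> carrier (Tc i (j + 1))"
    "two i j u u' = \<zero>\<^bsub>Tc i (j + 2)\<^esub>"
  shows "u = \<zero>\<^bsub>Tc i (j + 1)\<^esub>" "u' = \<zero>\<^bsub>Tc i (j + 1)\<^esub>"
proof -
  have j2: "j + 1 + 1 = j + 2" by simp
  have sc0: "sc (j + 1) \<zero>\<^bsub>K (j + 1)\<^esub> = \<zero>\<^bsub>Tc (j + 1) (j + 1)\<^esub>"
    by (rule additive_zero[OF T.sc_additive K.abelian_group_axioms abelian_group_Tc])
  have key: "mul i (j + 1) (j + 1) u (sc (j + 1) (Dp j (Y j) v)) \<oplus>\<^bsub>Tc i (j + 1)\<^esub>
      mul i (j + 1) (j + 1) u' (sc (j + 1) (Dp j (Y' j) v)) = \<zero>\<^bsub>Tc i (j + 1)\<^esub>" if v: "v \<in> carrier (E j)" for v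
  proof -
    obtain F where F: "additive (Tc i (j + 2)) (Tc i (j + 1)) F"
      "\<And>t w. t \<in> carrier (Tc i (j + 1)) \<Longrightarrow> w \<in> carrier (E (j + 1)) \<Longrightarrow>
        F (mul i (j + 1) (j + 2) t (vec (j + 1) w)) = mul i (j + 1) (j + 1) t (sc (j + 1) (Dp j w v))"
      by (rule T_contract[of "j + 1" "\<lambda>w. Dp j w v" i, unfolded j2])
        (use assms(1) v dual.D_left dual.D_lact in auto)
    have "F \<zero>\<^bsub>Tc i (j + 2)\<^esub> = \<zero>\<^bsub>Tc i (j + 1)\<^esub>"
      by (rule additive_zero[OF F(1) abelian_group_Tc abelian_group_Tc])
    then show ?thesis using assms(2-) F(2) additive_add[OF F(1)] by (metis T.vec_closed T.mul_closed dual.y_closed j2)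
  qed
  show "u = \<zero>\<^bsub>Tc i (j + 1)\<^esub>" "u' = \<zero>\<^bsub>Tc i (j + 1)\<^esub>"
    using key[of "X j"] key[of "X' j"] assms(2,3) by (simp_all add: T.sc_one T.unit_right sc0)
qed

end

section \<open>Koszul algebras\<close>

text \<open>Rank-nullity for \<open>g\<close>, with \<open>h\<close> identifying U with the kernel.
  It yields dim W + m = n, so the subtraction of natural numbers is not truncated.\<close>

lemma has_dim_exact:
  assumes K: "field K" and U: "has_dim K U m" and V: "has_dim K V n" and W: "module K W"
    and h: "additive U V h" "\<And>a u. a \<in> carrier K \<Longrightarrow> u \<in> carrier U \<Longrightarrow> h (a \<odot>\<^bsub>U\<^esub> u) = a \<odot>\<^bsub>V\<^esub> h u"
      "inj_on h (carrier U)"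
    and g: "additive V W g" "\<And>a v. a \<in> carrier K \<Longrightarrow> v \<in> carrier V \<Longrightarrow> g (a \<odot>\<^bsub>V\<^esub> v) = a \<odot>\<^bsub>W\<^esub> g v"
      "g ` carrier V = carrier W"
    and ker: "h ` carrier U = {v \<in> carrier V. g v = \<zero>\<^bsub>W\<^esub>}"
  shows "has_dim K W (n - m)"
proof -
  interpret U: vectorspace K U using U by (simp add: has_dim_def)
  interpret V: vectorspace K V using V by (simp add: has_dim_def)
  interpret W: vectorspace K W by (intro vectorspace.intro W K)
  interpret g: linear_map K V W g
    by (intro linear_map.intro mod_hom.intro mod_hom_axioms.intro V.vectorspace_axioms W.vectorspace_axioms
        V.module_axioms W.module_axioms) (use g in \<open>auto simp: module_hom_def additive_closed additive_add\<close>)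
  have fd: "V.fin_dim" and dimV: "V.dim = n" using V by (simp_all add: has_dim_def)
  have im: "g.imT = carrier W" using g(3) by (simp add: g.im_def)
  have kr: "g.kerT = h ` carrier U" using ker by (simp add: g.ker_def)
  have Wd: "vectorspace.dim K (W.vs g.imT) = W.dim" unfolding im by simp
  have "vectorspace K (V.vs g.kerT)" by (rule V.subspace_is_vs[OF g.kerT_is_subspace])
  then have "module K (V.vs g.kerT)" by (simp add: vectorspace_def)
  then have "has_dim K (V.vs g.kerT) m"
    by (rule has_dim_transfer[OF U K]) (use h kr in \<open>auto simp: bij_betw_def additive_add intro!: additiveI\<close>)
  then have "vectorspace.dim K (V.vs g.kerT) = m" by (simp add: has_dim_def)
  then have "W.dim + m = n" using g.rank_nullity[OF fd] Wd dimV by simp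
  moreover have "W.fin_dim" using g.rank_nullity_main(2)[OF fd g(3)] .
  ultimately show ?thesis unfolding has_dim_def using W.vectorspace_axioms by auto
qed

text \<open>\<open>gen\<close>, \<open>rel\<close> and \<open>ker\<close> express right exactness of
  multiplication by X_j, X'_j followed by Y_j, Y'_j; exactness at the left end has to be derived.
  The case \<open>i = j + 1\<close> belongs to \<open>ker\<close> on purpose: there b lies below the
  diagonal and vanishes, so \<open>ker\<close> asserts the independence of Y_j and Y'_j, where the
  descent ends.\<close>

locale koszul = chain_algebra K E D sc vec + dual_chain K E Dp X X' Y Y'
  for K :: "int \<Rightarrow> 'k ring" and E :: "int \<Rightarrow> ('k, 'v) bimod" and D :: "'a zalg"
    and sc :: "int \<Rightarrow> 'k \<Rightarrow> 'a" and vec :: "int \<Rightarrow> 'v \<Rightarrow> 'a" and Dp X X' Y Y' +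
  assumes lower: "j < i \<Longrightarrow> x \<in> carrier (zcomp D i j) \<Longrightarrow> x = \<zero>\<^bsub>zcomp D i j\<^esub>"
    and sc_onto: "x \<in> carrier (zcomp D i i) \<Longrightarrow> \<exists>a\<in>carrier (K i). x = sc i a"
    and sc_inj: "a \<in> carrier (K i) \<Longrightarrow> sc i a = \<zero>\<^bsub>zcomp D i i\<^esub> \<Longrightarrow> a = \<zero>\<^bsub>K i\<^esub>"
    and gen: "i \<le> j + 1 \<Longrightarrow> x \<in> carrier (zcomp D i (j + 2)) \<Longrightarrow>
      \<exists>a\<in>carrier (zcomp D i (j + 1)). \<exists>a'\<in>carrier (zcomp D i (j + 1)).
        x = zmul D i (j + 1) (j + 2) a (vec (j + 1) (Y j)) \<oplus>\<^bsub>zcomp D i (j + 2)\<^esub>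
            zmul D i (j + 1) (j + 2) a' (vec (j + 1) (Y' j))"
    and rel: "zmul D j (j + 1) (j + 2) (vec j (X j)) (vec (j + 1) (Y j)) \<oplus>\<^bsub>zcomp D j (j + 2)\<^esub>
        zmul D j (j + 1) (j + 2) (vec j (X' j)) (vec (j + 1) (Y' j)) = \<zero>\<^bsub>zcomp D j (j + 2)\<^esub>"
    and ker: "i \<le> j + 1 \<Longrightarrow> u \<in> carrier (zcomp D i (j + 1)) \<Longrightarrow> u' \<in> carrier (zcomp D i (j + 1)) \<Longrightarrow>
      zmul D i (j + 1) (j + 2) u (vec (j + 1) (Y j)) \<oplus>\<^bsub>zcomp D i (j + 2)\<^esub>
        zmul D i (j + 1) (j + 2) u' (vec (j + 1) (Y' j)) = \<zero>\<^bsub>zcomp D i (j + 2)\<^esub> \<Longrightarrow>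
      \<exists>b\<in>carrier (zcomp D i j). u = zmul D i j (j + 1) b (vec j (X j)) \<and> u' = zmul D i j (j + 1) b (vec j (X' j))"
begin

abbreviation "m \<equiv> zmul D"
abbreviation "Dc \<equiv> zcomp D"

lemma X_nonzero: "X j \<noteq> \<zero>\<^bsub>E j\<^esub>"
proof
  assume "X j = \<zero>\<^bsub>E j\<^esub>"
  then have "Dp j (Y j) (X j) = \<zero>\<^bsub>K (j + 1)\<^esub>"
    using additive_zero[OF dual.D_right E.abelian_group_W K.abelian_group_axioms, of "Y j" j] by simp
  then show False using dual.field_L.one_not_zero by simp
qed

lemma sc_zero [simp]: "sc i \<zero>\<^bsub>K i\<^esub> = \<zero>\<^bsub>Dc i i\<^esub>"
  by (rule additive_zero[OF sc_additive K.abelian_group_axioms D.comp_abelian])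

lemma vec_zero: "j = i + 1 \<Longrightarrow> vec i \<zero>\<^bsub>E i\<^esub> = \<zero>\<^bsub>Dc i j\<^esub>"
  using additive_zero[OF vec_additive E.abelian_group_W D.comp_abelian] by simp

lemma mul_sc_cancel:
  assumes "a \<in> carrier (Dc i j)" "c \<in> carrier (K j)" "c \<noteq> \<zero>\<^bsub>K j\<^esub>" "m i j j a (sc j c) = \<zero>\<^bsub>Dc i j\<^esub>"
  shows "a = \<zero>\<^bsub>Dc i j\<^esub>"
proof -
  have inv: "inv\<^bsub>K j\<^esub> c \<in> carrier (K j)" "c \<otimes>\<^bsub>K j\<^esub> inv\<^bsub>K j\<^esub> c = \<one>\<^bsub>K j\<^esub>"
    using assms dual.field_L.field_Units by auto
  have "a = m i j j a (sc j (c \<otimes>\<^bsub>K j\<^esub> inv\<^bsub>K j\<^esub> c))" using assms inv by (simp add: sc_one D.unit_right)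
  also have "\<dots> = m i j j (m i j j a (sc j c)) (sc j (inv\<^bsub>K j\<^esub> c))"
    using assms(1,2) inv(1) by (simp add: sc_mult D.mul_assoc)
  also have "\<dots> = \<zero>\<^bsub>Dc i j\<^esub>" using assms inv by simp
  finally show ?thesis .
qed

text \<open>Write z = \<alpha> Y + \<beta> Y'. Then \<open>ker\<close> gives a \<alpha> = b X and a
  \<beta> = b X' for one b. If \<alpha> = 0, take w = X. Otherwise put \<gamma> = \<beta>/\<alpha>;
  then b X' = a \<beta> = a \<alpha> \<gamma> = b X \<gamma>, so w = X' - X \<gamma> works, and it
  is nonzero because Y'(w) = 1. If b = 0, then a times a nonzero scalar vanishes.\<close>

lemma mul_vec_descent:
  assumes "i \<le> j + 1" and a: "a \<in> carrier (Dc i (j + 1))" and z: "z \<in> carrier (E (j + 1))" "z \<noteq> \<zero>\<^bsub>E (j + 1)\<^esub>"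
    and az: "m i (j + 1) (j + 2) a (vec (j + 1) z) = \<zero>\<^bsub>Dc i (j + 2)\<^esub>"
  obtains b w where "b \<in> carrier (Dc i j)" "w \<in> carrier (E j)" "w \<noteq> \<zero>\<^bsub>E j\<^esub>"
    "m i j (j + 1) b (vec j w) = \<zero>\<^bsub>Dc i (j + 1)\<^esub>" "b = \<zero>\<^bsub>Dc i j\<^esub> \<Longrightarrow> a = \<zero>\<^bsub>Dc i (j + 1)\<^esub>"
proof -
  define \<alpha> \<beta> where "\<alpha> = Dp j z (X j)" and "\<beta> = Dp j z (X' j)"
  have ab [simp]: "\<alpha> \<in> carrier (K (j + 1))" "\<beta> \<in> carrier (K (j + 1))" using z by (simp_all add: \<alpha>_def \<beta>_def)
  let ?a = "\<lambda>c. m i (j + 1) (j + 1) a (sc (j + 1) c)"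
  have zexp: "z = lact (E (j + 1)) \<alpha> (Y j) \<oplus>\<^bsub>E (j + 1)\<^esub> lact (E (j + 1)) \<beta> (Y' j)"
    using dual.expand_U[OF z(1)] by (simp add: \<alpha>_def \<beta>_def)
  have "m i (j + 1) (j + 2) a (vec (j + 1) z) = m i (j + 1) (j + 2) (?a \<alpha>) (vec (j + 1) (Y j)) \<oplus>\<^bsub>Dc i (j + 2)\<^esub>
      m i (j + 1) (j + 2) (?a \<beta>) (vec (j + 1) (Y' j))"
    using a by (subst zexp) (simp add: vec_add[of "j + 2"] vec_lact'[of "j + 2"] D.mul_add_right D.mul_assoc)
  then obtain b where b: "b \<in> carrier (Dc i j)" "?a \<alpha> = m i j (j + 1) b (vec j (X j))" "?a \<beta> = m i j (j + 1) b (vec j (X' j))"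
    using ker[OF assms(1), of "?a \<alpha>" "?a \<beta>"] a az by auto
  show thesis
  proof (cases "\<alpha> = \<zero>\<^bsub>K (j + 1)\<^esub>")
    case True
    have "\<beta> \<noteq> \<zero>\<^bsub>K (j + 1)\<^esub>"
    proof
      assume "\<beta> = \<zero>\<^bsub>K (j + 1)\<^esub>"
      then have "z = \<zero>\<^bsub>E (j + 1)\<^esub>" using zexp True by simp
      then show False using z(2) by simp
    qed
    show thesis
    proof (rule that[of b "X j"])
      show "m i j (j + 1) b (vec j (X j)) = \<zero>\<^bsub>Dc i (j + 1)\<^esub>" using b(2) a True by simp
      assume "b = \<zero>\<^bsub>Dc i j\<^esub>"
      then have "?a \<beta> = \<zero>\<^bsub>Dc i (j + 1)\<^esub>" using b(3) by simp
      then show "a = \<zero>\<^bsub>Dc i (j + 1)\<^esub>" by (rule mul_sc_cancel[OF a ab(2) \<open>\<beta> \<noteq> _\<close>])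
    qed (simp_all add: b X_nonzero)
  next
    case False
    define \<gamma> where "\<gamma> = inv\<^bsub>K (j + 1)\<^esub> \<alpha> \<otimes>\<^bsub>K (j + 1)\<^esub> \<beta>"
    have inv: "inv\<^bsub>K (j + 1)\<^esub> \<alpha> \<in> carrier (K (j + 1))" "\<alpha> \<otimes>\<^bsub>K (j + 1)\<^esub> inv\<^bsub>K (j + 1)\<^esub> \<alpha> = \<one>\<^bsub>K (j + 1)\<^esub>"
      using False dual.field_L.field_Units by auto
    have \<gamma>: "\<gamma> \<in> carrier (K (j + 1))" "\<alpha> \<otimes>\<^bsub>K (j + 1)\<^esub> \<gamma> = \<beta>"
      using inv by (simp_all add: \<gamma>_def K.m_assoc[symmetric])
    let ?w = "X' j \<ominus>\<^bsub>E j\<^esub> ract (E j) (X j) \<gamma>"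
    show thesis
    proof (rule that[of b ?w])
      have "?a \<beta> = m i (j + 1) (j + 1) (?a \<alpha>) (sc (j + 1) \<gamma>)"
        using a \<gamma>(1) by (simp add: \<gamma>(2)[symmetric] sc_mult D.mul_assoc del: \<gamma>(2))
      then have "m i j (j + 1) b (vec j (X' j)) = m i j (j + 1) b (vec j (ract (E j) (X j) \<gamma>))"
        using b \<gamma>(1) by (simp add: vec_ract D.mul_assoc)
      moreover have "vec j ?w = vec j (X' j) \<ominus>\<^bsub>Dc j (j + 1)\<^esub> vec j (ract (E j) (X j) \<gamma>)"
        using \<gamma>(1) by (simp add: additive_diff[OF vec_additive E.abelian_group_W D.comp_abelian])
      ultimately show "m i j (j + 1) b (vec j ?w) = \<zero>\<^bsub>Dc i (j + 1)\<^esub>"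
        using b(1) \<gamma>(1) by (simp add: D.mul_diff_right)
      show "?w \<noteq> \<zero>\<^bsub>E j\<^esub>"
      proof
        assume "?w = \<zero>\<^bsub>E j\<^esub>"
        then have "X' j = ract (E j) (X j) \<gamma>" using \<gamma>(1) by simp
        then have "Dp j (Y' j) (X' j) = Dp j (Y' j) (X j) \<otimes>\<^bsub>K (j + 1)\<^esub> \<gamma>" using dual.D_ract \<gamma>(1) by simp
        then show False using \<gamma>(1) dual.field_L.one_not_zero by simp
      qed
      assume "b = \<zero>\<^bsub>Dc i j\<^esub>"
      then have "?a \<alpha> = \<zero>\<^bsub>Dc i (j + 1)\<^esub>" using b(2) by simp
      then show "a = \<zero>\<^bsub>Dc i (j + 1)\<^esub>" by (rule mul_sc_cancel[OF a ab(1) False])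
    qed (use b \<gamma> in simp_all)
  qed
qed

text \<open>If \<open>a z = 0\<close>, the relations turn this
  into \<open>b w = 0\<close> with \<open>w \<noteq> 0\<close> one degree lower, where \<open>b = 0\<close> forces \<open>a = 0\<close>.\<close>

lemma mul_vec_inj_aux:
  "a \<in> carrier (Dc i (i + int n)) \<Longrightarrow> z \<in> carrier (E (i + int n)) \<Longrightarrow> z \<noteq> \<zero>\<^bsub>E (i + int n)\<^esub> \<Longrightarrow>
    m i (i + int n) (i + int n + 1) a (vec (i + int n) z) = \<zero>\<^bsub>Dc i (i + int n + 1)\<^esub> \<Longrightarrow>
    a = \<zero>\<^bsub>Dc i (i + int n)\<^esub>"
proof (induction n arbitrary: a z)
  case 0
  \<comment> \<open>In degree zero the descent leads below the diagonal, where b vanishes.\<close>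
  have *: "i - 1 + 1 = i" "i - 1 + 2 = i + 1" by auto
  show ?case
    by (rule mul_vec_descent[of i "i - 1" a z, unfolded *]) (use 0 lower in auto)
next
  case (Suc n)
  have *: "i + int n + 1 = i + int (Suc n)" "i + int n + 2 = i + int (Suc n) + 1" by auto
  show ?case
    by (rule mul_vec_descent[of i "i + int n" a z, unfolded *]) (use Suc in \<open>auto simp: *\<close>)
qed

lemma mul_vec_inj:
  assumes "i \<le> j" "a \<in> carrier (Dc i j)" "z \<in> carrier (E j)" "z \<noteq> \<zero>\<^bsub>E j\<^esub>"
    "m i j (j + 1) a (vec j z) = \<zero>\<^bsub>Dc i (j + 1)\<^esub>"
  shows "a = \<zero>\<^bsub>Dc i j\<^esub>"
  using mul_vec_inj_aux[of a i "nat (j - i)" z] assms by simp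

section \<open>The sequence through the tensor product with the last letter\<close>

lemma bimodule_E2: "bimodule (K (j + 1)) (K (j + 2)) (E (j + 1))"
  using bimod[of "j + 1"] by (simp add: add.assoc)

sublocale TP: tensor_product "K i" "K (j + 1)" "K (j + 2)" "bim i (j + 1)" "E (j + 1)" for i j
  by (intro tensor_product.intro bimodule_comp bimodule_E2)

abbreviation "TT i j \<equiv> tensor (K (j + 1)) (bim i (j + 1)) (E (j + 1))"
abbreviation "pt i j \<equiv> pure_tensor (K (j + 1)) (bim i (j + 1)) (E (j + 1))"

text \<open>The first map of the short exact sequence after identifying \<open>a\<close> with the
  tensor of \<open>a\<close> and q_j.\<close>

definition emb :: "int \<Rightarrow> int \<Rightarrow> 'a \<Rightarrow> ('a \<times> 'v \<Rightarrow>\<^sub>0 int) set"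
  where "emb i j a = pt i j (m i j (j + 1) a (vec j (X j))) (Y j) \<oplus>\<^bsub>TT i j\<^esub>
    pt i j (m i j (j + 1) a (vec j (X' j))) (Y' j)"

lemma TT_expand:
  assumes "a \<in> carrier (Dc i (j + 1))" "v \<in> carrier (E (j + 1))"
  shows "pt i j a v = pt i j (m i (j + 1) (j + 1) a (sc (j + 1) (Dp j v (X j)))) (Y j) \<oplus>\<^bsub>TT i j\<^esub>
    pt i j (m i (j + 1) (j + 1) a (sc (j + 1) (Dp j v (X' j)))) (Y' j)"
proof -
  have "pt i j a v = pt i j a (lact (E (j + 1)) (Dp j v (X j)) (Y j) \<oplus>\<^bsub>E (j + 1)\<^esub> lact (E (j + 1)) (Dp j v (X' j)) (Y' j))"
    using dual.expand_U[OF assms(2)] by simp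
  also have "\<dots> = pt i j a (lact (E (j + 1)) (Dp j v (X j)) (Y j)) \<oplus>\<^bsub>TT i j\<^esub>
      pt i j a (lact (E (j + 1)) (Dp j v (X' j)) (Y' j))"
    using assms by (intro TP.pt_add_right) auto
  also have "pt i j a (lact (E (j + 1)) (Dp j v (X j)) (Y j)) = pt i j (m i (j + 1) (j + 1) a (sc (j + 1) (Dp j v (X j)))) (Y j)"
    using TP.pt_middle[of a i j "Dp j v (X j)" "Y j"] assms by simp
  also have "pt i j a (lact (E (j + 1)) (Dp j v (X' j)) (Y' j)) = pt i j (m i (j + 1) (j + 1) a (sc (j + 1) (Dp j v (X' j)))) (Y' j)"
    using TP.pt_middle[of a i j "Dp j v (X' j)" "Y' j"] assms by simp
  finally show ?thesis .
qed

text \<open>\<open>C\<close> and \<open>C'\<close> are the contractions against \<open>X j\<close>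
  and \<open>X' j\<close>. They make every tensor a unique combination of \<open>Y j\<close> and
  \<open>Y' j\<close> with coefficients in the algebra.\<close>

lemma TT_coordinates:
  obtains C C' where "additive (TT i j) (Dc i (j + 1)) C" "additive (TT i j) (Dc i (j + 1)) C'"
    "\<And>t. t \<in> carrier (TT i j) \<Longrightarrow> t = pt i j (C t) (Y j) \<oplus>\<^bsub>TT i j\<^esub> pt i j (C' t) (Y' j)"
    "\<And>a a'. a \<in> carrier (Dc i (j + 1)) \<Longrightarrow> a' \<in> carrier (Dc i (j + 1)) \<Longrightarrow>
      C (pt i j a (Y j) \<oplus>\<^bsub>TT i j\<^esub> pt i j a' (Y' j)) = a"
    "\<And>a a'. a \<in> carrier (Dc i (j + 1)) \<Longrightarrow> a' \<in> carrier (Dc i (j + 1)) \<Longrightarrow>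
      C' (pt i j a (Y j) \<oplus>\<^bsub>TT i j\<^esub> pt i j a' (Y' j)) = a'"
proof -
  have ex: "\<exists>C. additive (TT i j) (Dc i (j + 1)) C \<and> (\<forall>a\<in>carrier (Dc i (j + 1)). \<forall>v\<in>carrier (E (j + 1)).
      C (pt i j a v) = m i (j + 1) (j + 1) a (sc (j + 1) (Dp j v w)))" if w: "w \<in> carrier (E j)" for w
  proof -
    obtain C where "additive (TT i j) (bim i (j + 1)) C"
      "\<And>a v. a \<in> carrier (bim i (j + 1)) \<Longrightarrow> v \<in> carrier (E (j + 1)) \<Longrightarrow> C (pt i j a v) = ract (bim i (j + 1)) a (Dp j v w)"
      by (rule TP.contract_right[of j "\<lambda>v. Dp j v w" i]) (use w dual.D_left dual.D_lact in auto)
    then show ?thesis by (intro exI[of _ C]) (simp del: TP.tensor_group)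
  qed
  obtain C where C: "additive (TT i j) (Dc i (j + 1)) C"
    "\<And>a v. a \<in> carrier (Dc i (j + 1)) \<Longrightarrow> v \<in> carrier (E (j + 1)) \<Longrightarrow> C (pt i j a v) = m i (j + 1) (j + 1) a (sc (j + 1) (Dp j v (X j)))"
    using ex[of "X j"] by auto
  obtain C' where C': "additive (TT i j) (Dc i (j + 1)) C'"
    "\<And>a v. a \<in> carrier (Dc i (j + 1)) \<Longrightarrow> v \<in> carrier (E (j + 1)) \<Longrightarrow> C' (pt i j a v) = m i (j + 1) (j + 1) a (sc (j + 1) (Dp j v (X' j)))"
    using ex[of "X' j"] by auto
  note [simp del] = TP.tensor_group
  note ptc = TP.pt_closed[of _ i j, simplified]
  show thesis
  proof (rule that[OF C(1) C'(1)])
    fix t assume t: "t \<in> carrier (TT i j)"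
    show "t = pt i j (C t) (Y j) \<oplus>\<^bsub>TT i j\<^esub> pt i j (C' t) (Y' j)"
    proof (rule TP.tensor_hom_eq[OF TP.abelian_group_tensor TP.additive_ident additive_plus[OF TP.abelian_group_tensor] _ t])
      show "additive (TT i j) (TT i j) (\<lambda>t. pt i j (C t) (Y j))" "additive (TT i j) (TT i j) (\<lambda>t. pt i j (C' t) (Y' j))"
        using additive_compose[OF C(1) TP.pt_additive_left[of "Y j" j i, simplified]]
          additive_compose[OF C'(1) TP.pt_additive_left[of "Y' j" j i, simplified]] by auto
    next
      fix a v assume av: "a \<in> carrier (bim i (j + 1))" "v \<in> carrier (E (j + 1))"
      then have a: "a \<in> carrier (Dc i (j + 1))" by simp
      show "pt i j a v = pt i j (C (pt i j a v)) (Y j) \<oplus>\<^bsub>TT i j\<^esub> pt i j (C' (pt i j a v)) (Y' j)"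
        unfolding C(2)[OF a av(2)] C'(2)[OF a av(2)] by (rule TT_expand[OF a av(2)])
    qed
  next
    fix a a' assume a: "a \<in> carrier (Dc i (j + 1))" "a' \<in> carrier (Dc i (j + 1))"
    show "C (pt i j a (Y j) \<oplus>\<^bsub>TT i j\<^esub> pt i j a' (Y' j)) = a" "C' (pt i j a (Y j) \<oplus>\<^bsub>TT i j\<^esub> pt i j a' (Y' j)) = a'"
      using a ptc by (simp_all add: additive_add[OF C(1)] additive_add[OF C'(1)] C(2) C'(2) sc_one D.unit_right)
  qed
qed

lemma emb_additive: "additive (bim i j) (TT i j) (emb i j)"
proof -
  have "additive (Dc i j) (TT i j) (\<lambda>a. pt i j (m i j (j + 1) a (vec j w)) v)"
    if "w \<in> carrier (E j)" "v \<in> carrier (E (j + 1))" for w v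
    using additive_compose[OF D.mul_additive_left TP.pt_additive_left[of v j i, simplified]] that by simp
  then show ?thesis unfolding emb_def by (simp add: additive_plus TP.abelian_group_tensor del: TP.tensor_group)
qed

lemma emb_lact:
  assumes "c \<in> carrier (K i)" "a \<in> carrier (Dc i j)"
  shows "emb i j (lact (bim i j) c a) = lact (TT i j) c (emb i j a)"
  using assms TP.tensor_lact(2)[of c i _ j] TP.pt_closed[of _ i j] additive_add[OF TP.tensor_lact(1), of c i]
  by (simp add: emb_def D.mul_assoc del: TP.tensor_group)

text \<open>Centrality of q_j inside the tensor product. On one side c X and c X' are expanded in
  the right basis, on the other Y c and Y' c in the left basis; the coefficients agree because (Y
  c)(w) = Y(c w).\<close>

lemma emb_ract:
  assumes c: "c \<in> carrier (K (j + 2))" and a: "a \<in> carrier (Dc i j)"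
  shows "emb i j (ract (bim i j) a c) = ract (TT i j) (emb i j a) c"
proof -
  note [simp del] = TP.tensor_group
  have c': "c \<in> carrier (K j)" using c by (simp add: period)
  note ptc = TP.pt_closed[of _ i j, simplified]
  let ?a = "\<lambda>w. m i j (j + 1) a (vec j w)"
  have Yc: "ract (E (j + 1)) (Y j) c \<in> carrier (E (j + 1))" "ract (E (j + 1)) (Y' j) c \<in> carrier (E (j + 1))"
    using c' by simp_all
  have left: "?a (lact (E j) c w) = m i (j + 1) (j + 1) (?a (X j)) (sc (j + 1) (Dp j (Y j) (lact (E j) c w))) \<oplus>\<^bsub>Dc i (j + 1)\<^esub>
      m i (j + 1) (j + 1) (?a (X' j)) (sc (j + 1) (Dp j (Y' j) (lact (E j) c w)))" if w: "w \<in> carrier (E j)" for w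
  proof -
    have "vec j (lact (E j) c w) = vec j (ract (E j) (X j) (Dp j (Y j) (lact (E j) c w)) \<oplus>\<^bsub>E j\<^esub>
        ract (E j) (X' j) (Dp j (Y' j) (lact (E j) c w)))"
      using dual.expand_W[of "lact (E j) c w" j] c' w by simp
    also have "\<dots> = m j (j + 1) (j + 1) (vec j (X j)) (sc (j + 1) (Dp j (Y j) (lact (E j) c w))) \<oplus>\<^bsub>Dc j (j + 1)\<^esub>
        m j (j + 1) (j + 1) (vec j (X' j)) (sc (j + 1) (Dp j (Y' j) (lact (E j) c w)))"
      using c' w by (simp add: vec_add[of "j + 1"] vec_ract)
    finally show ?thesis using a c' w by (simp add: D.mul_add_right D.mul_assoc)
  qed
  have "emb i j (ract (bim i j) a c) = pt i j (?a (lact (E j) c (X j))) (Y j) \<oplus>\<^bsub>TT i j\<^esub> pt i j (?a (lact (E j) c (X' j))) (Y' j)"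
    using a c' by (simp add: emb_def vec_lact D.mul_assoc period)
  also have "\<dots> = pt i j (?a (X j)) (ract (E (j + 1)) (Y j) c) \<oplus>\<^bsub>TT i j\<^esub> pt i j (?a (X' j)) (ract (E (j + 1)) (Y' j) c)"
    using a c' ptc TP.pt_add_left[of _ i j]
    by (simp add: left TT_expand[OF _ Yc(1)] TT_expand[OF _ Yc(2)] dual.D_middle TP.T.a_ac)
  also have "\<dots> = ract (TT i j) (emb i j a) c"
    using a c ptc TP.tensor_ract(2)[of c j _ i] additive_add[OF TP.tensor_ract(1), of c j] by (simp add: emb_def)
  finally show ?thesis .
qed

text \<open>The coefficient of the image at \<open>Y j\<close> is a X_j, and right multiplication by
  a nonzero vector is injective.\<close>

lemma emb_inj:
  assumes "i \<le> j"
  shows "inj_on (emb i j) (carrier (bim i j))"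
proof (rule additive_inj_on[OF emb_additive bimodule.abelian_group_W[OF bimodule_comp] TP.abelian_group_tensor])
  fix a assume a: "a \<in> carrier (bim i j)" "emb i j a = \<zero>\<^bsub>TT i j\<^esub>"
  obtain C C' where "additive (TT i j) (Dc i (j + 1)) C" "additive (TT i j) (Dc i (j + 1)) C'"
    "\<And>t. t \<in> carrier (TT i j) \<Longrightarrow> t = pt i j (C t) (Y j) \<oplus>\<^bsub>TT i j\<^esub> pt i j (C' t) (Y' j)"
    "\<And>a a'. a \<in> carrier (Dc i (j + 1)) \<Longrightarrow> a' \<in> carrier (Dc i (j + 1)) \<Longrightarrow>
      C (pt i j a (Y j) \<oplus>\<^bsub>TT i j\<^esub> pt i j a' (Y' j)) = a"
    "\<And>a a'. a \<in> carrier (Dc i (j + 1)) \<Longrightarrow> a' \<in> carrier (Dc i (j + 1)) \<Longrightarrow>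
      C' (pt i j a (Y j) \<oplus>\<^bsub>TT i j\<^esub> pt i j a' (Y' j)) = a'"
    by (rule TT_coordinates[of j i]) blast
  note C = this(1,4)
  have "m i j (j + 1) a (vec j (X j)) = C (emb i j a)" using a(1) by (simp add: emb_def C(2) del: TP.tensor_group)
  also have "\<dots> = \<zero>\<^bsub>Dc i (j + 1)\<^esub>"
    unfolding a(2) by (rule additive_zero[OF C(1) TP.abelian_group_tensor D.comp_abelian])
  finally show "a = \<zero>\<^bsub>bim i j\<^esub>"
    using mul_vec_inj[OF assms _ _ X_nonzero] a(1) by simp
qed

text \<open>In the coordinates at \<open>Y j\<close> and \<open>Y' j\<close>, surjectivity is
  \<open>gen\<close> and the description of the kernel is \<open>ker\<close>.\<close>

lemma TT_multiplication:
  assumes "i \<le> j"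
  obtains g where "bimodule_hom (K i) (K (j + 2)) (TT i j) (bim i (j + 2)) g"
    "\<And>a v. a \<in> carrier (Dc i (j + 1)) \<Longrightarrow> v \<in> carrier (E (j + 1)) \<Longrightarrow>
      g (pt i j a v) = m i (j + 1) (j + 2) a (vec (j + 1) v)"
    "g ` carrier (TT i j) = carrier (bim i (j + 2))"
    "emb i j ` carrier (bim i j) = {t \<in> carrier (TT i j). g t = \<zero>\<^bsub>bim i (j + 2)\<^esub>}"
proof -
  note [simp del] = TP.tensor_group
  note ptc = TP.pt_closed[of _ i j, simplified]
  obtain g where g: "additive (TT i j) (bim i (j + 2)) g"
    "\<And>a v. a \<in> carrier (bim i (j + 1)) \<Longrightarrow> v \<in> carrier (E (j + 1)) \<Longrightarrow>
      g (pt i j a v) = m i (j + 1) (j + 2) a (vec (j + 1) v)"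
  proof (rule TP.tensor_universal[where i = i and j = j and B = "bim i (j + 2)" and
        \<beta> = "\<lambda>a v. m i (j + 1) (j + 2) a (vec (j + 1) v)"])
    show "abelian_group (bim i (j + 2))" by (rule bimodule.abelian_group_W[OF bimodule_comp])
    show "additive (E (j + 1)) (bim i (j + 2)) (\<lambda>v. m i (j + 1) (j + 2) a (vec (j + 1) v))"
      if "a \<in> carrier (bim i (j + 1))" for a
      using that by (auto intro!: additiveI simp: vec_add[of "j + 2"] D.mul_add_right)
    show "m i (j + 1) (j + 2) (ract (bim i (j + 1)) a c) (vec (j + 1) v) =
        m i (j + 1) (j + 2) a (vec (j + 1) (lact (E (j + 1)) c v))"
      if "a \<in> carrier (bim i (j + 1))" "c \<in> carrier (K (j + 1))" "v \<in> carrier (E (j + 1))" for a c v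
      using that by (simp add: vec_lact'[of "j + 2"] D.mul_assoc)
  qed (use D.mul_additive_left in auto)
  have ga: "additive (TT i j) (Dc i (j + 2)) g" using g(1) by simp
  have gp: "g (pt i j a (Y j) \<oplus>\<^bsub>TT i j\<^esub> pt i j a' (Y' j)) = m i (j + 1) (j + 2) a (vec (j + 1) (Y j)) \<oplus>\<^bsub>Dc i (j + 2)\<^esub>
      m i (j + 1) (j + 2) a' (vec (j + 1) (Y' j))" if "a \<in> carrier (Dc i (j + 1))" "a' \<in> carrier (Dc i (j + 1))" for a a'
    using that g(2) ptc by (simp add: additive_add[OF ga])
  obtain C C' where C: "additive (TT i j) (Dc i (j + 1)) C" "additive (TT i j) (Dc i (j + 1)) C'"
    "\<And>t. t \<in> carrier (TT i j) \<Longrightarrow> t = pt i j (C t) (Y j) \<oplus>\<^bsub>TT i j\<^esub> pt i j (C' t) (Y' j)"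
    by (rule TT_coordinates[of j i]) (rule that; blast)
  show thesis
  proof (rule that)
    show "bimodule_hom (K i) (K (j + 2)) (TT i j) (bim i (j + 2)) g"
    proof (rule bimodule_homI[OF TP.bimodule_tensor bimodule_comp g(1)])
      fix c t assume c: "c \<in> carrier (K i)" and t: "t \<in> carrier (TT i j)"
      show "g (lact (TT i j) c t) = lact (bim i (j + 2)) c (g t)"
        by (rule TP.tensor_hom_eq[OF bimodule.abelian_group_W[OF bimodule_comp] additive_compose[OF TP.tensor_lact(1)[OF c] g(1)]
              additive_compose[OF g(1) bimodule.lact_additive[OF bimodule_comp c]] _ t])
          (use c in \<open>simp add: TP.tensor_lact(2) g(2) D.mul_assoc\<close>)
    next
      fix c t assume c: "c \<in> carrier (K (j + 2))" and t: "t \<in> carrier (TT i j)"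
      show "g (ract (TT i j) t c) = ract (bim i (j + 2)) (g t) c"
        by (rule TP.tensor_hom_eq[OF bimodule.abelian_group_W[OF bimodule_comp] additive_compose[OF TP.tensor_ract(1)[OF c] g(1)]
              additive_compose[OF g(1) bimodule.ract_additive[OF bimodule_comp c]] _ t])
          (use c bimodule.ract_closed[OF bimodule_E2 c] in \<open>simp add: TP.tensor_ract(2) g(2) D.mul_assoc vec_ract'[of "j + 2"]\<close>)
    qed
    show "g (pt i j a v) = m i (j + 1) (j + 2) a (vec (j + 1) v)"
      if "a \<in> carrier (Dc i (j + 1))" "v \<in> carrier (E (j + 1))" for a v using that g(2) by simp
    show "g ` carrier (TT i j) = carrier (bim i (j + 2))"
    proof (intro equalityI subsetI)
      fix x assume "x \<in> carrier (bim i (j + 2))"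
      then obtain a a' where *: "a \<in> carrier (Dc i (j + 1))" "a' \<in> carrier (Dc i (j + 1))"
        "x = m i (j + 1) (j + 2) a (vec (j + 1) (Y j)) \<oplus>\<^bsub>Dc i (j + 2)\<^esub> m i (j + 1) (j + 2) a' (vec (j + 1) (Y' j))"
        using gen[of i j x] assms by auto
      then have "x = g (pt i j a (Y j) \<oplus>\<^bsub>TT i j\<^esub> pt i j a' (Y' j))" using gp by simp
      then show "x \<in> g ` carrier (TT i j)" using * ptc by (metis TP.T.a_closed dual.y_closed imageI)
    qed (use additive_closed[OF ga] in auto)
    show "emb i j ` carrier (bim i j) = {t \<in> carrier (TT i j). g t = \<zero>\<^bsub>bim i (j + 2)\<^esub>}"
    proof (intro equalityI subsetI)
      fix t assume "t \<in> emb i j ` carrier (bim i j)"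
      then obtain a where a: "a \<in> carrier (Dc i j)" "t = emb i j a" by auto
      \<comment> \<open>The zero is replaced by the relation X Y + X' Y', so that both sides become
        a X Y + a X' Y'.\<close>
      have "g t = m i j (j + 2) a (\<zero>\<^bsub>Dc j (j + 2)\<^esub>)"
        unfolding rel[of j, symmetric] a(2) emb_def using a(1) by (simp add: gp D.mul_assoc D.mul_add_right)
      then show "t \<in> {t \<in> carrier (TT i j). g t = \<zero>\<^bsub>bim i (j + 2)\<^esub>}"
        using a additive_closed[OF emb_additive, of a i j] by simp
    next
      fix t assume t: "t \<in> {t \<in> carrier (TT i j). g t = \<zero>\<^bsub>bim i (j + 2)\<^esub>}"
      then have tc: "t \<in> carrier (TT i j)" by simp
      note CC = additive_closed[OF C(1) tc] additive_closed[OF C(2) tc]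
      have "g (pt i j (C t) (Y j) \<oplus>\<^bsub>TT i j\<^esub> pt i j (C' t) (Y' j)) = \<zero>\<^bsub>Dc i (j + 2)\<^esub>" using t C(3)[OF tc] by simp
      then obtain b where "b \<in> carrier (Dc i j)" "C t = m i j (j + 1) b (vec j (X j))" "C' t = m i j (j + 1) b (vec j (X' j))"
        using ker[of i j "C t" "C' t"] assms CC gp[OF CC] by auto
      then show "t \<in> emb i j ` carrier (bim i j)"
        using C(3)[OF tc] by (intro image_eqI[of _ _ b]) (simp_all add: emb_def)
    qed
  qed
qed

lemma sc_bij: "bij_betw (sc i) (carrier (K i)) (carrier (Dc i i))"
  unfolding bij_betw_def
  using additive_inj_on[OF sc_additive K.abelian_group_axioms D.comp_abelian sc_inj] sc_onto
  by (auto simp: image_iff)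

lemma zero_neq_unit: "zunit D i \<noteq> \<zero>\<^bsub>Dc i i\<^esub>"
  using sc_inj[of "\<one>\<^bsub>K i\<^esub>" i] dual.field_L.one_not_zero[of i] by (auto simp: sc_one)

text \<open>Injectivity is the degree zero case of \<open>mul_vec_inj\<close>: a nonzero v with 1 v
  = 0 would force 1 = 0. Surjectivity comes from \<open>gen\<close>, whose coefficients are scalars
  in this degree.\<close>

lemma vec_bij: "bij_betw (vec i) (carrier (E i)) (carrier (Dc i (i + 1)))"
  unfolding bij_betw_def
proof (intro conjI equalityI subsetI)
  show "inj_on (vec i) (carrier (E i))"
  proof (rule additive_inj_on[OF vec_additive E.abelian_group_W D.comp_abelian])
    fix v assume v: "v \<in> carrier (E i)" "vec i v = \<zero>\<^bsub>Dc i (i + 1)\<^esub>"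
    show "v = \<zero>\<^bsub>E i\<^esub>"
    proof (rule ccontr)
      assume "v \<noteq> \<zero>\<^bsub>E i\<^esub>"
      then have "zunit D i = \<zero>\<^bsub>Dc i i\<^esub>"
        by (intro mul_vec_inj[OF order_refl _ v(1)]) (simp_all add: v D.unit_left)
      then show False using zero_neq_unit by simp
    qed
  qed
  fix x assume x: "x \<in> carrier (Dc i (i + 1))"
  have e: "i - 1 + 1 = i" "i - 1 + 2 = i + 1" by auto
  obtain a a' where a: "a \<in> carrier (Dc i i)" "a' \<in> carrier (Dc i i)"
    "x = m i i (i + 1) a (vec i (Y (i - 1))) \<oplus>\<^bsub>Dc i (i + 1)\<^esub> m i i (i + 1) a' (vec i (Y' (i - 1)))"
    using gen[of i "i - 1" x, unfolded e] x by auto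
  obtain c where "c \<in> carrier (K i)" "a = sc i c" using sc_onto[OF a(1)] by blast
  moreover obtain c' where "c' \<in> carrier (K i)" "a' = sc i c'" using sc_onto[OF a(2)] by blast
  ultimately have c: "c \<in> carrier (K i)" "a = sc i c" "c' \<in> carrier (K i)" "a' = sc i c'" by auto
  have y: "Y (i - 1) \<in> carrier (E i)" "Y' (i - 1) \<in> carrier (E i)"
    using dual.y_closed[of "i - 1"] by simp_all
  have "x = vec i (lact (E i) c (Y (i - 1)) \<oplus>\<^bsub>E i\<^esub> lact (E i) c' (Y' (i - 1)))"
    using a(3) c y by (simp add: vec_add[of "i + 1"] vec_lact)
  then show "x \<in> vec i ` carrier (E i)" using c y by auto
qed auto

section \<open>Dimensions\<close>

lemma dim_scalars:
  "has_dim (K i) (left_module (bim i i)) 1" "has_dim (K i) (right_module (bim i i)) 1"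
proof -
  define \<kappa> where "\<kappa> = inv_into (carrier (K i)) (sc i)"
  have \<kappa>: "\<kappa> (sc i a) = a" if "a \<in> carrier (K i)" for a
    using sc_bij[of i] that by (simp add: \<kappa>_def bij_betw_def)
  have \<kappa>_add: "additive (Dc i i) (K i) \<kappa>"
    by (intro additiveI) (auto dest!: sc_onto simp: \<kappa> simp flip: sc_add)
  interpret B: bimodule "K i" "K i" "bim i i" by (rule bimodule_comp)
  interpret L: module "K i" "left_module (bim i i)" by (rule B.left)
  interpret R: module "K i" "right_module (bim i i)" by (rule B.right)
  have "basis_family (K i) (left_module (bim i i)) {0::nat} (\<lambda>_. zunit D i) (\<lambda>_. \<kappa>)"
    unfolding basis_family_def
    using \<kappa>_add by (auto dest!: sc_onto simp: \<kappa> sc_one[symmetric] simp flip: sc_mult)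
  from has_dim_if_basis_family[OF dual.field_L.field_axioms B.left this]
  show "has_dim (K i) (left_module (bim i i)) 1" by simp
  have "basis_family (K i) (right_module (bim i i)) {0::nat} (\<lambda>_. zunit D i) (\<lambda>_. \<kappa>)"
    unfolding basis_family_def
    using \<kappa>_add by (auto dest!: sc_onto simp: \<kappa> sc_one[symmetric] K.m_comm simp flip: sc_mult)
  from has_dim_if_basis_family[OF dual.field_L.field_axioms B.right this]
  show "has_dim (K i) (right_module (bim i i)) 1" by simp
qed

lemma dim_vectors:
  assumes "rank_two_bimodule (K i) (K (i + 1)) (E i)"
  shows "has_dim (K i) (left_module (bim i (i + 1))) 2" "has_dim (K (i + 1)) (right_module (bim i (i + 1))) 2"
proof -
  have "rank_two_bimodule (K i) (K (i + 1)) (bim i (i + 1))"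
    by (rule rank_two_transfer[OF assms dual.field_L.field_axioms dual.field_L.field_axioms, of "vec i"])
      (use vec_bij in \<open>auto simp: vec_zero vec_add[of "i + 1"] vec_lact vec_ract\<close>)
  then show "has_dim (K i) (left_module (bim i (i + 1))) 2" "has_dim (K (i + 1)) (right_module (bim i (i + 1))) 2"
    by (simp_all add: rank_two_bimodule_def)
qed

text \<open>The dimensions satisfy d(j+2) = 2 d(j+1) - d(j) on either side. On the right the first
  term is a space over K_{j+2}, which is K_j.\<close>

lemma dim_step:
  assumes rank: "rank_two_bimodule (K (j + 1)) (K (j + 2)) (E (j + 1))" and ij: "i \<le> j"
    and "has_dim (K i) (left_module (bim i j)) n" "has_dim (K j) (right_module (bim i j)) n"
    and "has_dim (K i) (left_module (bim i (j + 1))) k" "has_dim (K (j + 1)) (right_module (bim i (j + 1))) k"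
  shows "has_dim (K i) (left_module (bim i (j + 2))) (k * 2 - n)"
    "has_dim (K (j + 2)) (right_module (bim i (j + 2))) (k * 2 - n)"
proof -
  note [simp del] = TP.tensor_group
  have E: "has_dim (K (j + 1)) (left_module (E (j + 1))) 2" "has_dim (K (j + 2)) (right_module (E (j + 1))) 2"
    using rank by (simp_all add: rank_two_bimodule_def)
  have TT: "has_dim (K i) (left_module (TT i j)) (k * 2)" "has_dim (K (j + 2)) (right_module (TT i j)) (k * 2)"
    by (intro TP.tensor_left_dim TP.tensor_right_dim dual.field_L.field_axioms assms E)+
  obtain g where g: "bimodule_hom (K i) (K (j + 2)) (TT i j) (bim i (j + 2)) g"
    "g ` carrier (TT i j) = carrier (bim i (j + 2))"
    "emb i j ` carrier (bim i j) = {t \<in> carrier (TT i j). g t = \<zero>\<^bsub>bim i (j + 2)\<^esub>}"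
    by (rule TT_multiplication[OF ij]) blast
  have ga: "additive (TT i j) (Dc i (j + 2)) g"
    and gl: "\<And>a x. a \<in> carrier (K i) \<Longrightarrow> x \<in> carrier (TT i j) \<Longrightarrow> g (lact (TT i j) a x) = lact (bim i (j + 2)) a (g x)"
    and gr: "\<And>a x. a \<in> carrier (K (j + 2)) \<Longrightarrow> x \<in> carrier (TT i j) \<Longrightarrow> g (ract (TT i j) x a) = ract (bim i (j + 2)) (g x) a"
    using g(1) by (auto simp: bimodule_hom_def module_hom_def intro!: additiveI)
  interpret B: bimodule "K i" "K (j + 2)" "bim i (j + 2)" by (rule bimodule_comp)
  show "has_dim (K i) (left_module (bim i (j + 2))) (k * 2 - n)"
    by (rule has_dim_exact[OF dual.field_L.field_axioms assms(3) TT(1) B.left, of "emb i j" g])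
      (use emb_additive[of i j] emb_lact[of _ i _ j] emb_inj[OF ij] ga gl g(2,3) in auto)
  have "has_dim (K (j + 2)) (right_module (bim i j)) n" using assms(4) by (simp add: period)
  then show "has_dim (K (j + 2)) (right_module (bim i (j + 2))) (k * 2 - n)"
    by (rule has_dim_exact[OF dual.field_L.field_axioms _ TT(2) B.right, of _ _ "emb i j" g])
      (use emb_additive[of i j] emb_ract[of _ j _ i] emb_inj[OF ij] ga gr g(2,3) in auto)
qed

lemma dimensions:
  assumes rank: "\<And>i. rank_two_bimodule (K i) (K (i + 1)) (E i)" and "i \<le> j"
  shows "has_dim (K i) (left_module (bim i j)) (nat (j - i + 1))"
    "has_dim (K j) (right_module (bim i j)) (nat (j - i + 1))"
proof -
  have rank2: "rank_two_bimodule (K (j + 1)) (K (j + 2)) (E (j + 1))" for j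
    using rank[of "j + 1"] by (simp add: add.assoc)
  \<comment> \<open>The recursion has order two, so two consecutive degrees are carried along,
    starting from 1 and 2; the step is 2(n + 2) - (n + 1) = n + 3.\<close>
  have "has_dim (K i) (left_module (bim i (i + int n))) (n + 1) \<and>
      has_dim (K (i + int n)) (right_module (bim i (i + int n))) (n + 1) \<and>
      has_dim (K i) (left_module (bim i (i + int n + 1))) (n + 2) \<and>
      has_dim (K (i + int n + 1)) (right_module (bim i (i + int n + 1))) (n + 2)" for n
  proof (induction n)
    case 0
    then show ?case using dim_scalars[of i] dim_vectors[OF rank, of i] by (simp add: numeral_2_eq_2)
  next
    case (Suc n)
    have e: "i + int (Suc n) = i + int n + 1" "i + int n + 1 + 1 = i + int n + 2" "Suc n + 1 = n + 2"
      "Suc n + 2 = (n + 2) * 2 - (n + 1)" by auto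
    show ?case
      unfolding e using Suc dim_step[OF rank2, of i "i + int n" "n + 1" "n + 2"] by simp
  qed
  from this[of "nat (j - i)"] show "has_dim (K i) (left_module (bim i j)) (nat (j - i + 1))"
    "has_dim (K j) (right_module (bim i j)) (nat (j - i + 1))"
    using assms(2) by (simp_all add: nat_add_distrib)
qed

end

section \<open>The exact sequence of projective modules\<close>

lemma RDirProd_simps [simp]:
  "carrier (RDirProd G H) = carrier G \<times> carrier H" "\<zero>\<^bsub>RDirProd G H\<^esub> = (\<zero>\<^bsub>G\<^esub>, \<zero>\<^bsub>H\<^esub>)"
  "x \<oplus>\<^bsub>RDirProd G H\<^esub> y = (fst x \<oplus>\<^bsub>G\<^esub> fst y, snd x \<oplus>\<^bsub>H\<^esub> snd y)"
  by (auto simp: RDirProd_def DirProd_def monoid.defs ring.defs split: prod.splits)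

lemma abelian_group_RDirProd:
  assumes "abelian_group G" "abelian_group H"
  shows "abelian_group (RDirProd G H)"
proof -
  interpret G: abelian_group G by fact
  interpret H: abelian_group H by fact
  have "\<exists>y\<in>carrier (RDirProd G H). y \<oplus>\<^bsub>RDirProd G H\<^esub> x = \<zero>\<^bsub>RDirProd G H\<^esub>" if "x \<in> carrier (RDirProd G H)" for x
    using that by (intro bexI[of _ "(\<ominus>\<^bsub>G\<^esub> fst x, \<ominus>\<^bsub>H\<^esub> snd x)"]) (auto simp: G.l_neg H.l_neg)
  then show ?thesis
    by (intro abelian_groupI) (auto simp: G.a_assoc H.a_assoc intro: G.a_comm H.a_comm)
qed

lemma (in zalgebra) zmodule_proj_module: "zmodule D (proj_module D j)"
  by (intro zmodule.intro zmodule_axioms.intro zalgebra_axioms)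
    (simp_all add: proj_module_def comp_abelian mul_add_left mul_add_right mul_assoc unit_left)

lemma zmodule_zmod_sum:
  assumes "zmodule D M" "zmodule D N"
  shows "zmodule D (zmod_sum M N)"
proof -
  interpret M: zmodule D M by fact
  interpret N: zmodule D N by fact
  show ?thesis
    by (intro zmodule.intro zmodule_axioms.intro M.zalgebra_axioms)
      (auto simp: zmod_sum_def abelian_group_RDirProd M.mcomp_abelian N.mcomp_abelian M.act_closed N.act_closed
        M.act_add_left N.act_add_left M.act_add_right N.act_add_right M.act_assoc N.act_assoc M.act_unit N.act_unit)
qed

lemma (in zalgebra) zmodule_simple_module:
  assumes lower: "\<And>i j x. j < i \<Longrightarrow> x \<in> carrier (zcomp D i j) \<Longrightarrow> x = \<zero>\<^bsub>zcomp D i j\<^esub>"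
  shows "zmodule D (simple_module D j)"
proof (intro zmodule.intro zmodule_axioms.intro zalgebra_axioms)
  have zero_group: "abelian_group ((zcomp D i j)\<lparr>carrier := {\<zero>\<^bsub>zcomp D i j\<^esub>}\<rparr>)" for i
    by (rule abelian_groupI) auto
  show "abelian_group (mcomp (simple_module D j) i)" for i
    using comp_abelian[of j j] zero_group[of i] by (auto simp: simple_module_def)
  fix i k l x y v
  assume *: "x \<in> carrier (zcomp D i k)" "y \<in> carrier (zcomp D k l)" "v \<in> carrier (mcomp (simple_module D j) l)"
  show "mact (simple_module D j) i l (zmul D i k l x y) v = mact (simple_module D j) i k x (mact (simple_module D j) k l y v)"
  proof (cases "i = j \<and> l = j \<and> k \<noteq> j")
    case True
    \<comment> \<open>Passing from degree \<open>j\<close> through another degree and back gives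
      zero, as one of the two factors lies below the diagonal. Hence cutting the action down to
      degree \<open>j\<close> stays associative.\<close>
    then have "x = \<zero>\<^bsub>zcomp D i k\<^esub> \<or> y = \<zero>\<^bsub>zcomp D k l\<^esub>"
      using lower[of k i x] lower[of l k y] * by (cases "k < j") auto
    then have "zmul D i k l x y = \<zero>\<^bsub>zcomp D i l\<^esub>" using * by auto
    then show ?thesis using True * by (auto simp: simple_module_def)
  next
    case False
    then show ?thesis using * by (auto simp: simple_module_def mul_assoc split: if_splits)
  qed
qed (auto simp: simple_module_def mul_add_left mul_add_right unit_left split: if_splits)

context koszul begin

text \<open>The maps are right multiplication by the pair X_j, X'_j and by the pair Y_j, Y'_j, which
  commute with left multiplication. Exactness is checked degree by degree from \<open>ker\<close>,
  \<open>gen\<close> and injectivity; everything outside the triangle vanishes by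
  \<open>lower\<close>.\<close>

lemma exact_projectives:
  "\<exists>f g. exact_zmodules D (proj_module D j) f (zmod_sum (proj_module D (j + 1)) (proj_module D (j + 1))) g
    (proj_module D (j + 2)) (simple_proj D (j + 2)) (simple_module D (j + 2))"
proof (intro exI)
  let ?P = "proj_module D" and ?S = "zmod_sum (proj_module D (j + 1)) (proj_module D (j + 1))"
  let ?f = "\<lambda>i a. (m i j (j + 1) a (vec j (X j)), m i j (j + 1) a (vec j (X' j)))"
  let ?g = "\<lambda>i p. m i (j + 1) (j + 2) (fst p) (vec (j + 1) (Y j)) \<oplus>\<^bsub>Dc i (j + 2)\<^esub>
    m i (j + 1) (j + 2) (snd p) (vec (j + 1) (Y' j))"
  have mP [simp]: "mcomp (?P l) i = Dc i l" "mact (?P l) i k = m i k l" for i k l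
    by (simp_all add: proj_module_def)
  have mS [simp]: "mcomp ?S i = RDirProd (Dc i (j + 1)) (Dc i (j + 1))"
    "mact ?S i k x p = (m i k (j + 1) x (fst p), m i k (j + 1) x (snd p))" for i k x p
    by (simp_all add: zmod_sum_def proj_module_def split: prod.splits)
  have mM: "mcomp (simple_module D (j + 2)) i = (if i = j + 2 then Dc i i else (Dc i (j + 2))\<lparr>carrier := {\<zero>\<^bsub>Dc i (j + 2)\<^esub>}\<rparr>)"
    "mact (simple_module D (j + 2)) i l x v = (if i = j + 2 \<and> l = j + 2 then m i i i x v else \<zero>\<^bsub>Dc i (j + 2)\<^esub>)" for i l x v
    by (simp_all add: simple_module_def)
  have zP: "zmodule D (?P l)" for l by (rule D.zmodule_proj_module)
  have zS: "zmodule D ?S" by (rule zmodule_zmod_sum[OF zP zP])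
  have zM: "zmodule D (simple_module D (j + 2))" by (rule D.zmodule_simple_module[OF lower])
  have f: "zmodule_hom D (?P j) ?S ?f"
    unfolding zmodule_hom_def add_hom_iff_additive
    using zP zS by (auto intro!: additiveI simp: D.mul_add_left D.mul_assoc)
  have g: "zmodule_hom D ?S (?P (j + 2)) ?g"
    unfolding zmodule_hom_def add_hom_iff_additive
    using zP zS by (auto intro!: additiveI simp: D.mul_add_left D.mul_add_right D.mul_assoc D.C.a_ac)
  have h: "zmodule_hom D (?P (j + 2)) (simple_module D (j + 2)) (simple_proj D (j + 2))"
    unfolding zmodule_hom_def add_hom_iff_additive
  proof (intro conjI allI ballI zP zM)
    show "additive (mcomp (?P (j + 2)) i) (mcomp (simple_module D (j + 2)) i) (simple_proj D (j + 2) i)" for i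
      by (auto intro!: additiveI simp: mM simple_proj_def)
    fix i l x v assume *: "x \<in> carrier (Dc i l)" "v \<in> carrier (mcomp (?P (j + 2)) l)"
    show "simple_proj D (j + 2) i (mact (?P (j + 2)) i l x v) =
        mact (simple_module D (j + 2)) i l x (simple_proj D (j + 2) l v)"
    proof (cases "i = j + 2 \<and> l \<noteq> j + 2")
      case True
      then have "x = \<zero>\<^bsub>Dc i l\<^esub> \<or> v = \<zero>\<^bsub>Dc l (j + 2)\<^esub>"
        using lower[of l i x] lower[of "j + 2" l v] * by (cases "l < j + 2") auto
      then have "m i l (j + 2) x v = \<zero>\<^bsub>Dc i (j + 2)\<^esub>" using * by auto
      then show ?thesis using True by (auto simp: mM simple_proj_def)
    next
      case False
      then show ?thesis by (auto simp: mM simple_proj_def)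
    qed
  qed
  have exact_f: "inj_on (?f i) (carrier (Dc i j))" for i
  proof (cases "i \<le> j")
    case True
    have "inj_on (\<lambda>a. m i j (j + 1) a (vec j (X j))) (carrier (Dc i j))"
      by (rule additive_inj_on[OF D.mul_additive_left D.comp_abelian D.comp_abelian])
        (use mul_vec_inj[OF True _ _ X_nonzero] in auto)
    then show ?thesis by (auto simp: inj_on_def)
  next
    case False
    then show ?thesis using lower[of j i] by (auto simp: inj_on_def)
  qed
  have exact_S: "?f i ` carrier (Dc i j) = a_kernel (mcomp ?S i) (Dc i (j + 2)) (?g i)" for i
  proof (intro equalityI subsetI)
    fix p assume "p \<in> ?f i ` carrier (Dc i j)"
    then obtain a where a: "a \<in> carrier (Dc i j)" "p = ?f i a" by blast
    have "?g i p = m i j (j + 2) a \<zero>\<^bsub>Dc j (j + 2)\<^esub>"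
      unfolding rel[of j, symmetric] a(2) using a(1) by (simp add: D.mul_assoc D.mul_add_right)
    then show "p \<in> a_kernel (mcomp ?S i) (Dc i (j + 2)) (?g i)" using a by (simp add: a_kernel_def')
  next
    fix p assume "p \<in> a_kernel (mcomp ?S i) (Dc i (j + 2)) (?g i)"
    then have p: "fst p \<in> carrier (Dc i (j + 1))" "snd p \<in> carrier (Dc i (j + 1))" "?g i p = \<zero>\<^bsub>Dc i (j + 2)\<^esub>"
      by (auto simp: a_kernel_def')
    show "p \<in> ?f i ` carrier (Dc i j)"
    proof (cases "i \<le> j + 1")
      case True
      then obtain b where "b \<in> carrier (Dc i j)" "fst p = m i j (j + 1) b (vec j (X j))" "snd p = m i j (j + 1) b (vec j (X' j))"
        using ker[OF True p] by blast
      then show ?thesis by (intro image_eqI[of _ _ b]) (auto simp: prod_eq_iff)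
    next
      case False
      then have "p = (\<zero>\<^bsub>Dc i (j + 1)\<^esub>, \<zero>\<^bsub>Dc i (j + 1)\<^esub>)"
        using lower[OF _ p(1)] lower[OF _ p(2)] by (simp add: prod_eq_iff)
      then show ?thesis by (intro image_eqI[of _ _ "\<zero>\<^bsub>Dc i j\<^esub>"]) auto
    qed
  qed
  have exact_P: "?g i ` carrier (mcomp ?S i) =
      a_kernel (Dc i (j + 2)) (mcomp (simple_module D (j + 2)) i) (simple_proj D (j + 2) i)" for i
  proof (cases "i \<le> j + 1")
    case True
    have "a_kernel (Dc i (j + 2)) (mcomp (simple_module D (j + 2)) i) (simple_proj D (j + 2) i) = carrier (Dc i (j + 2))"
      using True by (auto simp: a_kernel_def' mM simple_proj_def)
    moreover have "?g i ` carrier (mcomp ?S i) = carrier (Dc i (j + 2))"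
    proof (intro equalityI subsetI)
      fix x assume "x \<in> carrier (Dc i (j + 2))"
      then obtain a a' where "a \<in> carrier (Dc i (j + 1))" "a' \<in> carrier (Dc i (j + 1))"
        "x = m i (j + 1) (j + 2) a (vec (j + 1) (Y j)) \<oplus>\<^bsub>Dc i (j + 2)\<^esub> m i (j + 1) (j + 2) a' (vec (j + 1) (Y' j))"
        using gen[OF True] by blast
      then show "x \<in> ?g i ` carrier (mcomp ?S i)" by (intro image_eqI[of _ _ "(a, a')"]) auto
    qed auto
    ultimately show ?thesis by simp
  next
    case False
    \<comment> \<open>For \<open>i > j + 1\<close> the image is zero. The kernel is zero as well:
      for \<open>i = j + 2\<close> the projection is the identity, and beyond that its source
      vanishes.\<close>
    have zero: "x = \<zero>\<^bsub>Dc i (j + 1)\<^esub>" if "x \<in> carrier (Dc i (j + 1))" for x using lower[OF _ that] False by simp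
    have "?g i ` carrier (mcomp ?S i) = {\<zero>\<^bsub>Dc i (j + 2)\<^esub>}"
    proof (intro equalityI subsetI)
      fix x assume "x \<in> ?g i ` carrier (mcomp ?S i)"
      then obtain p where p: "fst p \<in> carrier (Dc i (j + 1))" "snd p \<in> carrier (Dc i (j + 1))" "x = ?g i p" by auto
      show "x \<in> {\<zero>\<^bsub>Dc i (j + 2)\<^esub>}" unfolding p(3) zero[OF p(1)] zero[OF p(2)] by simp
    next
      fix x assume "x \<in> {\<zero>\<^bsub>Dc i (j + 2)\<^esub>}"
      then show "x \<in> ?g i ` carrier (mcomp ?S i)"
        by (intro image_eqI[of _ _ "(\<zero>\<^bsub>Dc i (j + 1)\<^esub>, \<zero>\<^bsub>Dc i (j + 1)\<^esub>)"]) auto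
    qed
    moreover have "a_kernel (Dc i (j + 2)) (mcomp (simple_module D (j + 2)) i) (simple_proj D (j + 2) i) = {\<zero>\<^bsub>Dc i (j + 2)\<^esub>}"
      using False lower[of "j + 2" i] by (cases "i = j + 2") (auto simp: a_kernel_def' mM simple_proj_def)
    ultimately show ?thesis by simp
  qed
  have exact_M: "simple_proj D (j + 2) i ` carrier (Dc i (j + 2)) = carrier (mcomp (simple_module D (j + 2)) i)" for i
    by (auto simp: mM simple_proj_def image_iff)
  show "exact_zmodules D (?P j) ?f ?S ?g (?P (j + 2)) (simple_proj D (j + 2)) (simple_module D (j + 2))"
    unfolding exact_zmodules_def using f g h exact_f exact_S exact_P exact_M by simp
qed

end

section \<open>The ideal of relations\<close>

lemma additive_subgroup_image:
  assumes "abelian_group G" "abelian_group H" "additive G H f" "additive_subgroup N G"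
  shows "additive_subgroup (f ` N) H"
proof (rule additive_subgroup.intro)
  interpret G: abelian_group G by fact
  interpret H: abelian_group H by fact
  interpret N: additive_subgroup N G by fact
  have neg: "\<ominus>\<^bsub>G\<^esub> x \<in> N" if "x \<in> N" for x
    using subgroup.m_inv_closed[OF N.a_subgroup that] by (simp add: a_inv_def)
  show "subgroup (f ` N) (add_monoid H)"
  proof (rule H.add.subgroupI)
    show "f ` N \<subseteq> carrier H" using additive_closed[OF assms(3)] N.a_subset by auto
    show "f ` N \<noteq> {}" using imageI[OF N.zero_closed, of f] by blast
    show "\<ominus>\<^bsub>H\<^esub> a \<in> f ` N" if a: "a \<in> f ` N" for a
    proof -
      obtain x where x: "x \<in> N" "a = f x" using a by blast
      have "\<ominus>\<^bsub>H\<^esub> a = f (\<ominus>\<^bsub>G\<^esub> x)"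
        unfolding x(2) by (rule additive_neg[OF assms(3,1,2), symmetric]) (rule subsetD[OF N.a_subset x(1)])
      then show ?thesis using neg[OF x(1)] by blast
    qed
    show "a \<oplus>\<^bsub>H\<^esub> b \<in> f ` N" if a: "a \<in> f ` N" and b: "b \<in> f ` N" for a b
    proof -
      obtain x y where x: "x \<in> N" "y \<in> N" "a = f x" "b = f y" using a b by blast
      have "a \<oplus>\<^bsub>H\<^esub> b = f (x \<oplus>\<^bsub>G\<^esub> y)"
        unfolding x(3,4) by (rule additive_add[OF assms(3), symmetric]) (use N.a_subset x in blast)+
      then show ?thesis using N.a_closed[OF x(1,2)] by blast
    qed
  qed
qed

lemma (in abelian_group) eq_if_diff_zero:
  assumes "x \<in> carrier G" "y \<in> carrier G" "x \<ominus> y = \<zero>"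
  shows "x = y"
proof -
  have "x = (x \<ominus> y) \<oplus> y" using assms(1,2) by (simp add: a_minus_def a_assoc l_neg)
  also have "\<dots> = y" unfolding assms(3) using assms(2) by simp
  finally show ?thesis .
qed

lemma generate_additive_eq:
  assumes "abelian_group G" "additive_subgroup H G" "S \<subseteq> H" "H \<subseteq> generate (add_monoid G) S"
  shows "generate (add_monoid G) S = H"
  using group.generate_subgroup_incl[OF abelian_group.a_group[OF assms(1)] assms(3) additive_subgroup.a_subgroup[OF assms(2)]]
    assms(4) by blast

context dual_chain begin

definition R :: "int \<Rightarrow> int \<Rightarrow> ('k \<times> 'v list \<Rightarrow>\<^sub>0 int) set set"
  where "R = gen_zideal T (\<lambda>i j. if j = i + 2 then quad i else {})"

lemma quad_carrier: "quad i \<subseteq> carrier (Tc i (i + 2))"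
  unfolding quad_eq by auto

lemma zideal_R: "zideal T R"
  unfolding R_def using quad_carrier by (intro zideal_gen_zideal[OF zalgebra_T]) auto

lemma quad_subset_R: "quad i \<subseteq> R i (i + 2)"
  using zideal_gen_zideal(2)[OF zalgebra_T, of "\<lambda>i j. if j = i + 2 then quad i else {}" i "i + 2"] quad_carrier
  unfolding R_def by auto

lemma R_minimal: "zideal T I \<Longrightarrow> (\<And>i. quad i \<subseteq> I i (i + 2)) \<Longrightarrow> R i j \<subseteq> I i j"
  unfolding R_def using quad_carrier by (intro zideal_gen_zideal(3)[OF zalgebra_T]) auto

sublocale Q: zquotient T R
  by (intro zquotient.intro zquotient_axioms.intro zalgebra_T zideal_R)

lemma q_in_quad: "q i \<in> quad i"
  unfolding quad_eq mem_Collect_eq by (rule exI[of _ "\<one>\<^bsub>K i\<^esub>"]) (simp add: T.sc_one T.unit_left)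

lemma mul_q: "t \<in> carrier (Tc i j) \<Longrightarrow>
    mul i j (j + 2) t (q j) = two i j (mul i j (j + 1) t (vec j (X j))) (mul i j (j + 1) t (vec j (X' j)))"
  by (simp add: q_def T.mul_add_right T.mul_assoc)

lemma two_add:
  assumes "u \<in> carrier (Tc i (j + 1))" "u' \<in> carrier (Tc i (j + 1))" "v \<in> carrier (Tc i (j + 1))" "v' \<in> carrier (Tc i (j + 1))"
  shows "two i j (u \<oplus>\<^bsub>Tc i (j + 1)\<^esub> v) (u' \<oplus>\<^bsub>Tc i (j + 1)\<^esub> v') = two i j u u' \<oplus>\<^bsub>Tc i (j + 2)\<^esub> two i j v v'"
  using assms by (simp add: T.mul_add_left Tc.a_ac)

lemma two_inj:
  assumes "i \<le> j + 1" "u \<in> carrier (Tc i (j + 1))" "u' \<in> carrier (Tc i (j + 1))" "v \<in> carrier (Tc i (j + 1))" "v' \<in> carrier (Tc i (j + 1))"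
    and eq: "two i j u u' = two i j v v'"
  shows "u = v" "u' = v'"
proof -
  have "two i j (u \<ominus>\<^bsub>Tc i (j + 1)\<^esub> v) (u' \<ominus>\<^bsub>Tc i (j + 1)\<^esub> v') = two i j u u' \<ominus>\<^bsub>Tc i (j + 2)\<^esub> two i j v v'"
    using assms(2-5) by (simp add: T.mul_diff_left Tc.add_diff_add)
  also have "\<dots> = \<zero>\<^bsub>Tc i (j + 2)\<^esub>" using assms(2-5) unfolding eq by simp
  finally have "u \<ominus>\<^bsub>Tc i (j + 1)\<^esub> v = \<zero>\<^bsub>Tc i (j + 1)\<^esub>" "u' \<ominus>\<^bsub>Tc i (j + 1)\<^esub> v' = \<zero>\<^bsub>Tc i (j + 1)\<^esub>" using T_free[OF assms(1), of "u \<ominus>\<^bsub>Tc i (j + 1)\<^esub> v" "u' \<ominus>\<^bsub>Tc i (j + 1)\<^esub> v'"] assms(2-5) by simp_all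
  then show "u = v" "u' = v'" using assms(2-5) Tc.eq_if_diff_zero by blast+
qed

lemma mul_q_sc:
  assumes "t \<in> carrier (Tc i j)" "a \<in> carrier (K j)"
  shows "mul i (j + 2) (j + 2) (mul i j (j + 2) t (q j)) (sc (j + 2) a) = mul i j (j + 2) (mul i j j t (sc j a)) (q j)"
  using assms T.sc_closed[of a "j + 2"] by (simp add: T.mul_assoc q_central period)

text \<open>The degree \<open>i, j + 2\<close> part of \<open>R\<close> is \<open>R\<^bsub>i,j+1\<^esub> \<otimes> E\<^bsub>j+1\<^esub> + T\<^bsub>ij\<^esub> \<otimes> Q\<^sub>j\<close>: these sums already form an ideal.\<close>

definition J :: "int \<Rightarrow> int \<Rightarrow> ('k \<times> 'v list \<Rightarrow>\<^sub>0 int) set set"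
  where "J i j = {two i j r r' \<oplus>\<^bsub>Tc i (j + 2)\<^esub> mul i j (j + 2) t (q j) | r r' t.
    r \<in> R i (j + 1) \<and> r' \<in> R i (j + 1) \<and> t \<in> carrier (Tc i j)}"

definition I :: "int \<Rightarrow> int \<Rightarrow> ('k \<times> 'v list \<Rightarrow>\<^sub>0 int) set set"
  where "I i l = (if l < i + 2 then {\<zero>\<^bsub>Tc i l\<^esub>} else J i (l - 2))"

lemma J_I: "r \<in> R i (j + 1) \<Longrightarrow> r' \<in> R i (j + 1) \<Longrightarrow> t \<in> carrier (Tc i j) \<Longrightarrow>
    two i j r r' \<oplus>\<^bsub>Tc i (j + 2)\<^esub> mul i j (j + 2) t (q j) \<in> J i j"
  unfolding J_def by blast

lemma J_subset_R: "J i j \<subseteq> R i (j + 2)"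
proof
  fix x assume "x \<in> J i j"
  then obtain r r' t where *: "x = two i j r r' \<oplus>\<^bsub>Tc i (j + 2)\<^esub> mul i j (j + 2) t (q j)"
    "r \<in> R i (j + 1)" "r' \<in> R i (j + 1)" "t \<in> carrier (Tc i j)" unfolding J_def by blast
  have "q j \<in> R j (j + 2)" using q_in_quad quad_subset_R by blast
  then show "x \<in> R i (j + 2)"
    unfolding *(1) using * by (intro Q.ideal_add Q.ideal_right[of _ i "j + 1"] Q.ideal_left[of t i j]) auto
qed

lemma additive_subgroup_J: "additive_subgroup (J i j) (Tc i (j + 2))"
proof (rule additive_subgroup.intro, rule Tc.add.subgroupI)
  note Rc = Q.ideal_carrier
  show "J i j \<subseteq> carrier (Tc i (j + 2))" using J_subset_R Rc by blast
  show "J i j \<noteq> {}" using J_I[OF Q.ideal_zero Q.ideal_zero Tc.zero_closed, of i j] by blast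
  show "\<ominus>\<^bsub>Tc i (j + 2)\<^esub> x \<in> J i j" if "x \<in> J i j" for x
  proof -
    obtain r r' t where *: "x = two i j r r' \<oplus>\<^bsub>Tc i (j + 2)\<^esub> mul i j (j + 2) t (q j)"
      "r \<in> R i (j + 1)" "r' \<in> R i (j + 1)" "t \<in> carrier (Tc i j)" using \<open>x \<in> J i j\<close> unfolding J_def by blast
    have "\<ominus>\<^bsub>Tc i (j + 2)\<^esub> x = two i j (\<ominus>\<^bsub>Tc i (j + 1)\<^esub> r) (\<ominus>\<^bsub>Tc i (j + 1)\<^esub> r') \<oplus>\<^bsub>Tc i (j + 2)\<^esub> mul i j (j + 2) (\<ominus>\<^bsub>Tc i j\<^esub> t) (q j)"
      using * Rc by (simp add: T.mul_neg_left Tc.minus_add)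
    then show ?thesis using J_I Q.ideal_neg * by simp
  qed
  show "x \<oplus>\<^bsub>Tc i (j + 2)\<^esub> y \<in> J i j" if x: "x \<in> J i j" and y: "y \<in> J i j" for x y
  proof -
    obtain r r' t where *: "x = two i j r r' \<oplus>\<^bsub>Tc i (j + 2)\<^esub> mul i j (j + 2) t (q j)"
      "r \<in> R i (j + 1)" "r' \<in> R i (j + 1)" "t \<in> carrier (Tc i j)" using x unfolding J_def by blast
    obtain s s' u where **: "y = two i j s s' \<oplus>\<^bsub>Tc i (j + 2)\<^esub> mul i j (j + 2) u (q j)"
      "s \<in> R i (j + 1)" "s' \<in> R i (j + 1)" "u \<in> carrier (Tc i j)" using y unfolding J_def by blast
    have "x \<oplus>\<^bsub>Tc i (j + 2)\<^esub> y = two i j (r \<oplus>\<^bsub>Tc i (j + 1)\<^esub> s) (r' \<oplus>\<^bsub>Tc i (j + 1)\<^esub> s') \<oplus>\<^bsub>Tc i (j + 2)\<^esub> mul i j (j + 2) (t \<oplus>\<^bsub>Tc i j\<^esub> u) (q j)"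
      using * ** Rc by (simp add: T.mul_add_left Tc.a_ac)
    then show ?thesis using J_I Q.ideal_add * ** by simp
  qed
qed

lemma I_zero: "\<zero>\<^bsub>Tc i l\<^esub> \<in> I i l"
  using additive_subgroup.zero_closed[OF additive_subgroup_J, of i "l - 2"] by (simp add: I_def)

lemma I_subset_R: "I i l \<subseteq> R i l"
  using J_subset_R[of i "l - 2"] Q.ideal_zero by (auto simp: I_def)

text \<open>Left multiplication preserves both summands of \<open>J\<close>. For right
  multiplication by \<open>y\<close>: if \<open>y\<close> has positive degree, it is u Y + u' Y',
  and x u, x u' already lie in \<open>R\<close>, so the product falls into the first summand; if
  \<open>y\<close> is a scalar, the last letters are expanded anew and q is central.\<close>

lemma zideal_I: "zideal T I"
  unfolding zideal_def
proof (intro conjI allI ballI)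
  note Rc = Q.ideal_carrier
  show "additive_subgroup (I i j) (Tc i j)" for i j
    using additive_subgroup_J[of i "j - 2"] Tc.add.triv_subgroup[of i j]
    by (auto simp: I_def additive_subgroup_def)
  show "mul i j l x y \<in> I i l" if x: "x \<in> carrier (Tc i j)" and y: "y \<in> I j l" for i j l x y
  proof (cases "l < j + 2 \<or> j < i")
    case True
    then have "x = \<zero>\<^bsub>Tc i j\<^esub> \<or> y = \<zero>\<^bsub>Tc j l\<^esub>" using x y T_lower by (auto simp: I_def)
    moreover have "y \<in> carrier (Tc j l)" using y I_subset_R Rc by blast
    ultimately have "mul i j l x y = \<zero>\<^bsub>Tc i l\<^esub>" using x by auto
    then show ?thesis using I_zero by simp
  next
    case False
    define k where "k = l - 2"
    have l: "l = k + 2" by (simp add: k_def)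
    obtain r r' t where *: "y = two j k r r' \<oplus>\<^bsub>Tc j (k + 2)\<^esub> mul j k (k + 2) t (q k)"
      "r \<in> R j (k + 1)" "r' \<in> R j (k + 1)" "t \<in> carrier (Tc j k)"
      using y False unfolding I_def J_def l by auto
    have "mul i j (k + 2) x y = two i k (mul i j (k + 1) x r) (mul i j (k + 1) x r') \<oplus>\<^bsub>Tc i (k + 2)\<^esub> mul i k (k + 2) (mul i j k x t) (q k)"
      using * x Rc by (simp add: T.mul_add_right T.mul_assoc)
    then have "mul i j (k + 2) x y \<in> J i k" using J_I Q.ideal_left x * by simp
    then show ?thesis using False by (simp add: I_def l)
  qed
  show "mul i j l x y \<in> I i l" if x: "x \<in> I i j" and y: "y \<in> carrier (Tc j l)" for i j l x y
  proof (cases "j < i + 2 \<or> l < j")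
    case True
    then have "x = \<zero>\<^bsub>Tc i j\<^esub> \<or> y = \<zero>\<^bsub>Tc j l\<^esub>" using x y T_lower by (auto simp: I_def)
    moreover have "x \<in> carrier (Tc i j)" using x I_subset_R Rc by blast
    ultimately have "mul i j l x y = \<zero>\<^bsub>Tc i l\<^esub>" using y by auto
    then show ?thesis using I_zero by simp
  next
    case False
    show ?thesis
    proof (cases "l = j")
      case True
      define k where "k = l - 2"
      have l: "l = k + 2" by (simp add: k_def)
      have "x \<in> J i k" using x False \<open>l = j\<close> by (simp add: I_def k_def)
      then obtain r r' t where *: "x = two i k r r' \<oplus>\<^bsub>Tc i (k + 2)\<^esub> mul i k (k + 2) t (q k)"
        "r \<in> R i (k + 1)" "r' \<in> R i (k + 1)" "t \<in> carrier (Tc i k)"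
        unfolding J_def by blast
      obtain b where b: "b \<in> carrier (K (k + 2))" "y = sc (k + 2) b"
        using y \<open>l = j\<close> l by (auto elim: T_scalar)
      have b': "b \<in> carrier (K k)" "b \<in> carrier (K (k + 1 + 1))" using b(1) period[of k] by (simp_all add: add.assoc)
      let ?c = "\<lambda>v w. sc (k + 1) (Dp k (ract (E (k + 1)) v b) w)"
      have cc: "?c v w \<in> carrier (Tc (k + 1) (k + 1))" if "v \<in> carrier (E (k + 1))" "w \<in> carrier (E k)" for v w
        using that b' by simp
      \<comment> \<open>The scalar is absorbed by the last letter, which is then expanded again in
        the left basis.\<close>
      have step: "mul i (k + 2) (k + 2) (mul i (k + 1) (k + 2) s (vec (k + 1) v)) y =
          two i k (mul i (k + 1) (k + 1) s (?c v (X k))) (mul i (k + 1) (k + 1) s (?c v (X' k)))"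
        if "s \<in> R i (k + 1)" "v \<in> carrier (E (k + 1))" for s v
      proof -
        have "mul i (k + 2) (k + 2) (mul i (k + 1) (k + 2) s (vec (k + 1) v)) y = mul i (k + 1) (k + 2) s (vec (k + 1) (ract (E (k + 1)) v b))"
          using that b Rc T.vec_ract'[of "k + 2" "k + 1" b v] by (simp add: T.mul_assoc)
        also have "\<dots> = two i k (mul i (k + 1) (k + 1) s (?c v (X k))) (mul i (k + 1) (k + 1) s (?c v (X' k)))"
          by (rule mul_vec_two) (use that b' Rc in auto)
        finally show ?thesis .
      qed
      have "mul i (k + 2) (k + 2) x y = (two i k (mul i (k + 1) (k + 1) r (?c (Y k) (X k))) (mul i (k + 1) (k + 1) r (?c (Y k) (X' k))) \<oplus>\<^bsub>Tc i (k + 2)\<^esub>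
          two i k (mul i (k + 1) (k + 1) r' (?c (Y' k) (X k))) (mul i (k + 1) (k + 1) r' (?c (Y' k) (X' k)))) \<oplus>\<^bsub>Tc i (k + 2)\<^esub>
          mul i k (k + 2) (mul i k k t (sc k b)) (q k)"
        unfolding step[OF *(2) dual.y_closed(1), symmetric] step[OF *(3) dual.y_closed(2), symmetric]
          mul_q_sc[OF *(4) b'(1), symmetric]
        using * b b' Rc by (simp add: T.mul_add_left)
      also have "\<dots> = two i k (mul i (k + 1) (k + 1) r (?c (Y k) (X k)) \<oplus>\<^bsub>Tc i (k + 1)\<^esub> mul i (k + 1) (k + 1) r' (?c (Y' k) (X k)))
          (mul i (k + 1) (k + 1) r (?c (Y k) (X' k)) \<oplus>\<^bsub>Tc i (k + 1)\<^esub> mul i (k + 1) (k + 1) r' (?c (Y' k) (X' k))) \<oplus>\<^bsub>Tc i (k + 2)\<^esub>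
          mul i k (k + 2) (mul i k k t (sc k b)) (q k)"
        using *(2,3) cc Rc by (subst two_add) auto
      also have "\<dots> \<in> J i k"
        using *(2-4) cc b' by (intro J_I Q.ideal_add Q.ideal_right) auto
      finally show ?thesis using False l \<open>l = j\<close> by (simp add: I_def)
    next
      case neq: False
      define k where "k = l - 2"
      have l: "l = k + 2" by (simp add: k_def)
      have jk: "j \<le> k + 1" using False neq l by simp
      obtain u u' where u: "u \<in> carrier (Tc j (k + 1))" "u' \<in> carrier (Tc j (k + 1))" "y = two j k u u'"
        using T_step[OF _ jk] y l by metis
      have xR: "x \<in> R i j" using x I_subset_R by blast
      have "mul i j (k + 2) x y = two i k (mul i j (k + 1) x u) (mul i j (k + 1) x u') \<oplus>\<^bsub>Tc i (k + 2)\<^esub> mul i k (k + 2) \<zero>\<^bsub>Tc i k\<^esub> (q k)"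
        using u Rc[OF xR] by (simp add: T.mul_add_right T.mul_assoc)
      also have "\<dots> \<in> J i k" using u xR by (intro J_I Q.ideal_right) auto
      finally show ?thesis using False neq l by (simp add: I_def)
    qed
  qed
qed

lemma quad_subset_I: "quad i \<subseteq> I i (i + 2)"
proof
  fix x assume "x \<in> quad i"
  then obtain a where a: "a \<in> carrier (K i)" "x = mul i i (i + 2) (sc i a) (q i)" unfolding quad_eq by blast
  have "x = two i i \<zero>\<^bsub>Tc i (i + 1)\<^esub> \<zero>\<^bsub>Tc i (i + 1)\<^esub> \<oplus>\<^bsub>Tc i (i + 2)\<^esub> mul i i (i + 2) (sc i a) (q i)"
    using a by simp
  also have "\<dots> \<in> J i i" using a by (intro J_I Q.ideal_zero) auto
  finally show "x \<in> I i (i + 2)" by (simp add: I_def)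
qed

text \<open>\<open>J\<close> is built from \<open>R\<close> itself and not by recursion: one
  inclusion holds because \<open>R\<close> is an ideal containing the \<open>quad i\<close>, the
  other by minimality once \<open>I\<close> is known to be such an ideal.\<close>

lemma R_eq_I: "R i j = I i j"
  using R_minimal[OF zideal_I quad_subset_I] I_subset_R by blast

lemma R_lower: "j < i + 2 \<Longrightarrow> R i j = {\<zero>\<^bsub>Tc i j\<^esub>}"
  by (simp add: R_eq_I I_def)

lemma R_step: "i \<le> j \<Longrightarrow> R i (j + 2) = J i j"
  by (simp add: R_eq_I I_def)

section \<open>The quotient by the relations\<close>

abbreviation "A \<equiv> zquot T R"
abbreviation "scA \<equiv> \<lambda>i a. R i i +>\<^bsub>Tc i i\<^esub> sc i a"
abbreviation "vecA \<equiv> \<lambda>i v. R i (i + 1) +>\<^bsub>Tc i (i + 1)\<^esub> vec i v"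

text \<open>\<open>gen\<close> and \<open>rel\<close> descend from the tensor algebra. For
  \<open>ker\<close>, an element u Y + u' Y' of \<open>R\<close> equals r Y + r' Y' + t q with r, r'
  in \<open>R\<close>; comparing coefficients in the tensor algebra gives u = r + t X and u' = r' +
  t X', so the class of t is the b required.\<close>

lemma koszul_A: "koszul K E A scA vecA Dp X X' Y Y'"
proof (intro koszul.intro koszul_axioms.intro T.chain_algebra_zquot[OF zideal_R] dual_chain_axioms)
  interpret QA: abelian_group "zcomp A i j" for i j by (rule Q.abelian_zquot)
  have clv: "vecA (j + 1) v = Q.cl (j + 1) (j + 2) (vec (j + 1) v)" for j v
  proof -
    have e: "j + 1 + 1 = j + 2" by simp
    show ?thesis unfolding e ..
  qed
  show "x = \<zero>\<^bsub>zcomp A i j\<^esub>" if lt: "j < i" and x: "x \<in> carrier (zcomp A i j)" for i j x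
  proof -
    obtain t where t: "t \<in> carrier (Tc i j)" "x = Q.cl i j t" using x by (rule Q.cl_cases)
    then show ?thesis using T_lower[OF lt] Q.ideal_zero Q.cl_zero_iff by metis
  qed
  show "\<exists>a\<in>carrier (K i). x = scA i a" if x: "x \<in> carrier (zcomp A i i)" for i x
  proof -
    obtain t where t: "t \<in> carrier (Tc i i)" "x = Q.cl i i t" using x by (rule Q.cl_cases)
    obtain a where "a \<in> carrier (K i)" "t = sc i a" using t(1) by (rule T_scalar)
    then show ?thesis using t(2) by blast
  qed
  show "a = \<zero>\<^bsub>K i\<^esub>" if "a \<in> carrier (K i)" "scA i a = \<zero>\<^bsub>zcomp A i i\<^esub>" for a i
    using that Q.cl_zero_iff[of "sc i a" i i] R_lower[of i i] sc_inj by simp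
  show "\<exists>a\<in>carrier (zcomp A i (j + 1)). \<exists>a'\<in>carrier (zcomp A i (j + 1)).
        x = zmul A i (j + 1) (j + 2) a (vecA (j + 1) (Y j)) \<oplus>\<^bsub>zcomp A i (j + 2)\<^esub>
            zmul A i (j + 1) (j + 2) a' (vecA (j + 1) (Y' j))"
    if ij: "i \<le> j + 1" and x: "x \<in> carrier (zcomp A i (j + 2))" for i j x
  proof -
    obtain t where t: "t \<in> carrier (Tc i (j + 2))" "x = Q.cl i (j + 2) t" using x by (rule Q.cl_cases)
    obtain u u' where u: "u \<in> carrier (Tc i (j + 1))" "u' \<in> carrier (Tc i (j + 1))" "t = two i j u u'"
      using t(1) ij by (rule T_step)
    have "x = zmul A i (j + 1) (j + 2) (Q.cl i (j + 1) u) (vecA (j + 1) (Y j)) \<oplus>\<^bsub>zcomp A i (j + 2)\<^esub>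
            zmul A i (j + 1) (j + 2) (Q.cl i (j + 1) u') (vecA (j + 1) (Y' j))"
      unfolding clv t(2) u(3) using u(1,2) by (simp add: Q.cl_mul Q.cl_add)
    then show ?thesis using Q.cl_closed u(1,2) by blast
  qed
  show "zmul A j (j + 1) (j + 2) (vecA j (X j)) (vecA (j + 1) (Y j)) \<oplus>\<^bsub>zcomp A j (j + 2)\<^esub>
        zmul A j (j + 1) (j + 2) (vecA j (X' j)) (vecA (j + 1) (Y' j)) = \<zero>\<^bsub>zcomp A j (j + 2)\<^esub>" for j
  proof -
    have "zmul A j (j + 1) (j + 2) (vecA j (X j)) (vecA (j + 1) (Y j)) \<oplus>\<^bsub>zcomp A j (j + 2)\<^esub>
        zmul A j (j + 1) (j + 2) (vecA j (X' j)) (vecA (j + 1) (Y' j)) = Q.cl j (j + 2) (q j)"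
      unfolding clv q_def by (simp add: Q.cl_mul Q.cl_add)
    also have "\<dots> = \<zero>\<^bsub>zcomp A j (j + 2)\<^esub>"
      using q_in_quad quad_subset_R by (subst Q.cl_zero_iff) auto
    finally show ?thesis .
  qed
  show "\<exists>b\<in>carrier (zcomp A i j). a = zmul A i j (j + 1) b (vecA j (X j)) \<and> a' = zmul A i j (j + 1) b (vecA j (X' j))"
    if ij: "i \<le> j + 1" and a: "a \<in> carrier (zcomp A i (j + 1))" and a': "a' \<in> carrier (zcomp A i (j + 1))"
      and eq: "zmul A i (j + 1) (j + 2) a (vecA (j + 1) (Y j)) \<oplus>\<^bsub>zcomp A i (j + 2)\<^esub>
        zmul A i (j + 1) (j + 2) a' (vecA (j + 1) (Y' j)) = \<zero>\<^bsub>zcomp A i (j + 2)\<^esub>" for i j a a'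
  proof -
    obtain u where u: "u \<in> carrier (Tc i (j + 1))" "a = Q.cl i (j + 1) u" using a by (rule Q.cl_cases)
    obtain u' where u': "u' \<in> carrier (Tc i (j + 1))" "a' = Q.cl i (j + 1) u'" using a' by (rule Q.cl_cases)
    have "Q.cl i (j + 2) (two i j u u') = \<zero>\<^bsub>zcomp A i (j + 2)\<^esub>"
      using eq u u' unfolding clv by (simp add: Q.cl_mul Q.cl_add)
    then have mem: "two i j u u' \<in> R i (j + 2)" using u u' Q.cl_zero_iff by simp
    show ?thesis
    proof (cases "i \<le> j")
      case True
      obtain r r' t where r: "r \<in> R i (j + 1)" "r' \<in> R i (j + 1)" "t \<in> carrier (Tc i j)"
        "two i j u u' = two i j r r' \<oplus>\<^bsub>Tc i (j + 2)\<^esub> mul i j (j + 2) t (q j)"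
        using mem unfolding R_step[OF True] J_def by blast
      note rc = Q.ideal_carrier[OF r(1)] Q.ideal_carrier[OF r(2)]
      \<comment> \<open>Expanding t q at the last letter puts both summands of \<open>J\<close> into
        one combination of \<open>Y j\<close> and \<open>Y' j\<close>.\<close>
      have uu: "two i j u u' = two i j (r \<oplus>\<^bsub>Tc i (j + 1)\<^esub> mul i j (j + 1) t (vec j (X j))) (r' \<oplus>\<^bsub>Tc i (j + 1)\<^esub> mul i j (j + 1) t (vec j (X' j)))"
        unfolding r(4) mul_q[OF r(3)] using rc r(3) by (subst two_add) auto
      have "u = r \<oplus>\<^bsub>Tc i (j + 1)\<^esub> mul i j (j + 1) t (vec j (X j))" "u' = r' \<oplus>\<^bsub>Tc i (j + 1)\<^esub> mul i j (j + 1) t (vec j (X' j))"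
        using two_inj[OF ij u(1) u'(1) _ _ uu] rc r(3) by simp_all
      moreover have "Q.cl i (j + 1) r = \<zero>\<^bsub>zcomp A i (j + 1)\<^esub>" "Q.cl i (j + 1) r' = \<zero>\<^bsub>zcomp A i (j + 1)\<^esub>"
        using Q.cl_zero_iff rc r(1,2) by auto
      ultimately have "a = zmul A i j (j + 1) (Q.cl i j t) (vecA j (X j)) \<and> a' = zmul A i j (j + 1) (Q.cl i j t) (vecA j (X' j))"
        using u u' rc r(3) by (simp add: Q.cl_add Q.cl_mul QA.l_zero)
      then show ?thesis using r(3) by (intro bexI[of _ "Q.cl i j t"]) auto
    next
      case False
      \<comment> \<open>Here \<open>i = j + 1\<close>: there are no relations in this degree, so u =
        u' = 0 and b = 0 works.\<close>
      then have "two i j u u' = \<zero>\<^bsub>Tc i (j + 2)\<^esub>" using mem R_lower[of "j + 2" i] by simp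
      then have "u = \<zero>\<^bsub>Tc i (j + 1)\<^esub>" "u' = \<zero>\<^bsub>Tc i (j + 1)\<^esub>" using T_free[OF ij u(1) u'(1)] by auto
      then have "a = zmul A i j (j + 1) (Q.cl i j \<zero>\<^bsub>Tc i j\<^esub>) (vecA j (X j)) \<and> a' = zmul A i j (j + 1) (Q.cl i j \<zero>\<^bsub>Tc i j\<^esub>) (vecA j (X' j))"
        using u u' by (simp add: Q.cl_mul)
      then show ?thesis by (intro bexI[of _ "Q.cl i j \<zero>\<^bsub>Tc i j\<^esub>"]) auto
    qed
  qed
qed

text \<open>Injectivity of right multiplication by \<open>X j\<close> on the quotient, read in the
  tensor algebra.\<close>

lemma R_saturated:
  assumes "i \<le> j" "t \<in> carrier (Tc i j)" "mul i j (j + 1) t (vec j (X j)) \<in> R i (j + 1)"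
  shows "t \<in> R i j"
proof -
  interpret A: koszul K E A scA vecA Dp X X' Y Y' by (rule koszul_A)
  have "zmul A i j (j + 1) (Q.cl i j t) (vecA j (X j)) = \<zero>\<^bsub>zcomp A i (j + 1)\<^esub>"
    using assms by (simp add: Q.cl_mul Q.cl_zero_iff)
  then have "Q.cl i j t = \<zero>\<^bsub>zcomp A i j\<^esub>"
    using A.mul_vec_inj[OF assms(1) _ _ A.X_nonzero] assms(2) by simp
  then show ?thesis using Q.cl_zero_iff assms(2) by simp
qed

text \<open>Elements of \<open>quad j\<close> are c q, and n (c q) = (n c) q with n c again in
  \<open>N\<close>. So the products already form a subgroup, the image of \<open>N\<close> under
  multiplication by q.\<close>

lemma span_quad:
  assumes N: "additive_subgroup N (Tc i j)" and sN: "\<And>t a. t \<in> N \<Longrightarrow> a \<in> carrier (K j) \<Longrightarrow> mul i j j t (sc j a) \<in> N"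
  shows "zprod_span T i j (j + 2) N (quad j) = (\<lambda>t. mul i j (j + 2) t (q j)) ` N"
  unfolding zprod_span_def
proof (rule generate_additive_eq[OF abelian_group_Tc])
  note Nc = subsetD[OF additive_subgroup.a_subset[OF N]]
  show "additive_subgroup ((\<lambda>t. mul i j (j + 2) t (q j)) ` N) (Tc i (j + 2))"
    by (rule additive_subgroup_image[OF abelian_group_Tc abelian_group_Tc T.mul_additive_left N]) simp
  show "{mul i j (j + 2) x y |x y. x \<in> N \<and> y \<in> quad j} \<subseteq> (\<lambda>t. mul i j (j + 2) t (q j)) ` N"
  proof clarify
    fix x y assume x: "x \<in> N" and y: "y \<in> quad j"
    then obtain a where a: "a \<in> carrier (K j)" "y = mul j j (j + 2) (sc j a) (q j)" unfolding quad_eq by blast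
    then have "mul i j (j + 2) x y = mul i j (j + 2) (mul i j j x (sc j a)) (q j)" using Nc[OF x] by (simp add: T.mul_assoc)
    then show "mul i j (j + 2) x y \<in> (\<lambda>t. mul i j (j + 2) t (q j)) ` N" using sN[OF x a(1)] by blast
  qed
  show "(\<lambda>t. mul i j (j + 2) t (q j)) ` N \<subseteq> generate (add_monoid (Tc i (j + 2))) {mul i j (j + 2) x y |x y. x \<in> N \<and> y \<in> quad j}"
    using q_in_quad by (auto intro!: generate.incl)
qed

text \<open>\<open>R\<close> is stable under right scalars, so expanding a letter in the left basis
  brings each product to this two-term form, and these forms are closed under sums and
  negatives.\<close>

lemma span_R_vec:
  "zprod_span T i (j + 1) (j + 2) (R i (j + 1)) (vec (j + 1) ` carrier (E (j + 1))) =
    {two i j r r' | r r'. r \<in> R i (j + 1) \<and> r' \<in> R i (j + 1)}" (is "_ = ?H")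
  unfolding zprod_span_def
proof (rule generate_additive_eq[OF abelian_group_Tc])
  note Rc = Q.ideal_carrier
  let ?S = "{mul i (j + 1) (j + 2) x y |x y. x \<in> R i (j + 1) \<and> y \<in> vec (j + 1) ` carrier (E (j + 1))}"
  show "additive_subgroup ?H (Tc i (j + 2))"
  proof (rule additive_subgroup.intro, rule Tc.add.subgroupI)
    show "?H \<subseteq> carrier (Tc i (j + 2))" using Rc by auto
    show "?H \<noteq> {}" using Q.ideal_zero by blast
    fix x assume "x \<in> ?H"
    then obtain r r' where r: "x = two i j r r'" "r \<in> R i (j + 1)" "r' \<in> R i (j + 1)" by blast
    have "\<ominus>\<^bsub>Tc i (j + 2)\<^esub> x = two i j (\<ominus>\<^bsub>Tc i (j + 1)\<^esub> r) (\<ominus>\<^bsub>Tc i (j + 1)\<^esub> r')"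
      using r Rc by (simp add: T.mul_neg_left Tc.minus_add)
    then show "\<ominus>\<^bsub>Tc i (j + 2)\<^esub> x \<in> ?H" using Q.ideal_neg r by blast
    fix y assume "y \<in> ?H"
    then obtain s s' where s: "y = two i j s s'" "s \<in> R i (j + 1)" "s' \<in> R i (j + 1)" by blast
    have "x \<oplus>\<^bsub>Tc i (j + 2)\<^esub> y = two i j (r \<oplus>\<^bsub>Tc i (j + 1)\<^esub> s) (r' \<oplus>\<^bsub>Tc i (j + 1)\<^esub> s')"
      unfolding r(1) s(1) using r s Rc by (subst two_add) auto
    then show "x \<oplus>\<^bsub>Tc i (j + 2)\<^esub> y \<in> ?H" using Q.ideal_add r s by blast
  qed
  show "?S \<subseteq> ?H"
  proof clarify
    fix x v assume x: "x \<in> R i (j + 1)" and v: "v \<in> carrier (E (j + 1))"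
    then have "mul i (j + 1) (j + 1) x (sc (j + 1) (Dp j v (X j))) \<in> R i (j + 1)"
      "mul i (j + 1) (j + 1) x (sc (j + 1) (Dp j v (X' j))) \<in> R i (j + 1)"
      by (auto intro: Q.ideal_right)
    then show "\<exists>r r'. mul i (j + 1) (j + 2) x (vec (j + 1) v) = two i j r r' \<and> r \<in> R i (j + 1) \<and> r' \<in> R i (j + 1)"
      using mul_vec_two[OF Rc[OF x] v] by blast
  qed
  show "?H \<subseteq> generate (add_monoid (Tc i (j + 2))) ?S"
  proof clarify
    fix r r' assume r: "r \<in> R i (j + 1)" "r' \<in> R i (j + 1)"
    have "mul i (j + 1) (j + 2) r (vec (j + 1) (Y j)) \<otimes>\<^bsub>add_monoid (Tc i (j + 2))\<^esub> mul i (j + 1) (j + 2) r' (vec (j + 1) (Y' j))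
        \<in> generate (add_monoid (Tc i (j + 2))) ?S"
      by (intro generate.eng generate.incl) (use r dual.y_closed in blast)+
    then show "two i j r r' \<in> generate (add_monoid (Tc i (j + 2))) ?S" by simp
  qed
qed

text \<open>A common element is r Y + r' Y' = t q. Uniqueness of the expansion gives r = t X_j, so t
  X_j is in \<open>R\<close> and saturation applies.\<close>

lemma intersection_eq:
  assumes "i \<le> j"
  shows "zprod_span T i (j + 1) (j + 2) (R i (j + 1)) (vec (j + 1) ` carrier (E (j + 1))) \<inter>
      zprod_span T i j (j + 2) (carrier (Tc i j)) (quad j) = zprod_span T i j (j + 2) (R i j) (quad j)"
proof -
  note Rc = Q.ideal_carrier
  have full: "zprod_span T i j (j + 2) (carrier (Tc i j)) (quad j) = (\<lambda>t. mul i j (j + 2) t (q j)) ` carrier (Tc i j)"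
    by (rule span_quad[OF additive_subgroup.intro[OF Tc.add.subgroup_self]]) simp
  have RR: "zprod_span T i j (j + 2) (R i j) (quad j) = (\<lambda>t. mul i j (j + 2) t (q j)) ` R i j"
    by (rule span_quad[OF Q.subgroup]) (auto intro: Q.ideal_right)
  show ?thesis
    unfolding full RR span_R_vec
  proof (intro equalityI subsetI)
    fix x assume "x \<in> {two i j r r' | r r'. r \<in> R i (j + 1) \<and> r' \<in> R i (j + 1)} \<inter> (\<lambda>t. mul i j (j + 2) t (q j)) ` carrier (Tc i j)"
    then obtain r r' t where *: "r \<in> R i (j + 1)" "r' \<in> R i (j + 1)" "x = two i j r r'" "t \<in> carrier (Tc i j)"
      "x = mul i j (j + 2) t (q j)" by blast
    have "two i j r r' = two i j (mul i j (j + 1) t (vec j (X j))) (mul i j (j + 1) t (vec j (X' j)))"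
      using * mul_q by simp
    then have "r = mul i j (j + 1) t (vec j (X j))"
      using assms * Rc by (intro two_inj(1)[of i j r r']) auto
    then show "x \<in> (\<lambda>t. mul i j (j + 2) t (q j)) ` R i j" using R_saturated[OF assms *(4)] * by blast
  next
    fix x assume "x \<in> (\<lambda>t. mul i j (j + 2) t (q j)) ` R i j"
    then obtain t where t: "t \<in> R i j" "x = mul i j (j + 2) t (q j)" by blast
    then show "x \<in> {two i j r r' | r r'. r \<in> R i (j + 1) \<and> r' \<in> R i (j + 1)} \<inter> (\<lambda>t. mul i j (j + 2) t (q j)) ` carrier (Tc i j)"
      using mul_q[OF Rc[OF t(1)]] Q.ideal_right[OF t(1), OF T.vec_closed[OF refl dual.x_closed(1)]]
        Q.ideal_right[OF t(1), OF T.vec_closed[OF refl dual.x_closed(2)]] Rc[OF t(1)] by blast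
  qed
qed

end

section \<open>The short exact sequence with the relations as first factor\<close>

lemma bimodule_regular:
  assumes "cring R"
  shows "bimodule R R (make_bimod R (\<otimes>\<^bsub>R\<^esub>) (\<otimes>\<^bsub>R\<^esub>))"
proof -
  interpret cring R by fact
  show ?thesis
  proof (rule bimoduleI)
    show "abelian_group (make_bimod R (\<otimes>\<^bsub>R\<^esub>) (\<otimes>\<^bsub>R\<^esub>))"
      by (rule abelian_group_cong[OF abelian_group_axioms]) (simp_all add: make_bimod_def ring.defs bimod.defs)
  qed (auto simp: make_bimod_def ring.defs bimod.defs l_distr r_distr m_assoc intro: cring_axioms)
qed

context dual_chain begin

abbreviation "bimA i j \<equiv> comp_bimod scA A i j"

definition quadb :: "int \<Rightarrow> ('k, ('k \<times> 'v list \<Rightarrow>\<^sub>0 int) set) bimod"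
  where "quadb j = (comp_bimod sc T j (j + 2))\<lparr>carrier := quad j\<rparr>"

lemma quadb_simps [simp]:
  "carrier (quadb j) = quad j" "\<zero>\<^bsub>quadb j\<^esub> = \<zero>\<^bsub>Tc j (j + 2)\<^esub>" "add (quadb j) = add (Tc j (j + 2))"
  "lact (quadb j) a t = mul j j (j + 2) (sc j a) t" "ract (quadb j) t b = mul j (j + 2) (j + 2) t (sc (j + 2) b)"
  by (simp_all add: quadb_def)

text \<open>Deduced from the quotient, where degree one is already known to be a faithful copy of
  \<open>E i\<close>.\<close>

lemma vec_inj: "v \<in> carrier (E i) \<Longrightarrow> vec i v = \<zero>\<^bsub>Tc i (i + 1)\<^esub> \<Longrightarrow> v = \<zero>\<^bsub>E i\<^esub>"
proof -
  assume v: "v \<in> carrier (E i)" "vec i v = \<zero>\<^bsub>Tc i (i + 1)\<^esub>"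
  interpret A: koszul K E A scA vecA Dp X X' Y Y' by (rule koszul_A)
  have "vecA i v = vecA i \<zero>\<^bsub>E i\<^esub>"
    unfolding A.vec_zero[OF refl] v(2) by (subst Q.cl_zero_iff) (auto intro: Q.ideal_zero)
  then show "v = \<zero>\<^bsub>E i\<^esub>"
    using A.vec_bij[of i] v(1) by (auto simp: bij_betw_def inj_on_def)
qed

abbreviation "quad_of j c \<equiv> mul j j (j + 2) (sc j c) (q j)"

text \<open>If c q = 0, then c X_j = 0 by uniqueness of the expansion, and c = 0 because X_j is
  nonzero and K_j is a field.\<close>

lemma quad_of_bij: "bij_betw (quad_of j) (carrier (K j)) (quad j)"
  unfolding bij_betw_def
proof
  show "inj_on (quad_of j) (carrier (K j))"
  proof (rule additive_inj_on[OF additive_compose[OF T.sc_additive T.mul_additive_left] K.abelian_group_axioms abelian_group_Tc])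
    fix c assume c: "c \<in> carrier (K j)" "quad_of j c = \<zero>\<^bsub>Tc j (j + 2)\<^esub>"
    then have "mul j j (j + 1) (sc j c) (vec j (X j)) = \<zero>\<^bsub>Tc j (j + 1)\<^esub>"
      using mul_q[of "sc j c" j j] T_free(1)[of j j "mul j j (j + 1) (sc j c) (vec j (X j))" "mul j j (j + 1) (sc j c) (vec j (X' j))"] by simp
    then have z: "lact (E j) c (X j) = \<zero>\<^bsub>E j\<^esub>" using c(1) by (intro vec_inj) (simp_all add: T.vec_lact)
    show "c = \<zero>\<^bsub>K j\<^esub>"
    proof (rule ccontr)
      assume "c \<noteq> \<zero>\<^bsub>K j\<^esub>"
      then have inv: "inv\<^bsub>K j\<^esub> c \<in> carrier (K j)" "inv\<^bsub>K j\<^esub> c \<otimes>\<^bsub>K j\<^esub> c = \<one>\<^bsub>K j\<^esub>"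
        using c(1) dual.field_L.field_Units by auto
      have "X j = lact (E j) (inv\<^bsub>K j\<^esub> c) (lact (E j) c (X j))"
        using inv c(1) by (simp flip: E.lact_mult)
      also have "\<dots> = \<zero>\<^bsub>E j\<^esub>" unfolding z by (rule additive_zero[OF E.lact_additive[OF inv(1)] E.abelian_group_W E.abelian_group_W])
      finally show False using koszul.X_nonzero[OF koszul_A] by blast
    qed
  qed simp
  show "quad_of j ` carrier (K j) = quad j" unfolding quad_eq by blast
qed

text \<open>The regular bimodule is transported along c to c q; the right actions correspond because
  q is central and K_{j+2} = K_j.\<close>

lemma bimodule_quadb: "bimodule (K j) (K (j + 2)) (quadb j)"
proof -
  have "bimodule (K j) (K (j + 2)) (make_bimod (K j) (\<otimes>\<^bsub>K j\<^esub>) (\<otimes>\<^bsub>K j\<^esub>))"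
    unfolding period by (rule bimodule_regular) (rule K.cring_axioms)
  then show ?thesis
  proof (rule bimodule_transfer[where f = "quad_of j"])
    show "bij_betw (quad_of j) (carrier (make_bimod (K j) (\<otimes>\<^bsub>K j\<^esub>) (\<otimes>\<^bsub>K j\<^esub>))) (carrier (quadb j))"
      using quad_of_bij by (simp add: make_bimod_def ring.defs bimod.defs)
    show "quad_of j (ract (make_bimod (K j) (\<otimes>\<^bsub>K j\<^esub>) (\<otimes>\<^bsub>K j\<^esub>)) c a) = ract (quadb j) (quad_of j c) a"
      if a: "a \<in> carrier (K (j + 2))" and c: "c \<in> carrier (make_bimod (K j) (\<otimes>\<^bsub>K j\<^esub>) (\<otimes>\<^bsub>K j\<^esub>))" for a c
    proof -
      have "a \<in> carrier (K j)" using a period by simp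
      then show ?thesis using c by (simp add: make_bimod_def ring.defs bimod.defs T.sc_mult mul_q_sc)
    qed
  qed (auto simp: make_bimod_def ring.defs bimod.defs T.sc_add T.sc_mult T.mul_add_left T.mul_assoc
      additive_zero[OF T.sc_additive K.abelian_group_axioms abelian_group_Tc])
qed

text \<open>An element of \<open>quad j\<close> may be written as a sum of tensors in many ways.
  Expanding any such sum at the last letter must give the coefficients c X_j and c X'_j of c q,
  which shows that the first map does not depend on the chosen expression.\<close>

lemma quad_coefficients:
  assumes c: "c \<in> carrier (K j)" and x: "\<And>k. k < n \<Longrightarrow> x k \<in> carrier (E j)" and \<psi>: "\<And>k. k < n \<Longrightarrow> \<psi> k \<in> carrier (E (j + 1))"
    and t: "quad_of j c = (\<Oplus>\<^bsub>Tc j (j + 2)\<^esub> k\<in>{..<n::nat}. tens_pure K E j [x k, \<psi> k])"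
  shows "mul j j (j + 1) (sc j c) (vec j (X j)) =
      (\<Oplus>\<^bsub>Tc j (j + 1)\<^esub> k\<in>{..<n}. mul j (j + 1) (j + 1) (vec j (x k)) (sc (j + 1) (Dp j (\<psi> k) (X j))))" (is "?l = ?s (X j)")
    and "mul j j (j + 1) (sc j c) (vec j (X' j)) =
      (\<Oplus>\<^bsub>Tc j (j + 1)\<^esub> k\<in>{..<n}. mul j (j + 1) (j + 1) (vec j (x k)) (sc (j + 1) (Dp j (\<psi> k) (X' j))))" (is "?l' = ?s (X' j)")
proof -
  let ?u = "\<lambda>w k. mul j (j + 1) (j + 1) (vec j (x k)) (sc (j + 1) (Dp j (\<psi> k) w))"
  have u: "?u w k \<in> carrier (Tc j (j + 1))" if "w \<in> carrier (E j)" "k < n" for w k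
    using that x \<psi> by simp
  have sum: "mul j (j + 1) (j + 2) (?s w) v = (\<Oplus>\<^bsub>Tc j (j + 2)\<^esub> k\<in>{..<n}. mul j (j + 1) (j + 2) (?u w k) v)"
    if "w \<in> carrier (E j)" "v \<in> carrier (Tc (j + 1) (j + 2))" for w v
    by (rule additive_finsum[OF T.mul_additive_left abelian_group_Tc abelian_group_Tc]) (use that u in auto)
  have "two j j (?s (X j)) (?s (X' j)) = (\<Oplus>\<^bsub>Tc j (j + 2)\<^esub> k\<in>{..<n}. mul j (j + 1) (j + 2) (?u (X j) k) (vec (j + 1) (Y j)) \<oplus>\<^bsub>Tc j (j + 2)\<^esub>
      mul j (j + 1) (j + 2) (?u (X' j) k) (vec (j + 1) (Y' j)))"
    unfolding sum[OF dual.x_closed(1) T.vec_closed[OF _ dual.y_closed(1)], simplified] sum[OF dual.x_closed(2) T.vec_closed[OF _ dual.y_closed(2)], simplified]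
    using u by (intro Tc.finsum_addf[symmetric]) auto
  also have "\<dots> = (\<Oplus>\<^bsub>Tc j (j + 2)\<^esub> k\<in>{..<n}. tens_pure K E j [x k, \<psi> k])"
  proof (rule Tc.finsum_cong'[OF refl])
    fix k assume "k \<in> {..<n}"
    then have k: "x k \<in> carrier (E j)" "\<psi> k \<in> carrier (E (j + 1))" using x \<psi> by auto
    show "mul j (j + 1) (j + 2) (?u (X j) k) (vec (j + 1) (Y j)) \<oplus>\<^bsub>Tc j (j + 2)\<^esub>
        mul j (j + 1) (j + 2) (?u (X' j) k) (vec (j + 1) (Y' j)) = tens_pure K E j [x k, \<psi> k]"
      unfolding tens_pure_two[OF k] by (rule mul_vec_two[symmetric]) (use k in auto)
  qed (use x \<psi> in \<open>simp add: tens_pure_two\<close>)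
  also have "\<dots> = two j j ?l ?l'" unfolding t[symmetric] using mul_q[of "sc j c" j j] c by simp
  finally have eq: "two j j ?l ?l' = two j j (?s (X j)) (?s (X' j))" ..
  have s: "?s w \<in> carrier (Tc j (j + 1))" if "w \<in> carrier (E j)" for w
    using u that by (intro Tc.finsum_closed) auto
  show "?l = ?s (X j)" "?l' = ?s (X' j)"
    by (rule two_inj[OF _ _ _ _ _ eq]; use c s in simp)+
qed

text \<open>As \<open>quad j\<close> is free of rank one on q, tensoring with it changes nothing:
  the tensor of a and c q corresponds to a c. The first map is this isomorphism followed by
  \<open>emb\<close>, so exactness is inherited from the sequence starting at the algebra.\<close>

lemma short_exact:
  assumes ij: "i \<le> j"
  obtains f g where
    "short_exact_bimodules (K i) (K (j + 2)) (tensor (K j) (bimA i j) (quadb j)) f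
      (tensor (K (j + 1)) (bimA i (j + 1)) (E (j + 1))) g (bimA i (j + 2))"
    "\<And>a v. a \<in> carrier (zcomp A i (j + 1)) \<Longrightarrow> v \<in> carrier (E (j + 1)) \<Longrightarrow>
      g (pure_tensor (K (j + 1)) (bimA i (j + 1)) (E (j + 1)) a v) = zmul A i (j + 1) (j + 2) a (vecA (j + 1) v)"
    "\<And>a n x \<psi> t. a \<in> carrier (zcomp A i j) \<Longrightarrow> (\<And>k. k < n \<Longrightarrow> x k \<in> carrier (E j)) \<Longrightarrow>
      (\<And>k. k < n \<Longrightarrow> \<psi> k \<in> carrier (E (j + 1))) \<Longrightarrow>
      t = (\<Oplus>\<^bsub>Tc j (j + 2)\<^esub> k\<in>{..<n::nat}. tens_pure K E j [x k, \<psi> k]) \<Longrightarrow> t \<in> quad j \<Longrightarrow>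
      f (pure_tensor (K j) (bimA i j) (quadb j) a t) =
        (\<Oplus>\<^bsub>tensor (K (j + 1)) (bimA i (j + 1)) (E (j + 1))\<^esub> k\<in>{..<n}.
          pure_tensor (K (j + 1)) (bimA i (j + 1)) (E (j + 1)) (zmul A i j (j + 1) a (vecA j (x k))) (\<psi> k))"
proof -
  interpret A: koszul K E A scA vecA Dp X X' Y Y' by (rule koszul_A)
  interpret S: tensor_product "K i" "K j" "K (j + 2)" "bimA i j" "quadb j"
    by (intro tensor_product.intro A.bimodule_comp bimodule_quadb)
  note [simp del] = S.tensor_group A.TP.tensor_group
  have qq: "q j \<in> quad j" by (rule q_in_quad)
  \<comment> \<open>\<open>\<kappa>\<close> takes c q back to c; it is linear on both sides and has
    value one at q.\<close>
  define \<kappa> where "\<kappa> = inv_into (carrier (K j)) (quad_of j)"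
  have \<kappa>: "\<kappa> (quad_of j c) = c" if "c \<in> carrier (K j)" for c
    unfolding \<kappa>_def by (rule inv_into_f_f[OF bij_betw_imp_inj_on[OF quad_of_bij] that])
  have quadE: "\<exists>c\<in>carrier (K j). t = quad_of j c" if "t \<in> quad j" for t
    using quad_of_bij[of j] that by (auto simp: bij_betw_def)
  have \<kappa>_closed: "\<kappa> t \<in> carrier (K j)" and \<kappa>_eq: "quad_of j (\<kappa> t) = t" if "t \<in> quad j" for t
    using quadE[OF that] \<kappa> by auto
  have \<kappa>_add: "\<kappa> (s \<oplus>\<^bsub>Tc j (j + 2)\<^esub> t) = \<kappa> s \<oplus>\<^bsub>K j\<^esub> \<kappa> t" if "s \<in> quad j" "t \<in> quad j" for s t
    using quadE[OF that(1)] quadE[OF that(2)] by (auto simp: \<kappa> simp flip: T.mul_add_left T.sc_add)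
  have \<kappa>_lact: "\<kappa> (mul j j (j + 2) (sc j a) t) = a \<otimes>\<^bsub>K j\<^esub> \<kappa> t" if "a \<in> carrier (K j)" "t \<in> quad j" for a t
    using quadE[OF that(2)] that(1) by (auto simp: \<kappa> simp flip: T.mul_assoc T.sc_mult)
  have \<kappa>_ract: "\<kappa> (mul j (j + 2) (j + 2) t (sc (j + 2) a)) = \<kappa> t \<otimes>\<^bsub>K j\<^esub> a" if "a \<in> carrier (K j)" "t \<in> quad j" for a t
    using quadE[OF that(2)] that(1) by (auto simp: \<kappa> mul_q_sc simp flip: T.sc_mult)
  have \<kappa>_q: "\<kappa> (q j) = \<one>\<^bsub>K j\<^esub>"
    using \<kappa>[OF K.one_closed] by (simp add: T.sc_one T.unit_left)
  obtain h where h: "additive S.T (bimA i j) h"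
    "\<And>a t. a \<in> carrier (bimA i j) \<Longrightarrow> t \<in> carrier (quadb j) \<Longrightarrow> h (S.pt a t) = ract (bimA i j) a (\<kappa> t)"
    by (rule S.contract_right[of \<kappa>]) (auto intro!: additiveI simp: \<kappa>_closed \<kappa>_add \<kappa>_lact)
  note abA = bimodule.abelian_group_W[OF A.bimodule_comp[of i j]]
  \<comment> \<open>The inverse of \<open>h\<close> sends a to the tensor of a and q: the
    coefficient c of c q is moved across the tensor sign.\<close>
  have h_pt: "S.pt (h t) (q j) = t" if t: "t \<in> carrier S.T" for t
  proof (rule S.tensor_hom_eq[OF S.abelian_group_tensor additive_compose[OF h(1) S.pt_additive_left] S.additive_ident _ t])
    fix a s assume as: "a \<in> carrier (bimA i j)" "s \<in> carrier (quadb j)"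
    have "S.pt (h (S.pt a s)) (q j) = S.pt a (lact (quadb j) (\<kappa> s) (q j))"
      unfolding h(2)[OF as] by (rule S.pt_middle) (use as qq \<kappa>_closed in auto)
    then show "S.pt (h (S.pt a s)) (q j) = S.pt a s" using as \<kappa>_eq by simp
  qed (use qq in simp)
  have pt_h: "h (S.pt a (q j)) = a" if a: "a \<in> carrier (bimA i j)" for a
    using h(2)[OF a] qq a by (simp add: \<kappa>_q A.sc_one A.D.unit_right)
  have h_bij: "bij_betw h (carrier S.T) (carrier (bimA i j))"
    by (rule bij_betw_byWitness[of _ "\<lambda>a. S.pt a (q j)"])
      (use h_pt pt_h additive_closed[OF h(1)] S.pt_closed[of _ "q j"] qq in auto)
  have h_lact: "h (lact S.T c t) = lact (bimA i j) c (h t)" if c: "c \<in> carrier (K i)" and t: "t \<in> carrier S.T" for c t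
    by (rule S.tensor_hom_eq[OF abA additive_compose[OF S.tensor_lact(1)[OF c] h(1)]
          additive_compose[OF h(1) bimodule.lact_additive[OF A.bimodule_comp c]] _ t])
      (use c \<kappa>_closed in \<open>simp add: S.tensor_lact(2) h(2) A.D.mul_assoc\<close>)
  have h_ract: "h (ract S.T t c) = ract (bimA i j) (h t) c" if c: "c \<in> carrier (K (j + 2))" and t: "t \<in> carrier S.T" for c t
  proof -
    have c': "c \<in> carrier (K j)" using c period by simp
    show ?thesis
      by (rule S.tensor_hom_eq[OF abA additive_compose[OF S.tensor_ract(1)[OF c] h(1)]
            additive_compose[OF h(1) bimodule.ract_additive[OF A.bimodule_comp c']] _ t])
        (use c c' \<kappa>_closed bimodule.ract_closed[OF bimodule_quadb c] in
          \<open>simp add: S.tensor_ract(2) h(2) A.D.mul_assoc \<kappa>_ract A.sc_mult\<close>)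
  qed
  note TPc = A.TP.pt_closed[where i = i and j = j]
  define f where "f = (\<lambda>t. A.emb i j (h t))"
  obtain g where g: "bimodule_hom (K i) (K (j + 2)) (A.TT i j) (bimA i (j + 2)) g"
    "\<And>a v. a \<in> carrier (zcomp A i (j + 1)) \<Longrightarrow> v \<in> carrier (E (j + 1)) \<Longrightarrow>
      g (A.pt i j a v) = zmul A i (j + 1) (j + 2) a (vecA (j + 1) v)"
    "g ` carrier (A.TT i j) = carrier (bimA i (j + 2))"
    "A.emb i j ` carrier (bimA i j) = {t \<in> carrier (A.TT i j). g t = \<zero>\<^bsub>bimA i (j + 2)\<^esub>}"
    by (rule A.TT_multiplication[OF ij]) blast
  have f: "bimodule_hom (K i) (K (j + 2)) S.T (A.TT i j) f"
  proof (rule bimodule_homI[OF S.bimodule_tensor A.TP.bimodule_tensor])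
    show "additive S.T (A.TT i j) f" unfolding f_def by (rule additive_compose[OF h(1) A.emb_additive])
    show "f (lact S.T c t) = lact (A.TT i j) c (f t)" if "c \<in> carrier (K i)" "t \<in> carrier S.T" for c t
      using that additive_closed[OF h(1)] by (simp add: f_def h_lact A.emb_lact del: A.comp_bimod_simps(4))
    show "f (ract S.T t c) = ract (A.TT i j) (f t) c" if c: "c \<in> carrier (K (j + 2))" and t: "t \<in> carrier S.T" for c t
      unfolding f_def h_ract[OF c t] by (rule A.emb_ract[OF c additive_closed[OF h(1) t, simplified]])
  qed
  show thesis
  proof (rule that)
    have im: "f ` carrier S.T = A.emb i j ` carrier (bimA i j)"
      using h_bij by (auto simp: f_def bij_betw_def image_image[symmetric])
    have inj: "inj_on f (carrier S.T)"
      using comp_inj_on[of h "carrier S.T" "A.emb i j"] h_bij A.emb_inj[OF ij]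
      by (simp add: bij_betw_def f_def comp_def)
    show "short_exact_bimodules (K i) (K (j + 2)) S.T f (A.TT i j) g (bimA i (j + 2))"
      unfolding short_exact_bimodules_def im using f g inj
      by (simp add: a_kernel_def kernel_def)
    show "g (A.pt i j a v) = zmul A i (j + 1) (j + 2) a (vecA (j + 1) v)"
      if "a \<in> carrier (zcomp A i (j + 1))" "v \<in> carrier (E (j + 1))" for a v using g(2) that .
    fix a t x \<psi> and n :: nat
    assume a: "a \<in> carrier (zcomp A i j)" and x: "\<And>k. k < n \<Longrightarrow> x k \<in> carrier (E j)"
      and \<psi>: "\<And>k. k < n \<Longrightarrow> \<psi> k \<in> carrier (E (j + 1))"
      and t: "t = (\<Oplus>\<^bsub>Tc j (j + 2)\<^esub> k\<in>{..<n}. tens_pure K E j [x k, \<psi> k])" "t \<in> quad j"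
    obtain c where c: "c \<in> carrier (K j)" "t = quad_of j c" using quadE[OF t(2)] by blast
    let ?a = "\<lambda>w k. zmul A i (j + 1) (j + 1) (zmul A i j (j + 1) a (vecA j (x k))) (scA (j + 1) (Dp j (\<psi> k) w))"
    have ac: "?a w k \<in> carrier (zcomp A i (j + 1))" if "w \<in> carrier (E j)" "k < n" for w k
      using that a x \<psi> by simp
    \<comment> \<open>The identity in degree one of the tensor algebra is mapped to the quotient and
      multiplied on the left by \<open>a\<close>.\<close>
    have key: "zmul A i j (j + 1) (zmul A i j j a (scA j c)) (vecA j w) = (\<Oplus>\<^bsub>zcomp A i (j + 1)\<^esub> k\<in>{..<n}. ?a w k)"
      if w: "w \<in> carrier (E j)" and eq: "mul j j (j + 1) (sc j c) (vec j w) =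
        (\<Oplus>\<^bsub>Tc j (j + 1)\<^esub> k\<in>{..<n}. mul j (j + 1) (j + 1) (vec j (x k)) (sc (j + 1) (Dp j (\<psi> k) w)))" for w
    proof -
      have "zmul A i j (j + 1) (zmul A i j j a (scA j c)) (vecA j w) = zmul A i j (j + 1) a (Q.cl j (j + 1) (mul j j (j + 1) (sc j c) (vec j w)))"
        using a c w by (simp add: A.D.mul_assoc Q.cl_mul)
      also have "\<dots> = (\<Oplus>\<^bsub>zcomp A i (j + 1)\<^esub> k\<in>{..<n}. zmul A i j (j + 1) a
          (Q.cl j (j + 1) (mul j (j + 1) (j + 1) (vec j (x k)) (sc (j + 1) (Dp j (\<psi> k) w)))))"
        unfolding eq
        by (rule additive_finsum[OF additive_compose[OF Q.cl_additive A.D.mul_additive_right] abelian_group_Tc A.D.comp_abelian])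
          (use a x \<psi> w in auto)
      also have "\<dots> = (\<Oplus>\<^bsub>zcomp A i (j + 1)\<^esub> k\<in>{..<n}. ?a w k)"
        by (rule A.D.C.finsum_cong'[OF refl]) (use a x \<psi> w in \<open>auto simp: A.D.mul_assoc Q.cl_mul\<close>)
      finally show ?thesis .
    qed
    have sum: "A.pt i j (\<Oplus>\<^bsub>zcomp A i (j + 1)\<^esub> k\<in>{..<n}. ?a w k) y = (\<Oplus>\<^bsub>A.TT i j\<^esub> k\<in>{..<n}. A.pt i j (?a w k) y)"
      if w: "w \<in> carrier (E j)" and y: "y \<in> carrier (E (j + 1))" for w y
      by (rule additive_finsum[OF A.TP.pt_additive_left[OF y, of i, simplified] A.D.comp_abelian A.TP.abelian_group_tensor])
        (use ac w in auto)
    have t': "quad_of j c = (\<Oplus>\<^bsub>Tc j (j + 2)\<^esub> k\<in>{..<n}. tens_pure K E j [x k, \<psi> k])" using t(1) c(2) by simp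
    have k1: "zmul A i j (j + 1) (zmul A i j j a (scA j c)) (vecA j (X j)) = (\<Oplus>\<^bsub>zcomp A i (j + 1)\<^esub> k\<in>{..<n}. ?a (X j) k)"
      by (rule key[OF dual.x_closed(1)], rule quad_coefficients(1)[OF c(1) _ _ t']) (use x \<psi> in auto)
    have k2: "zmul A i j (j + 1) (zmul A i j j a (scA j c)) (vecA j (X' j)) = (\<Oplus>\<^bsub>zcomp A i (j + 1)\<^esub> k\<in>{..<n}. ?a (X' j) k)"
      by (rule key[OF dual.x_closed(2)], rule quad_coefficients(2)[OF c(1) _ _ t']) (use x \<psi> in auto)
    have "f (S.pt a t) = A.emb i j (zmul A i j j a (scA j c))"
      using h(2)[of a t] a t(2) c \<kappa> by (simp add: f_def)
    also have "\<dots> = A.pt i j (\<Oplus>\<^bsub>zcomp A i (j + 1)\<^esub> k\<in>{..<n}. ?a (X j) k) (Y j) \<oplus>\<^bsub>A.TT i j\<^esub>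
        A.pt i j (\<Oplus>\<^bsub>zcomp A i (j + 1)\<^esub> k\<in>{..<n}. ?a (X' j) k) (Y' j)"
      by (simp only: A.emb_def k1 k2)
    also have "\<dots> = (\<Oplus>\<^bsub>A.TT i j\<^esub> k\<in>{..<n}. A.pt i j (?a (X j) k) (Y j) \<oplus>\<^bsub>A.TT i j\<^esub> A.pt i j (?a (X' j) k) (Y' j))"
      unfolding sum[OF dual.x_closed(1) dual.y_closed(1)] sum[OF dual.x_closed(2) dual.y_closed(2)]
      by (rule A.TP.T.finsum_addf[symmetric]) (use ac TPc in auto)
    \<comment> \<open>For each \<open>k\<close> the two terms are the expansion of the tensor with
      second factor \<open>\<psi> k\<close> in the left basis, read backwards.\<close>
    also have "\<dots> = (\<Oplus>\<^bsub>A.TT i j\<^esub> k\<in>{..<n}. A.pt i j (zmul A i j (j + 1) a (vecA j (x k))) (\<psi> k))"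
    proof (rule A.TP.T.finsum_cong'[OF refl])
      fix k assume "k \<in> {..<n}"
      then have k: "zmul A i j (j + 1) a (vecA j (x k)) \<in> carrier (zcomp A i (j + 1))" "\<psi> k \<in> carrier (E (j + 1))"
        using a x \<psi> by simp_all
      show "A.pt i j (?a (X j) k) (Y j) \<oplus>\<^bsub>A.TT i j\<^esub> A.pt i j (?a (X' j) k) (Y' j) =
          A.pt i j (zmul A i j (j + 1) a (vecA j (x k))) (\<psi> k)"
        by (rule A.TT_expand[OF k, symmetric])
    qed (use a x \<psi> TPc in auto)
    finally show "f (S.pt a t) = (\<Oplus>\<^bsub>A.TT i j\<^esub> k\<in>{..<n}. A.pt i j (zmul A i j (j + 1) a (vecA j (x k))) (\<psi> k))" .
  qed
qed

end

theorem lemma3p6: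
  fixes K0 K1 :: "'k ring" and V :: "('k, 'v) bimod"
  assumes "field K0" and "field K1"
    and "\<one>\<^bsub>K0\<^esub> \<oplus>\<^bsub>K0\<^esub> \<one>\<^bsub>K0\<^esub> \<noteq> \<zero>\<^bsub>K0\<^esub>" and "\<one>\<^bsub>K1\<^esub> \<oplus>\<^bsub>K1\<^esub> \<one>\<^bsub>K1\<^esub> \<noteq> \<zero>\<^bsub>K1\<^esub>"
    and "rank_two_bimodule K0 K1 V"
  defines "K \<equiv> field_at K0 K1"
    and "T \<equiv> nc_tensor K0 K1 V"
    and "R \<equiv> nc_ideal K0 K1 V"
    and "Q \<equiv> quad_rel K0 K1 V"
    and "A \<equiv> nc_sym K0 K1 V"
    and "Ab \<equiv> sym_bimod K0 K1 V"
  shows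
    "(\<forall>i j. i \<le> j \<longrightarrow>
        zprod_span T i (j + 1) (j + 2) (R i (j + 1)) (deg_one K0 K1 V (j + 1)) \<inter>
        zprod_span T i j (j + 2) (carrier (zcomp T i j)) (Q j) =
        zprod_span T i j (j + 2) (R i j) (Q j)) \<and>
     (\<forall>i j. i \<le> j \<longrightarrow>
        (\<exists>f g. mult_induced_left K0 K1 V i j f \<and> mult_induced_right K0 K1 V i j g \<and>
           short_exact_bimodules (K i) (K (j + 2))
             (tensor (K j) (Ab i j) (quad_bimod K0 K1 V j)) f
             (tensor (K (j + 1)) (Ab i (j + 1)) (iter_dual K0 K1 V (j + 1))) g
             (Ab i (j + 2)))) \<and>
     (\<forall>i j. i \<le> j \<longrightarrow>
        has_dim (K i) (left_module (Ab i j)) (nat (j - i + 1)) \<and>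
        has_dim (K j) (right_module (Ab i j)) (nat (j - i + 1))) \<and>
     (\<forall>j. \<exists>f g. exact_zmodules A
        (proj_module A j) f
        (zmod_sum (proj_module A (j + 1)) (proj_module A (j + 1))) g
        (proj_module A (j + 2)) (simple_proj A (j + 2))
        (simple_module A (j + 2)))"
proof -
  note fields = assms(1,2,5)
  \<comment> \<open>Dual bases are chosen for all indices at once.\<close>
  obtain X X' Y Y' where XY: "\<And>i. dual_pair (K i) (K (i + 1)) (iter_dual K0 K1 V i) (iter_dual K0 K1 V (i + 1))
      (dual_pairing K0 K1 V i) (X i) (X' i) (Y i) (Y' i)"
    using dual_pair_iter_dual[OF fields] unfolding K_def by metis
  have rank: "rank_two_bimodule (K i) (K (i + 1)) (iter_dual K0 K1 V i)" for i
    unfolding K_def by (rule rank_two_iter_dual[OF fields])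
  interpret C: dual_chain K "iter_dual K0 K1 V" "dual_pairing K0 K1 V" X X' Y Y'
    by (intro dual_chain.intro bimodule_chain.intro dual_chain_axioms.intro XY)
      (use rank field_at_add_two[OF fields] in \<open>auto simp: rank_two_bimodule_def K_def\<close>)
  \<comment> \<open>With these data the algebra, the relations and the quotient of the statement are
    instances of the general constructions for a chain with dual bases.\<close>
  have T: "T = C.T" by (simp add: K_def T_def nc_tensor_def)
  have Q: "Q = C.quad" by (rule ext) (simp add: K_def Q_def C.quad_def[unfolded K_def] quad_rel_def nc_tensor_def)
  have R: "R = C.R"
    unfolding R_def nc_ideal_def C.R_def Q[unfolded Q_def] T[unfolded T_def] ..
  have A: "A = C.A" using R T by (simp add: A_def R_def T_def nc_sym_def)
  have cl: "sym_class K0 K1 V i j t = C.Q.cl i j t" for i j t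
    using R T by (simp add: sym_class_def R_def T_def)
  have sc: "tens_scalar (field_at K0 K1) (iter_dual K0 K1 V) = C.sc" by (simp add: K_def)
  have vecs: "sym_vec K0 K1 V i v = C.vecA i v" for i v by (simp add: sym_vec_def cl K_def)
  have Ab: "Ab i j = C.bimA i j" for i j
    using A by (simp add: Ab_def A_def sym_bimod_def cl sc)
  have Qb: "quad_bimod K0 K1 V j = C.quadb j" for j
    using T Q by (simp add: quad_bimod_def C.quadb_def sc T_def Q_def)
  have deg: "deg_one K0 K1 V j = C.vec j ` carrier (iter_dual K0 K1 V j)" for j
    by (simp add: deg_one_def K_def)
  interpret A: koszul K "iter_dual K0 K1 V" C.A C.scA C.vecA "dual_pairing K0 K1 V" X X' Y Y'
    by (rule C.koszul_A)
  show ?thesis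
  proof (intro conjI allI impI)
    fix i j :: int
    assume ij: "i \<le> j"
    show "zprod_span T i (j + 1) (j + 2) (R i (j + 1)) (deg_one K0 K1 V (j + 1)) \<inter>
        zprod_span T i j (j + 2) (carrier (zcomp T i j)) (Q j) = zprod_span T i j (j + 2) (R i j) (Q j)"
      unfolding T Q R deg by (rule C.intersection_eq[OF ij])
    show "has_dim (K i) (left_module (Ab i j)) (nat (j - i + 1))"
      "has_dim (K j) (right_module (Ab i j)) (nat (j - i + 1))"
      unfolding Ab by (rule A.dimensions[OF rank ij])+
    obtain f g where fg: "short_exact_bimodules (K i) (K (j + 2)) (tensor (K j) (C.bimA i j) (C.quadb j)) f
        (tensor (K (j + 1)) (C.bimA i (j + 1)) (iter_dual K0 K1 V (j + 1))) g (C.bimA i (j + 2))"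
      "\<And>a v. a \<in> carrier (zcomp C.A i (j + 1)) \<Longrightarrow> v \<in> carrier (iter_dual K0 K1 V (j + 1)) \<Longrightarrow>
        g (pure_tensor (K (j + 1)) (C.bimA i (j + 1)) (iter_dual K0 K1 V (j + 1)) a v) =
          zmul C.A i (j + 1) (j + 2) a (C.vecA (j + 1) v)"
      "\<And>a n x \<psi> t. a \<in> carrier (zcomp C.A i j) \<Longrightarrow> (\<And>k. k < n \<Longrightarrow> x k \<in> carrier (iter_dual K0 K1 V j)) \<Longrightarrow>
        (\<And>k. k < n \<Longrightarrow> \<psi> k \<in> carrier (iter_dual K0 K1 V (j + 1))) \<Longrightarrow>
        t = (\<Oplus>\<^bsub>C.Tc j (j + 2)\<^esub> k\<in>{..<n::nat}. tens_pure K (iter_dual K0 K1 V) j [x k, \<psi> k]) \<Longrightarrow> t \<in> C.quad j \<Longrightarrow>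
        f (pure_tensor (K j) (C.bimA i j) (C.quadb j) a t) =
          (\<Oplus>\<^bsub>tensor (K (j + 1)) (C.bimA i (j + 1)) (iter_dual K0 K1 V (j + 1))\<^esub> k\<in>{..<n}.
            pure_tensor (K (j + 1)) (C.bimA i (j + 1)) (iter_dual K0 K1 V (j + 1)) (zmul C.A i j (j + 1) a (C.vecA j (x k))) (\<psi> k))"
      by (rule C.short_exact[OF ij]) blast
    have "mult_induced_left K0 K1 V i j f"
      unfolding mult_induced_left_def Ab[unfolded Ab_def] Qb A[unfolded A_def] T[unfolded T_def] Q[unfolded Q_def] vecs
        K_def[symmetric]
      using fg(3) by blast
    moreover have "mult_induced_right K0 K1 V i j g"
      unfolding mult_induced_right_def Ab[unfolded Ab_def] A[unfolded A_def] vecs K_def[symmetric]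
      using fg(2) by blast
    ultimately show "\<exists>f g. mult_induced_left K0 K1 V i j f \<and> mult_induced_right K0 K1 V i j g \<and>
           short_exact_bimodules (K i) (K (j + 2))
             (tensor (K j) (Ab i j) (quad_bimod K0 K1 V j)) f
             (tensor (K (j + 1)) (Ab i (j + 1)) (iter_dual K0 K1 V (j + 1))) g
             (Ab i (j + 2))"
      using fg(1) unfolding Ab Qb by blast
  next
    fix j :: int
    show "\<exists>f g. exact_zmodules A (proj_module A j) f
        (zmod_sum (proj_module A (j + 1)) (proj_module A (j + 1))) g
        (proj_module A (j + 2)) (simple_proj A (j + 2)) (simple_module A (j + 2))"
      unfolding A by (rule A.exact_projectives)
  qed
qed

end
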